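(* Fix $\alpha\in(0,1)$ and $p\in[1,\infty]$. Let $\phi:\mathbb{R}^K\to\mathbb{R}$ be any function which is subadditive, positive homogeneous and bounded by the $\ell_p$-norm, and let $W$ be an exchangeable resampling weight vector. 1. If the $\mathbf{Y}^i$ are Gaussian vectors, then $$\phi(\overline{\mathbf{Y}}-\mu)<\frac{\mathbb{E}_W[\phi(\overline{\mathbf{Y}}^{\langle W-\overline{W}\rangle})]}{B_W}+\|\sigma\|_p\,\overline{\Phi}^{-1}(\alpha/2)\left[\frac{C_W}{nB_W}+\frac{1}{\sqrt n}\right]$$ holds with probability at least $1-\alpha$. Likewise, $$\phi(\overline{\mathbf{Y}}-\mu)>\frac{\mathbb{E}_W[\phi(\overline{\mathbf{Y}}^{\langle W-\overline{W}\rangle})]}{B_W}-\|\sigma\|_p\,\overline{\Phi}^{-1}(\alpha/2)\left[\frac{C_W}{nB_W}+\frac{1}{\sqrt n}\right]$$ holds with probability at least $1-\alpha$. 2. If the distribution of $\mathbf{Y}^i$ is symmetric about $\mu$, that is $(\mathbf{Y}^i-\mu)\sim(\mu-\mathbf{Y}^i)$, and $\|\mathbf{Y}^i-\mu\|_p\le M$ almost surely for some $M>0$, then $$\phi(\overline{\mathbf{Y}}-\mu)<\frac{\mathbb{E}_W[\phi(\overline{\mathbf{Y}}^{\langle W-\overline{W}\rangle})]}{A_W}+\frac{2M}{\sqrt n}\sqrt{\log(1/\alpha)}$$ holds with probability at least $1-\alpha$. If, moreover, there are $a>0$ and $x_0\in\mathbb{R}$ such that $|W_i-x_0|=a$ almost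 surely for all $i$, then, with $D_W:=a+\mathbb{E}|\overline{W}-x_0|$, $$\phi(\overline{\mathbf{Y}}-\mu)>\frac{\mathbb{E}_W[\phi(\overline{\mathbf{Y}}^{\langle W-\overline{W}\rangle})]}{D_W}-\frac{M}{\sqrt n}\sqrt{1+\frac{A_W^2}{D_W^2}}\sqrt{2\log(1/\alpha)}$$ holds with probability at least $1-\alpha$.
   Context: Let $K\ge1$, $n\ge2$ be integers and $\mathbf{Y}=(\mathbf{Y}^1,\dots,\mathbf{Y}^n)$ a sample of i.i.d. integrable random vectors in $\mathbb{R}^K$ with common mean $\mu$ (and arbitrary dependency between coordinates). Write $\overline{\mathbf{Y}}=\frac1n\sum_{i=1}^n\mathbf{Y}^i$, and for $w\in\mathbb{R}^n$, $\overline{\mathbf{Y}}^{\langle w\rangle}=\frac1n\sum_{i=1}^n w_i\mathbf{Y}^i$. Let $\sigma=(\sigma_k)_{1\le k\le K}$ with $\sigma_k=\mathrm{Var}^{1/2}(\mathbf{Y}^1_k)$, and $\overline{\Phi}(x)=\mathbb{P}(X\ge x)$ for $X\sim\mathcal N(0,1)$. $\|\cdot\|_p$ is the $\ell_p$-norm on $\mathbb{R}^K$ (max-norm for $p=\infty$). Properties of $\phi$: subadditive means $\phi(x+x')\le\phi(x)+\phi(x')$ for all $x,x'$; positive homogeneous means $\phi(\lambda x)=\lambda\phi(x)$ for all $x$ and all $\lambda\in\mathbb{R}^+$; bounded by the $\ell_p$-norm means $|\phi(x)|\le\|x\|_p$ for all $x$. A resampling weight vector is an $\mathbb{R}^n$-valued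 random vector $W=(W_i)_{1\le i\le n}$, independent of $\mathbf{Y}$, with $\mathbb{E}[W_i^2]<\infty$ for all $i$ and $n^{-1}\sum_{i=1}^n\mathbb{E}|W_i-\overline{W}|>0$, where $\overline{W}=\frac1n\sum_{i=1}^nW_i$; it is exchangeable if its distribution is invariant under permutations of the indices. $W-\overline{W}$ denotes $(W_i-\overline{W})_{1\le i\le n}$. $\mathbb{E}_W$ denotes expectation over $W$ only, i.e. conditionally on $\mathbf{Y}$. For an exchangeable resampling weight vector, $$A_W=\mathbb{E}|W_1-\overline{W}|,\quad B_W=\mathbb{E}\Big[\Big(\tfrac1n\sum_{i=1}^n(W_i-\overline{W})^2\Big)^{1/2}\Big],\quad C_W=\Big(\tfrac{n}{n-1}\mathbb{E}[(W_1-\overline{W})^2]\Big)^{1/2}.$$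
   Formalization: Part 1 additionally assumes σ ≠ 0: if σ = 0, the Gaussian vectors equal μ almost surely, both sides of the strict inequalities are 0, and the printed claims fail. *)

theory Defs
  imports "HOL-Probability.Probability"
begin

definition lp_norm :: "ereal \<Rightarrow> real ^ 'k \<Rightarrow> real" where
  "lp_norm p x =
     (if p = \<infinity> then infnorm x
      else (\<Sum>k\<in>UNIV. \<bar>x $ k\<bar> powr real_of_ereal p) powr (1 / real_of_ereal p))"

definition std_normal_tail :: "real \<Rightarrow> real" where
  "std_normal_tail x = measure (density lborel (\<lambda>t. ennreal (std_normal_density t))) {x..}"

(* std_normal_tail is a bijection from the reals onto {0<..<1}; its inverse is meant for
   arguments in that interval only. *)
definition std_normal_tail_inv :: "real \<Rightarrow> real" where
  "std_normal_tail_inv = inv std_normal_tail"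

(* Every linear functional of X is a (possibly degenerate) normal variable; the point mass
   is listed separately because normal_density with standard deviation 0 is not a density. *)
definition gaussian_vector :: "'a measure \<Rightarrow> ('a \<Rightarrow> real ^ 'k) \<Rightarrow> bool" where
  "gaussian_vector P X \<longleftrightarrow> X \<in> borel_measurable P \<and>
     (\<forall>u. (\<exists>m s. s > 0 \<and> distributed P lborel (\<lambda>\<omega>. u \<bullet> X \<omega>) (normal_density m s)) \<or>
          (\<exists>m. AE \<omega> in P. u \<bullet> X \<omega> = m))"

definition std_dev_vector :: "'a measure \<Rightarrow> ('a \<Rightarrow> real ^ 'k) \<Rightarrow> real ^ 'k" where
  "std_dev_vector P X = (\<chi> k. sqrt (prob_space.variance P (\<lambda>\<omega>. X \<omega> $ k)))"

definition iid_vectors :: "'a measure \<Rightarrow> nat \<Rightarrow> (nat \<Rightarrow> 'a \<Rightarrow> real ^ 'k) \<Rightarrow> bool" where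
  "iid_vectors P n Y \<longleftrightarrow>
     prob_space.indep_vars P (\<lambda>_. borel) Y {1..n} \<and>
     (\<forall>i\<in>{1..n}. distr P borel (Y i) = distr P borel (Y 1))"

definition average :: "nat \<Rightarrow> (nat \<Rightarrow> 'b::real_vector) \<Rightarrow> 'b" where
  "average n x = (1 / real n) *\<^sub>R (\<Sum>i=1..n. x i)"

definition weighted_average :: "nat \<Rightarrow> (nat \<Rightarrow> real) \<Rightarrow> (nat \<Rightarrow> 'b::real_vector) \<Rightarrow> 'b" where
  "weighted_average n w x = (1 / real n) *\<^sub>R (\<Sum>i=1..n. w i *\<^sub>R x i)"

definition centred :: "nat \<Rightarrow> (nat \<Rightarrow> 'a \<Rightarrow> real) \<Rightarrow> nat \<Rightarrow> 'a \<Rightarrow> real" where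
  "centred n W i \<omega> = W i \<omega> - average n (\<lambda>j. W j \<omega>)"

(* The finite family (X 1, ..., X n) as one random element of the product space. *)
definition joint :: "nat \<Rightarrow> (nat \<Rightarrow> 'a \<Rightarrow> 'b) \<Rightarrow> 'a \<Rightarrow> nat \<Rightarrow> 'b" where
  "joint n X \<omega> = (\<lambda>i\<in>{1..n}. X i \<omega>)"

(* Independence of the generated sigma-algebras; the library's indep_var would require both
   families to take values in the same type. *)
definition independent_families ::
  "'a measure \<Rightarrow> nat \<Rightarrow> (nat \<Rightarrow> 'a \<Rightarrow> 'b::topological_space) \<Rightarrow>
     (nat \<Rightarrow> 'a \<Rightarrow> 'c::topological_space) \<Rightarrow> bool" where
  "independent_families P n X Y \<longleftrightarrow>
     prob_space.indep_set P
       (sets (vimage_algebra (space P) (joint n X) (\<Pi>\<^sub>M i\<in>{1..n}. borel)))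
       (sets (vimage_algebra (space P) (joint n Y) (\<Pi>\<^sub>M i\<in>{1..n}. borel)))"

definition resampling_weights ::
  "'a measure \<Rightarrow> nat \<Rightarrow> (nat \<Rightarrow> 'a \<Rightarrow> real ^ 'k) \<Rightarrow> (nat \<Rightarrow> 'a \<Rightarrow> real) \<Rightarrow> bool" where
  "resampling_weights P n Y W \<longleftrightarrow>
     (\<forall>i\<in>{1..n}. W i \<in> borel_measurable P) \<and>
     independent_families P n W Y \<and>
     (\<forall>i\<in>{1..n}. integrable P (\<lambda>\<omega>. (W i \<omega>)\<^sup>2)) \<and>
     average n (\<lambda>i. \<integral>\<omega>. \<bar>centred n W i \<omega>\<bar> \<partial>P) > 0"

definition exchangeable :: "'a measure \<Rightarrow> nat \<Rightarrow> (nat \<Rightarrow> 'a \<Rightarrow> real) \<Rightarrow> bool" where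
  "exchangeable P n W \<longleftrightarrow>
     (\<forall>\<pi>. \<pi> permutes {1..n} \<longrightarrow>
        distr P (\<Pi>\<^sub>M i\<in>{1..n}. borel) (joint n (\<lambda>i. W (\<pi> i))) =
        distr P (\<Pi>\<^sub>M i\<in>{1..n}. borel) (joint n W))"

(* Expectation over the weights only: the sample y is held fixed while the weights are
   integrated out. *)
definition resampled_expectation ::
  "'a measure \<Rightarrow> nat \<Rightarrow> (real ^ 'k \<Rightarrow> real) \<Rightarrow> (nat \<Rightarrow> 'a \<Rightarrow> real) \<Rightarrow> (nat \<Rightarrow> real ^ 'k) \<Rightarrow> real" where
  "resampled_expectation P n \<phi> W y =
     (\<integral>\<omega>. \<phi> (weighted_average n (\<lambda>i. centred n W i \<omega>) y) \<partial>P)"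

definition const_A :: "'a measure \<Rightarrow> nat \<Rightarrow> (nat \<Rightarrow> 'a \<Rightarrow> real) \<Rightarrow> real" where
  "const_A P n W = (\<integral>\<omega>. \<bar>centred n W 1 \<omega>\<bar> \<partial>P)"

definition const_B :: "'a measure \<Rightarrow> nat \<Rightarrow> (nat \<Rightarrow> 'a \<Rightarrow> real) \<Rightarrow> real" where
  "const_B P n W = (\<integral>\<omega>. sqrt (average n (\<lambda>i. (centred n W i \<omega>)\<^sup>2)) \<partial>P)"

definition const_C :: "'a measure \<Rightarrow> nat \<Rightarrow> (nat \<Rightarrow> 'a \<Rightarrow> real) \<Rightarrow> real" where
  "const_C P n W = sqrt (real n / (real n - 1) * (\<integral>\<omega>. (centred n W 1 \<omega>)\<^sup>2 \<partial>P))"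

definition const_D :: "'a measure \<Rightarrow> nat \<Rightarrow> (nat \<Rightarrow> 'a \<Rightarrow> real) \<Rightarrow> real \<Rightarrow> real \<Rightarrow> real" where
  "const_D P n W a x\<^sub>0 = a + (\<integral>\<omega>. \<bar>average n (\<lambda>i. W i \<omega>) - x\<^sub>0\<bar> \<partial>P)"

end

theory Submission
  imports Defs "HOL-Probability.Probability"
begin

text \<open>Both parts compare \<open>\<phi>\<close> of the centred sample mean with a multiple of its resampled expectation. Centred weights
annihilate the mean, so the sample may be assumed centred, and the comparison function becomes a positively homogeneous
function of the sample whose fluctuations have to be controlled.

Symmetric bounded samples. Independent symmetric vectors keep their joint law when each is multiplied by a sign, so it is
enough to bound the exponential moment of the comparison function over all sign patterns with the vectors held fixed; Chernoff's
bound finishes. For fixed vectors \<open>y\<close> the functional becomes a sublinear form of signs, that is, a function on the discrete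
cube \<open>Pow I\<close>, where a set marks the coordinates of sign \<open>- 1\<close>. Instead of estimating a mean and then the deviation
from it, the exponential moment is estimated directly: if \<open>h\<close> lies below a sum of functions \<open>g j\<close> that are odd in coordinate
\<open>j\<close> and bounded by \<open>c j\<close>, and if \<open>h\<close> changes by at most \<open>2 L\<close> in every coordinate, then the logarithmic derivative of
the exponential moment at \<open>t\<close> is at most \<open>L t\<close> times the sum of the \<open>c j\<close> (\<open>cube_exp_moment_odd\<close>). For general exchangeable
weights such a decomposition arises by replacing the absolute weights by the weights one coordinate at a time
(\<open>centred_weights_exp_moment\<close>). For two-valued weights the resampled expectation is a mixture, over the number of minority
signs, of averages over subsets of a given size. Each of them lies below the averages of the form over all layers of the cube
that are at least as central; the mixture is reduced to two-point mixtures, and these are handled by the decomposition above or,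
for the most central layers, by integrating half of the coordinates first (\<open>mixture_exp_moment\<close>).

Gaussian samples. A Gaussian sample is a linear image of a standard Gaussian vector \<open>z\<close> (\<open>coords_law\<close>). By positive
homogeneity the expectation of \<open>\<phi>\<close> at a weighted sum of independent copies depends on the weights through their Euclidean
norm only, so the comparison function \<open>gap\<close> has mean zero (\<open>gap_mean\<close>). It is Lipschitz in \<open>z\<close> with the constant
of the theorem: the sample mean contributes \<open>1 / sqrt n\<close>, and the second moments of exchangeable centred weights turn the
resampled expectation into the contribution \<open>C / (n B)\<close> (\<open>gap_lipschitz\<close>). What remains is the concentration inequality
\<open>gauss_concentration\<close>: a function with Lipschitz constant \<open>L\<close> exceeds its Gaussian mean by \<open>L q\<close> with probability at most
twice the normal tail at \<open>q\<close>. The idea is that the conditional expectations of the function along a Brownian path form a continuous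
martingale of total quadratic variation at most \<open>L\<^sup>2\<close>, hence a Brownian motion observed no longer than time \<open>L\<^sup>2\<close>,
and that the reflection principle gives the probability that such a motion ever reaches \<open>L q\<close>. The proof runs this
argument in small discrete steps, with the crossing probability as a supersolution.\<close>

section \<open>Exponential moments on the discrete cube\<close>

definition toggle :: "'i => 'i set => 'i set" where
 "toggle j A = (if j \<in> A then A - {j} else insert j A)"

lemma toggle_toggle [simp]: "toggle j (toggle j A) = A"
 by (auto simp: toggle_def)

lemma toggle_subset: "j \<in> I ==> A \<subseteq> I ==> toggle j A \<subseteq> I"
 by (auto simp: toggle_def)

lemma sum_Pow_toggle:
 assumes "j \<in> I"
 shows "(\<Sum>A\<in>Pow I. f (toggle j A)) = (\<Sum>A\<in>Pow I. f A)"
 by (rule sum.reindex_bij_witness[of _ "toggle j" "toggle j"])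
  (use assms toggle_subset in \<open>auto simp: subset_iff toggle_def\<close>)

lemma exp_minus_one_le:
 fixes d :: real assumes "0 <= d"
 shows "exp d - 1 <= d * (exp d + 1) / 2"
proof -
 let ?f = "%d::real. d * (exp d + 1) / 2 - exp d + 1"
 have "?f 0 <= ?f d"
 proof (rule DERIV_nonneg_imp_nondecreasing[OF assms])
  fix x :: real assume x: "0 <= x" "x <= d"
  have e: "1 - x <= exp (-x)" using exp_ge_add_one_self[of "-x"] by simp
  have "(1 - x) * exp x <= exp (-x) * exp x" by (intro mult_right_mono e) auto
  then have "0 <= (1 - exp x + x * exp x) / 2" by (simp add: algebra_simps flip: exp_add)
  moreover have "(?f has_real_derivative (1 - exp x + x * exp x) / 2) (at x)"
   by (auto intro!: derivative_eq_intros simp: field_simps)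
  ultimately show "\<exists>y. (?f has_real_derivative y) (at x) \<and> 0 <= y" by blast
 qed
 then show ?thesis by simp
qed

text \<open>The secant of the exponential is at most the mean of the end slopes, by convexity of its derivative.\<close>

lemma exp_diff_le:
 fixes s t :: real
 shows "\<bar>exp s - exp t\<bar> <= \<bar>s - t\<bar> * (exp s + exp t) / 2"
proof -
 have *: "exp s - exp t <= (s - t) * (exp s + exp t) / 2" if "t <= s" for s t :: real
 proof -
  have "exp t * (exp (s - t) - 1) <= exp t * ((s - t) * (exp (s - t) + 1) / 2)"
   using exp_minus_one_le[of "s - t"] that by (intro mult_left_mono) auto
  then show ?thesis by (simp add: algebra_simps flip: exp_add)
 qed
 show ?thesis using *[of s t] *[of t s] by (cases "t <= s") (auto simp: algebra_simps)
qed

text \<open>Flipping coordinate \<open>j\<close> preserves the uniform measure and changes the sign of \<open>g\<close>, so the correlation with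
\<open>exp (lam * h)\<close> only sees half the difference of that weight across coordinate \<open>j\<close>. The bound of \<open>exp s - exp t\<close> by
the trapezoidal mean \<open>(exp s + exp t) / 2\<close> keeps the constant sharp.\<close>

lemma odd_correlation_le:
 fixes h g :: "'i set => real"
 assumes "j \<in> I" and fin: "finite I"
  and odd: "!!A. A \<subseteq> I ==> g (toggle j A) = - g A"
  and g: "!!A. A \<subseteq> I ==> \<bar>g A\<bar> <= c"
  and h: "!!A. A \<subseteq> I ==> \<bar>h A - h (toggle j A)\<bar> <= 2 * L"
  and lam: "0 <= lam"
 shows "(\<Sum>A\<in>Pow I. g A * exp (lam * h A)) <= c * lam * L * (\<Sum>A\<in>Pow I. exp (lam * h A))"
proof -
 let ?w = "%A. exp (lam * h A)"
 have c0: "0 <= c" using g[of "{}"] by auto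
 have "(\<Sum>A\<in>Pow I. g A * ?w A) = (\<Sum>A\<in>Pow I. g (toggle j A) * ?w (toggle j A))"
  by (rule sum_Pow_toggle[OF assms(1), symmetric])
 also have "... = - (\<Sum>A\<in>Pow I. g A * ?w (toggle j A))"
  by (simp add: odd sum_negf[symmetric])
 finally have "2 * (\<Sum>A\<in>Pow I. g A * ?w A) = (\<Sum>A\<in>Pow I. g A * (?w A - ?w (toggle j A)))"
  by (simp add: algebra_simps sum_subtractf)
 also have "... <= (\<Sum>A\<in>Pow I. c * (lam * L * (?w A + ?w (toggle j A))))"
 proof (rule sum_mono)
  fix A assume A: "A \<in> Pow I"
  then have A': "A \<subseteq> I" by auto
  have "\<bar>?w A - ?w (toggle j A)\<bar> <= \<bar>lam * h A - lam * h (toggle j A)\<bar> * (?w A + ?w (toggle j A)) / 2"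
   by (rule exp_diff_le)
  also have "... <= (lam * (2 * L)) * (?w A + ?w (toggle j A)) / 2"
  proof -
   have "\<bar>lam * h A - lam * h (toggle j A)\<bar> = lam * \<bar>h A - h (toggle j A)\<bar>"
    using lam by (simp add: abs_mult flip: right_diff_distrib)
   then have "\<bar>lam * h A - lam * h (toggle j A)\<bar> <= lam * (2 * L)"
    using h[OF A'] lam by (simp add: mult_left_mono)
   then show ?thesis by (intro divide_right_mono mult_right_mono) auto
  qed
  finally have w: "\<bar>?w A - ?w (toggle j A)\<bar> <= lam * L * (?w A + ?w (toggle j A))" by simp
  have "g A * (?w A - ?w (toggle j A)) <= \<bar>g A\<bar> * \<bar>?w A - ?w (toggle j A)\<bar>"
   by (metis abs_ge_self abs_mult)
  also have "... <= c * (lam * L * (?w A + ?w (toggle j A)))"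
   by (intro mult_mono g[OF A'] w c0) auto
  finally show "g A * (?w A - ?w (toggle j A)) <= c * (lam * L * (?w A + ?w (toggle j A)))" .
 qed
 also have "... = c * lam * L * ((\<Sum>A\<in>Pow I. ?w A) + (\<Sum>A\<in>Pow I. ?w (toggle j A)))"
  by (simp add: sum_distrib_left sum.distrib algebra_simps)
 also have "(\<Sum>A\<in>Pow I. ?w (toggle j A)) = (\<Sum>A\<in>Pow I. ?w A)"
  by (rule sum_Pow_toggle[OF assms(1)])
 finally show ?thesis by simp
qed

text \<open>Herbst's argument: integrate the differential inequality for the logarithm of the exponential moment from 0.\<close>

lemma exp_moment_le_of_logarithmic_derivative:
 fixes h :: "'a => real"
 assumes fin: "finite S"
  and d: "!!t. 0 <= t ==> (\<Sum>A\<in>S. h A * exp (t * h A)) <= K * t * (\<Sum>A\<in>S. exp (t * h A))"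
  and "0 <= lam"
 shows "(\<Sum>A\<in>S. exp (lam * h A)) <= real (card S) * exp (K * lam\<^sup>2 / 2)"
proof -
 let ?f = "%t. (\<Sum>A\<in>S. exp (t * h A)) * exp (- (K * t\<^sup>2 / 2))"
 have "?f 0 >= ?f lam"
 proof (rule DERIV_nonpos_imp_nonincreasing[OF assms(3)])
  fix t :: real assume t: "0 <= t" "t <= lam"
  have "(?f has_real_derivative
    ((\<Sum>A\<in>S. h A * exp (t * h A)) - K * t * (\<Sum>A\<in>S. exp (t * h A))) * exp (- (K * t\<^sup>2 / 2))) (at t)"
   by (auto intro!: derivative_eq_intros simp: algebra_simps power2_eq_square)
  moreover have "((\<Sum>A\<in>S. h A * exp (t * h A)) - K * t * (\<Sum>A\<in>S. exp (t * h A))) * exp (- (K * t\<^sup>2 / 2)) <= 0"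
   using d[OF t(1)] by (intro mult_nonpos_nonneg) auto
  ultimately show "\<exists>y. (?f has_real_derivative y) (at t) \<and> y <= 0" by blast
 qed
 then have "(\<Sum>A\<in>S. exp (lam * h A)) * exp (- (K * lam\<^sup>2 / 2)) * exp (K * lam\<^sup>2 / 2) <= real (card S) * exp (K * lam\<^sup>2 / 2)"
  by (intro mult_right_mono) auto
 then show ?thesis by (simp add: mult.assoc flip: exp_add)
qed

text \<open>The function \<open>h\<close> need not have mean zero here; lying below a sum of odd functions replaces the bound on its mean. The
variance proxy is the product of the slope of \<open>h\<close> and the total size of the odd parts, and each factor can be
estimated on its own.\<close>

theorem cube_exp_moment_odd:
 fixes h :: "'i set => real" and g :: "'i => 'i set => real"
 assumes fin: "finite I"
  and le: "!!A. A \<subseteq> I ==> h A <= (\<Sum>j\<in>I. g j A)"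
  and odd: "!!A j. A \<subseteq> I ==> j \<in> I ==> g j (toggle j A) = - g j A"
  and g: "!!A j. A \<subseteq> I ==> j \<in> I ==> \<bar>g j A\<bar> <= c j"
  and h: "!!A j. A \<subseteq> I ==> j \<in> I ==> \<bar>h A - h (toggle j A)\<bar> <= 2 * L"
  and lam: "0 <= lam"
 shows "(\<Sum>A\<in>Pow I. exp (lam * h A)) <= 2 ^ card I * exp (L * (\<Sum>j\<in>I. c j) * lam\<^sup>2 / 2)"
proof -
 have "(\<Sum>A\<in>Pow I. exp (lam * h A)) <= real (card (Pow I)) * exp (L * (\<Sum>j\<in>I. c j) * lam\<^sup>2 / 2)"
 proof (rule exp_moment_le_of_logarithmic_derivative)
  fix t :: real assume t: "0 <= t"
  have "(\<Sum>A\<in>Pow I. h A * exp (t * h A)) <= (\<Sum>A\<in>Pow I. (\<Sum>j\<in>I. g j A) * exp (t * h A))"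
   by (intro sum_mono mult_right_mono le) auto
  also have "... = (\<Sum>j\<in>I. \<Sum>A\<in>Pow I. g j A * exp (t * h A))"
   by (subst sum.swap) (simp add: sum_distrib_right)
  also have "... <= (\<Sum>j\<in>I. c j * t * L * (\<Sum>A\<in>Pow I. exp (t * h A)))"
  proof (rule sum_mono)
   fix j assume j: "j \<in> I"
   show "(\<Sum>A\<in>Pow I. g j A * exp (t * h A)) <= c j * t * L * (\<Sum>A\<in>Pow I. exp (t * h A))"
    by (rule odd_correlation_le[OF j fin _ _ _ t]) (use odd g h j in auto)
  qed
  also have "... = L * (\<Sum>j\<in>I. c j) * t * (\<Sum>A\<in>Pow I. exp (t * h A))"
   unfolding sum_distrib_right[symmetric] by (simp add: mult_ac)
  finally show "(\<Sum>A\<in>Pow I. h A * exp (t * h A)) <= L * (\<Sum>j\<in>I. c j) * t * (\<Sum>A\<in>Pow I. exp (t * h A))" .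
 qed (use fin lam in auto)
 then show ?thesis using fin by (simp add: card_Pow)
qed

lemma exp_add_exp_le:
 fixes u v :: real
 assumes "\<bar>u - v\<bar> <= 2 * L"
 shows "exp u + exp v <= 2 * exp (L\<^sup>2 / 2) * exp ((u + v) / 2)"
proof -
 let ?d = "(u - v) / 2"
 have c: "exp ?d + exp (- ?d) <= 2 * exp (?d\<^sup>2 / 2)"
 proof -
  \<comment> \<open>the one-coordinate cube with \<open>h\<close> taking the values \<open>1\<close> and \<open>- 1\<close>\<close>
  have *: "exp x + exp (- x) <= 2 * exp (x\<^sup>2 / 2)" if "0 <= x" for x :: real
   using cube_exp_moment_odd[of "{0::nat}" "%A. if A = {} then 1 else - 1"
     "%j A. if A = {} then 1 else - 1" "%_. 1" 1 x] that
   by (simp add: toggle_def Pow_insert subset_singleton_iff) (fastforce split: if_splits)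
  show ?thesis using *[of ?d] *[of "- ?d"] by (cases "0 <= ?d") (auto simp: field_simps)
 qed
 have "?d\<^sup>2 <= L\<^sup>2" using assms by (intro abs_le_square_iff[THEN iffD1]) auto
 then have c2: "exp ?d + exp (- ?d) <= 2 * exp (L\<^sup>2 / 2)"
  using c by (smt (verit) exp_le_cancel_iff divide_right_mono)
 have "exp u + exp v = exp ((u + v) / 2) * (exp ?d + exp (- ?d))"
  by (simp add: distrib_left flip: exp_add) (simp add: field_simps)
 also have "... <= exp ((u + v) / 2) * (2 * exp (L\<^sup>2 / 2))" by (intro mult_left_mono c2) auto
 finally show ?thesis by (simp add: mult_ac)
qed

lemma sum_Pow_insert:
 assumes "finite I" "i \<notin> I"
 shows "(\<Sum>A\<in>Pow (insert i I). f A) = (\<Sum>A\<in>Pow I. f A + f (insert i A))"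
proof -
 have "inj_on (insert i) (Pow I)" using assms by (auto simp: inj_on_def)
 moreover have "Pow I \<inter> insert i ` Pow I = {}" using assms by auto
 ultimately show ?thesis using assms
  by (simp add: Pow_insert sum.union_disjoint sum.reindex sum.distrib)
qed

text \<open>McDiarmid's inequality on the cube, by averaging out one coordinate at a time.\<close>

theorem cube_exp_moment_bounded_differences:
 fixes F :: "'i set => real"
 assumes fin: "finite I"
  and F: "!!A j. A \<subseteq> I ==> j \<in> I ==> \<bar>F A - F (toggle j A)\<bar> <= 2 * L j"
  and lam: "0 <= lam"
 shows "(\<Sum>A\<in>Pow I. exp (lam * F A)) \<le>
  2 ^ card I * exp (lam * ((\<Sum>A\<in>Pow I. F A) / 2 ^ card I)) * exp (lam\<^sup>2 * (\<Sum>j\<in>I. (L j)\<^sup>2) / 2)"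
 using fin F
proof (induction I arbitrary: F rule: finite_induct)
 case empty
 then show ?case by simp
next
 case (insert i I)
 let ?G = "%A. (F A + F (insert i A)) / 2"
 have G: "\<bar>?G A - ?G (toggle j A)\<bar> <= 2 * L j" if "A \<subseteq> I" "j \<in> I" for A j
 proof -
  have "j \<noteq> i" using that insert by auto
  then have t: "toggle j (insert i A) = insert i (toggle j A)" by (auto simp: toggle_def)
  have "\<bar>F A - F (toggle j A)\<bar> <= 2 * L j" "\<bar>F (insert i A) - F (toggle j (insert i A))\<bar> <= 2 * L j"
   using insert.prems[of A j] insert.prems[of "insert i A" j] that by auto
  then show ?thesis unfolding t by (auto simp: abs_if field_simps split: if_splits)
 qed
 have "(\<Sum>A\<in>Pow (insert i I). exp (lam * F A)) = (\<Sum>A\<in>Pow I. exp (lam * F A) + exp (lam * F (insert i A)))"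
  by (rule sum_Pow_insert) (use insert in auto)
 also have "... <= (\<Sum>A\<in>Pow I. 2 * exp ((lam * L i)\<^sup>2 / 2) * exp (lam * ?G A))"
 proof (rule sum_mono)
  fix A assume "A \<in> Pow I"
  then have "toggle i A = insert i A" "A \<subseteq> insert i I" using insert by (auto simp: toggle_def)
  then have "\<bar>F A - F (insert i A)\<bar> <= 2 * L i" using insert.prems[of A i] by auto
  then have "\<bar>lam * F A - lam * F (insert i A)\<bar> <= 2 * (lam * L i)"
   using lam by (simp add: abs_mult mult_left_mono flip: right_diff_distrib)
    (metis mult.left_commute mult_left_mono)
  from exp_add_exp_le[OF this]
  show "exp (lam * F A) + exp (lam * F (insert i A)) <= 2 * exp ((lam * L i)\<^sup>2 / 2) * exp (lam * ?G A)"
   by (simp add: algebra_simps)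
 qed
 also have "... = 2 * exp ((lam * L i)\<^sup>2 / 2) * (\<Sum>A\<in>Pow I. exp (lam * ?G A))"
  by (simp add: sum_distrib_left)
 also have "... <= 2 * exp ((lam * L i)\<^sup>2 / 2) *
  (2 ^ card I * exp (lam * ((\<Sum>A\<in>Pow I. ?G A) / 2 ^ card I)) * exp (lam\<^sup>2 * (\<Sum>j\<in>I. (L j)\<^sup>2) / 2))"
  by (intro mult_left_mono insert.IH G) auto
 also have "(\<Sum>A\<in>Pow I. ?G A) / 2 ^ card I = (\<Sum>A\<in>Pow (insert i I). F A) / 2 ^ card (insert i I)"
  using insert by (subst sum_Pow_insert) (auto simp: sum_divide_distrib[symmetric])
 finally show ?case using insert
  by (simp add: mult_ac power_mult_distrib flip: exp_add) (simp add: algebra_simps add_divide_distrib)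
qed

lemma sum_Pow_Un:
 assumes "finite P" "finite Q" "P \<inter> Q = {}"
 shows "(\<Sum>A\<in>Pow (P \<union> Q). f A) = (\<Sum>A\<in>Pow P. \<Sum>B\<in>Pow Q. f (A \<union> B))"
proof -
 have "(\<Sum>A\<in>Pow P. \<Sum>B\<in>Pow Q. f (A \<union> B)) = (\<Sum>(A,B)\<in>Pow P \<times> Pow Q. f (A \<union> B))"
  by (rule sum.cartesian_product)
 also have "... = (\<Sum>A\<in>Pow (P \<union> Q). f A)"
  by (rule sum.reindex_bij_witness[of _ "%A. (A \<inter> P, A \<inter> Q)" "%(A, B). A \<union> B"])
   (use assms(3) in \<open>auto intro: arg_cong[of _ _ f]\<close>)
 finally show ?thesis by simp
qed

text \<open>McDiarmid's inequality in the coordinates \<open>Q\<close> only, which leaves the function averaged over them.\<close>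

theorem cube_exp_moment_two_phase:
 fixes F :: "'i set => real"
 assumes fin: "finite P" "finite Q" "P \<inter> Q = {}"
  and F: "!!A j. A \<subseteq> P \<union> Q ==> j \<in> Q ==> \<bar>F A - F (toggle j A)\<bar> <= 2 * L j"
  and lam: "0 <= lam"
 shows "(\<Sum>A\<in>Pow (P \<union> Q). exp (lam * F A)) \<le>
  2 ^ card Q * exp (lam\<^sup>2 * (\<Sum>j\<in>Q. (L j)\<^sup>2) / 2) *
   (\<Sum>A\<in>Pow P. exp (lam * ((\<Sum>B\<in>Pow Q. F (A \<union> B)) / 2 ^ card Q)))"
proof -
 have "(\<Sum>A\<in>Pow (P \<union> Q). exp (lam * F A)) = (\<Sum>A\<in>Pow P. \<Sum>B\<in>Pow Q. exp (lam * F (A \<union> B)))"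
  by (rule sum_Pow_Un[OF fin])
 also have "... <= (\<Sum>A\<in>Pow P. 2 ^ card Q * exp (lam * ((\<Sum>B\<in>Pow Q. F (A \<union> B)) / 2 ^ card Q)) *
   exp (lam\<^sup>2 * (\<Sum>j\<in>Q. (L j)\<^sup>2) / 2))"
 proof (intro sum_mono cube_exp_moment_bounded_differences fin lam)
  fix A B j assume *: "A \<in> Pow P" "B \<subseteq> Q" "j \<in> Q"
  then have "toggle j (A \<union> B) = A \<union> toggle j B" using fin by (auto simp: toggle_def)
  then show "\<bar>F (A \<union> B) - F (A \<union> toggle j B)\<bar> <= 2 * L j"
   using F[of "A \<union> B" j] * by auto
 qed
 finally show ?thesis by (simp add: sum_distrib_left mult_ac)
qed

text \<open>The average of \<open>G\<close> after a random set of flips with weights \<open>w\<close>.\<close>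

definition flip_average :: "'i set => ('i set => real) => ('i set => real) => 'i set => real" where
 "flip_average I w G A = (\<Sum>N\<in>Pow I. w N * G (sym_diff A N))"

lemma sym_diff_toggle: "sym_diff (toggle j A) N = toggle j (sym_diff A N)"
 by (auto simp: toggle_def)

lemma sym_diff_toggle2: "sym_diff A (toggle j N) = toggle j (sym_diff A N)"
 by (auto simp: toggle_def)

lemma sym_diff_telescope:
 fixes N :: "nat set" and G :: "nat set => real"
 assumes "finite N"
 shows "G (sym_diff A N) - G A =
  (\<Sum>j\<in>N. G (toggle j (sym_diff A {i\<in>N. i < j})) - G (sym_diff A {i\<in>N. i < j}))"
 using assms
proof (induction N rule: finite_linorder_max_induct)
 case empty
 then show ?case by simp
next
 case (insert b N)
 have b: "b \<notin> N" using insert by auto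
 have 1: "{i\<in>insert b N. i < b} = N" using insert by auto
 have 2: "{i\<in>insert b N. i < j} = {i\<in>N. i < j}" if "j \<in> N" for j using insert that by auto
 have 3: "sym_diff A (insert b N) = toggle b (sym_diff A N)" using b by (auto simp: toggle_def)
 have "(\<Sum>j\<in>N. G (toggle j (sym_diff A {i\<in>insert b N. i < j})) - G (sym_diff A {i\<in>insert b N. i < j}))
   = G (sym_diff A N) - G A"
  unfolding insert.IH by (intro sum.cong refl) (simp only: 2)
 then show ?case unfolding 3 by (simp only: sum.insert[OF insert.hyps(1) b] 1)
qed

text \<open>Averaging smooths: a change of coordinate \<open>j\<close> can be absorbed into the flipped set, so that only the variation of the
weight across \<open>j\<close> is felt. For slowly varying \<open>w\<close> this is much less than the slope of \<open>G\<close>.\<close>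

lemma flip_average_lipschitz:
 fixes G :: "'i set => real"
 assumes fin: "finite I" and j: "j \<in> I" and A: "A \<subseteq> I"
  and G: "!!B. B \<subseteq> I ==> \<bar>G B - G (toggle j B)\<bar> <= 2 * K"
  and r: "(\<Sum>N\<in>Pow (I - {j}). \<bar>w N - w (insert j N)\<bar>) <= r"
  and K: "0 <= K"
 shows "\<bar>flip_average I w G A - flip_average I w G (toggle j A)\<bar> <= 2 * (K * r)"
proof -
 have I: "I = insert j (I - {j})" using j by auto
 have s: "(\<Sum>N\<in>Pow I. f N) = (\<Sum>N\<in>Pow (I - {j}). f N + f (insert j N))" for f :: "'i set => real"
  by (subst I, rule sum_Pow_insert) (use fin in auto)
 have t: "toggle j N = insert j N" if "N \<subseteq> I - {j}" for N using that by (auto simp: toggle_def)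
 have "flip_average I w G A - flip_average I w G (toggle j A)
  = (\<Sum>N\<in>Pow (I - {j}). (w N - w (insert j N)) * (G (sym_diff A N) - G (toggle j (sym_diff A N))))"
  unfolding flip_average_def s sum_subtractf[symmetric]
 proof (intro sum.cong refl)
  fix N assume "N \<in> Pow (I - {j})"
  then have "insert j N = toggle j N" by (simp add: t)
  then show "w N * G (sym_diff A N) + w (insert j N) * G (sym_diff A (insert j N)) -
    (w N * G (sym_diff (toggle j A) N) + w (insert j N) * G (sym_diff (toggle j A) (insert j N))) =
    (w N - w (insert j N)) * (G (sym_diff A N) - G (toggle j (sym_diff A N)))"
   by (simp only: sym_diff_toggle sym_diff_toggle2 toggle_toggle) (simp add: algebra_simps)
 qed
 also have "\<bar>...\<bar> <= (\<Sum>N\<in>Pow (I - {j}). \<bar>w N - w (insert j N)\<bar> * (2 * K))"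
  by (intro order_trans[OF sum_abs] sum_mono) (use A in \<open>auto simp: abs_mult intro!: mult_left_mono G\<close>)
 also have "... = (\<Sum>N\<in>Pow (I - {j}). \<bar>w N - w (insert j N)\<bar>) * (2 * K)"
  by (simp add: sum_distrib_right)
 also have "... <= r * (2 * K)" using r K by (intro mult_right_mono) auto
 finally show ?thesis by (simp add: mult_ac)
qed

text \<open>Perform the flips of the random set in increasing order. The step that flips \<open>j\<close> changes \<open>G\<close> by an
amount odd in \<open>j\<close>, and it happens with probability at most one half.\<close>

lemma flip_average_odd_decomposition:
 fixes G :: "nat set => real" and I :: "nat set"
 assumes fin: "finite I"
  and G: "!!B j. B \<subseteq> I ==> j \<in> I ==> \<bar>G B - G (toggle j B)\<bar> <= 2 * K"
  and w: "!!N. N \<subseteq> I ==> 0 <= w N" "(\<Sum>N\<in>Pow I. w N) = 1"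
  and half: "!!j. j \<in> I ==> (\<Sum>N | N \<subseteq> I \<and> j \<in> N. w N) <= 1 / 2"
  and K: "0 <= K"
 obtains g where "!!A. A \<subseteq> I ==> flip_average I w G A - G A = (\<Sum>j\<in>I. g j A)"
  "!!A j. A \<subseteq> I ==> j \<in> I ==> g j (toggle j A) = - g j A"
  "!!A j. A \<subseteq> I ==> j \<in> I ==> \<bar>g j A\<bar> <= K"
proof
 let ?B = "%A N j. sym_diff A {i\<in>N. i < j}"
 let ?g = "%j A. \<Sum>N | N \<subseteq> I \<and> j \<in> N. w N * (G (toggle j (?B A N j)) - G (?B A N j))"
 fix A assume A: "A \<subseteq> I"
 have "flip_average I w G A - G A = (\<Sum>N\<in>Pow I. w N * (G (sym_diff A N) - G A))"
  using w(2) by (simp add: flip_average_def right_diff_distrib sum_subtractf flip: sum_distrib_right)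
 also have "... = (\<Sum>N\<in>Pow I. \<Sum>j\<in>N. w N * (G (toggle j (?B A N j)) - G (?B A N j)))"
 proof (intro sum.cong refl)
  fix N assume "N \<in> Pow I"
  then have "finite N" using fin finite_subset by auto
  then show "w N * (G (sym_diff A N) - G A) = (\<Sum>j\<in>N. w N * (G (toggle j (?B A N j)) - G (?B A N j)))"
   by (simp only: sym_diff_telescope sum_distrib_left)
 qed
 also have "... = (\<Sum>N\<in>Pow I. \<Sum>j\<in>{j\<in>I. j \<in> N}. w N * (G (toggle j (?B A N j)) - G (?B A N j)))"
  by (intro sum.cong) auto
 also have "... = (\<Sum>j\<in>I. \<Sum>N\<in>{N\<in>Pow I. j \<in> N}. w N * (G (toggle j (?B A N j)) - G (?B A N j)))"
  by (rule sum.swap_restrict) (use fin in auto)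
 also have "... = (\<Sum>j\<in>I. ?g j A)" by (intro sum.cong) auto
 finally show "flip_average I w G A - G A = (\<Sum>j\<in>I. ?g j A)" .
 fix j assume j: "j \<in> I"
 show "?g j (toggle j A) = - ?g j A"
  unfolding sum_negf[symmetric]
  by (intro sum.cong refl) (simp only: sym_diff_toggle toggle_toggle, simp add: algebra_simps)
 have "\<bar>?g j A\<bar> <= (\<Sum>N | N \<subseteq> I \<and> j \<in> N. w N * (2 * K))"
 proof (intro order_trans[OF sum_abs] sum_mono)
  fix N assume N: "N \<in> {N. N \<subseteq> I \<and> j \<in> N}"
  then have "?B A N j \<subseteq> I" using A by auto
  from G[OF this j] have "\<bar>G (toggle j (?B A N j)) - G (?B A N j)\<bar> <= 2 * K" by (simp add: abs_minus_commute)
  then show "\<bar>w N * (G (toggle j (?B A N j)) - G (?B A N j))\<bar> <= w N * (2 * K)"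
   using w(1)[of N] N by (simp add: abs_mult mult_left_mono)
 qed
 also have "... = (\<Sum>N | N \<subseteq> I \<and> j \<in> N. w N) * (2 * K)" by (simp add: sum_distrib_right)
 also have "... <= 1 / 2 * (2 * K)" using half[OF j] K by (intro mult_right_mono) auto
 finally show "\<bar>?g j A\<bar> <= K" by simp
qed

theorem cube_exp_moment_flip_average:
 fixes G :: "nat set => real" and I :: "nat set"
 assumes fin: "finite I"
  and G: "!!B j. B \<subseteq> I ==> j \<in> I ==> \<bar>G B - G (toggle j B)\<bar> <= 2 * K"
  and w: "!!N. N \<subseteq> I ==> 0 <= w N" "(\<Sum>N\<in>Pow I. w N) = 1"
  and half: "!!j. j \<in> I ==> (\<Sum>N | N \<subseteq> I \<and> j \<in> N. w N) <= 1 / 2"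
  and r: "!!j. j \<in> I ==> (\<Sum>N\<in>Pow (I - {j}). \<bar>w N - w (insert j N)\<bar>) <= r"
  and h: "!!A. A \<subseteq> I ==> h A <= flip_average I w G A - G A"
  and K: "0 <= K" and lam: "0 <= lam"
 shows "(\<Sum>A\<in>Pow I. exp (lam * h A)) <= 2 ^ card I * exp (K\<^sup>2 * real (card I) * (1 + r) * lam\<^sup>2 / 2)"
proof -
 let ?h = "%A. flip_average I w G A - G A"
 obtain g where g: "!!A. A \<subseteq> I ==> ?h A = (\<Sum>j\<in>I. g j A)"
  "!!A j. A \<subseteq> I ==> j \<in> I ==> g j (toggle j A) = - g j A"
  "!!A j. A \<subseteq> I ==> j \<in> I ==> \<bar>g j A\<bar> <= K"
  by (rule flip_average_odd_decomposition[OF fin G w half K]) auto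
 have "(\<Sum>A\<in>Pow I. exp (lam * h A)) <= (\<Sum>A\<in>Pow I. exp (lam * ?h A))"
  using h lam by (intro sum_mono) (auto intro!: mult_left_mono)
 also have "... <= 2 ^ card I * exp (K * (1 + r) * (\<Sum>j\<in>I. K) * lam\<^sup>2 / 2)"
 proof (rule cube_exp_moment_odd[where g = g])
  fix A j assume A: "A \<subseteq> I" and j: "j \<in> I"
  show "\<bar>?h A - ?h (toggle j A)\<bar> <= 2 * (K * (1 + r))"
   using flip_average_lipschitz[OF fin j A _ r[OF j] K, of G] G[OF _ j] G[OF A j]
   by (simp add: algebra_simps abs_le_iff)
 qed (use fin lam g in auto)
 finally show ?thesis by (simp add: power2_eq_square mult_ac)
qed

lemma sum_Pow_sym_diff:
 assumes "N \<subseteq> I"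
 shows "(\<Sum>B\<in>Pow I. f (sym_diff B N)) = (\<Sum>B\<in>Pow I. f B)"
proof (rule sum.reindex_bij_witness[of _ "%B. sym_diff B N" "%B. sym_diff B N"])
 fix B assume "B \<in> Pow I"
 show "sym_diff (sym_diff B N) N = B" by blast
 then show "sym_diff (sym_diff B N) N = B" .
qed (use assms in auto)

text \<open>Here the averaged function also contains two flipped copies of \<open>G\<close>. Averaging over the coordinates of \<open>N2\<close> gives them the
same mean as \<open>G\<close> itself, so integrating these coordinates out first removes the copies and leaves \<open>u\<close> times a flip
average on the remaining coordinates.\<close>

theorem cube_exp_moment_half:
 fixes G :: "nat set => real" and I N1 N2 :: "nat set"
 assumes fin: "finite I" and N: "N1 \<subseteq> N2" "N2 \<subseteq> I" "card (N2 - N1) <= 1"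
  and G: "!!B j. B \<subseteq> I ==> j \<in> I ==> \<bar>G B - G (toggle j B)\<bar> <= 2 * K"
  and w: "!!N. N \<subseteq> I ==> 0 <= w N" "(\<Sum>N\<in>Pow I. w N) = 1"
  and half: "!!j. j \<in> I ==> (\<Sum>N | N \<subseteq> I \<and> j \<in> N. w N) <= 1 / 2"
  and r: "!!j. j \<in> I ==> (\<Sum>N\<in>Pow (I - {j}). \<bar>w N - w (insert j N)\<bar>) <= r"
  and K: "0 <= K" and lam: "0 <= lam" and au: "0 <= a" "0 <= u" "a + u = 1"
 shows "(\<Sum>A\<in>Pow I. exp (lam * (a * ((G (sym_diff A N1) + G (sym_diff A N2)) / 2) + u * flip_average I w G A - G A)))
  <= 2 ^ card I * exp (lam\<^sup>2 * K\<^sup>2 * (real (card (I - N2)) * u\<^sup>2 * (1 + r) + real (card (N2 - N1)) * (1 + u * r)\<^sup>2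
    + real (card N1) * (1 + a + u * r)\<^sup>2) / 2)"
proof -
 define P where "P = I - N2"
 define F where "F = (%A. a * ((G (sym_diff A N1) + G (sym_diff A N2)) / 2) + u * flip_average I w G A - G A)"
 define L where "L = (%j. if j \<in> N1 then K * (1 + a + u * r) else K * (1 + u * r))"
 define Psi where "Psi = (%A. (\<Sum>B\<in>Pow N2. G (A \<union> B)) / 2 ^ card N2)"
 define w' where "w' = (%X. \<Sum>Y\<in>Pow N2. w (X \<union> Y))"
 have PI: "P \<union> N2 = I" "P \<inter> N2 = {}" using N by (auto simp: P_def)
 have finN: "finite N2" "finite N1" "finite P" using fin N finite_subset by (auto simp: P_def intro: finite_subset)
 have am: "\<bar>a * x - a * y\<bar> = a * \<bar>x - y\<bar>" for x y :: real
  using au(1) by (simp add: abs_mult flip: right_diff_distrib)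
 have slope: "\<bar>F A - F (toggle j A)\<bar> <= 2 * L j" if A: "A \<subseteq> P \<union> N2" and j: "j \<in> N2" for A j
 proof -
  have A': "A \<subseteq> I" and jI: "j \<in> I" using A j N by (auto simp: P_def)
  have 1: "\<bar>flip_average I w G A - flip_average I w G (toggle j A)\<bar> <= 2 * (K * r)"
   by (rule flip_average_lipschitz[OF fin jI A' _ r[OF jI] K]) (use G jI in auto)
  have 1: "\<bar>u * flip_average I w G A - u * flip_average I w G (toggle j A)\<bar> <= 2 * (K * (u * r))"
  proof -
   have "u * \<bar>flip_average I w G A - flip_average I w G (toggle j A)\<bar> <= u * (2 * (K * r))"
    by (intro mult_left_mono 1 au)
   then show ?thesis using au(2) by (simp add: abs_mult mult_ac flip: right_diff_distrib)
  qed
  have 2: "\<bar>G A - G (toggle j A)\<bar> <= 2 * K" by (rule G[OF A' jI])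
  let ?S = "%A. (G (sym_diff A N1) + G (sym_diff A N2)) / 2"
  have 3: "\<bar>a * ?S A - a * ?S (toggle j A)\<bar> <= 2 * (if j \<in> N1 then K * a else 0)"
  proof (cases "j \<in> N1")
   case True
   have "sym_diff A N1 \<subseteq> I" "sym_diff A N2 \<subseteq> I" using A' N by auto
   from this[THEN G[OF _ jI]] have "\<bar>?S A - ?S (toggle j A)\<bar> <= 2 * K"
    by (simp only: sym_diff_toggle) (simp add: abs_le_iff field_simps)
   then have "a * \<bar>?S A - ?S (toggle j A)\<bar> <= a * (2 * K)" by (intro mult_left_mono au)
   then show ?thesis unfolding am using True by (simp add: mult_ac)
  next
   case False
   \<comment> \<open>the one coordinate in \<open>N2 - N1\<close> is flipped in exactly one of the two terms\<close>
   then have "N2 - N1 = {j}" using N(3) j finN by (auto simp: card_le_Suc0_iff_eq)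
   then have "N2 = toggle j N1" using N(1) False by (auto simp: toggle_def)
   then have e: "?S (toggle j A) = ?S A"
    by (simp only: sym_diff_toggle sym_diff_toggle2 toggle_toggle) simp
   show ?thesis unfolding e using False by simp
  qed
  have "F A - F (toggle j A) = (a * ?S A - a * ?S (toggle j A))
    + (u * flip_average I w G A - u * flip_average I w G (toggle j A)) - (G A - G (toggle j A))"
   unfolding F_def by simp
  then have "\<bar>F A - F (toggle j A)\<bar> <= 2 * (if j \<in> N1 then K * a else 0) + 2 * (K * (u * r)) + 2 * K"
   using 1 2 3 by linarith
  also have "... = 2 * L j" by (simp add: L_def algebra_simps)
  finally show ?thesis .
 qed
 have mean: "(\<Sum>B\<in>Pow N2. F (A \<union> B)) / 2 ^ card N2 = u * (flip_average P w' Psi A - Psi A)" if A: "A \<subseteq> P" for A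
 proof -
  have G1: "(\<Sum>B\<in>Pow N2. G (sym_diff (A \<union> B) M)) = (\<Sum>B\<in>Pow N2. G (sym_diff A (M \<inter> P) \<union> B))"
   if M: "M \<subseteq> I" for M
  proof -
   have "sym_diff (A \<union> B) M = sym_diff A (M \<inter> P) \<union> sym_diff B (M \<inter> N2)" if "B \<subseteq> N2" for B
    using M A PI that by blast
   then have "(\<Sum>B\<in>Pow N2. G (sym_diff (A \<union> B) M)) = (\<Sum>B\<in>Pow N2. G (sym_diff A (M \<inter> P) \<union> sym_diff B (M \<inter> N2)))"
    by (intro sum.cong) auto
   then show ?thesis
    using sum_Pow_sym_diff[of "M \<inter> N2" N2 "%B. G (sym_diff A (M \<inter> P) \<union> B)"] by simp
  qed
  have "(\<Sum>B\<in>Pow N2. flip_average I w G (A \<union> B)) = (\<Sum>N\<in>Pow I. w N * (\<Sum>B\<in>Pow N2. G (sym_diff (A \<union> B) N)))"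
   unfolding flip_average_def by (subst sum.swap) (simp add: sum_distrib_left)
  also have "... = (\<Sum>N\<in>Pow (P \<union> N2). w N * (2 ^ card N2 * Psi (sym_diff A (N \<inter> P))))"
   unfolding PI Psi_def by (intro sum.cong refl) (subst G1, auto)
  also have "... = (\<Sum>X\<in>Pow P. \<Sum>Y\<in>Pow N2. w (X \<union> Y) * (2 ^ card N2 * Psi (sym_diff A ((X \<union> Y) \<inter> P))))"
   by (rule sum_Pow_Un) (use finN PI in auto)
  also have "... = (\<Sum>X\<in>Pow P. \<Sum>Y\<in>Pow N2. w (X \<union> Y) * (2 ^ card N2 * Psi (sym_diff A X)))"
  proof (intro sum.cong refl)
   fix X Y assume "X \<in> Pow P" "Y \<in> Pow N2"
   then have "(X \<union> Y) \<inter> P = X" using PI by auto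
   then show "w (X \<union> Y) * (2 ^ card N2 * Psi (sym_diff A ((X \<union> Y) \<inter> P))) = w (X \<union> Y) * (2 ^ card N2 * Psi (sym_diff A X))"
    by simp
  qed
  also have "... = 2 ^ card N2 * flip_average P w' Psi A"
   by (simp add: flip_average_def w'_def sum_distrib_left sum_distrib_right mult_ac)
  finally have fa: "(\<Sum>B\<in>Pow N2. flip_average I w G (A \<union> B)) = 2 ^ card N2 * flip_average P w' Psi A" .
  have g0: "(\<Sum>B\<in>Pow N2. G (A \<union> B)) = 2 ^ card N2 * Psi A" by (simp add: Psi_def)
  have N0: "N1 \<inter> P = {}" "N2 \<inter> P = {}" using N PI by auto
  have g1: "(\<Sum>B\<in>Pow N2. G (sym_diff (A \<union> B) N1)) = 2 ^ card N2 * Psi A"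
   "(\<Sum>B\<in>Pow N2. G (sym_diff (A \<union> B) N2)) = 2 ^ card N2 * Psi A"
   using G1[of N1] G1[of N2] N N0 g0 by auto
  have "(\<Sum>B\<in>Pow N2. F (A \<union> B)) = a * ((2 ^ card N2 * Psi A + 2 ^ card N2 * Psi A) / 2)
    + u * (2 ^ card N2 * flip_average P w' Psi A) - 2 ^ card N2 * Psi A"
   unfolding F_def g0[symmetric] fa[symmetric] sum_subtractf sum.distrib
   by (simp add: g1 g0 sum.distrib flip: sum_distrib_left sum_divide_distrib)
  then have "(\<Sum>B\<in>Pow N2. F (A \<union> B)) = 2 ^ card N2 * (u * flip_average P w' Psi A + (a - 1) * Psi A)"
   by (simp add: algebra_simps)
  moreover have "a - 1 = - u" using au by simp
  ultimately have "(\<Sum>B\<in>Pow N2. F (A \<union> B)) = 2 ^ card N2 * (u * (flip_average P w' Psi A - Psi A))"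
   by (simp only: right_diff_distrib) (simp add: algebra_simps)
  then show ?thesis by simp
 qed
 have first: "(\<Sum>A\<in>Pow P. exp (lam * (u * (flip_average P w' Psi A - Psi A)))) \<le>
   2 ^ card P * exp (K\<^sup>2 * real (card P) * (1 + r) * (lam * u)\<^sup>2 / 2)"
 proof -
  have sw: "(\<Sum>X\<in>Pow P. f X * w' X) = (\<Sum>N\<in>Pow I. f (N \<inter> P) * w N)" for f :: "nat set => real"
  proof -
   have "(\<Sum>N\<in>Pow (P \<union> N2). f (N \<inter> P) * w N) = (\<Sum>X\<in>Pow P. \<Sum>Y\<in>Pow N2. f ((X \<union> Y) \<inter> P) * w (X \<union> Y))"
    by (rule sum_Pow_Un) (use finN PI in auto)
   also have "... = (\<Sum>X\<in>Pow P. \<Sum>Y\<in>Pow N2. f X * w (X \<union> Y))"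
   proof (intro sum.cong refl)
    fix X Y assume "X \<in> Pow P" "Y \<in> Pow N2"
    then have "(X \<union> Y) \<inter> P = X" using PI by auto
    then show "f ((X \<union> Y) \<inter> P) * w (X \<union> Y) = f X * w (X \<union> Y)" by simp
   qed
   finally show ?thesis by (simp add: PI w'_def sum_distrib_left)
  qed
  have "(\<Sum>A\<in>Pow P. exp (lam * u * (flip_average P w' Psi A - Psi A)))
   <= 2 ^ card P * exp (K\<^sup>2 * real (card P) * (1 + r) * (lam * u)\<^sup>2 / 2)"
  proof (rule cube_exp_moment_flip_average)
   fix B j assume B: "B \<subseteq> P" and j: "j \<in> P"
   have "\<bar>G (B \<union> Y) - G (toggle j B \<union> Y)\<bar> <= 2 * K" if "Y \<subseteq> N2" for Y
   proof -
    have "toggle j (B \<union> Y) = toggle j B \<union> Y" using that j PI by (auto simp: toggle_def)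
    then show ?thesis using G[of "B \<union> Y" j] that B j PI by auto
   qed
   then have "\<bar>\<Sum>Y\<in>Pow N2. G (B \<union> Y) - G (toggle j B \<union> Y)\<bar> <= (\<Sum>Y\<in>Pow N2. 2 * K)"
    by (intro order_trans[OF sum_abs] sum_mono) auto
   then have *: "\<bar>\<Sum>Y\<in>Pow N2. G (B \<union> Y) - G (toggle j B \<union> Y)\<bar> <= 2 ^ card N2 * (2 * K)"
    using finN by (simp add: card_Pow)
   have "Psi B - Psi (toggle j B) = (\<Sum>Y\<in>Pow N2. G (B \<union> Y) - G (toggle j B \<union> Y)) / 2 ^ card N2"
    by (simp add: Psi_def sum_subtractf diff_divide_distrib)
   then show "\<bar>Psi B - Psi (toggle j B)\<bar> <= 2 * K"
    using * by (simp add: abs_divide pos_divide_le_eq mult_ac)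
  next
   fix X assume "X \<subseteq> P"
   then have "X \<union> Y \<subseteq> I" if "Y \<subseteq> N2" for Y using that PI by auto
   then show "0 <= w' X" unfolding w'_def by (intro sum_nonneg w) auto
  next
   show "(\<Sum>X\<in>Pow P. w' X) = 1" using sw[of "%_. 1"] w(2) by simp
  next
   fix j assume j: "j \<in> P"
   have "(\<Sum>X | X \<subseteq> P \<and> j \<in> X. w' X) = (\<Sum>X\<in>Pow P. (if j \<in> X then 1 else 0) * w' X)"
    using finN by (intro sum.mono_neutral_cong_left) auto
   also have "... = (\<Sum>N\<in>Pow I. (if j \<in> N \<inter> P then 1 else 0) * w N)" by (rule sw)
   also have "... = (\<Sum>N | N \<subseteq> I \<and> j \<in> N. w N)"
    using fin j by (intro sum.mono_neutral_cong_right) auto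
   finally show "(\<Sum>X | X \<subseteq> P \<and> j \<in> X. w' X) <= 1 / 2" using half j PI by auto
   have "(\<Sum>X\<in>Pow (P - {j}). \<bar>w' X - w' (insert j X)\<bar>)
    <= (\<Sum>X\<in>Pow (P - {j}). \<Sum>Y\<in>Pow N2. \<bar>w (X \<union> Y) - w (insert j (X \<union> Y))\<bar>)"
    unfolding w'_def sum_subtractf[symmetric] by (intro sum_mono order_trans[OF sum_abs]) simp
   also have "... = (\<Sum>N\<in>Pow ((P - {j}) \<union> N2). \<bar>w N - w (insert j N)\<bar>)"
    by (rule sum_Pow_Un[symmetric]) (use finN PI in auto)
   also have "(P - {j}) \<union> N2 = I - {j}" using PI j by auto
   finally show "(\<Sum>X\<in>Pow (P - {j}). \<bar>w' X - w' (insert j X)\<bar>) <= r" using r[of j] j PI by auto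
  qed (use finN K lam au in auto)
  then show ?thesis by (simp add: mult_ac)
 qed
 have Lsum: "(\<Sum>j\<in>N2. (L j)\<^sup>2) = K\<^sup>2 * (real (card (N2 - N1)) * (1 + u * r)\<^sup>2 + real (card N1) * (1 + a + u * r)\<^sup>2)"
 proof -
  have "(\<Sum>j\<in>N2. (L j)\<^sup>2) = (\<Sum>j\<in>N2 - N1. (L j)\<^sup>2) + (\<Sum>j\<in>N1. (L j)\<^sup>2)"
   by (rule sum.subset_diff[OF N(1)]) (use finN in auto)
  also have "... = (\<Sum>j\<in>N2 - N1. (K * (1 + u * r))\<^sup>2) + (\<Sum>j\<in>N1. (K * (1 + a + u * r))\<^sup>2)"
   by (simp add: L_def)
  finally have Ls: "(\<Sum>j\<in>N2. (L j)\<^sup>2) = real (card (N2 - N1)) * (K * (1 + u * r))\<^sup>2 + real (card N1) * (K * (1 + a + u * r))\<^sup>2"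
   by simp
  have "c1 * (K * x)\<^sup>2 + c2 * (K * y)\<^sup>2 = K\<^sup>2 * (c1 * x\<^sup>2 + c2 * y\<^sup>2)" for x y c1 c2 :: real
   by (simp add: power_mult_distrib distrib_left mult_ac)
  then show ?thesis unfolding Ls .
 qed
 have "(\<Sum>A\<in>Pow I. exp (lam * F A)) = (\<Sum>A\<in>Pow (P \<union> N2). exp (lam * F A))" by (simp add: PI)
 also have "... <= 2 ^ card N2 * exp (lam\<^sup>2 * (\<Sum>j\<in>N2. (L j)\<^sup>2) / 2) *
   (\<Sum>A\<in>Pow P. exp (lam * ((\<Sum>B\<in>Pow N2. F (A \<union> B)) / 2 ^ card N2)))"
  by (rule cube_exp_moment_two_phase) (use finN PI slope lam in auto)
 also have "(\<Sum>A\<in>Pow P. exp (lam * ((\<Sum>B\<in>Pow N2. F (A \<union> B)) / 2 ^ card N2))) =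
   (\<Sum>A\<in>Pow P. exp (lam * (u * (flip_average P w' Psi A - Psi A))))"
  by (intro sum.cong refl) (simp only: mean Pow_iff)
 also have "2 ^ card N2 * exp (lam\<^sup>2 * (\<Sum>j\<in>N2. (L j)\<^sup>2) / 2) * ... \<le>
   2 ^ card N2 * exp (lam\<^sup>2 * (\<Sum>j\<in>N2. (L j)\<^sup>2) / 2) * (2 ^ card P * exp (K\<^sup>2 * real (card P) * (1 + r) * (lam * u)\<^sup>2 / 2))"
  by (intro mult_left_mono first) auto
 also have "... = 2 ^ (card P + card N2) * exp (lam\<^sup>2 * (\<Sum>j\<in>N2. (L j)\<^sup>2) / 2 + K\<^sup>2 * real (card P) * (1 + r) * (lam * u)\<^sup>2 / 2)"
  by (simp add: power_add exp_add)
 also have "card P + card N2 = card I" using card_Un_disjoint[of P N2] finN PI by simp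
 finally show ?thesis unfolding F_def Lsum P_def
  by (simp add: power_mult_distrib algebra_simps add_divide_distrib)
qed

section \<open>Central layers of the cube\<close>

definition layer_sum :: "nat set => (nat set => real) => nat set => nat => real" where
 "layer_sum I G A k = (\<Sum>N | N \<subseteq> I \<and> card N = k. G (sym_diff A N))"

text \<open>The number of subsets of an \<open>n\<close>-set in the central window of sizes \<open>{j..n-j}\<close>; the weight below is the
uniform law on that window.\<close>

definition middle_size :: "nat => nat => nat" where
 "middle_size n j = (\<Sum>i=j..n-j. n choose i)"

definition middle_weight :: "nat set => nat => nat set => real" where
 "middle_weight I j N = (if j <= card N \<and> card N <= card I - j then 1 / real (middle_size (card I) j) else 0)"

definition middle_ratio :: "nat => nat => real" where
 "middle_ratio n j = real (n choose j) / real (middle_size n j)"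

lemma sum_by_card:
 fixes f :: "nat set => real"
 assumes "finite I"
 shows "(\<Sum>N | N \<subseteq> I \<and> card N \<in> J. f N) = (\<Sum>k\<in>J \<inter> {..card I}. \<Sum>N | N \<subseteq> I \<and> card N = k. f N)"
proof -
 have "(\<Sum>k\<in>J \<inter> {..card I}. sum f {N \<in> {N. N \<subseteq> I \<and> card N \<in> J}. card N = k}) = sum f {N. N \<subseteq> I \<and> card N \<in> J}"
  by (rule sum.group) (use assms card_mono in auto)
 moreover have "(\<Sum>k\<in>J \<inter> {..card I}. sum f {N \<in> {N. N \<subseteq> I \<and> card N \<in> J}. card N = k})
   = (\<Sum>k\<in>J \<inter> {..card I}. sum f {N. N \<subseteq> I \<and> card N = k})"
  by (intro sum.cong refl arg_cong2[where f = sum]) auto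
 ultimately show ?thesis by simp
qed

lemma middle_size_pos: "2 * j <= n ==> 0 < middle_size n j"
 unfolding middle_size_def by (rule sum_pos2[of _ j]) auto

text \<open>Binomial coefficients are smallest at the edges of a symmetric window.\<close>

lemma choose_le_middle:
 assumes "j <= i" "i <= n - j" "2 * j <= n"
 shows "n choose j <= n choose i"
proof (cases "2 * i <= n")
 case True
 then show ?thesis using assms by (intro binomial_mono) auto
next
 case False
 have "n choose j <= n choose (n - i)" using assms False by (intro binomial_mono) auto
 also have "... = n choose i" using assms by (intro binomial_symmetric[symmetric]) auto
 finally show ?thesis .
qed

lemma middle_size_ge:
 assumes "2 * j <= n"
 shows "(n - 2 * j + 1) * (n choose j) <= middle_size n j"
proof -
 have "(\<Sum>i=j..n-j. n choose j) <= middle_size n j"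
  unfolding middle_size_def by (intro sum_mono choose_le_middle) (use assms in auto)
 moreover have "card {j..n-j} = n - 2 * j + 1" using assms by auto
 ultimately show ?thesis by simp
qed

text \<open>Beyond counting \<open>n choose j\<close> for each layer, the inner layers are larger by the factor \<open>(n - j) / (j + 1)\<close>.\<close>

lemma middle_size_ge_inner:
 assumes "2 * j + 2 <= n"
 shows "(2 * (j + 1) + (n - 2 * j - 1) * (n - j)) * (n choose j) <= (j + 1) * middle_size n j"
proof -
 have "{j..n-j} = insert j (insert (n-j) {j+1..n-j-1})" using assms by auto
 then have "middle_size n j = (n choose j) + ((n choose (n-j)) + (\<Sum>i=j+1..n-j-1. n choose i))"
 proof -
  have "j \<notin> insert (n-j) {j+1..n-j-1}" "n - j \<notin> {j+1..n-j-1}" using assms by auto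
  then show ?thesis unfolding middle_size_def \<open>{j..n-j} = _\<close> by simp
 qed
 also have "n choose (n - j) = n choose j" using assms by (intro binomial_symmetric[symmetric]) auto
 finally have m: "middle_size n j = 2 * (n choose j) + (\<Sum>i=j+1..n-j-1. n choose i)" by simp
 have "(\<Sum>i=j+1..n-j-1. n choose (j+1)) <= (\<Sum>i=j+1..n-j-1. n choose i)"
  by (intro sum_mono choose_le_middle) (use assms in auto)
 moreover have "card {j+1..n-j-1} = n - 2 * j - 1" using assms by auto
 ultimately have "(n - 2 * j - 1) * (n choose (j+1)) <= (\<Sum>i=j+1..n-j-1. n choose i)" by simp
 then have "(j + 1) * ((n - 2 * j - 1) * (n choose (j+1))) <= (j + 1) * (\<Sum>i=j+1..n-j-1. n choose i)"
  by (rule mult_le_mono2)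
 moreover have "(j + 1) * (n choose (j+1)) = (n - j) * (n choose j)"
  using binomial_absorb_comp[of n j] binomial_absorption[of j n] assms
  by (metis Suc_eq_plus1 Suc_times_binomial_eq binomial_absorption mult.commute times_binomial_minus1_eq)
 ultimately have *: "(n - 2 * j - 1) * ((n - j) * (n choose j)) <= (j + 1) * (\<Sum>i=j+1..n-j-1. n choose i)"
  by (metis mult.left_commute)
 have "(2 * (j + 1) + (n - 2 * j - 1) * (n - j)) * (n choose j)
   = 2 * (j + 1) * (n choose j) + (n - 2 * j - 1) * (n - j) * (n choose j)"
  by (rule add_mult_distrib)
 also have "... = (j + 1) * (2 * (n choose j)) + (n - 2 * j - 1) * ((n - j) * (n choose j))"
  by (simp only: mult.assoc mult.left_commute)
 also have "... <= (j + 1) * (2 * (n choose j)) + (j + 1) * (\<Sum>i=j+1..n-j-1. n choose i)"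
  using * by (rule add_left_mono)
 finally show ?thesis unfolding m by (simp only: distrib_left)
qed

lemma middle_size_le: "middle_size n j <= 2 ^ n"
 unfolding middle_size_def choose_row_sum[symmetric] by (rule sum_mono2) auto

lemma middle_size_ge_proportion:
 assumes "2 * k <= n"
 shows "2 ^ n * (n - 2 * k + 1) <= middle_size n k * (n + 1)"
proof -
 have "{..n} = {..<k} \<union> ({k..n-k} \<union> {n-k<..n})" using assms by auto
 then have "(2::nat) ^ n = (\<Sum>i\<in>{..<k} \<union> ({k..n-k} \<union> {n-k<..n}). n choose i)"
  by (simp add: choose_row_sum[symmetric])
 also have "... = (\<Sum>i<k. n choose i) + (middle_size n k + (\<Sum>i\<in>{n-k<..n}. n choose i))"
  unfolding middle_size_def using assms by (subst sum.union_disjoint, auto)+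
 also have "(\<Sum>i<k. n choose i) <= (\<Sum>i<k. n choose k)"
  by (intro sum_mono binomial_mono) (use assms in auto)
 also have "(\<Sum>i\<in>{n-k<..n}. n choose i) <= (\<Sum>i\<in>{n-k<..n}. n choose k)"
 proof (rule sum_mono)
  fix i assume i: "i \<in> {n-k<..n}"
  then have "n choose i = n choose (n - i)" by (intro binomial_symmetric) auto
  also have "... <= n choose k" using i assms by (intro binomial_mono) auto
  finally show "n choose i <= n choose k" .
 qed
 finally have "2 ^ n <= middle_size n k + 2 * k * (n choose k)" using assms by (simp add: algebra_simps)
 then have "2 ^ n * (n - 2 * k + 1) <= (middle_size n k + 2 * k * (n choose k)) * (n - 2 * k + 1)"
  by (rule mult_le_mono1)
 also have "... = middle_size n k * (n - 2 * k + 1) + 2 * k * ((n - 2 * k + 1) * (n choose k))"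
  by (simp add: algebra_simps)
 also have "... <= middle_size n k * (n - 2 * k + 1) + 2 * k * middle_size n k"
  by (intro add_left_mono mult_le_mono2 middle_size_ge assms)
 also have "... = middle_size n k * (n + 1)"
 proof -
  obtain d where "n = 2 * k + d" using assms le_Suc_ex by blast
  then show ?thesis by (simp add: algebra_simps)
 qed
 finally show ?thesis .
qed

context
 fixes I :: "nat set" and n :: nat
 assumes fin: "finite I" and n: "card I = n" and n0: "0 < n"
begin

lemma card_layer: "card {N. N \<subseteq> I \<and> card N = k} = n choose k"
 using n_subsets[OF fin, of k] n by simp

lemma sum_middle:
 assumes "2 * j <= n"
 shows "(\<Sum>N\<in>Pow I. middle_weight I j N * f N) =
  (\<Sum>k=j..n-j. \<Sum>N | N \<subseteq> I \<and> card N = k. f N) / middle_size n j"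
proof -
 have "(\<Sum>N\<in>Pow I. middle_weight I j N * f N) = (\<Sum>N | N \<subseteq> I \<and> card N \<in> {j..n-j}. f N / middle_size n j)"
  using fin by (intro sum.mono_neutral_cong_right) (auto simp: middle_weight_def n)
 also have "... = (\<Sum>k\<in>{j..n-j} \<inter> {..n}. \<Sum>N | N \<subseteq> I \<and> card N = k. f N / middle_size n j)"
  using sum_by_card[OF fin, of _ "{j..n-j}"] n by simp
 also have "{j..n-j} \<inter> {..n} = {j..n-j}" by auto
 finally show ?thesis by (simp add: sum_divide_distrib)
qed

lemma middle_weight_nonneg: "0 <= middle_weight I j N"
 by (simp add: middle_weight_def)

lemma middle_weight_sum:
 assumes "2 * j <= n" shows "(\<Sum>N\<in>Pow I. middle_weight I j N) = 1"
proof -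
 have "(\<Sum>k=j..n-j. \<Sum>N | N \<subseteq> I \<and> card N = k. 1) = real (middle_size n j)"
  by (simp add: card_layer middle_size_def)
 then show ?thesis using sum_middle[OF assms, of "%_. 1"] middle_size_pos[OF assms] by simp
qed

text \<open>The window is symmetric under complementation, which exchanges the sets containing \<open>i\<close> with those avoiding it.\<close>

lemma middle_weight_half:
 assumes "2 * j <= n" "i \<in> I"
 shows "(\<Sum>N | N \<subseteq> I \<and> i \<in> N. middle_weight I j N) = 1 / 2"
proof -
 have c: "middle_weight I j (I - N) = middle_weight I j N" if "N \<subseteq> I" for N
 proof -
  have "card (I - N) = n - card N" "card N <= n"
   using that fin n card_mono by (auto simp: card_Diff_subset finite_subset)
  then show ?thesis using assms(1) by (auto simp: middle_weight_def n)
 qed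
 have "(\<Sum>N | N \<subseteq> I \<and> i \<in> N. middle_weight I j N) = (\<Sum>N | N \<subseteq> I \<and> i \<notin> N. middle_weight I j N)"
  by (rule sum.reindex_bij_witness[of _ "%N. I - N" "%N. I - N"]) (use assms c in \<open>auto simp: double_diff\<close>)
 moreover have "(\<Sum>N\<in>Pow I. middle_weight I j N) =
   (\<Sum>N | N \<subseteq> I \<and> i \<in> N. middle_weight I j N) + (\<Sum>N | N \<subseteq> I \<and> i \<notin> N. middle_weight I j N)"
  using fin by (subst sum.union_disjoint[symmetric]) (auto intro!: sum.cong)
 ultimately show ?thesis using middle_weight_sum[OF assms(1)] by simp
qed

text \<open>The weight is constant inside the window, so inserting \<open>i\<close> matters only when it crosses one of the two boundary layers.\<close>

lemma middle_weight_slope: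
 assumes j: "2 * j <= n" and i: "i \<in> I"
 shows "(\<Sum>N\<in>Pow (I - {i}). \<bar>middle_weight I j N - middle_weight I j (insert i N)\<bar>)
  = 2 * real j / real n * middle_ratio n j"
proof (cases "j = 0")
 case True
 have "middle_weight I j N = middle_weight I j (insert i N)" if "N \<subseteq> I - {i}" for N
 proof -
  have "card N <= n" "card (insert i N) <= n" using that fin n i by (auto intro!: card_mono)
  then show ?thesis using True by (simp add: middle_weight_def n)
 qed
 then have "(\<Sum>N\<in>Pow (I - {i}). \<bar>middle_weight I j N - middle_weight I j (insert i N)\<bar>) = 0"
  by (intro sum.neutral) auto
 then show ?thesis using True by simp
next
 case False
 let ?S = "real (middle_size n j)"
 have n1: "card (I - {i}) = n - 1" using i fin n by simp
 have e: "\<bar>middle_weight I j N - middle_weight I j (insert i N)\<bar> = (if card N \<in> {j - 1, n - j} then 1 / ?S else 0)"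
  if "N \<subseteq> I - {i}" for N
 proof -
  have "finite N" "i \<notin> N" using that fin finite_subset by auto
  then have "card (insert i N) = Suc (card N)" by simp
  then show ?thesis using False j by (auto simp: middle_weight_def n)
 qed
 have "(\<Sum>N\<in>Pow (I - {i}). \<bar>middle_weight I j N - middle_weight I j (insert i N)\<bar>)
   = (\<Sum>N\<in>Pow (I - {i}). if card N \<in> {j - 1, n - j} then 1 / ?S else 0)"
  by (intro sum.cong) (use e in auto)
 also have "... = (\<Sum>N | N \<subseteq> I - {i} \<and> card N \<in> {j - 1, n - j}. 1 / ?S)"
  using fin by (intro sum.mono_neutral_cong_right) auto
 also have "... = (\<Sum>k\<in>{j - 1, n - j} \<inter> {..n - 1}. \<Sum>N | N \<subseteq> I - {i} \<and> card N = k. 1 / ?S)"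
  by (rule sum_by_card[of "I - {i}" _ "{j - 1, n - j}", unfolded n1]) (use fin in auto)
 also have "{j - 1, n - j} \<inter> {..n - 1} = {j - 1, n - j}" using False j by auto
 also have "(\<Sum>k\<in>{j - 1, n - j}. \<Sum>N | N \<subseteq> I - {i} \<and> card N = k. 1 / ?S)
  = (\<Sum>k\<in>{j - 1, n - j}. real ((n - 1) choose k) / ?S)"
  using n_subsets[of "I - {i}"] fin n1 by simp
 also have "... = (real ((n - 1) choose (j - 1)) + real ((n - 1) choose (n - j))) / ?S"
  using False j by (subst sum.insert) (auto simp: add_divide_distrib)
 also have "(n - 1) choose (n - j) = (n - 1) choose (j - 1)"
  using False j by (subst binomial_symmetric) auto
 also have "real ((n - 1) choose (j - 1)) = real j / real n * real (n choose j)"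
 proof -
  have "j * (n choose j) = n * ((n - 1) choose (j - 1))"
   using False j n0 by (metis times_binomial_minus1_eq neq0_conv)
  then have "real j * real (n choose j) = real n * real ((n - 1) choose (j - 1))" by (metis of_nat_mult)
  then show ?thesis using n0 by (simp add: field_simps)
 qed
 finally show ?thesis by (simp add: middle_ratio_def)
qed

lemma flip_average_middle:
 assumes "2 * j <= n"
 shows "flip_average I (middle_weight I j) G A = (\<Sum>k=j..n-j. layer_sum I G A k) / middle_size n j"
 unfolding flip_average_def layer_sum_def by (rule sum_middle[OF assms])

lemma layers_dominate:
 assumes dom: "!!k. j <= k ==> k <= n - j ==> 2 * real (n choose k) * x <= layer_sum I G A k + layer_sum I G A (n - k)"
  and J: "J \<subseteq> {j..n-j}" "!!k. k \<in> J ==> n - k \<in> J"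
 shows "(\<Sum>k\<in>J. real (n choose k)) * x <= (\<Sum>k\<in>J. layer_sum I G A k)"
proof -
 have "(\<Sum>k\<in>J. layer_sum I G A (n - k)) = (\<Sum>k\<in>J. layer_sum I G A k)"
 proof (rule sum.reindex_bij_witness[of _ "%k. n - k" "%k. n - k"])
  fix k assume "k \<in> J"
  then have "k \<in> {j..n-j}" using J(1) by blast
  then have "k <= n" by (meson atLeastAtMost_iff diff_le_self le_trans)
  then show "n - (n - k) = k" by simp
  then show "n - (n - k) = k" .
 qed (use J in auto)
 moreover have "(\<Sum>k\<in>J. 2 * real (n choose k) * x) <= (\<Sum>k\<in>J. layer_sum I G A k + layer_sum I G A (n - k))"
  using J by (intro sum_mono dom) auto
 ultimately have "(\<Sum>k\<in>J. 2 * real (n choose k) * x) <= 2 * (\<Sum>k\<in>J. layer_sum I G A k)"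
  by (simp add: sum.distrib)
 moreover have "(\<Sum>k\<in>J. 2 * real (n choose k) * x) = 2 * ((\<Sum>k\<in>J. real (n choose k)) * x)"
  by (simp add: sum_distrib_left sum_distrib_right mult_ac)
 ultimately show ?thesis by linarith
qed

end

text \<open>This and the next three lemmas isolate the numerical inequalities needed to compare the variance proxies with
\<open>1 + r\<^sup>2\<close>. Here the boundary share \<open>rho\<close> of a window is controlled by the lower bound on its size.\<close>

lemma two_level_arith_inner:
 fixes j n :: nat and rho :: real
 assumes j: "1 <= j" "2 * j + 2 <= n" and rho: "0 < rho"
  "(real (2 * (j + 1)) + real (n - 2 * j - 1) * real (n - j)) * rho <= real (j + 1)"
 shows "rho * ((3 * n + 1) + (n + 1) * (2 * j / n) * rho) <= 4 * j"
proof -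
 define h where "h = real n - 2 * real j - 1"
 have n: "real n = 2 * real j + h + 1" and h: "1 <= h" using j by (auto simp: h_def)
 have r: "(2 * (real j + 1) + h * (real j + h + 1)) * rho <= real j + 1"
  using rho(2) j by (simp add: h_def of_nat_diff algebra_simps)
 have r3: "rho <= 1 / 3"
 proof -
  have "3 * (real j + 1) <= 2 * (real j + 1) + h * (real j + h + 1)"
   using h mult_mono[of 1 h "real j + 1" "real j + h + 1"] by auto
  then have "3 * (real j + 1) * rho <= (2 * (real j + 1) + h * (real j + h + 1)) * rho"
   using rho(1) by (intro mult_right_mono) auto
  also note r
  finally have "3 * (real j + 1) * rho <= real j + 1" .
  then have "(real j + 1) * (3 * rho) <= (real j + 1) * 1" by (simp add: mult_ac)
  then show ?thesis by (subst (asm) mult_le_cancel_left_pos) auto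
 qed
 have "(n + 1) * (2 * j / n) * rho <= (n + 1) * (2 * j / n) * (1 / 3)"
  using r3 by (intro mult_left_mono) auto
 also have "... = 2 / 3 * real j * ((real n + 1) / real n)" by (simp add: mult_ac add_ac)
 also have "... <= 2 / 3 * real j * (5 / 4)"
  using j by (intro mult_left_mono) (auto simp: divide_simps)
 finally have a: "(n + 1) * (2 * j / n) * rho <= 5 / 6 * real j" by simp
 have "(6 * real j + 3 * h + 4 + 5 / 6 * real j) * (real j + 1) <= 4 * real j * (2 * (real j + 1) + h * (real j + h + 1))"
 proof -
  define x where "x = real j - 1"
  define y where "y = h - 1"
  have xy: "real j = x + 1" "h = y + 1" "0 <= x" "0 <= y" using j h by (auto simp: x_def y_def)
  have "0 <= x * y" "0 <= x * y * y" "0 <= x * x * y" using xy by auto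
  moreover have "0 <= x * x" "0 <= y * y" by auto
  ultimately show ?thesis using xy(3,4) unfolding xy(1,2) by (simp add: algebra_simps)
 qed
 then have "(6 * real j + 3 * h + 4 + 5 / 6 * real j) * (real j + 1) * rho
   <= 4 * real j * (2 * (real j + 1) + h * (real j + h + 1)) * rho" using rho by (intro mult_right_mono) auto
 also have "... <= 4 * real j * (real j + 1)" using r by (simp add: mult.assoc mult_left_mono)
 finally have "(real j + 1) * (rho * (6 * real j + 3 * h + 4 + 5 / 6 * real j)) <= (real j + 1) * (4 * real j)"
  by (simp add: mult_ac)
 then have "rho * (6 * real j + 3 * h + 4 + 5 / 6 * real j) <= 4 * real j"
  by (subst (asm) mult_le_cancel_left_pos) auto
 moreover have "rho * ((3 * n + 1) + (n + 1) * (2 * j / n) * rho) <= rho * (6 * real j + 3 * h + 4 + 5 / 6 * real j)"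
  using a rho(1) by (intro mult_left_mono) (auto simp: n)
 ultimately show ?thesis by linarith
qed

text \<open>The three summands are the contributions of the untouched half, of a possible middle coordinate when \<open>n\<close> is odd, and of the flipped
half of the coordinates.\<close>

lemma two_level_arith_half:
 fixes n t e q s u a r :: real
 assumes n: "n = 2 * t + e" "0 <= t" "0 <= e" and u: "0 <= u" "u <= 1" "a = 1 - u"
  and q: "q <= s" "q * (2 * n - t) + (n - t) * q\<^sup>2 <= n * s\<^sup>2"
  and r: "a + u * s <= r" "0 <= s"
 shows "t * u\<^sup>2 * (1 + q) + e * (1 + u * q)\<^sup>2 + t * (1 + a + u * q)\<^sup>2 <= n * (1 + r\<^sup>2)"
proof -
 have *: "(1 - u) * (2 * n * q) + u * (q * (2 * n - t) + (n - t) * q\<^sup>2) <= (1 - u) * (2 * n * s) + u * (n * s\<^sup>2)"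
  using n u q by (intro add_mono mult_left_mono) auto
 have "t * u\<^sup>2 * (1 + q) + e * (1 + u * q)\<^sup>2 + t * (1 + a + u * q)\<^sup>2
   = n + 2 * t * a\<^sup>2 + u * ((1 - u) * (2 * n * q) + u * (q * (2 * n - t) + (n - t) * q\<^sup>2))"
  unfolding u(3) n(1) by (simp add: power2_eq_square algebra_simps)
 also have "... <= n + n * a\<^sup>2 + u * ((1 - u) * (2 * n * s) + u * (n * s\<^sup>2))"
 proof -
  have "2 * t * a\<^sup>2 <= n * a\<^sup>2" using n by (intro mult_right_mono) auto
  then show ?thesis using mult_left_mono[OF * u(1)] by linarith
 qed
 also have "... = n * (1 + (a + u * s)\<^sup>2)"
  unfolding u(3) by (simp add: power2_eq_square algebra_simps)
 also have "... <= n * (1 + r\<^sup>2)"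
  using r n u by (intro mult_left_mono add_left_mono power_mono) auto
 finally show ?thesis .
qed

lemma two_level_arith_outer:
 fixes n j k m b p :: real
 assumes n: "n = m + 2 * k" and m: "0 < m" and j: "0 <= j" "j <= k" and k: "0 < k"
  and kb: "1 <= 2 * k * b" and km: "n <= 2 * k * (m + 1)" and p: "0 <= p" "p <= 1"
  and fail: "p * (2 * (k - j) / (n - 2 * j)) * (1 - b) < p - b"
 shows "1 / (m + 1) <= (1 - p) * (2 * j / n) + p * (2 * k / n)"
proof -
 define d where "d = k - j"
 have nj: "0 < n - 2 * j" "0 < n" "0 <= d" using n m j k by (auto simp: d_def)
 have "p * (2 * d) * (1 - b) < (p - b) * (n - 2 * j)"
  using fail nj by (simp add: d_def divide_simps)
 then have 1: "b * (n - 2 * j - 2 * d * p) < p * m"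
  using n by (simp add: d_def algebra_simps)
 have "0 <= n - 2 * j - 2 * d * p"
 proof -
  have "d * p <= d * 1" using p nj by (intro mult_left_mono) auto
  moreover have "n - 2 * j = m + 2 * d" by (simp add: n d_def)
  ultimately show ?thesis using m by linarith
 qed
 then have "1 * (n - 2 * j - 2 * d * p) <= 2 * k * b * (n - 2 * j - 2 * d * p)"
  by (intro mult_right_mono kb) auto
 also have "... <= 2 * k * (p * m)" using 1 k by simp
 finally have 2: "n - 2 * j <= p * (2 * k * m + 2 * d)" by (simp add: algebra_simps)
 let ?D = "2 * k * m + 2 * d"
 have D: "0 < ?D" using k m nj by (simp add: add_pos_nonneg)
 have "n * ?D <= n * ?D + 2 * m * j * (2 * k * (m + 1) - n)" using m j km by simp
 also have "... = (m + 1) * (2 * j * ?D + 2 * d * (n - 2 * j))"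
  unfolding d_def n by (simp add: algebra_simps)
 also have "... <= (m + 1) * (2 * j * ?D + 2 * d * (p * ?D))"
  using 2 nj m by (intro mult_left_mono add_left_mono) auto
 also have "... = ((m + 1) * (2 * j + 2 * d * p)) * ?D" by (simp add: algebra_simps)
 finally have "n <= (m + 1) * (2 * j + 2 * d * p)" using D by (subst (asm) mult_le_cancel_right_pos) auto
 then show ?thesis using nj m by (simp add: d_def field_simps)
qed

lemma two_level_arith_mix:
 fixes a p q1 q2 s1 s2 r rho :: real
 assumes "0 <= a" "a <= p" "p <= 1" "0 <= s1" "s1 <= s2" "q1 <= s1 * s1" "q2 = s2 * rho" "rho <= r"
  and r: "r = (1 - p) * s1 + p * s2"
 shows "(1 - a) * q1 + a * q2 <= r\<^sup>2"
proof -
 have sr: "s1 <= r" unfolding r using assms by (simp add: algebra_simps mult_left_mono)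
 have "(1 - a) * q1 + a * q2 <= (1 - a) * (s1 * r) + a * (s2 * r)"
 proof -
  have "q1 <= s1 * r" using assms(6) mult_left_mono[OF sr assms(4)] by linarith
  moreover have "q2 <= s2 * r" unfolding assms(7) using assms by (intro mult_left_mono) auto
  ultimately show ?thesis using assms by (intro add_mono mult_left_mono) auto
 qed
 also have "... = (s1 + a * (s2 - s1)) * r" by (simp add: algebra_simps)
 also have "... <= (s1 + p * (s2 - s1)) * r"
  using assms sr by (intro mult_right_mono add_left_mono) auto
 also have "... = r\<^sup>2" unfolding r by (simp add: power2_eq_square algebra_simps)
 finally show ?thesis .
qed

section \<open>Functions dominated by central layers\<close>

lemma exp_sum_le:
 fixes x :: "'a => real"
 assumes "finite T" "!!t. t \<in> T ==> 0 <= q t" "(\<Sum>t\<in>T. q t) = 1"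
 shows "exp (\<Sum>t\<in>T. q t * x t) <= (\<Sum>t\<in>T. q t * exp (x t))"
proof -
 have "T \<noteq> {}" using assms by auto
 then show ?thesis
  using convex_on_sum[of T UNIV exp q x] assms exp_convex by (auto simp: convex_on_def)
qed

lemma exp_average_le:
 fixes x :: "'a => real"
 assumes "finite T" "T \<noteq> {}"
 shows "exp ((\<Sum>t\<in>T. x t) / card T) <= (\<Sum>t\<in>T. exp (x t)) / card T"
 using exp_sum_le[of T "%_. 1 / card T" x] assms by (simp add: sum_divide_distrib)

lemma card_supersets:
 assumes "finite I" "N \<subseteq> I" "card N = s" "s <= m"
 shows "card {M. N \<subseteq> M \<and> M \<subseteq> I \<and> card M = m} = (card I - s) choose (m - s)"
proof -
 have "bij_betw (%D. N \<union> D) {D. D \<subseteq> I - N \<and> card D = m - s} {M. N \<subseteq> M \<and> M \<subseteq> I \<and> card M = m}"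
 proof (rule bij_betwI[where g = "%M. M - N"])
  have fN: "finite N" using assms finite_subset by auto
  show "(%D. N \<union> D) \<in> {D. D \<subseteq> I - N \<and> card D = m - s} \<rightarrow> {M. N \<subseteq> M \<and> M \<subseteq> I \<and> card M = m}"
  proof
   fix D assume D: "D \<in> {D. D \<subseteq> I - N \<and> card D = m - s}"
   then have "finite D" "N \<inter> D = {}" using assms finite_subset by auto
   then show "N \<union> D \<in> {M. N \<subseteq> M \<and> M \<subseteq> I \<and> card M = m}"
    using D assms fN by (auto simp: card_Un_disjoint)
  qed
  show "(%M. M - N) \<in> {M. N \<subseteq> M \<and> M \<subseteq> I \<and> card M = m} \<rightarrow> {D. D \<subseteq> I - N \<and> card D = m - s}"
   using assms fN by (auto simp: card_Diff_subset)
 qed auto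
 then have "card {M. N \<subseteq> M \<and> M \<subseteq> I \<and> card M = m} = card {D. D \<subseteq> I - N \<and> card D = m - s}"
  by (simp add: bij_betw_same_card)
 also have "... = card (I - N) choose (m - s)" using assms by (intro n_subsets) auto
 also have "card (I - N) = card I - s" using assms by (simp add: card_Diff_subset finite_subset)
 finally show ?thesis .
qed

lemma card_between:
 assumes "finite M" "card M = m"
 shows "card {N. N \<subseteq> M \<and> card N = s} = m choose s"
 using n_subsets[of M s] assms by simp

definition nested_pairs :: "nat set => nat => nat => (nat set \<times> nat set) set" where
 "nested_pairs I s m = {(N, M). N \<subseteq> M \<and> M \<subseteq> I \<and> card N = s \<and> card M = m}"

lemma finite_nested_pairs: "finite I ==> finite (nested_pairs I s m)"
 by (rule finite_subset[of _ "Pow I \<times> Pow I"]) (auto simp: nested_pairs_def)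

lemma sum_nested_pairs_fst:
 fixes f :: "nat set => real"
 assumes fin: "finite I" "s <= m"
 shows "(\<Sum>(N, M)\<in>nested_pairs I s m. f N) = real ((card I - s) choose (m - s)) * (\<Sum>N | N \<subseteq> I \<and> card N = s. f N)"
proof -
 have "nested_pairs I s m = Sigma {N. N \<subseteq> I \<and> card N = s} (%N. {M. N \<subseteq> M \<and> M \<subseteq> I \<and> card M = m})"
  by (auto simp: nested_pairs_def)
 then have "(\<Sum>(N, M)\<in>nested_pairs I s m. f N) =
   (\<Sum>N | N \<subseteq> I \<and> card N = s. \<Sum>M | N \<subseteq> M \<and> M \<subseteq> I \<and> card M = m. f N)"
  using fin by (simp only:) (subst sum.Sigma, auto)
 also have "... = (\<Sum>N | N \<subseteq> I \<and> card N = s. real ((card I - s) choose (m - s)) * f N)"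
  using fin by (intro sum.cong refl) (simp add: card_supersets)
 finally show ?thesis by (simp add: sum_distrib_left)
qed

lemma sum_nested_pairs_snd:
 fixes f :: "nat set => real"
 assumes fin: "finite I"
 shows "(\<Sum>(N, M)\<in>nested_pairs I s m. f M) = real (m choose s) * (\<Sum>M | M \<subseteq> I \<and> card M = m. f M)"
proof -
 have "(\<Sum>(N, M)\<in>nested_pairs I s m. f M) = (\<Sum>(M, N)\<in>Sigma {M. M \<subseteq> I \<and> card M = m} (%M. {N. N \<subseteq> M \<and> card N = s}). f M)"
  by (rule sum.reindex_bij_witness[of _ "%(M, N). (N, M)" "%(N, M). (M, N)"]) (auto simp: nested_pairs_def)
 also have "... = (\<Sum>M | M \<subseteq> I \<and> card M = m. \<Sum>N | N \<subseteq> M \<and> card N = s. f M)"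
  using fin by (subst sum.Sigma) (auto intro: finite_subset[OF _ finite_Pow_iff[THEN iffD2, OF finite_subset[of _ I]]])
 also have "... = (\<Sum>M | M \<subseteq> I \<and> card M = m. real (m choose s) * f M)"
  using fin by (intro sum.cong refl) (auto simp: card_between[OF finite_subset])
 finally show ?thesis by (simp add: sum_distrib_left)
qed

text \<open>The property of minority averages that the estimates use: \<open>X\<close> lies below the average of \<open>G\<close> over each
symmetric pair of layers at distance between \<open>j\<close> and \<open>n - j\<close> from the argument.\<close>

definition dominated :: "nat set => (nat set => real) => nat => (nat set => real) => bool" where
 "dominated I G j X \<longleftrightarrow> (\<forall>A\<subseteq>I. \<forall>k. j <= k --> k <= card I - j -->
  2 * real (card I choose k) * X A <= layer_sum I G A k + layer_sum I G A (card I - k))"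

locale cube_function =
 fixes I :: "nat set" and n :: nat and G :: "nat set => real" and K lam :: real
 assumes fin: "finite I" and n: "card I = n" and n0: "0 < n"
  and G: "!!B j. B \<subseteq> I ==> j \<in> I ==> \<bar>G B - G (toggle j B)\<bar> <= 2 * K"
  and K: "0 <= K" and lam: "0 <= lam"
begin

abbreviation "Uni j \<equiv> flip_average I (middle_weight I j) G"
abbreviation "sz j \<equiv> real (middle_size n j)"
abbreviation "sp j \<equiv> 2 * real j / real n"
abbreviation "slp j \<equiv> sp j * middle_ratio n j"

lemma dominated_uniform:
 assumes "dominated I G j X" "j <= k" "2 * k <= n" "A \<subseteq> I"
 shows "X A <= Uni k A"
proof -
 have "(\<Sum>i=k..n-k. real (n choose i)) * X A <= (\<Sum>i=k..n-k. layer_sum I G A i)"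
  by (rule layers_dominate[OF fin n n0, of k]) (use assms n in \<open>auto simp: dominated_def\<close>)
 then have "sz k * X A <= (\<Sum>i=k..n-k. layer_sum I G A i)" by (simp add: middle_size_def)
 moreover have "0 < sz k" using middle_size_pos[OF assms(3)] by simp
 ultimately show ?thesis
  unfolding flip_average_middle[OF fin n n0 assms(3)] by (simp add: pos_le_divide_eq mult.commute)
qed

text \<open>The layers of the larger window that lie outside the smaller one dominate \<open>X\<close> as well.\<close>

lemma dominated_difference:
 assumes "dominated I G j X" "j <= k" "2 * k <= n" "A \<subseteq> I"
 shows "(sz j - sz k) * X A <= sz j * Uni j A - sz k * Uni k A"
proof -
 let ?J = "{j..n-j} - {k..n-k}"
 have j: "2 * j <= n" using assms by simp
 have sub: "{k..n-k} \<subseteq> {j..n-j}" using assms by auto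
 have "(\<Sum>i\<in>?J. real (n choose i)) * X A <= (\<Sum>i\<in>?J. layer_sum I G A i)"
  by (rule layers_dominate[OF fin n n0, of j]) (use assms n in \<open>auto simp: dominated_def\<close>)
 moreover have "(\<Sum>i\<in>?J. real (n choose i)) = sz j - sz k"
  unfolding middle_size_def of_nat_sum by (rule sum_diff[OF _ sub]) auto
 moreover have "(\<Sum>i\<in>?J. layer_sum I G A i) = sz j * Uni j A - sz k * Uni k A"
  unfolding flip_average_middle[OF fin n n0 j] flip_average_middle[OF fin n n0 assms(3)]
  using middle_size_pos[OF j] middle_size_pos[OF assms(3)] by (simp add: sum_diff[OF _ sub])
 ultimately show ?thesis by simp
qed

lemma slope_le:
 assumes "2 * j <= n" shows "middle_ratio n j <= 1 / (real n - 2 * real j + 1)"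
  "j \<noteq> 0 ==> middle_ratio n j <= sp j" "0 < middle_ratio n j" "middle_ratio n j <= 1"
proof -
 have p: "0 < sz j" "0 < real (n choose j)" using middle_size_pos[OF assms] assms by (auto simp: zero_less_binomial)
 have "real (n - 2 * j + 1) * real (n choose j) <= sz j"
  unfolding of_nat_mult[symmetric] using middle_size_ge[OF assms] by (rule of_nat_mono)
 moreover have "real (n - 2 * j + 1) = real n - 2 * real j + 1" using assms by (simp add: of_nat_diff)
 ultimately have "(real n - 2 * real j + 1) * real (n choose j) <= sz j" by metis
 then show 1: "middle_ratio n j <= 1 / (real n - 2 * real j + 1)"
  using p assms by (simp add: middle_ratio_def divide_simps mult_ac)
 show "middle_ratio n j <= 1"
  by (rule order_trans[OF 1]) (use assms in \<open>simp add: divide_simps\<close>)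
 show "0 < middle_ratio n j" using p by (simp add: middle_ratio_def)
 show "middle_ratio n j <= sp j" if nz: "j \<noteq> 0"
 proof -
  obtain i where i: "j = Suc i" using not0_implies_Suc[OF nz] by blast
  obtain m where m: "n = 2 * j + m" using assms le_Suc_ex by blast
  have "real n <= 2 * real j * (real n - 2 * real j + 1)"
   unfolding m i by (simp add: algebra_simps)
  then have "1 / (real n - 2 * real j + 1) <= sp j"
   using n0 assms by (simp add: divide_simps mult_ac)
  then show ?thesis using 1 by linarith
 qed
qed

text \<open>Flip averages over windows have odd parts of total size at most \<open>n K\<close>, and after subtraction of \<open>G\<close> the slope is at most
\<open>K (1 + r\<^sup>2)\<close>.\<close>

lemma uniform_exp_moment:
 assumes j: "2 * j <= n" and a: "0 <= a" "a <= 1" and k: "2 * k <= n"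
  and h: "!!A. A \<subseteq> I ==> h A <= (1 - a) * Uni j A + a * Uni k A - G A"
  and r: "(1 - a) * slp j + a * slp k <= r\<^sup>2"
 shows "(\<Sum>A\<in>Pow I. exp (lam * h A)) <= 2 ^ n * exp (K\<^sup>2 * n * (1 + r\<^sup>2) * lam\<^sup>2 / 2)"
proof -
 let ?w = "%N. (1 - a) * middle_weight I j N + a * middle_weight I k N"
 have fa: "flip_average I ?w G A = (1 - a) * Uni j A + a * Uni k A" for A
  unfolding flip_average_def sum_distrib_left sum.distrib[symmetric] by (simp add: algebra_simps)
 have "(\<Sum>A\<in>Pow I. exp (lam * h A)) <= 2 ^ card I * exp (K\<^sup>2 * real (card I) * (1 + r\<^sup>2) * lam\<^sup>2 / 2)"
 proof (rule cube_exp_moment_flip_average[where w = ?w])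
  show "(\<Sum>N\<in>Pow I. ?w N) = 1"
   using middle_weight_sum[OF fin n n0] j k by (simp add: sum.distrib flip: sum_distrib_left)
  fix i assume i: "i \<in> I"
  show "(\<Sum>N | N \<subseteq> I \<and> i \<in> N. ?w N) <= 1 / 2"
   unfolding sum.distrib sum_distrib_left[symmetric] middle_weight_half[OF fin n n0 j i] middle_weight_half[OF fin n n0 k i]
   by (simp add: field_simps)
  have "(\<Sum>N\<in>Pow (I - {i}). \<bar>?w N - ?w (insert i N)\<bar>) \<le>
   (\<Sum>N\<in>Pow (I - {i}). (1 - a) * \<bar>middle_weight I j N - middle_weight I j (insert i N)\<bar>
    + a * \<bar>middle_weight I k N - middle_weight I k (insert i N)\<bar>)"
  proof (rule sum_mono)
   fix N
   have eq: "?w N - ?w (insert i N) = (1 - a) * (middle_weight I j N - middle_weight I j (insert i N))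
    + a * (middle_weight I k N - middle_weight I k (insert i N))" by (simp add: algebra_simps)
   have "\<bar>(1 - a) * x + a * y\<bar> <= (1 - a) * \<bar>x\<bar> + a * \<bar>y\<bar>" for x y
    using a abs_triangle_ineq[of "(1 - a) * x" "a * y"] by (simp add: abs_mult)
   then show "\<bar>?w N - ?w (insert i N)\<bar> <= (1 - a) * \<bar>middle_weight I j N - middle_weight I j (insert i N)\<bar>
    + a * \<bar>middle_weight I k N - middle_weight I k (insert i N)\<bar>"
    unfolding eq .
  qed
  also have "... = (1 - a) * slp j + a * slp k"
   using middle_weight_slope[OF fin n n0 _ i] j k by (simp add: sum.distrib flip: sum_distrib_left)
  finally show "(\<Sum>N\<in>Pow (I - {i}). \<bar>?w N - ?w (insert i N)\<bar>) <= r\<^sup>2" using r by simp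
 next
  show "h A <= flip_average I ?w G A - G A" if "A \<subseteq> I" for A
   unfolding fa using that by (rule h)
 qed (use fin G K lam a middle_weight_nonneg[OF fin n n0] in auto)
 then show ?thesis by (simp add: n)
qed

text \<open>The function \<open>Y\<close> is bounded by the layers of size \<open>n div 2\<close> and \<open>n - n div 2\<close> alone. By Jensen's inequality it is enough to treat a single nested pair of such sets, for which half of the
coordinates can be integrated out first.\<close>

lemma half_exp_moment:
 assumes j: "2 * j <= n" "j = 0 \<or> 2 * j + 2 <= n" and Y: "dominated I G k Y" "2 * k <= n"
  and au: "0 <= a" "0 <= u" "a + u = 1"
  and h: "!!A. A \<subseteq> I ==> h A <= a * Y A + u * Uni j A - G A"
  and r: "a + u * sp j <= r"
 shows "(\<Sum>A\<in>Pow I. exp (lam * h A)) <= 2 ^ n * exp (K\<^sup>2 * n * (1 + r\<^sup>2) * lam\<^sup>2 / 2)"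
proof -
 \<comment> \<open>\<open>e\<close> is the parity of \<open>n\<close>\<close>
 define t where "t = n div 2"
 define e where "e = n - 2 * t"
 have te: "n = 2 * t + e" "e <= 1" by (auto simp: t_def e_def)
 let ?T = "nested_pairs I t (n - t)"
 define Z where "Z = (%N M A. (G (sym_diff A N) + G (sym_diff A M)) / 2)"
 define c where "c = real ((n - t) choose t)"
 have c: "0 < c" using te by (simp add: c_def zero_less_binomial)
 have c': "real ((card I - t) choose (n - t - t)) = c"
  unfolding n c_def using te by (subst binomial_symmetric) auto
 have cardT: "real (card ?T) = c * real (n choose t)"
  using sum_nested_pairs_fst[OF fin, of t "n - t" "%_. 1"] te card_layer[OF fin n n0] unfolding c'
  by (simp add: case_prod_unfold)
 have nt: "real (n choose t) > 0" using te by (simp add: zero_less_binomial)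
 have T0: "?T \<noteq> {}" "finite ?T" using cardT c nt finite_nested_pairs[OF fin] by auto
 have avg: "(\<Sum>(N, M)\<in>?T. Z N M A) / card ?T = (layer_sum I G A t + layer_sum I G A (n - t)) / (2 * real (n choose t))" for A
 proof -
  have "(\<Sum>(N, M)\<in>?T. Z N M A) = ((\<Sum>(N, M)\<in>?T. G (sym_diff A N)) + (\<Sum>(N, M)\<in>?T. G (sym_diff A M))) / 2"
   by (simp only: Z_def case_prod_unfold sum.distrib sum_divide_distrib[symmetric])
  also have "... = c * (layer_sum I G A t + layer_sum I G A (n - t)) / 2"
   using sum_nested_pairs_fst[OF fin, of t "n - t" "%N. G (sym_diff A N)"]
    sum_nested_pairs_snd[OF fin, of "%N. G (sym_diff A N)" t "n - t"] te
   unfolding c' layer_sum_def c_def[symmetric] by (simp add: distrib_left)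
  finally show ?thesis unfolding cardT using c nt by (simp add: field_simps)
 qed
 have YZ: "Y A <= (\<Sum>(N, M)\<in>?T. Z N M A) / card ?T" if "A \<subseteq> I" for A
 proof -
  have "2 * real (n choose t) * Y A <= layer_sum I G A t + layer_sum I G A (n - t)"
  proof -
   have "k <= t" "t <= n - k" using Y(2) te by linarith+
   then show ?thesis using Y(1) that unfolding dominated_def n by blast
  qed
  then show ?thesis unfolding avg using nt by (subst pos_le_divide_eq) (auto simp: mult_ac)
 qed
 define F where "F = (%(N, M) A. a * Z N M A + u * Uni j A - G A)"
 have "(\<Sum>A\<in>Pow I. exp (lam * h A)) <= (\<Sum>A\<in>Pow I. (\<Sum>p\<in>?T. exp (lam * F p A)) / card ?T)"
 proof (rule sum_mono)
  fix A assume "A \<in> Pow I"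
  then have A: "A \<subseteq> I" by simp
  have "h A <= a * ((\<Sum>(N, M)\<in>?T. Z N M A) / card ?T) + u * Uni j A - G A"
   using h[OF A] mult_left_mono[OF YZ[OF A] au(1)] by linarith
  also have "... = (\<Sum>p\<in>?T. F p A) / card ?T"
  proof -
   have "(\<Sum>p\<in>?T. F p A) = a * (\<Sum>(N, M)\<in>?T. Z N M A) + card ?T * (u * Uni j A - G A)"
    by (simp only: F_def case_prod_unfold sum.distrib sum_subtractf sum_distrib_left[symmetric]) (simp add: algebra_simps)
   moreover have "real (card ?T) \<noteq> 0" using T0 by simp
   ultimately show ?thesis by (simp only: add_divide_distrib nonzero_mult_div_cancel_left) simp
  qed
  finally have "lam * h A <= lam * ((\<Sum>p\<in>?T. F p A) / card ?T)" by (rule mult_left_mono[OF _ lam])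
  also have "... = (\<Sum>p\<in>?T. lam * F p A) / card ?T" unfolding sum_distrib_left[symmetric] by simp
  finally have "lam * h A <= (\<Sum>p\<in>?T. lam * F p A) / card ?T" .
  then have "exp (lam * h A) <= exp ((\<Sum>p\<in>?T. lam * F p A) / card ?T)" by simp
  also have "... <= (\<Sum>p\<in>?T. exp (lam * F p A)) / card ?T"
   by (rule exp_average_le) (use T0 in auto)
  finally show "exp (lam * h A) <= (\<Sum>p\<in>?T. exp (lam * F p A)) / card ?T" .
 qed
 also have "... = (\<Sum>p\<in>?T. \<Sum>A\<in>Pow I. exp (lam * F p A)) / card ?T"
  unfolding sum_divide_distrib[symmetric] by (subst sum.swap) (rule refl)
 also have "... <= (\<Sum>p\<in>?T. 2 ^ n * exp (K\<^sup>2 * n * (1 + r\<^sup>2) * lam\<^sup>2 / 2)) / card ?T"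
 proof (intro divide_right_mono sum_mono)
  fix p assume p: "p \<in> ?T"
  obtain N M where pNM: "p = (N, M)" by (cases p)
  have NM: "N \<subseteq> M" "M \<subseteq> I" "card N = t" "card M = n - t" using p pNM by (auto simp: nested_pairs_def)
  have fNM: "finite N" "finite M" using finite_subset[OF NM(2) fin] finite_subset[OF NM(1)] by auto
  have cd: "card (M - N) = e" "card (I - M) = t"
   using te(1) by (simp_all add: card_Diff_subset[OF fNM(1) NM(1)] card_Diff_subset[OF fNM(2) NM(2)] NM n del: card_0_eq)
  define q where "q = slp j"
  have arith: "t * u\<^sup>2 * (1 + q) + e * (1 + u * q)\<^sup>2 + t * (1 + a + u * q)\<^sup>2 <= n * (1 + r\<^sup>2)"
  proof (rule two_level_arith_half[where s = "sp j"])
   show "real n = 2 * real t + real e" using te by simp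
   show "q <= sp j" unfolding q_def using slope_le(4)[OF j(1)] by (intro mult_left_le) auto
   show "q * (2 * real n - real t) + (real n - real t) * q\<^sup>2 <= real n * (sp j)\<^sup>2"
   proof (cases "j = 0")
    case False
    let ?rho = "middle_ratio n j"
    have j2: "1 <= j" "2 * j + 2 <= n" using False j by auto
    have rho: "0 < ?rho" by (rule slope_le(3)[OF j(1)])
    have "(real (2 * (j + 1)) + real (n - 2 * j - 1) * real (n - j)) * real (n choose j) <= real (j + 1) * sz j"
     unfolding of_nat_mult[symmetric] of_nat_add[symmetric] using middle_size_ge_inner[OF j2(2)] by (rule of_nat_mono)
    then have "(real (2 * (j + 1)) + real (n - 2 * j - 1) * real (n - j)) * ?rho <= real (j + 1)"
     unfolding middle_ratio_def times_divide_eq_right using middle_size_pos[OF j(1)] by (subst pos_divide_le_eq) auto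
    from two_level_arith_inner[OF j2 rho this]
    have inner: "?rho * ((3 * n + 1) + (n + 1) * sp j * ?rho) <= 4 * j" by simp
    have "t >= (real n - 1) / 2" using te by simp
    then have "q * (2 * real n - real t) + (real n - real t) * q\<^sup>2
      <= q * ((3 * real n + 1) / 2) + (real n + 1) / 2 * q\<^sup>2"
     using rho by (intro add_mono mult_left_mono mult_right_mono) (auto simp: q_def field_simps)
    also have "... = sp j / 2 * (?rho * ((3 * n + 1) + (n + 1) * sp j * ?rho))"
     by (simp add: q_def power2_eq_square algebra_simps add_divide_distrib)
    also have "... <= sp j / 2 * (4 * j)" by (intro mult_left_mono inner) auto
    also have "... = real n * (sp j)\<^sup>2" using n0 by (simp add: power2_eq_square field_simps)
    finally show ?thesis .
   qed (simp add: q_def)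
  qed (use au r in auto)
  have "(\<Sum>A\<in>Pow I. exp (lam * F p A)) <= 2 ^ card I * exp (lam\<^sup>2 * K\<^sup>2 * (real (card (I - M)) * u\<^sup>2 * (1 + q)
    + real (card (M - N)) * (1 + u * q)\<^sup>2 + real (card N) * (1 + a + u * q)\<^sup>2) / 2)"
   unfolding F_def Z_def pNM prod.case
   by (rule cube_exp_moment_half)
    (use fin NM cd te G K lam au middle_weight_sum[OF fin n n0 j(1)] middle_weight_half[OF fin n n0 j(1)]
      middle_weight_slope[OF fin n n0 j(1)] middle_weight_nonneg[OF fin n n0] in \<open>auto simp: q_def\<close>)
  also have "... <= 2 ^ n * exp (lam\<^sup>2 * K\<^sup>2 * (n * (1 + r\<^sup>2)) / 2)"
   unfolding n cd NM using arith by (intro mult_left_mono exp_le_cancel_iff[THEN iffD2] divide_right_mono) auto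
  finally show "(\<Sum>A\<in>Pow I. exp (lam * F p A)) <= 2 ^ n * exp (K\<^sup>2 * n * (1 + r\<^sup>2) * lam\<^sup>2 / 2)"
   by (simp add: mult_ac)
 qed auto
 also have "... = 2 ^ n * exp (K\<^sup>2 * n * (1 + r\<^sup>2) * lam\<^sup>2 / 2)" using T0 by simp
 finally show ?thesis .
qed

end

context cube_function begin

text \<open>Let \<open>b\<close> be the share of the window of \<open>k\<close> in the window of \<open>j\<close>. The mixture of \<open>X\<close> and \<open>Y\<close> with weights \<open>1 - b\<close>
and \<open>b\<close> lies below a single window average. For \<open>p <= b\<close> this is enough; for larger \<open>p\<close> the surplus of \<open>Y\<close> is
bounded by the most central layers or, when \<open>r\<close> is too small for that, by the window of \<open>k\<close>.\<close>

lemma two_atom_exp_moment: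
 assumes X: "dominated I G j X" and Y: "dominated I G k Y" and jk: "j < k" "2 * k <= n"
  and p: "0 <= p" "p <= 1" and r: "r = (1 - p) * sp j + p * sp k"
  and h: "!!A. A \<subseteq> I ==> h A <= (1 - p) * X A + p * Y A - G A"
 shows "(\<Sum>A\<in>Pow I. exp (lam * h A)) <= 2 ^ n * exp (K\<^sup>2 * n * (1 + r\<^sup>2) * lam\<^sup>2 / 2)"
proof -
 have j: "2 * j <= n" and j': "j = 0 \<or> 2 * j + 2 <= n" using jk by auto
 \<comment> \<open>the law with weight \<open>b\<close> on \<open>k\<close> is the one that a uniform set in the large window induces\<close>
 define b where "b = sz k / sz j"
 have sz: "0 < sz j" "0 < sz k" using middle_size_pos[OF j] middle_size_pos[OF jk(2)] by auto
 have "Suc k <= n - j" using jk by auto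
 have "middle_size n k < middle_size n j"
 proof -
  have "middle_size n k = (\<Sum>i=k..n-k. n choose i)" by (simp add: middle_size_def)
  also have "... < (\<Sum>i=j..n-j. n choose i)"
   by (rule sum_strict_mono2[where b = j]) (use jk j in \<open>auto simp: zero_less_binomial\<close>)
  finally show ?thesis by (simp add: middle_size_def)
 qed
 then have b: "0 < b" "b < 1" using sz by (auto simp: b_def)
 have sp: "0 <= sp j" "sp j <= sp k" "sp k <= 1" "sp j < 1" using jk n0 by (auto simp: divide_simps)
 have r': "r = sp j + p * (sp k - sp j)" unfolding r by (simp only: left_diff_distrib right_diff_distrib)
 have sjr: "sp j <= r" unfolding r' using p sp by simp
 have slpj: "slp j <= sp j * sp j"
 proof (cases "j = 0")
  case False
  show ?thesis by (rule mult_left_mono[OF slope_le(2)[OF j False] sp(1)])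
 qed simp
 have XY: "(1 - b) * X A + b * Y A <= Uni j A" if A: "A \<subseteq> I" for A
 proof -
  have bk: "sz k = sz j * b" using sz by (simp add: b_def)
  have "(sz j - sz k) * X A <= sz j * Uni j A - sz k * Uni k A"
   using dominated_difference[OF X _ jk(2) A] jk(1) by simp
  then have "sz j * ((1 - b) * X A) <= sz j * (Uni j A - b * Uni k A)"
   unfolding bk by (simp only: algebra_simps mult_1_right)
  then have "(1 - b) * X A <= Uni j A - b * Uni k A" using sz by simp
  moreover have "b * Y A <= b * Uni k A"
   using dominated_uniform[OF Y _ jk(2) A] b by simp
  ultimately show ?thesis by linarith
 qed
 show ?thesis
 proof (cases "p <= b")
  case True
  show ?thesis
  proof (rule uniform_exp_moment[OF j, where a = 0 and k = j])
   fix A assume A: "A \<subseteq> I"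
   have "(1 - p) * X A + p * Y A = p / b * ((1 - b) * X A + b * Y A) + (1 - p / b) * X A"
    using b by (simp add: field_simps)
   also have "... <= p / b * Uni j A + (1 - p / b) * Uni j A"
    using XY[OF A] dominated_uniform[OF X order_refl j A] True b p
    by (intro add_mono mult_left_mono) auto
   also have "... = Uni j A" by (simp add: algebra_simps)
   finally show "h A <= (1 - 0) * Uni j A + 0 * Uni j A - G A" using h[OF A] by simp
  next
   have "sp j * sp j <= r\<^sup>2" unfolding power2_eq_square
    by (rule mult_mono[OF sjr sjr order_trans[OF sp(1) sjr] sp(1)])
   then show "(1 - 0) * slp j + 0 * slp j <= r\<^sup>2" using slpj by simp
  qed (use j in auto)
 next
  case False
  \<comment> \<open>the weights \<open>(1 - p, p)\<close> are the mixture of \<open>(1 - b, b)\<close> and \<open>(0, 1)\<close> with weights \<open>1 - a\<close> and \<open>a\<close>\<close>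
  define a where "a = (p - b) / (1 - b)"
  have a: "0 <= a" "a <= 1" "a * (1 - b) = p - b" using False b p by (auto simp: a_def)
  have ap: "a <= p"
  proof -
   have "p - b <= p * (1 - b)" using b p by (simp add: algebra_simps mult_left_le)
   then show ?thesis using b by (simp add: a_def divide_simps)
  qed
  have hA: "h A <= a * Y A + (1 - a) * Uni j A - G A" if A: "A \<subseteq> I" for A
  proof -
   have "1 - p = (1 - a) * (1 - b)" "p = (1 - a) * b + a" using a(3) by (auto simp: algebra_simps)
   then have "(1 - p) * X A + p * Y A = (1 - a) * (1 - b) * X A + ((1 - a) * b + a) * Y A" by metis
   also have "... = (1 - a) * ((1 - b) * X A + b * Y A) + a * Y A" by (simp add: algebra_simps)
   also have "... <= (1 - a) * Uni j A + a * Y A"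
    using XY[OF A] a by (intro add_mono mult_left_mono) auto
   finally show ?thesis using h[OF A] by simp
  qed
  show ?thesis
  proof (cases "a * (1 - sp j) <= p * (sp k - sp j)")
   case True
   have "a + (1 - a) * s = s + a * (1 - s)" for s :: real by (simp add: algebra_simps)
   then have ar: "a + (1 - a) * sp j <= r" unfolding r' using True by (simp only: add_left_mono)
   show ?thesis
    by (rule half_exp_moment[OF j j' Y jk(2) a(1) _ _ hA ar]) (use a in auto)
  next
   case fail: False
   have rho: "middle_ratio n k <= r"
   proof -
    define m where "m = n - 2 * k"
    have nm: "n = m + 2 * k" using jk by (simp add: m_def)
    have m: "0 < m"
    proof (rule ccontr)
     assume "\<not> 0 < m"
     then have "sp k = 1" using nm n0 by simp
     then have "p * (1 - sp j) < a * (1 - sp j)" using fail by simp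
     then show False using ap sp by (simp add: mult_less_cancel_right)
    qed
    have k0: "1 <= k" using jk by simp
    have "m + 2 * k + 1 <= 2 * k * (m + 1)"
    proof -
     have "m + 1 <= 2 * m" using m by simp
     also have "... <= 2 * k * m" using k0 by simp
     finally show ?thesis by simp
    qed
    then have "real (n + 1) <= real (2 * k * (m + 1))" unfolding nm by (rule of_nat_mono)
    then have km: "real n + 1 <= 2 * real k * (real m + 1)" by (simp add: algebra_simps)
    have kb: "1 <= 2 * real k * b"
    proof -
     have "real (2 ^ n * (m + 1)) <= real (middle_size n k * (n + 1))"
      using middle_size_ge_proportion[OF jk(2)] unfolding m_def by (rule of_nat_mono)
     then have "2 ^ n * (real m + 1) <= sz k * (real n + 1)" by (simp add: algebra_simps)
     also have "sz k = b * sz j" using sz by (simp add: b_def)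
     also have "b * sz j * (real n + 1) <= b * 2 ^ n * (real n + 1)"
     proof -
      have "sz j <= real (2 ^ n)" using middle_size_le by (rule of_nat_mono)
      then show ?thesis using b by (intro mult_right_mono mult_left_mono) auto
     qed
     finally have "2 ^ n * (real m + 1) <= 2 ^ n * (b * (real n + 1))" by (simp add: mult_ac)
     then have "real m + 1 <= b * (real n + 1)" by simp
     also have "... <= b * (2 * real k * (real m + 1))" using km b by (intro mult_left_mono) auto
     finally have "1 * (real m + 1) <= (2 * real k * b) * (real m + 1)" by (simp add: mult_ac)
     then show ?thesis by (subst (asm) mult_le_cancel_right_pos) auto
    qed
    have fail': "p * (2 * (real k - real j) / (real n - 2 * real j)) * (1 - b) < p - b"
    proof -
     have nj: "0 < real n - 2 * real j" using jk by auto
     have "p * (2 * (real k - real j)) / n < a * (real n - 2 * real j) / n"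
      using fail n0 by (simp add: field_simps)
     then have "p * (2 * (real k - real j)) < a * (real n - 2 * real j)" using n0 by (simp add: divide_less_cancel)
     then have "p * (2 * (real k - real j) / (real n - 2 * real j)) < a" using nj by (simp add: divide_simps)
     then have "p * (2 * (real k - real j) / (real n - 2 * real j)) * (1 - b) < a * (1 - b)"
      using b by (intro mult_strict_right_mono) auto
     then show ?thesis using a(3) by simp
    qed
    have "1 / (real m + 1) <= (1 - p) * (2 * real j / real n) + p * (2 * real k / real n)"
     by (rule two_level_arith_outer[where b = b]) (use nm m jk k0 kb km p fail' in auto)
    moreover have "middle_ratio n k <= 1 / (real m + 1)" using slope_le(1)[OF jk(2)] nm by simp
    ultimately show ?thesis unfolding r by simp
   qed
   have 1: "(1 - a) * slp j + a * slp k <= r\<^sup>2"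
    by (rule two_level_arith_mix[where ?s1.0 = "sp j" and ?s2.0 = "sp k" and p = p, OF a(1) ap p(2) sp(1,2) slpj refl rho r])
   have 2: "h A <= (1 - a) * Uni j A + a * Uni k A - G A" if A: "A \<subseteq> I" for A
    using hA[OF A] mult_left_mono[OF dominated_uniform[OF Y order_refl jk(2) A] a(1)] by linarith
   show ?thesis by (rule uniform_exp_moment[OF j a(1,2) jk(2) 2 1])
  qed
 qed
qed

lemma one_atom_exp_moment:
 assumes X: "dominated I G j X" and j: "2 * j <= n"
  and h: "!!A. A \<subseteq> I ==> h A <= X A - G A"
 shows "(\<Sum>A\<in>Pow I. exp (lam * h A)) <= 2 ^ n * exp (K\<^sup>2 * n * (1 + (sp j)\<^sup>2) * lam\<^sup>2 / 2)"
proof (rule uniform_exp_moment[OF j, where a = 0 and k = j])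
 fix A assume A: "A \<subseteq> I"
 show "h A <= (1 - 0) * Uni j A + 0 * Uni j A - G A"
  using h[OF A] dominated_uniform[OF X order_refl j A] by simp
next
 have "slp j <= sp j * sp j"
 proof (cases "j = 0")
  case False
  show ?thesis by (rule mult_left_mono[OF slope_le(2)[OF j False]]) simp
 qed simp
 then show "(1 - 0) * slp j + 0 * slp j <= (sp j)\<^sup>2" by (simp add: power2_eq_square)
qed (use j in auto)

end

text \<open>A law with finitely many atoms is a mixture of laws with at most two atoms and the same mean: pair the atoms below the mean with those
above it, in proportion to their distances from it.\<close>

lemma two_atom_decomposition:
 fixes q v :: "'t => real"
 assumes fin: "finite T" and q: "!!t. t \<in> T ==> 0 <= q t" and sq: "(\<Sum>t\<in>T. q t) = 1"
  and r: "r = (\<Sum>t\<in>T. q t * v t)"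
 obtains U :: "('t \<times> 't) set" and al p where "finite U"
  "\<forall>(t, t')\<in>U. t \<in> T \<and> t' \<in> T \<and> 0 <= al t t' \<and> 0 <= p t t' \<and> p t t' <= 1 \<and>
    (v t < v t' \<and> r = (1 - p t t') * v t + p t t' * v t' \<or> t = t' \<and> v t = r)"
  "(\<Sum>(t, t')\<in>U. al t t') = 1" "\<forall>x. (\<Sum>(t, t')\<in>U. al t t' * ((1 - p t t') * x t + p t t' * x t')) = (\<Sum>t\<in>T. q t * x t)"
proof -
 define L where "L = {t\<in>T. v t < r}"
 define H where "H = {t\<in>T. r < v t}"
 define M where "M = {t\<in>T. v t = r}"
 have T: "T = L \<union> H \<union> M" "finite L" "finite H" "finite M" "L \<inter> H = {}" "(L \<union> H) \<inter> M = {}"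
  using fin by (auto simp: L_def H_def M_def)
 have split: "(\<Sum>t\<in>T. f t) = (\<Sum>t\<in>L. f t) + (\<Sum>t\<in>H. f t) + (\<Sum>t\<in>M. f t)" for f :: "'t => real"
  using T by (simp add: sum.union_disjoint)
 define S where "S = (\<Sum>t\<in>H. q t * (v t - r))"
 have "(\<Sum>t\<in>T. q t * (v t - r)) = 0"
  using sq r by (simp add: right_diff_distrib sum_subtractf flip: sum_distrib_right)
 moreover have "(\<Sum>t\<in>M. q t * (v t - r)) = 0" by (rule sum.neutral) (simp add: M_def)
 ultimately have SL: "(\<Sum>t\<in>L. q t * (r - v t)) = S"
  unfolding split S_def by (simp add: right_diff_distrib sum_subtractf)
 have S0: "0 <= S" unfolding S_def by (rule sum_nonneg) (auto simp: H_def q)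
 define al where "al = (%t t'. if t = t' then q t else q t * q t' * (v t' - v t) / S)"
 define p where "p = (%t t'. if t = t' then 0 else (r - v t) / (v t' - v t))"
 define Ul where "Ul = (%t. (t, t)) ` M"
 define U where "U = Ul \<union> L \<times> H"
 have LH: "t \<noteq> t'" "v t < v t'" if "t \<in> L" "t' \<in> H" for t t' using that by (auto simp: L_def H_def)
 have sumU: "(\<Sum>(t, t')\<in>U. f t t') = (\<Sum>t\<in>M. f t t) + (\<Sum>t\<in>L. \<Sum>t'\<in>H. f t t')" for f :: "'t => 't => real"
 proof -
  have "(\<Sum>(t, t')\<in>U. f t t') = (\<Sum>(t, t')\<in>Ul. f t t') + (\<Sum>(t, t')\<in>L \<times> H. f t t')"
   unfolding U_def using T by (intro sum.union_disjoint) (auto simp: Ul_def M_def L_def)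
  also have "(\<Sum>(t, t')\<in>Ul. f t t') = (\<Sum>t\<in>M. f t t)"
   unfolding Ul_def by (subst sum.reindex) (auto simp: inj_on_def)
  finally show ?thesis by (simp add: sum.cartesian_product)
 qed
 have main: "(\<Sum>(t, t')\<in>U. al t t' * ((1 - p t t') * x t + p t t' * x t')) = (\<Sum>t\<in>T. q t * x t)" for x
 proof -
  have "(\<Sum>t\<in>M. al t t * ((1 - p t t) * x t + p t t * x t)) = (\<Sum>t\<in>M. q t * x t)"
   by (simp add: al_def p_def)
  moreover have "(\<Sum>t\<in>L. \<Sum>t'\<in>H. al t t' * ((1 - p t t') * x t + p t t' * x t')) = (\<Sum>t\<in>L. q t * x t) + (\<Sum>t\<in>H. q t * x t)"
  proof (cases "S = 0")
   case True
   have "q t = 0" if "t \<in> H" for t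
   proof -
    have "S = 0 \<longleftrightarrow> (\<forall>t\<in>H. q t * (v t - r) = 0)"
     unfolding S_def by (rule sum_nonneg_eq_0_iff[OF T(3)]) (auto simp: H_def q)
    then have "q t * (v t - r) = 0" using True that by blast
    then show ?thesis using that by (auto simp: H_def)
   qed
   moreover have "q t = 0" if "t \<in> L" for t
   proof -
    have "S = 0 \<longleftrightarrow> (\<forall>t\<in>L. q t * (r - v t) = 0)"
     unfolding SL[symmetric] by (rule sum_nonneg_eq_0_iff[OF T(2)]) (auto simp: L_def q)
    then have "q t * (r - v t) = 0" using True that by blast
    then show ?thesis using that by (auto simp: L_def)
   qed
   moreover have "al t t' = 0" if "t \<in> L" "t' \<in> H" for t t'
    using LH[OF that] True by (simp add: al_def)
   ultimately show ?thesis by simp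
  next
   case False
   have "al t t' * ((1 - p t t') * x t + p t t' * x t') = (q t * x t * (q t' * (v t' - r)) + q t * (r - v t) * (q t' * x t')) / S"
    if "t \<in> L" "t' \<in> H" for t t'
   proof -
    have "v t' - v t \<noteq> 0" using LH[OF that] by simp
    then have pd: "(v t' - v t) * p t t' = r - v t" using LH[OF that] by (simp add: p_def)
    have "(v t' - v t) * ((1 - p t t') * x t + p t t' * x t')
      = (v t' - v t) * x t - ((v t' - v t) * p t t') * x t + ((v t' - v t) * p t t') * x t'"
     by (simp add: algebra_simps)
    then have vx: "(v t' - v t) * ((1 - p t t') * x t + p t t' * x t') = (v t' - r) * x t + (r - v t) * x t'"
     unfolding pd by (simp add: algebra_simps)
    have "al t t' * ((1 - p t t') * x t + p t t' * x t')
      = q t * q t' * ((v t' - v t) * ((1 - p t t') * x t + p t t' * x t')) / S"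
     using LH[OF that] by (simp add: al_def)
    also have "... = q t * q t' * ((v t' - r) * x t + (r - v t) * x t') / S"
     by (simp only: vx)
    finally show ?thesis by (simp add: algebra_simps)
   qed
   then have "(\<Sum>t\<in>L. \<Sum>t'\<in>H. al t t' * ((1 - p t t') * x t + p t t' * x t'))
    = (\<Sum>t\<in>L. \<Sum>t'\<in>H. (q t * x t * (q t' * (v t' - r)) + q t * (r - v t) * (q t' * x t')) / S)"
    by (intro sum.cong refl) auto
   also have "... = ((\<Sum>t\<in>L. q t * x t) * S + (\<Sum>t\<in>L. q t * (r - v t)) * (\<Sum>t\<in>H. q t * x t)) / S"
    unfolding S_def sum_product sum.distrib[symmetric] sum_divide_distrib ..
   also have "... = (\<Sum>t\<in>L. q t * x t) + (\<Sum>t\<in>H. q t * x t)"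
    unfolding SL using False by (simp add: add_divide_distrib)
   finally show ?thesis .
  qed
  ultimately show ?thesis unfolding sumU split by simp
 qed
 have one: "(\<Sum>(t, t')\<in>U. al t t') = 1"
  using main[of "%_. 1"] sq by simp
 have "finite U" using T by (simp add: U_def Ul_def)
 moreover have "t \<in> T \<and> t' \<in> T \<and> 0 <= al t t' \<and> 0 <= p t t' \<and> p t t' <= 1 \<and>
    (v t < v t' \<and> r = (1 - p t t') * v t + p t t' * v t' \<or> t = t' \<and> v t = r)" if "(t, t') \<in> U" for t t'
 proof (cases "t = t'")
  case True
  then have "t \<in> M" using that LH by (auto simp: U_def Ul_def)
  then show ?thesis using True q by (auto simp: al_def p_def M_def)
 next
  case False
  then have tt: "t \<in> L" "t' \<in> H" using that by (auto simp: U_def Ul_def)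
  then have lt: "v t < r" "r < v t'" and T': "t \<in> T" "t' \<in> T" by (auto simp: L_def H_def)
  have pd: "p t t' * (v t' - v t) = r - v t" using False lt by (simp add: p_def)
  have "(1 - p t t') * v t + p t t' * v t' = v t + p t t' * (v t' - v t)" by (simp add: algebra_simps)
  then have "r = (1 - p t t') * v t + p t t' * v t'" using pd by simp
  moreover have "0 <= p t t'" "p t t' <= 1" using False lt by (simp_all add: p_def)
  moreover have "0 <= al t t'"
   using False lt S0 q T' by (auto simp: al_def intro!: divide_nonneg_nonneg mult_nonneg_nonneg)
  ultimately show ?thesis using lt T' by simp
 qed
 ultimately show ?thesis using one main by (intro that[of U al p]) auto
qed

context cube_function begin

text \<open>The bound depends on the mixture only through its mean \<open>r\<close>, and the exponential is convex, so the mixture may be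
replaced by two-point mixtures of the same mean.\<close>

theorem mixture_exp_moment:
 fixes q :: "'t => real" and X :: "'t => nat set => real"
 assumes T: "finite T" and q: "!!t. t \<in> T ==> 0 <= q t" "(\<Sum>t\<in>T. q t) = 1"
  and X: "!!t. t \<in> T ==> dominated I G (j t) (X t)" "!!t. t \<in> T ==> 2 * j t <= n"
  and r: "r = (\<Sum>t\<in>T. q t * sp (j t))"
  and h: "!!A. A \<subseteq> I ==> h A <= (\<Sum>t\<in>T. q t * X t A) - G A"
 shows "(\<Sum>A\<in>Pow I. exp (lam * h A)) <= 2 ^ n * exp (K\<^sup>2 * n * (1 + r\<^sup>2) * lam\<^sup>2 / 2)"
proof (rule two_atom_decomposition[OF T q r])
 fix U al p assume U0: "finite U"
  "\<forall>(t, t')\<in>U. t \<in> T \<and> t' \<in> T \<and> 0 <= al t t' \<and> 0 <= p t t' \<and> p t t' <= 1 \<and>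
    (sp (j t) < sp (j t') \<and> r = (1 - p t t') * sp (j t) + p t t' * sp (j t') \<or> t = t' \<and> sp (j t) = r)"
  "(\<Sum>(t, t')\<in>U. al t t') = 1"
  "\<forall>x. (\<Sum>(t, t')\<in>U. al t t' * ((1 - p t t') * x t + p t t' * x t')) = (\<Sum>t\<in>T. q t * x t)"
 have U: "finite U"
  "!!t t'. (t, t') \<in> U ==> t \<in> T \<and> t' \<in> T \<and> 0 <= al t t' \<and> 0 <= p t t' \<and> p t t' <= 1 \<and>
    (sp (j t) < sp (j t') \<and> r = (1 - p t t') * sp (j t) + p t t' * sp (j t') \<or> t = t' \<and> sp (j t) = r)"
  "(\<Sum>(t, t')\<in>U. al t t') = 1"
  "!!x. (\<Sum>(t, t')\<in>U. al t t' * ((1 - p t t') * x t + p t t' * x t')) = (\<Sum>t\<in>T. q t * x t)"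
  using U0 by auto
 let ?F = "%t t' A. (1 - p t t') * X t A + p t t' * X t' A - G A"
 have "exp (lam * h A) <= (\<Sum>(t, t')\<in>U. al t t' * exp (lam * ?F t t' A))" if A: "A \<subseteq> I" for A
 proof -
  have "(\<Sum>(t, t')\<in>U. al t t' * ?F t t' A) = (\<Sum>(t, t')\<in>U. al t t' * ((1 - p t t') * X t A + p t t' * X t' A)) - (\<Sum>(t, t')\<in>U. al t t') * G A"
   unfolding case_prod_unfold sum_distrib_right sum_subtractf[symmetric]
   by (intro sum.cong refl) (simp add: algebra_simps)
  also have "... = (\<Sum>t\<in>T. q t * X t A) - G A" by (simp add: U(3) U(4)[of "%t. X t A"])
  finally have "lam * h A <= lam * (\<Sum>(t, t')\<in>U. al t t' * ?F t t' A)"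
   using h[OF A] lam by (intro mult_left_mono) auto
  also have "... = (\<Sum>u\<in>U. (case u of (t, t') => al t t') * (case u of (t, t') => lam * ?F t t' A))"
   by (simp add: case_prod_unfold sum_distrib_left mult_ac)
  finally have "exp (lam * h A) <= exp ..." by simp
  also have "... <= (\<Sum>u\<in>U. (case u of (t, t') => al t t') * exp (case u of (t, t') => lam * ?F t t' A))"
   by (rule exp_sum_le) (use U(1-3) in \<open>auto simp: case_prod_unfold\<close>)
  finally show ?thesis by (simp add: case_prod_unfold)
 qed
 then have "(\<Sum>A\<in>Pow I. exp (lam * h A)) <= (\<Sum>A\<in>Pow I. \<Sum>(t, t')\<in>U. al t t' * exp (lam * ?F t t' A))"
  by (intro sum_mono) auto
 also have "... = (\<Sum>(t, t')\<in>U. al t t' * (\<Sum>A\<in>Pow I. exp (lam * ?F t t' A)))"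
  by (subst sum.swap) (simp add: case_prod_unfold sum_distrib_left)
 also have "... <= (\<Sum>(t, t')\<in>U. al t t' * (2 ^ n * exp (K\<^sup>2 * n * (1 + r\<^sup>2) * lam\<^sup>2 / 2)))"
 proof (rule sum_mono, clarify)
  fix t t' assume tt: "(t, t') \<in> U"
  have "(\<Sum>A\<in>Pow I. exp (lam * ?F t t' A)) <= 2 ^ n * exp (K\<^sup>2 * n * (1 + r\<^sup>2) * lam\<^sup>2 / 2)"
  proof (cases "sp (j t) < sp (j t')")
   case True
   then have "j t < j t'" using n0 by (simp add: divide_less_cancel)
   moreover have "r = (1 - p t t') * sp (j t) + p t t' * sp (j t')" using U(2)[OF tt] True by auto
   ultimately show ?thesis
    using U(2)[OF tt] X
    by (intro two_atom_exp_moment[where j = "j t" and k = "j t'" and p = "p t t'" and X = "X t" and Y = "X t'"]) auto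
  next
   case False
   then have "t = t'" "r = sp (j t)" using U(2)[OF tt] by auto
   then show ?thesis using U(2)[OF tt] X one_atom_exp_moment[of "j t" "X t" "?F t t"]
    by (auto simp: algebra_simps)
  qed
  then show "al t t' * (\<Sum>A\<in>Pow I. exp (lam * ?F t t' A)) <= al t t' * (2 ^ n * exp (K\<^sup>2 * n * (1 + r\<^sup>2) * lam\<^sup>2 / 2))"
   using U(2)[OF tt] by (intro mult_left_mono) auto
 qed
 also have "... = (\<Sum>(t, t')\<in>U. al t t') * (2 ^ n * exp (K\<^sup>2 * n * (1 + r\<^sup>2) * lam\<^sup>2 / 2))"
  by (simp add: case_prod_unfold sum_distrib_right)
 finally show ?thesis using U(3) by simp
qed
end

section \<open>Sublinear forms at random signs\<close>

text \<open>Only finitely many coordinates matter, so the function is a continuous function on a finite-dimensional space.\<close>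

lemma lipschitz_measurable:
 fixes g :: "('i::countable => real) => real"
 assumes I: "finite I" and g: "!!x z. \<bar>g x - g z\<bar> <= L * (\<Sum>i\<in>I. \<bar>x i - z i\<bar>)"
  and c: "!!i. i \<in> I ==> c i \<in> borel_measurable P"
 shows "(%w. g (%i. c i w)) \<in> borel_measurable P"
proof -
 have "continuous_on UNIV g"
 proof (subst continuous_on_eq_continuous_at)
  show "\<forall>x\<in>UNIV. isCont g x"
  proof
   fix x :: "'i => real"
   have "continuous_on UNIV (%z :: 'i => real. L * (\<Sum>i\<in>I. \<bar>z i - x i\<bar>))"
    by (intro continuous_intros continuous_on_product_coordinates)
   then have "isCont (%z. L * (\<Sum>i\<in>I. \<bar>z i - x i\<bar>)) x"
    by (simp add: continuous_on_eq_continuous_at)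
   then have "((%z. L * (\<Sum>i\<in>I. \<bar>z i - x i\<bar>)) \<longlongrightarrow> 0) (at x)"
    by (simp add: isCont_def)
   then have "((%z. g z - g x) \<longlongrightarrow> 0) (at x)"
    by (rule Lim_null_comparison[rotated]) (use g[of _ x] in auto)
   then show "isCont g x" by (simp add: isCont_def LIM_zero_iff)
  qed
 qed simp
 then have 1: "g \<in> borel_measurable borel" by (rule borel_measurable_continuous_onI)
 have 2: "(%w i. if i \<in> I then c i w else 0) \<in> borel_measurable P"
 proof (rule measurable_coordinatewise_then_product)
  fix i show "(%w. if i \<in> I then c i w else 0) \<in> borel_measurable P"
   using c[of i] by (cases "i \<in> I") simp_all
 qed
 have "(%w. g (%i. if i \<in> I then c i w else 0)) \<in> borel_measurable P"
  using measurable_compose[OF 2 1] by simp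
 also have "(%w. g (%i. if i \<in> I then c i w else 0)) = (%w. g (%i. c i w))"
 proof
  fix w
  have "(\<Sum>i\<in>I. \<bar>(if i \<in> I then c i w else 0) - c i w\<bar>) = 0" by (rule sum.neutral) simp
  then show "g (%i. if i \<in> I then c i w else 0) = g (%i. c i w)"
   using g[of "%i. if i \<in> I then c i w else 0" "%i. c i w"] by simp
 qed
 finally show ?thesis .
qed

text \<open>The sign vector encoded by the set of its negative coordinates.\<close>

definition sv :: "nat set => nat => real" where "sv A i = (if i \<in> A then - 1 else 1)"

lemma abs_sv [simp]: "\<bar>sv A i\<bar> = 1" by (simp add: sv_def)
lemma sv_sym_diff: "sv (sym_diff A B) i = sv A i * sv B i"
 by (cases "i \<in> A"; cases "i \<in> B") (simp_all add: sv_def)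
lemma sv_toggle: "sv (toggle j A) i = (if i = j then - sv A i else sv A i)"
 by (cases "i = j"; cases "j \<in> A"; cases "i \<in> A") (simp_all add: sv_def toggle_def)

locale sublinear_form =
 fixes phi :: "'v::real_vector => real" and y :: "nat => 'v" and n :: nat and M :: real
 assumes subadd: "!!u v. phi (u + v) <= phi u + phi v"
  and homog: "!!c u. 0 <= c ==> phi (c *\<^sub>R u) = c * phi u"
  and bound: "!!i. i \<in> {1..n} ==> \<bar>phi (y i)\<bar> <= M" "!!i. i \<in> {1..n} ==> \<bar>phi (- y i)\<bar> <= M"
  and n0: "0 < n"
begin

definition form :: "(nat => real) => real" where "form x = phi (weighted_average n x y)"

lemma phi_zero: "phi 0 = 0" using homog[of 0 0] by simp

lemma M_nonneg: "0 <= M" using bound(1)[of 1] n0 abs_ge_zero[of "phi (y 1)"] by (auto simp: Suc_le_eq)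

lemma phi_sum: "finite S ==> phi (\<Sum>s\<in>S. f s) <= (\<Sum>s\<in>S. phi (f s))"
proof (induction S rule: finite_induct)
 case (insert s S)
 then show ?case using subadd[of "f s" "sum f S"] by simp
qed (simp add: phi_zero)

lemma form_cong: "(!!i. i \<in> {1..n} ==> x i = z i) ==> form x = form z"
 by (simp add: form_def weighted_average_def)

lemma form_scale: "0 <= c ==> form (%i. c * x i) = c * form x"
 by (simp add: form_def weighted_average_def homog[symmetric] scaleR_sum_right mult_ac)

lemma form_sum: "finite S ==> form (%i. \<Sum>s\<in>S. x s i) <= (\<Sum>s\<in>S. form (x s))"
proof -
 assume S: "finite S"
 have "weighted_average n (%i. \<Sum>s\<in>S. x s i) y = (\<Sum>s\<in>S. weighted_average n (x s) y)"
  unfolding weighted_average_def scaleR_sum_left scaleR_sum_right by (rule sum.swap)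
 then show ?thesis unfolding form_def using phi_sum[OF S] by simp
qed

lemma form_add: "form (%i. x i + z i) <= form x + form z"
proof -
 have "weighted_average n (%i. x i + z i) y = weighted_average n x y + weighted_average n z y"
  by (simp add: weighted_average_def scaleR_add_left scaleR_add_right sum.distrib)
 then show ?thesis unfolding form_def by (simp add: subadd)
qed

lemma form_le: "form x <= M / n * (\<Sum>i=1..n. \<bar>x i\<bar>)"
proof -
 have *: "phi (c *\<^sub>R y i) <= \<bar>c\<bar> * M" if "i \<in> {1..n}" for c i
 proof (cases "0 <= c")
  case True
  then show ?thesis using bound(1)[OF that] by (simp add: homog mult_left_mono)
 next
  case False
  then have "phi (c *\<^sub>R y i) = (- c) * phi (- y i)" using homog[of "- c" "- y i"] by simp
  then show ?thesis using bound(2)[OF that] False mult_left_mono[of "phi (- y i)" M "- c"] by simp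
 qed
 have "form x = phi (\<Sum>i=1..n. (x i / n) *\<^sub>R y i)"
  by (simp add: form_def weighted_average_def scaleR_sum_right)
 also have "... <= (\<Sum>i=1..n. phi ((x i / n) *\<^sub>R y i))" by (rule phi_sum) simp
 also have "... <= (\<Sum>i=1..n. \<bar>x i / n\<bar> * M)" by (intro sum_mono *)
 also have "... = M / n * (\<Sum>i=1..n. \<bar>x i\<bar>)" by (simp add: sum_distrib_left mult_ac)
 finally show ?thesis .
qed

lemma form_lipschitz: "\<bar>form x - form z\<bar> <= M / n * (\<Sum>i=1..n. \<bar>x i - z i\<bar>)"
proof -
 have "form x - form z <= M / n * (\<Sum>i=1..n. \<bar>x i - z i\<bar>)" for x z
  using form_add[of "%i. x i - z i" z] form_le[of "%i. x i - z i"] by simp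
 from this[of x z] this[of z x] show ?thesis by (simp add: abs_minus_commute)
qed

lemma form_bound: "\<bar>form x\<bar> <= M / n * (\<Sum>i=1..n. \<bar>x i\<bar>)"
 using form_lipschitz[of x "%_. 0"] by (simp add: form_def weighted_average_def phi_zero)

lemma form_single:
 assumes j: "j \<in> {1..n}" and "!!i. i \<in> {1..n} ==> i \<noteq> j ==> x i = z i"
 shows "\<bar>form x - form z\<bar> <= M / n * \<bar>x j - z j\<bar>"
proof -
 have "(\<Sum>i=1..n. \<bar>x i - z i\<bar>) = \<bar>x j - z j\<bar>"
  using assms by (subst sum.remove[of _ j]) auto
 then show ?thesis using form_lipschitz[of x z] by simp
qed

lemma form_toggle: "j \<in> {1..n} ==> \<bar>form (%i. c i * sv A i) - form (%i. c i * sv (toggle j A) i)\<bar> <= M / n * (2 * \<bar>c j\<bar>)"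
 using form_single[of j "%i. c i * sv A i" "%i. c i * sv (toggle j A) i"]
 by (simp add: sv_toggle abs_mult flip: mult_2)

lemma form_measurable [measurable]:
 assumes c: "!!i. i \<in> {1..n} ==> c i \<in> borel_measurable P"
 shows "(%w. form (%i. c i w)) \<in> borel_measurable P"
 by (rule lipschitz_measurable[OF finite_atLeastAtMost form_lipschitz c])

lemma form_integrable:
 assumes c: "!!i. i \<in> {1..n} ==> integrable P (c i)"
 shows "integrable P (%w. form (%i. c i w))"
proof (rule Bochner_Integration.integrable_bound)
 show "integrable P (%w. M / n * (\<Sum>i=1..n. \<bar>c i w\<bar>))"
  by (intro integrable_mult_right Bochner_Integration.integrable_sum integrable_abs c)
 show "(%w. form (%i. c i w)) \<in> borel_measurable P" using c by (intro form_measurable) auto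
 show "AE w in P. norm (form (%i. c i w)) <= norm (M / n * (\<Sum>i=1..n. \<bar>c i w\<bar>))"
  using form_bound M_nonneg by (auto simp: abs_mult sum_nonneg)
qed

text \<open>By the Jensen hypothesis \<open>h\<close> is at most the difference between the forms with weights \<open>\<bar>c\<bar>\<close> and \<open>c\<close>,
divided by \<open>a\<close>. Replacing \<open>\<bar>c j\<bar>\<close> by \<open>c j\<close> is a sign flip of coordinate \<open>j\<close> when \<open>c j\<close> is negative, and nothing
otherwise; hence the increments are odd in \<open>j\<close>, and as \<open>c j\<close> has mean zero they are at most \<open>M / n\<close> after division.\<close>

lemma centred_weights_exp_moment:
 assumes P: "prob_space P" and c: "!!i. i \<in> {1..n} ==> integrable P (c i)"
  and c0: "!!i. i \<in> {1..n} ==> (\<integral>w. c i w \<partial>P) = 0"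
  and ca: "!!i. i \<in> {1..n} ==> (\<integral>w. \<bar>c i w\<bar> \<partial>P) = a" and a: "0 < a"
  and jensen: "!!x. a * form x <= (\<integral>w. form (%i. \<bar>c i w\<bar> * x i) \<partial>P)"
  and lam: "0 <= lam"
 shows "(\<Sum>A\<in>Pow {1..n}. exp (lam * (form (sv A) - (\<integral>w. form (%i. c i w * sv A i) \<partial>P) / a)))
  <= 2 ^ n * exp (M\<^sup>2 * lam\<^sup>2 / n)"
proof -
 interpret prob_space P by fact
 let ?I = "{1..n}"
 have ci: "integrable P (%w. c i w * s)" "integrable P (%w. \<bar>c i w\<bar> * s)" if "i \<in> ?I" for i s
  using c[OF that] by auto
 \<comment> \<open>the hybrids between \<open>c\<close> and its absolute value\<close>
 define v where "v = (%j w i. if i < j then c i w else \<bar>c i w\<bar>)"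
 have vi: "integrable P (%w. form (%i. v j w i * sv A i))" for j A
 proof (rule form_integrable)
  fix i assume "i \<in> ?I"
  then show "integrable P (%w. v j w i * sv A i)" using ci by (cases "i < j") (auto simp: v_def)
 qed
 define g where "g = (%j A. (\<integral>w. form (%i. v j w i * sv A i) - form (%i. v (Suc j) w i * sv A i) \<partial>P) / a)"
 have step: "form (%i. v (Suc j) w i * sv A i) = form (%i. v j w i * sv (if c j w < 0 then toggle j A else A) i)" for j w A
  by (rule form_cong) (auto simp: v_def sv_toggle less_Suc_eq)
 define h where "h = (%A. form (sv A) - (\<integral>w. form (%i. c i w * sv A i) \<partial>P) / a)"
 have "(\<Sum>A\<in>Pow ?I. exp (lam * h A)) <= 2 ^ card ?I * exp (2 * M / n * (\<Sum>j\<in>?I. M / n) * lam\<^sup>2 / 2)"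
 proof (rule cube_exp_moment_odd[where g = g])
  fix A
  have "(\<Sum>j\<in>?I. g j A) = (\<integral>w. (\<Sum>j\<in>?I. form (%i. v j w i * sv A i) - form (%i. v (Suc j) w i * sv A i)) \<partial>P) / a"
   unfolding g_def sum_divide_distrib[symmetric] using vi by (subst Bochner_Integration.integral_sum) auto
  also have "... = (\<integral>w. form (%i. v 1 w i * sv A i) - form (%i. v (Suc n) w i * sv A i) \<partial>P) / a"
  proof -
   have tele: "(\<Sum>j\<in>?I. f j - f (Suc j)) = f 1 - f (Suc n)" for f :: "nat => real"
    using sum_Suc_diff[of 1 n "%j. - f j"] by simp
   show ?thesis
    by (intro arg_cong[where f = "%x. x / a"] Bochner_Integration.integral_cong refl
      tele[of "%j. form (%i. v j w i * sv A i)" for w])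
  qed
  also have "... = ((\<integral>w. form (%i. \<bar>c i w\<bar> * sv A i) \<partial>P) - (\<integral>w. form (%i. c i w * sv A i) \<partial>P)) / a"
  proof -
   have "form (%i. v 1 w i * sv A i) = form (%i. \<bar>c i w\<bar> * sv A i)"
    "form (%i. v (Suc n) w i * sv A i) = form (%i. c i w * sv A i)" for w
    by (rule form_cong; auto simp: v_def)+
   note eq = this
   have int: "integrable P (%w. form (%i. \<bar>c i w\<bar> * sv A i))" "integrable P (%w. form (%i. c i w * sv A i))"
    by (rule form_integrable, rule ci, assumption)+
   show ?thesis unfolding eq by (simp only: Bochner_Integration.integral_diff[OF int])
  qed
  finally show "h A <= (\<Sum>j\<in>?I. g j A)"
   using jensen[of "sv A"] a by (simp add: h_def field_simps)
 next
  fix A j assume j: "j \<in> ?I"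
  have "form (%i. v j w i * sv (toggle j A) i) - form (%i. v (Suc j) w i * sv (toggle j A) i)
   = - (form (%i. v j w i * sv A i) - form (%i. v (Suc j) w i * sv A i))" for w
   unfolding step by simp
  note flip = this
  show "g j (toggle j A) = - g j A"
   unfolding g_def flip Bochner_Integration.integral_minus by simp
  have le: "\<bar>form (%i. v j w i * sv A i) - form (%i. v (Suc j) w i * sv A i)\<bar> <= M / n * (\<bar>c j w\<bar> - c j w)" for w
  proof (cases "c j w < 0")
   case True
   then have "v j w j = - c j w" by (simp add: v_def)
   then show ?thesis using form_toggle[OF j, of "v j w" A] True unfolding step by simp
  qed (simp add: step)
  have "\<bar>\<integral>w. form (%i. v j w i * sv A i) - form (%i. v (Suc j) w i * sv A i) \<partial>P\<bar>
    <= (\<integral>w. \<bar>form (%i. v j w i * sv A i) - form (%i. v (Suc j) w i * sv A i)\<bar> \<partial>P)" by (rule integral_abs_bound)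
  also have "... <= (\<integral>w. M / n * (\<bar>c j w\<bar> - c j w) \<partial>P)"
   using le vi c[OF j] by (intro integral_mono) auto
  also have "... = M / n * a" using c[OF j] c0[OF j] ca[OF j] by simp
  finally show "\<bar>g j A\<bar> <= M / n" using a by (simp add: g_def divide_le_eq)
  have "\<bar>(\<integral>w. form (%i. c i w * sv A i) \<partial>P) - (\<integral>w. form (%i. c i w * sv (toggle j A) i) \<partial>P)\<bar>
    = \<bar>\<integral>w. form (%i. c i w * sv A i) - form (%i. c i w * sv (toggle j A) i) \<partial>P\<bar>"
   using ci by (subst Bochner_Integration.integral_diff) (auto intro!: form_integrable)
  also have "... <= (\<integral>w. \<bar>form (%i. c i w * sv A i) - form (%i. c i w * sv (toggle j A) i)\<bar> \<partial>P)" by (rule integral_abs_bound)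
  also have "... <= (\<integral>w. M / n * (2 * \<bar>c j w\<bar>) \<partial>P)"
  proof (rule integral_mono)
   show "integrable P (%w. M / n * (2 * \<bar>c j w\<bar>))" using c[OF j] by simp
   show "\<bar>form (%i. c i w * sv A i) - form (%i. c i w * sv (toggle j A) i)\<bar> <= M / n * (2 * \<bar>c j w\<bar>)" for w
    by (rule form_toggle[OF j])
   show "integrable P (%w. \<bar>form (%i. c i w * sv A i) - form (%i. c i w * sv (toggle j A) i)\<bar>)"
    by (intro integrable_abs Bochner_Integration.integrable_diff form_integrable ci)
  qed
  also have "... = 2 * M / n * a" using ca[OF j] by simp
  finally have 1: "\<bar>(\<integral>w. form (%i. c i w * sv A i) \<partial>P) / a - (\<integral>w. form (%i. c i w * sv (toggle j A) i) \<partial>P) / a\<bar> <= 2 * M / n"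
   using a by (simp add: divide_le_eq flip: diff_divide_distrib)
  have "\<bar>form (sv A) - form (sv (toggle j A))\<bar> <= 2 * M / n"
   using form_toggle[OF j, of "%_. 1" A] by (simp add: mult.commute)
  then show "\<bar>h A - h (toggle j A)\<bar> <= 2 * (2 * M / n)"
   using 1 unfolding h_def by linarith
 qed (use lam in auto)
 also have "... = 2 ^ n * exp (M\<^sup>2 * lam\<^sup>2 / n)"
  using n0 by (simp add: power2_eq_square)
 finally show ?thesis by (simp add: h_def)
qed

end

lemma sum_supersets_sv:
 assumes fin: "finite I" and C: "C \<subseteq> I" "card C = k" "k <= m" and i: "i \<in> I" "i \<notin> C"
 shows "(\<Sum>N | C \<subseteq> N \<and> N \<subseteq> I \<and> card N = m. sv N i)
  = real ((card I - k) choose (m - k)) * (1 - 2 * (real m - real k) / (real (card I) - real k))"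
proof -
 let ?S = "{N. C \<subseteq> N \<and> N \<subseteq> I \<and> card N = m}"
 define c where "c = real ((card I - k) choose (m - k))"
 have fS: "finite ?S" using fin by (auto intro: finite_subset[of _ "Pow I"])
 have fC: "finite C" using C fin finite_subset by auto
 have "card (insert i C) <= card I" using C i fin by (intro card_mono) auto
 then have kI: "k < card I" using i fC C by simp
 have cS: "card ?S = (card I - k) choose (m - k)" by (rule card_supersets[OF fin C(1,2,3)])
 have cnt: "(card I - k) * card {N\<in>?S. i \<in> N} = (m - k) * ((card I - k) choose (m - k))"
 proof (cases "m = k")
  case True
  have "N = C" if "N \<in> ?S" for N
   using that True C fin card_subset_eq[of N C] finite_subset[of N I] by auto
  then have "{N\<in>?S. i \<in> N} = {}" using i by blast
  then have "card {N\<in>?S. i \<in> N} = 0" by (simp only: card.empty)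
  then show ?thesis using True by simp
 next
  case False
  have "{N\<in>?S. i \<in> N} = {N. insert i C \<subseteq> N \<and> N \<subseteq> I \<and> card N = m}" by auto
  also have "card ... = (card I - Suc k) choose (m - Suc k)"
   using C i fC False by (intro card_supersets[OF fin]) auto
  finally have "card {N\<in>?S. i \<in> N} = (card I - k - 1) choose (m - k - 1)" by simp
  then show ?thesis using times_binomial_minus1_eq[of "m - k" "card I - k"] False C by simp
 qed
 have "(\<Sum>N\<in>?S. sv N i) = (\<Sum>N\<in>?S. 1 - 2 * (if i \<in> N then 1 else 0))"
  by (intro sum.cong refl) (simp add: sv_def)
 also have "... = c - 2 * real (card {N\<in>?S. i \<in> N})"
  using fS by (simp add: sum_subtractf cS c_def sum.If_cases Int_def flip: sum_distrib_left)
 also have "real (card {N\<in>?S. i \<in> N}) = (real m - real k) / (real (card I) - real k) * c"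
 proof -
  have "real (card I - k) * real (card {N\<in>?S. i \<in> N}) = real (m - k) * c"
   unfolding c_def of_nat_mult[symmetric] cnt ..
  then show ?thesis using kI C(3) by (simp add: of_nat_diff field_simps)
 qed
 finally show ?thesis by (simp add: c_def algebra_simps)
qed

context sublinear_form begin

abbreviation "I \<equiv> {1..n}"
abbreviation "G A \<equiv> form (sv A)"

lemma sv_complement: "i \<in> I ==> sv (I - A) i = - sv A i" by (simp add: sv_def)

text \<open>Averaging sign vectors \<open>sv N\<close> over all \<open>N \<supseteq> C\<close> of size \<open>m\<close> gives \<open>- 1\<close> on \<open>C\<close> and a constant elsewhere;
for the mean of the sizes \<open>m\<close> and \<open>n - m\<close> this constant is \<open>k / (n - k)\<close>, whatever \<open>m\<close> is. Sublinearity does the rest.\<close>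

lemma minority_vector_le:
 assumes C: "C \<subseteq> I" "card C = k" and k: "2 * k <= n" "k <= m" "m <= n - k"
 shows "form (%i. (if i \<in> C then - 1 else real k / (real n - real k)) * x i)
  <= ((\<Sum>N | C \<subseteq> N \<and> N \<subseteq> I \<and> card N = m. form (%i. sv N i * x i)) / real ((n - k) choose (m - k))
   + (\<Sum>N | C \<subseteq> N \<and> N \<subseteq> I \<and> card N = n - m. form (%i. sv N i * x i)) / real ((n - k) choose (n - m - k))) / 2"
proof -
 let ?S = "%m. {N. C \<subseteq> N \<and> N \<subseteq> I \<and> card N = m}"
 let ?c = "%m. real ((n - k) choose (m - k))"
 have fS: "finite (?S m)" for m by (rule finite_subset[of _ "Pow I"]) auto
 have nk: "real n - real k > 0" using k n0 by auto
 have pos: "0 < ?c m" "0 < ?c (n - m)" using k by (auto simp: zero_less_binomial)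
 have coord: "(\<Sum>N\<in>?S m. sv N i * x i) / ?c m = (if i \<in> C then - 1 else 1 - 2 * (real m - real k) / (real n - real k)) * x i"
  if i: "i \<in> I" and m: "k <= m" "m <= n" for i m
 proof (cases "i \<in> C")
  case True
  have "(\<Sum>N\<in>?S m. sv N i * x i) = (\<Sum>N\<in>?S m. - x i)"
   using True by (intro sum.cong refl) (auto simp: sv_def)
  also have "... = - (?c m * x i)" using card_supersets[OF _ C m(1)] by simp
  finally show ?thesis using True m by (simp add: zero_less_binomial)
 next
  case False
  have "(\<Sum>N\<in>?S m. sv N i) = ?c m * (1 - 2 * (real m - real k) / (real n - real k))"
   using sum_supersets_sv[OF _ C m(1) i False] by simp
  moreover have "?c m \<noteq> 0" using m by (simp add: zero_less_binomial[THEN less_imp_neq, THEN not_sym] diff_le_mono)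
  ultimately show ?thesis using False unfolding sum_distrib_right[symmetric] by simp
 qed
 have "form (%i. (if i \<in> C then - 1 else real k / (real n - real k)) * x i)
  = form (%i. (1 / (2 * ?c m)) * (\<Sum>N\<in>?S m. sv N i * x i) + (1 / (2 * ?c (n - m))) * (\<Sum>N\<in>?S (n - m). sv N i * x i))"
 proof (rule form_cong)
  fix i assume i: "i \<in> I"
  have m: "k <= m" "m <= n" "k <= n - m" "n - m <= n" using k by auto
  have "(1 / (2 * ?c m)) * (\<Sum>N\<in>?S m. sv N i * x i) + (1 / (2 * ?c (n - m))) * (\<Sum>N\<in>?S (n - m). sv N i * x i)
   = ((\<Sum>N\<in>?S m. sv N i * x i) / ?c m + (\<Sum>N\<in>?S (n - m). sv N i * x i) / ?c (n - m)) / 2"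
   by (simp add: add_divide_distrib)
  also have "... = (if i \<in> C then - 1 else real k / (real n - real k)) * x i"
  proof -
   define d where "d = real n - real k"
   have "(real m - real k) / d + (real (n - m) - real k) / d = (d - real k) / d"
    unfolding add_divide_distrib[symmetric] using m by (simp add: d_def of_nat_diff)
   also have "... = 1 - real k / d" using nk unfolding d_def[symmetric] by (simp add: diff_divide_distrib)
   finally have *: "2 * (real k / d) = (1 - 2 * (real m - real k) / d) + (1 - 2 * (real (n - m) - real k) / d)"
    unfolding times_divide_eq_right[symmetric] by linarith
   have "real k / d * x i = (a * x i + b * x i) / 2"
    if "a = 1 - 2 * (real m - real k) / d" "b = 1 - 2 * (real (n - m) - real k) / d" for a b
   proof -
    define e where "e = real k / d"
    have "2 * e = a + b" using * unfolding that e_def .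
    then have e2: "e = (a + b) / 2" by simp
    show ?thesis unfolding e_def[symmetric] e2 by (simp add: distrib_right)
   qed
   then show ?thesis
    unfolding coord[OF i m(1,2)] coord[OF i m(3,4)] by (cases "i \<in> C") (simp_all add: d_def)
  qed
  finally show "(if i \<in> C then - 1 else real k / (real n - real k)) * x i = (1 / (2 * ?c m)) * (\<Sum>N\<in>?S m. sv N i * x i) + (1 / (2 * ?c (n - m))) * (\<Sum>N\<in>?S (n - m). sv N i * x i)"
   by simp
 qed
 also have "... <= form (%i. (1 / (2 * ?c m)) * (\<Sum>N\<in>?S m. sv N i * x i)) + form (%i. (1 / (2 * ?c (n - m))) * (\<Sum>N\<in>?S (n - m). sv N i * x i))"
  by (rule form_add)
 also have "... = (1 / (2 * ?c m)) * form (%i. \<Sum>N\<in>?S m. sv N i * x i) + (1 / (2 * ?c (n - m))) * form (%i. \<Sum>N\<in>?S (n - m). sv N i * x i)"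
  by (subst (1 2) form_scale) auto
 also have "... <= (1 / (2 * ?c m)) * (\<Sum>N\<in>?S m. form (%i. sv N i * x i)) + (1 / (2 * ?c (n - m))) * (\<Sum>N\<in>?S (n - m). form (%i. sv N i * x i))"
  by (intro add_mono mult_left_mono form_sum fS) auto
 finally show ?thesis by (simp add: add_divide_distrib)
qed

text \<open>The vector is \<open>sv C\<close>, centred at its mean and divided by \<open>1 + tau k\<close>; \<open>e\<close> is a global sign, which exchanges the
roles of the two weights.\<close>

definition minority_average :: "nat => real => nat set => real" where
 "minority_average k e A = (\<Sum>C | C \<subseteq> I \<and> card C = k.
  form (%i. (if i \<in> C then - 1 else real k / (real n - real k)) * (e * sv A i))) / real (n choose k)"

lemma layer_sum_complement:
 assumes "A \<subseteq> I" "m <= n"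
 shows "layer_sum I G (I - A) m = layer_sum I G A (n - m)"
 unfolding layer_sum_def
proof (rule sum.reindex_bij_witness[of _ "%N. I - N" "%N. I - N"])
 fix N assume "N \<in> {N. N \<subseteq> I \<and> card N = m}"
 then have N: "N \<subseteq> I" "card N = m" by auto
 show "I - (I - N) = N" using N by auto
 show "I - N \<in> {N. N \<subseteq> I \<and> card N = n - m}" using N by (auto simp: card_Diff_subset finite_subset)
 have "sym_diff A (I - N) = sym_diff (I - A) N" using N assms by blast
 then show "G (sym_diff A (I - N)) = G (sym_diff (I - A) N)" by (rule arg_cong)
next
 fix N assume "N \<in> {N. N \<subseteq> I \<and> card N = n - m}"
 then have N: "N \<subseteq> I" "card N = n - m" by auto
 show "I - (I - N) = N" using N by auto
 show "I - N \<in> {N. N \<subseteq> I \<and> card N = m}" using N assms by (auto simp: card_Diff_subset finite_subset)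
qed

lemma minority_average_dominated:
 assumes k: "2 * k <= n" and e: "e = 1 \<or> e = - 1"
 shows "dominated I G k (minority_average k e)"
 unfolding dominated_def
proof (intro allI impI)
 fix A m assume A: "A \<subseteq> I" and km: "k <= m" "m <= card I - k"
 then have m: "m <= n - k" by simp
 have half: "2 * real (n choose m) * minority_average k 1 A <= layer_sum I G A m + layer_sum I G A (n - m)"
  if A: "A \<subseteq> I" for A
 proof -
  let ?S = "%C m. {N. C \<subseteq> N \<and> N \<subseteq> I \<and> card N = m}"
  have nested: "(\<Sum>C | C \<subseteq> I \<and> card C = k. (\<Sum>N\<in>?S C m. form (%i. sv N i * (1 * sv A i))) / real ((n - k) choose (m - k)))
   = real (n choose k) / real (n choose m) * layer_sum I G A m" if m: "k <= m" "m <= n" for m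
  proof -
   have "(\<Sum>C | C \<subseteq> I \<and> card C = k. \<Sum>N\<in>?S C m. form (%i. sv N i * (1 * sv A i)))
    = (\<Sum>(C, N)\<in>nested_pairs I k m. G (sym_diff A N))"
   proof -
    have "nested_pairs I k m = Sigma {C. C \<subseteq> I \<and> card C = k} (%C. ?S C m)" by (auto simp: nested_pairs_def)
    moreover have "form (%i. sv N i * (1 * sv A i)) = G (sym_diff A N)" for N
     by (rule form_cong) (simp add: sv_sym_diff)
    moreover have "finite {C. C \<subseteq> I \<and> card C = k}" "finite (?S C m)" for C
     by (auto intro: finite_subset[of _ "Pow I"])
    ultimately show ?thesis by (simp add: sum.Sigma)
   qed
   also have "... = real (m choose k) * layer_sum I G A m"
    unfolding layer_sum_def by (rule sum_nested_pairs_snd) simp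
   finally have "(\<Sum>C | C \<subseteq> I \<and> card C = k. (\<Sum>N\<in>?S C m. form (%i. sv N i * (1 * sv A i))) / real ((n - k) choose (m - k)))
    = real (m choose k) / real ((n - k) choose (m - k)) * layer_sum I G A m"
    unfolding sum_divide_distrib[symmetric] by simp
   also have "real (m choose k) / real ((n - k) choose (m - k)) = real (n choose k) / real (n choose m)"
   proof -
    have "real (n choose m) * real (m choose k) = real (n choose k) * real ((n - k) choose (m - k))"
     unfolding of_nat_mult[symmetric] choose_mult[OF m] ..
    moreover have "real (n choose m) > 0" "real ((n - k) choose (m - k)) > 0" using m by (auto simp: zero_less_binomial)
    ultimately show ?thesis by (simp add: field_simps)
   qed
   finally show ?thesis .
  qed
  note nested' = nested[unfolded sum_divide_distrib[symmetric]]
  have mm: "k <= m" "m <= n" "k <= n - m" "n - m <= n" using km m k by auto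
  have pos: "0 < real (n choose m)" "0 < real (n choose k)" using mm by (auto simp: zero_less_binomial)
  have "minority_average k 1 A * real (n choose k) = (\<Sum>C | C \<subseteq> I \<and> card C = k.
  form (%i. (if i \<in> C then - 1 else real k / (real n - real k)) * (1 * sv A i)))"
   using pos by (simp add: minority_average_def)
  also have "... <= (\<Sum>C | C \<subseteq> I \<and> card C = k.
   ((\<Sum>N\<in>?S C m. form (%i. sv N i * (1 * sv A i))) / real ((n - k) choose (m - k))
   + (\<Sum>N\<in>?S C (n - m). form (%i. sv N i * (1 * sv A i))) / real ((n - k) choose (n - m - k))) / 2)"
   by (rule sum_mono) (use minority_vector_le[OF _ _ k km(1) m] in auto)
  also have "... = real (n choose k) * (layer_sum I G A m + layer_sum I G A (n - m)) / real (n choose m) / 2"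
   unfolding sum_divide_distrib[symmetric] sum.distrib nested'[OF mm(1,2)] nested'[OF mm(3,4)]
    binomial_symmetric[OF mm(2), symmetric] using pos by (simp add: field_simps)
  finally have "real (n choose k) * minority_average k 1 A
    <= real (n choose k) * ((layer_sum I G A m + layer_sum I G A (n - m)) / real (n choose m) / 2)"
   by (simp add: mult.commute)
  then have "minority_average k 1 A <= (layer_sum I G A m + layer_sum I G A (n - m)) / real (n choose m) / 2"
   using pos by (simp only: mult_le_cancel_left_pos)
  then show ?thesis using pos by (simp add: pos_le_divide_eq mult_ac)
 qed
 show "2 * real (card I choose m) * minority_average k e A <= layer_sum I G A m + layer_sum I G A (card I - m)"
 proof (cases "e = 1")
  case True
  then show ?thesis using half[OF A] by simp
 next
  case False
  then have e: "e = - 1" using e by simp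
  have "minority_average k e A = minority_average k 1 (I - A)"
   unfolding minority_average_def e
  proof (intro arg_cong2[where f = "(/)"] sum.cong refl form_cong)
   fix C i assume "i \<in> I"
   then show "(if i \<in> C then - 1 else real k / (real n - real k)) * (- 1 * sv A i)
     = (if i \<in> C then - 1 else real k / (real n - real k)) * (1 * sv (I - A) i)"
    unfolding sv_complement[OF \<open>i \<in> I\<close>] by simp
  qed
  then show ?thesis using half[of "I - A"] layer_sum_complement[OF A, of m] layer_sum_complement[OF A, of "n - m"] m k
   by simp
 qed
qed

definition tau :: "nat => real" where "tau s = (real n - 2 * real s) / real n"

definition sign_average :: "nat => nat set => real" where
 "sign_average s A = (\<Sum>S | S \<subseteq> I \<and> card S = s. form (%i. (sv S i - tau s) * sv A i)) / real (n choose s)"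

lemma sign_average_dominated:
 assumes s: "s <= n"
 shows "dominated I G (min s (n - s)) (%A. sign_average s A / (1 + \<bar>tau s\<bar>))"
proof (cases "2 * s <= n")
 case True
 then have t: "tau s >= 0" by (simp add: tau_def)
 have "sign_average s A / (1 + \<bar>tau s\<bar>) = minority_average s 1 A" for A
 proof -
  have "form (%i. (sv S i - tau s) * sv A i) = (1 + tau s) * form (%i. (if i \<in> S then - 1 else real s / (real n - real s)) * (1 * sv A i))" for S
   unfolding form_scale[symmetric, OF add_nonneg_nonneg[OF zero_le_one t]]
  proof (rule form_cong)
   fix i
   have "real n - real s > 0" using True n0 by auto
   then show "(sv S i - tau s) * sv A i = (1 + tau s) * ((if i \<in> S then - 1 else real s / (real n - real s)) * (1 * sv A i))"
    using n0 by (simp add: tau_def sv_def field_simps)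
  qed
  then show ?thesis using t by (simp add: sign_average_def minority_average_def sum_distrib_left[symmetric])
 qed
 moreover have "min s (n - s) = s" using True by (intro min_absorb1) linarith
 ultimately show ?thesis using minority_average_dominated[OF True, of 1] by simp
next
 case False
 define k where "k = n - s"
 have k: "2 * k <= n" "k <= n" "s = n - k" "real s = real n - real k" using False s by (auto simp: k_def of_nat_diff)
 have t: "tau s <= 0" using False by (simp add: tau_def divide_le_0_iff)
 have "sign_average s A / (1 + \<bar>tau s\<bar>) = minority_average k (- 1) A" for A
 proof -
  have "form (%i. (sv (I - C) i - tau s) * sv A i) = (1 - tau s) * form (%i. (if i \<in> C then - 1 else real k / (real n - real k)) * (- 1 * sv A i))" for C
   unfolding form_scale[symmetric, OF diff_ge_0_iff_ge[THEN iffD2, OF order_trans[OF t zero_le_one]]]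
  proof (rule form_cong)
   fix i assume "i \<in> I"
   moreover have "real n - real k > 0" using k n0 by auto
   ultimately show "(sv (I - C) i - tau s) * sv A i = (1 - tau s) * ((if i \<in> C then - 1 else real k / (real n - real k)) * (- 1 * sv A i))"
    using n0 unfolding tau_def k(4) by (simp add: sv_def field_simps)
  qed
  moreover have "(\<Sum>S | S \<subseteq> I \<and> card S = s. form (%i. (sv S i - tau s) * sv A i))
   = (\<Sum>C | C \<subseteq> I \<and> card C = k. form (%i. (sv (I - C) i - tau s) * sv A i))"
  proof (rule sum.reindex_bij_witness[of _ "%N. I - N" "%N. I - N"])
   fix N assume "N \<in> {N. N \<subseteq> I \<and> card N = s}"
   then have N: "N \<subseteq> I" "card N = s" by auto
   show "I - (I - N) = N" using N by auto
   then show "form (%i. (sv (I - (I - N)) i - tau s) * sv A i) = form (%i. (sv N i - tau s) * sv A i)" by simp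
   show "I - N \<in> {N. N \<subseteq> I \<and> card N = k}" using N by (auto simp: card_Diff_subset finite_subset k_def)
  next
   fix N assume "N \<in> {N. N \<subseteq> I \<and> card N = k}"
   then have N: "N \<subseteq> I" "card N = k" by auto
   show "I - (I - N) = N" using N by auto
   show "I - N \<in> {N. N \<subseteq> I \<and> card N = s}" using N s by (auto simp: card_Diff_subset finite_subset k_def)
  qed
  moreover have "(n choose s) = (n choose k)" unfolding k(3) by (rule binomial_symmetric[OF k(2), symmetric])
  ultimately show ?thesis using t by (simp add: sign_average_def minority_average_def sum_distrib_left[symmetric])
 qed
 moreover have "min s (n - s) = k" using False unfolding k_def by (intro min_absorb2) linarith
 ultimately show ?thesis using minority_average_dominated[OF k(1), of "- 1"] by simp
qed

text \<open>Normalised by \<open>1 + \<bar>tau s\<bar>\<close>, each sign average is dominated by the window of the minority size \<open>min s (n - s)\<close>,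
whose relative size is \<open>1 - \<bar>tau s\<bar>\<close>. With the tilted mixture weights \<open>p s * (1 + \<bar>tau s\<bar>) / D\<close> the mean is therefore the given \<open>r\<close>.\<close>

theorem sign_weights_exp_moment:
 assumes p: "!!s. s <= n ==> 0 <= p s" "(\<Sum>s\<le>n. p s) = 1" and lam: "0 <= lam"
  and D: "D = (\<Sum>s\<le>n. p s * (1 + \<bar>tau s\<bar>))" and r: "r = (\<Sum>s\<le>n. p s * (1 - (tau s)\<^sup>2)) / D"
 shows "(\<Sum>A\<in>Pow I. exp (lam * ((\<Sum>s\<le>n. p s * sign_average s A) / D - G A))) <= 2 ^ n * exp (M\<^sup>2 * (1 + r\<^sup>2) * lam\<^sup>2 / (2 * n))"
proof -
 interpret cube_function I n G "M / n" lam
  by unfold_locales (use n0 M_nonneg lam form_toggle[of _ "%_. 1"] in \<open>auto simp: mult_ac\<close>)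
 have D1: "1 <= D"
 proof -
  have "(\<Sum>s\<le>n. p s) <= D" unfolding D by (intro sum_mono) (use p in \<open>auto simp: distrib_left\<close>)
  then show ?thesis using p by simp
 qed
 \<comment> \<open>tilting absorbs the normalisation of the sign averages into the mixture\<close>
 define q where "q = (%s. p s * (1 + \<bar>tau s\<bar>) / D)"
 have "(\<Sum>A\<in>Pow I. exp (lam * ((\<Sum>s\<le>n. p s * sign_average s A) / D - G A)))
  <= 2 ^ n * exp ((M / n)\<^sup>2 * n * (1 + r\<^sup>2) * lam\<^sup>2 / 2)"
 proof (rule mixture_exp_moment[of "{..n}" q "%s. min s (n - s)" "%s A. sign_average s A / (1 + \<bar>tau s\<bar>)"])
  show "(\<Sum>s\<le>n. q s) = 1" unfolding q_def sum_divide_distrib[symmetric] D[symmetric] using D1 by simp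
  show "r = (\<Sum>t\<le>n. q t * (2 * real (min t (n - t)) / real n))"
   unfolding r q_def sum_divide_distrib times_divide_eq_left
  proof (intro sum.cong refl arg_cong2[where f = "(/)"])
   fix s assume "s \<in> {..n}"
   then have "2 * real (min s (n - s)) / real n = 1 - \<bar>tau s\<bar>"
    using n0 by (auto simp: tau_def min_def of_nat_diff field_simps abs_if)
   moreover have "(1 + \<bar>tau s\<bar>) * (1 - \<bar>tau s\<bar>) = 1 - (tau s)\<^sup>2"
    by (simp add: algebra_simps power2_eq_square)
   ultimately show "p s * (1 - (tau s)\<^sup>2) = p s * (1 + \<bar>tau s\<bar>) * (2 * real (min s (n - s)) / real n)"
    by (simp add: mult.assoc)
  qed
  fix A
  have "(\<Sum>t\<le>n. q t * (sign_average t A / (1 + \<bar>tau t\<bar>))) = (\<Sum>s\<le>n. p s * sign_average s A) / D"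
   unfolding sum_divide_distrib by (intro sum.cong refl) (simp add: q_def add_pos_nonneg[THEN less_imp_neq, THEN not_sym])
  then show "(\<Sum>s\<le>n. p s * sign_average s A) / D - G A <= (\<Sum>t\<le>n. q t * (sign_average t A / (1 + \<bar>tau t\<bar>))) - G A"
   by simp
 qed (use p D1 sign_average_dominated in \<open>auto simp: q_def\<close>)
 then show ?thesis using n0 by (simp add: power2_eq_square field_simps)
qed

end

section \<open>Exchangeable weights\<close>

lemma sum_permutations_average:
 fixes f :: "'i => real"
 assumes S: "finite S" and i: "i \<in> S"
 shows "card S * (\<Sum>\<pi> | \<pi> permutes S. f (\<pi> i)) = fact (card S) * (\<Sum>j\<in>S. f j)"
proof -
 have same: "(\<Sum>\<pi> | \<pi> permutes S. f (\<pi> j)) = (\<Sum>\<pi> | \<pi> permutes S. f (\<pi> i))" if "j \<in> S" for j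
 proof (rule sum.reindex_bij_witness[where i = "%\<pi>. \<pi> \<circ> Transposition.transpose i j" and j = "%\<pi>. \<pi> \<circ> Transposition.transpose i j"])
  fix \<pi> assume "\<pi> \<in> {\<pi>. \<pi> permutes S}"
  then show "\<pi> \<circ> Transposition.transpose i j \<in> {\<pi>. \<pi> permutes S}"
   using permutes_compose[OF permutes_swap_id[OF i that]] by simp
  show "f ((\<pi> \<circ> Transposition.transpose i j) i) = f (\<pi> j)" by simp
 next
  fix \<pi> assume "\<pi> \<in> {\<pi>. \<pi> permutes S}"
  then show "\<pi> \<circ> Transposition.transpose i j \<in> {\<pi>. \<pi> permutes S}"
   using permutes_compose[OF permutes_swap_id[OF i that]] by simp
 qed (auto simp: comp_assoc)
 have "real (card S) * (\<Sum>\<pi> | \<pi> permutes S. f (\<pi> i)) = (\<Sum>j\<in>S. \<Sum>\<pi> | \<pi> permutes S. f (\<pi> j))"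
  using same by simp
 also have "... = (\<Sum>\<pi> | \<pi> permutes S. \<Sum>j\<in>S. f (\<pi> j))" by (rule sum.swap)
 also have "... = (\<Sum>\<pi> | \<pi> permutes S. \<Sum>j\<in>S. f j)"
 proof (rule sum.cong[OF refl])
  fix \<pi> assume "\<pi> \<in> {\<pi>. \<pi> permutes S}"
  then show "(\<Sum>j\<in>S. f (\<pi> j)) = sum f S" using sum.permute[of \<pi> S f] by (simp add: comp_def)
 qed
 also have "... = fact (card S) * (\<Sum>j\<in>S. f j)" using S by (simp add: card_permutations)
 finally show ?thesis by simp
qed

lemma integrable_mult_of_squares:
 fixes f g :: "'a => real"
 assumes "f \<in> borel_measurable M" "g \<in> borel_measurable M"
  and "integrable M (%x. (f x)\<^sup>2)" "integrable M (%x. (g x)\<^sup>2)"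
 shows "integrable M (%x. f x * g x)"
proof (rule Bochner_Integration.integrable_bound)
 show "integrable M (%x. (f x)\<^sup>2 + (g x)\<^sup>2)" using assms(3,4) by (rule Bochner_Integration.integrable_add)
 show "(%x. f x * g x) \<in> borel_measurable M" using assms(1,2) by (rule borel_measurable_times)
 have *: "\<bar>a * b\<bar> <= \<bar>a\<^sup>2 + b\<^sup>2\<bar>" for a b :: real
 proof -
  have "0 <= (\<bar>a\<bar> - \<bar>b\<bar>)\<^sup>2" by simp
  then have "2 * (\<bar>a\<bar> * \<bar>b\<bar>) <= a\<^sup>2 + b\<^sup>2" by (simp add: power2_eq_square algebra_simps)
  moreover have "0 <= \<bar>a\<bar> * \<bar>b\<bar>" by simp
  ultimately have "\<bar>a\<bar> * \<bar>b\<bar> <= a\<^sup>2 + b\<^sup>2" by linarith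
  then show ?thesis by (simp add: abs_mult)
 qed
 show "AE x in M. norm (f x * g x) <= norm ((f x)\<^sup>2 + (g x)\<^sup>2)"
  by (rule AE_I2) (simp only: real_norm_def *)
qed

locale exchangeable_weights = prob_space P for P :: "'a measure" +
 fixes n :: nat and W :: "nat => 'a => real"
 assumes W: "!!i. i \<in> {1..n} ==> W i \<in> borel_measurable P"
  and W2: "!!i. i \<in> {1..n} ==> integrable P (%\<omega>. (W i \<omega>)\<^sup>2)"
  and ex: "exchangeable P n W" and n0: "0 < n"
  and nondeg: "0 < average n (%i. \<integral>\<omega>. \<bar>centred n W i \<omega>\<bar> \<partial>P)"
begin

abbreviation "c i \<omega> \<equiv> centred n W i \<omega>"

lemma exchange:
 fixes h :: "(nat => real) => real"
 assumes "\<pi> permutes {1..n}" and h: "h \<in> borel_measurable (\<Pi>\<^sub>M i\<in>{1..n}. borel)"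
 shows "(\<integral>\<omega>. h (\<lambda>i\<in>{1..n}. W (\<pi> i) \<omega>) \<partial>P) = (\<integral>\<omega>. h (\<lambda>i\<in>{1..n}. W i \<omega>) \<partial>P)"
proof -
 have m: "(%\<omega>. \<lambda>i\<in>{1..n}. W (\<pi>' i) \<omega>) \<in> measurable P (\<Pi>\<^sub>M i\<in>{1..n}. borel)" if "\<pi>' permutes {1..n}" for \<pi>'
  using W permutes_in_image[OF that] by (intro measurable_restrict) auto
 have eq: "distr P (\<Pi>\<^sub>M i\<in>{1..n}. borel) (%\<omega>. \<lambda>i\<in>{1..n}. W (\<pi> i) \<omega>) = distr P (\<Pi>\<^sub>M i\<in>{1..n}. borel) (%\<omega>. \<lambda>i\<in>{1..n}. W i \<omega>)"
  using ex assms(1) unfolding exchangeable_def joint_def by blast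
 have "(\<integral>\<omega>. h (\<lambda>i\<in>{1..n}. W (\<pi> i) \<omega>) \<partial>P) = (\<integral>x. h x \<partial>distr P (\<Pi>\<^sub>M i\<in>{1..n}. borel) (%\<omega>. \<lambda>i\<in>{1..n}. W (\<pi> i) \<omega>))"
  by (rule integral_distr[symmetric, OF m[OF assms(1)] h])
 also have "... = (\<integral>\<omega>. h (\<lambda>i\<in>{1..n}. W i \<omega>) \<partial>P)"
  unfolding eq using m[OF permutes_id] by (intro integral_distr h) simp
 finally show ?thesis .
qed

lemma average_cong: "(!!i. i \<in> {1..n} ==> x i = z i) ==> average n x = average n z"
 by (simp add: average_def)

lemma exchange_centred:
 fixes g :: "(nat => real) => real"
 assumes \<pi>: "\<pi> permutes {1..n}" and g: "g \<in> borel_measurable (\<Pi>\<^sub>M i\<in>{1..n}. borel)"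
 shows "(\<integral>\<omega>. g (\<lambda>i\<in>{1..n}. c (\<pi> i) \<omega>) \<partial>P) = (\<integral>\<omega>. g (\<lambda>i\<in>{1..n}. c i \<omega>) \<partial>P)"
proof -
 define h where "h = (%x. g (\<lambda>i\<in>{1..n}. x i - average n x))"
 have "h \<in> borel_measurable (\<Pi>\<^sub>M i\<in>{1..n}. borel)"
  unfolding h_def average_def
  by (intro measurable_compose[OF _ g] measurable_restrict borel_measurable_diff borel_measurable_scaleR
    borel_measurable_const borel_measurable_sum measurable_component_singleton) auto
 from exchange[OF \<pi> this] have "(\<integral>\<omega>. h (\<lambda>i\<in>{1..n}. W (\<pi> i) \<omega>) \<partial>P) = (\<integral>\<omega>. h (\<lambda>i\<in>{1..n}. W i \<omega>) \<partial>P)" .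
 moreover have "h (\<lambda>i\<in>{1..n}. W i \<omega>) = g (\<lambda>i\<in>{1..n}. c i \<omega>)" for \<omega>
  unfolding h_def centred_def using average_cong[of "\<lambda>i\<in>{1..n}. W i \<omega>" "%i. W i \<omega>"]
  by (intro arg_cong[where f = g] ext) (auto simp: restrict_def)
 moreover have "h (\<lambda>i\<in>{1..n}. W (\<pi> i) \<omega>) = g (\<lambda>i\<in>{1..n}. c (\<pi> i) \<omega>)" for \<omega>
 proof -
  have "average n (\<lambda>i\<in>{1..n}. W (\<pi> i) \<omega>) = average n (%i. W (\<pi> i) \<omega>)"
   by (rule average_cong) simp
  also have "... = average n (%i. W i \<omega>)"
   unfolding average_def using sum.permute[OF \<pi>, of "%i. W i \<omega>"] by (simp add: comp_def)
  finally show ?thesis unfolding h_def centred_def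
   by (intro arg_cong[where f = g] ext) (auto simp: restrict_def)
 qed
 ultimately show ?thesis by simp
qed

lemma integrable_W: "i \<in> {1..n} ==> integrable P (W i)"
 by (rule square_integrable_imp_integrable[OF W W2])

lemma integrable_c: "i \<in> {1..n} ==> integrable P (c i)"
 unfolding centred_def average_def
 by (intro Bochner_Integration.integrable_diff integrable_W integrable_scaleR_right Bochner_Integration.integrable_sum) auto

lemma sum_c: "(\<Sum>i=1..n. c i \<omega>) = 0"
 using n0 by (simp add: centred_def average_def sum_subtractf)

lemma integral_c_eq:
 fixes f :: "real => real"
 assumes i: "i \<in> {1..n}" and f: "f \<in> borel_measurable borel"
 shows "(\<integral>\<omega>. f (c i \<omega>) \<partial>P) = (\<integral>\<omega>. f (c 1 \<omega>) \<partial>P)"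
proof -
 have 1: "1 \<in> {1..n}" using n0 by auto
 have "(%x. f (x (1 :: nat))) \<in> borel_measurable (\<Pi>\<^sub>M i\<in>{1..n}. borel)"
  by (intro measurable_compose[OF _ f] measurable_component_singleton 1)
 from exchange_centred[OF permutes_swap_id[OF 1 i] this] show ?thesis using 1 by simp
qed

lemma integral_c: assumes i: "i \<in> {1..n}" shows "(\<integral>\<omega>. c i \<omega> \<partial>P) = 0"
proof -
 have "real n * (\<integral>\<omega>. c 1 \<omega> \<partial>P) = (\<Sum>i=1..n. \<integral>\<omega>. c i \<omega> \<partial>P)"
 proof -
  have "(\<Sum>i=1..n. \<integral>\<omega>. c i \<omega> \<partial>P) = (\<Sum>i=1..n. \<integral>\<omega>. c 1 \<omega> \<partial>P)"
   by (intro sum.cong[OF refl] integral_c_eq[of _ "%x. x"]) auto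
  then show ?thesis by simp
 qed
 also have "... = (\<integral>\<omega>. (\<Sum>i=1..n. c i \<omega>) \<partial>P)" using integrable_c by simp
 also have "... = 0" unfolding sum_c by simp
 finally show ?thesis using integral_c_eq[OF i, of "%x. x"] n0 by simp
qed

lemma integral_abs_c: "i \<in> {1..n} ==> (\<integral>\<omega>. \<bar>c i \<omega>\<bar> \<partial>P) = const_A P n W"
 unfolding const_A_def by (rule integral_c_eq) auto

lemma const_A_pos: "0 < const_A P n W"
proof -
 have "average n (%i. \<integral>\<omega>. \<bar>c i \<omega>\<bar> \<partial>P) = average n (%i. const_A P n W)"
  by (rule average_cong) (rule integral_abs_c)
 then show ?thesis using nondeg n0 by (simp add: average_def)
qed

text \<open>All permutations of the absolute weights give the same expectation, while by subadditivity the sum over the permutations is at least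
the form at the averaged vector, in which every weight is replaced by the mean absolute weight.\<close>

lemma abs_c_jensen:
 assumes "sublinear_form phi y n M"
 shows "const_A P n W * sublinear_form.form phi y n x <= (\<integral>\<omega>. sublinear_form.form phi y n (%i. \<bar>c i \<omega>\<bar> * x i) \<partial>P)"
proof -
 interpret sublinear_form phi y n M by fact
 let ?S = "{\<pi>. \<pi> permutes {1..n}}"
 have S: "finite ?S" "card ?S = fact n" by (auto simp: finite_permutations card_permutations)
 have int: "integrable P (%\<omega>. form (%i. \<bar>c (\<pi> i) \<omega>\<bar> * x i))" if "\<pi> permutes {1..n}" for \<pi>
  using integrable_c permutes_in_image[OF that]
  by (intro form_integrable integrable_mult_left integrable_abs) auto
 have same: "(\<integral>\<omega>. form (%i. \<bar>c (\<pi> i) \<omega>\<bar> * x i) \<partial>P) = (\<integral>\<omega>. form (%i. \<bar>c i \<omega>\<bar> * x i) \<partial>P)" if "\<pi> permutes {1..n}" for \<pi>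
 proof -
  have "(%z. form (%i. \<bar>z i\<bar> * x i)) \<in> borel_measurable (\<Pi>\<^sub>M i\<in>{1..n}. borel)"
   by (intro form_measurable borel_measurable_times borel_measurable_abs measurable_component_singleton) auto
  from exchange_centred[OF that this]
  have eq: "(\<integral>\<omega>. form (%i. \<bar>(\<lambda>i\<in>{1..n}. c (\<pi> i) \<omega>) i\<bar> * x i) \<partial>P) = (\<integral>\<omega>. form (%i. \<bar>(\<lambda>i\<in>{1..n}. c i \<omega>) i\<bar> * x i) \<partial>P)" .
  have restr: "form (%i. \<bar>(\<lambda>i\<in>{1..n}. c (\<pi>' i) \<omega>) i\<bar> * x i) = form (%i. \<bar>c (\<pi>' i) \<omega>\<bar> * x i)" for \<pi>' \<omega>
   by (rule form_cong) simp
  from eq[unfolded restr restr[of "%i. i"]] show ?thesis .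
 qed
 have "fact n * (const_A P n W * form x) <= (\<integral>\<omega>. (\<Sum>\<pi>\<in>?S. form (%i. \<bar>c (\<pi> i) \<omega>\<bar> * x i)) \<partial>P)"
 proof -
  have "fact n * (const_A P n W * form x) = (\<integral>\<omega>. (fact n / n * (\<Sum>j=1..n. \<bar>c j \<omega>\<bar>)) * form x \<partial>P)"
   using integrable_c integral_abs_c n0 by (simp add: integral_abs_c)
  also have "... <= (\<integral>\<omega>. (\<Sum>\<pi>\<in>?S. form (%i. \<bar>c (\<pi> i) \<omega>\<bar> * x i)) \<partial>P)"
  proof (rule integral_mono)
   show "integrable P (%\<omega>. (fact n / n * (\<Sum>j=1..n. \<bar>c j \<omega>\<bar>)) * form x)"
    using integrable_c by (intro integrable_mult_left integrable_mult_right Bochner_Integration.integrable_sum integrable_abs) auto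
   show "integrable P (%\<omega>. \<Sum>\<pi>\<in>?S. form (%i. \<bar>c (\<pi> i) \<omega>\<bar> * x i))"
    using int by (intro Bochner_Integration.integrable_sum) auto
   fix \<omega>
   have "(fact n / n * (\<Sum>j=1..n. \<bar>c j \<omega>\<bar>)) * form x = form (%i. (fact n / n * (\<Sum>j=1..n. \<bar>c j \<omega>\<bar>)) * x i)"
    by (rule form_scale[symmetric]) (simp add: sum_nonneg)
   also have "... = form (%i. \<Sum>\<pi>\<in>?S. \<bar>c (\<pi> i) \<omega>\<bar> * x i)"
   proof (rule form_cong)
    fix i assume i: "i \<in> {1..n}"
    have "real n * (\<Sum>\<pi>\<in>?S. \<bar>c (\<pi> i) \<omega>\<bar>) = fact n * (\<Sum>j=1..n. \<bar>c j \<omega>\<bar>)"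
     using sum_permutations_average[OF _ i, of "%j. \<bar>c j \<omega>\<bar>"] by simp
    then show "(fact n / n * (\<Sum>j=1..n. \<bar>c j \<omega>\<bar>)) * x i = (\<Sum>\<pi>\<in>?S. \<bar>c (\<pi> i) \<omega>\<bar> * x i)"
     using n0 unfolding sum_distrib_right[symmetric] by (simp add: field_simps)
   qed
   also have "... <= (\<Sum>\<pi>\<in>?S. form (%i. \<bar>c (\<pi> i) \<omega>\<bar> * x i))" by (rule form_sum[OF S(1)])
   finally show "(fact n / n * (\<Sum>j=1..n. \<bar>c j \<omega>\<bar>)) * form x <= (\<Sum>\<pi>\<in>?S. form (%i. \<bar>c (\<pi> i) \<omega>\<bar> * x i))" .
  qed
  finally show ?thesis .
 qed
 also have "... = (\<Sum>\<pi>\<in>?S. \<integral>\<omega>. form (%i. \<bar>c (\<pi> i) \<omega>\<bar> * x i) \<partial>P)"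
  using int by (intro Bochner_Integration.integral_sum) auto
 also have "... = fact n * (\<integral>\<omega>. form (%i. \<bar>c i \<omega>\<bar> * x i) \<partial>P)"
  using same S by simp
 finally show ?thesis by simp
qed

lemma c_square_integrable:
 assumes i: "i \<in> {1..n}" shows "integrable P (%\<omega>. (c i \<omega>)\<^sup>2)"
proof (rule Bochner_Integration.integrable_bound)
 show "integrable P (%\<omega>. 2 * (W i \<omega>)\<^sup>2 + 2 * (\<Sum>j=1..n. (W j \<omega>)\<^sup>2))"
  using W2 i by (intro Bochner_Integration.integrable_add integrable_mult_right Bochner_Integration.integrable_sum) auto
 show "(%\<omega>. (c i \<omega>)\<^sup>2) \<in> borel_measurable P"
  by (intro borel_measurable_power borel_measurable_integrable[OF integrable_c[OF i]])
 show "AE \<omega> in P. norm ((c i \<omega>)\<^sup>2) <= norm (2 * (W i \<omega>)\<^sup>2 + 2 * (\<Sum>j=1..n. (W j \<omega>)\<^sup>2))"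
 proof (rule AE_I2)
  fix \<omega>
  let ?S = "\<Sum>j=1..n. (W j \<omega>)\<^sup>2"
  define m where "m = average n (%j. W j \<omega>)"
  have S: "0 <= ?S" by (intro sum_nonneg) auto
  have "m\<^sup>2 = (\<Sum>j=1..n. W j \<omega>)\<^sup>2 / (real n)\<^sup>2" by (simp add: m_def average_def power_divide)
  also have "... <= ?S * real n / (real n)\<^sup>2"
   using sum_squared_le_sum_of_squares[of "%j. W j \<omega>" "{1..n}"] by (intro divide_right_mono) auto
  also have "... = ?S / real n" using n0 by (simp add: power2_eq_square)
  also have "... <= ?S / 1" using n0 S by (intro divide_left_mono) auto
  finally have m: "m\<^sup>2 <= ?S" by simp
  have "(W i \<omega> - m)\<^sup>2 <= 2 * (W i \<omega>)\<^sup>2 + 2 * m\<^sup>2"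
   using zero_le_power2[of "W i \<omega> + m"] by (simp add: power2_eq_square algebra_simps)
  then have "(c i \<omega>)\<^sup>2 <= 2 * (W i \<omega>)\<^sup>2 + 2 * ?S" using m by (simp add: centred_def m_def)
  then show "norm ((c i \<omega>)\<^sup>2) <= norm (2 * (W i \<omega>)\<^sup>2 + 2 * ?S)" by simp
 qed
qed

lemma c_mult_integrable: "i \<in> {1..n} ==> j \<in> {1..n} ==> integrable P (%\<omega>. c i \<omega> * c j \<omega>)"
 by (intro integrable_mult_of_squares borel_measurable_integrable[OF integrable_c] c_square_integrable)

text \<open>Exchangeability makes all mixed moments with a fixed weight equal, and they sum to zero with its second moment since the
centred weights add up to zero.\<close>

lemma integral_c_mult:
 assumes n2: "2 <= n" and ij: "i \<in> {1..n}" "j \<in> {1..n}"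
 defines "v \<equiv> \<integral>\<omega>. (c 1 \<omega>)\<^sup>2 \<partial>P"
 shows "(\<integral>\<omega>. c i \<omega> * c j \<omega> \<partial>P) = v / (real n - 1) * (if i = j then real n else 0) - v / (real n - 1)"
proof -
 define e where "e = (%k. \<integral>\<omega>. c i \<omega> * c k \<omega> \<partial>P)"
 have ei: "e i = v"
  using integral_c_eq[OF ij(1), of "%x. x\<^sup>2"] by (simp add: e_def v_def power2_eq_square)
 have same: "e k = e l" if kl: "k \<in> {1..n}" "l \<in> {1..n}" "k \<noteq> i" "l \<noteq> i" for k l
 proof -
  have "(%x. x i * x k :: real) \<in> borel_measurable (\<Pi>\<^sub>M i\<in>{1..n}. borel)"
   using ij kl by (intro borel_measurable_times measurable_component_singleton)
  from exchange_centred[OF permutes_swap_id[OF kl(1,2)] this] show ?thesis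
   using ij kl by (simp add: e_def Transposition.transpose_def)
 qed
 have "(\<Sum>k=1..n. e k) = (\<integral>\<omega>. c i \<omega> * (\<Sum>k=1..n. c k \<omega>) \<partial>P)"
  unfolding e_def sum_distrib_left using c_mult_integrable ij by (intro Bochner_Integration.integral_sum[symmetric]) auto
 then have sum0: "(\<Sum>k=1..n. e k) = 0" unfolding sum_c by simp
 show ?thesis
 proof (cases "i = j")
  case True
  then have "(\<integral>\<omega>. c i \<omega> * c j \<omega> \<partial>P) = v" using ei by (simp add: e_def)
  moreover have "v / (real n - 1) * real n - v / (real n - 1) = v / (real n - 1) * (real n - 1)"
   by (simp only: right_diff_distrib mult_1_right)
  ultimately show ?thesis using True n2 by simp
 next
  case False
  have "(\<Sum>k=1..n. e k) = e i + (\<Sum>k\<in>{1..n} - {i}. e k)" using ij by (intro sum.remove) auto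
  also have "(\<Sum>k\<in>{1..n} - {i}. e k) = (\<Sum>k\<in>{1..n} - {i}. e j)"
   using False ij by (intro sum.cong refl same) auto
  also have "... = (real n - 1) * e j" using ij n2 by (simp add: card_Diff_singleton of_nat_diff)
  finally have "(real n - 1) * e j = - v" using sum0 ei by simp
  then show ?thesis using False n2 by (simp add: e_def field_simps)
 qed
qed

lemma const_C_square:
 assumes n2: "2 <= n" shows "0 <= const_C P n W" "(const_C P n W)\<^sup>2 = (\<integral>\<omega>. (c 1 \<omega>)\<^sup>2 \<partial>P) / (real n - 1) * real n"
proof -
 have v: "0 <= (\<integral>\<omega>. (c 1 \<omega>)\<^sup>2 \<partial>P)" by (intro integral_nonneg_AE) auto
 then show "0 <= const_C P n W" using n2 by (simp add: const_C_def)
 have "0 <= real n / (real n - 1) * (\<integral>\<omega>. (c 1 \<omega>)\<^sup>2 \<partial>P)" using v n2 by simp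
 then show "(const_C P n W)\<^sup>2 = (\<integral>\<omega>. (c 1 \<omega>)\<^sup>2 \<partial>P) / (real n - 1) * real n"
  unfolding const_C_def by (subst real_sqrt_pow2) (auto simp: mult_ac)
qed

text \<open>The mixed moments are negative multiples of the second moment, so the quadratic form is \<open>C\<^sup>2\<close> times the sum of
squares of \<open>x\<close> after centring.\<close>

lemma linear_form_second_moment:
 assumes n2: "2 <= n"
 shows "integrable P (%\<omega>. (\<Sum>i=1..n. c i \<omega> * x i)\<^sup>2)"
  "(\<integral>\<omega>. (\<Sum>i=1..n. c i \<omega> * x i)\<^sup>2 \<partial>P) <= (const_C P n W)\<^sup>2 * (\<Sum>i=1..n. (x i)\<^sup>2)"
proof -
 define d where "d = (\<integral>\<omega>. (c 1 \<omega>)\<^sup>2 \<partial>P) / (real n - 1)"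
 have d: "0 <= d" unfolding d_def using n2 by (intro divide_nonneg_nonneg integral_nonneg_AE) auto
 have eq: "(\<Sum>i=1..n. c i \<omega> * x i)\<^sup>2 = (\<Sum>i=1..n. \<Sum>j=1..n. x i * x j * (c i \<omega> * c j \<omega>))" for \<omega>
  by (simp add: power2_eq_square sum_product mult_ac)
 have int: "integrable P (%\<omega>. x i * x j * (c i \<omega> * c j \<omega>))" if "i \<in> {1..n}" "j \<in> {1..n}" for i j
  using that by (intro integrable_mult_right c_mult_integrable)
 have ints: "integrable P (%\<omega>. \<Sum>j=1..n. x i * x j * (c i \<omega> * c j \<omega>))" if "i \<in> {1..n}" for i
  using that by (intro Bochner_Integration.integrable_sum int)
 show "integrable P (%\<omega>. (\<Sum>i=1..n. c i \<omega> * x i)\<^sup>2)" unfolding eq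
  by (intro Bochner_Integration.integrable_sum ints)
 have "(\<integral>\<omega>. (\<Sum>i=1..n. c i \<omega> * x i)\<^sup>2 \<partial>P) = (\<Sum>i=1..n. \<integral>\<omega>. (\<Sum>j=1..n. x i * x j * (c i \<omega> * c j \<omega>)) \<partial>P)"
  unfolding eq by (intro Bochner_Integration.integral_sum ints)
 also have "... = (\<Sum>i=1..n. \<Sum>j=1..n. x i * x j * (\<integral>\<omega>. c i \<omega> * c j \<omega> \<partial>P))"
 proof (rule sum.cong[OF refl])
  fix i assume i: "i \<in> {1..n}"
  have "(\<integral>\<omega>. (\<Sum>j=1..n. x i * x j * (c i \<omega> * c j \<omega>)) \<partial>P) = (\<Sum>j=1..n. \<integral>\<omega>. x i * x j * (c i \<omega> * c j \<omega>) \<partial>P)"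
   by (intro Bochner_Integration.integral_sum int i)
  then show "(\<integral>\<omega>. (\<Sum>j=1..n. x i * x j * (c i \<omega> * c j \<omega>)) \<partial>P) = (\<Sum>j=1..n. x i * x j * (\<integral>\<omega>. c i \<omega> * c j \<omega> \<partial>P))" by simp
 qed
 also have "... = (\<Sum>i=1..n. \<Sum>j=1..n. x i * x j * (d * (if i = j then real n else 0) - d))"
  by (intro sum.cong refl) (simp add: integral_c_mult[OF n2] d_def)
 also have "... = (\<Sum>i=1..n. d * real n * (x i)\<^sup>2 - d * (x i * (\<Sum>j=1..n. x j)))"
 proof (rule sum.cong[OF refl])
  fix i assume i: "i \<in> {1..n}"
  have "(\<Sum>j=1..n. x i * x j * (d * (if i = j then real n else 0) - d))
   = (\<Sum>j=1..n. (if j = i then d * real n * (x i)\<^sup>2 else 0) - d * x i * x j)"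
   by (intro sum.cong refl) (simp add: power2_eq_square algebra_simps)
  also have "... = d * real n * (x i)\<^sup>2 - d * x i * (\<Sum>j=1..n. x j)"
   using i by (simp add: sum_subtractf sum_distrib_left)
  finally show "(\<Sum>j=1..n. x i * x j * (d * (if i = j then real n else 0) - d)) = d * real n * (x i)\<^sup>2 - d * (x i * (\<Sum>j=1..n. x j))"
   by (simp only: mult.assoc)
 qed
 also have "... = d * real n * (\<Sum>i=1..n. (x i)\<^sup>2) - d * (\<Sum>i=1..n. x i)\<^sup>2"
  by (simp add: sum_subtractf power2_eq_square[of "sum x _"] flip: sum_distrib_left sum_distrib_right)
 also have "... <= d * real n * (\<Sum>i=1..n. (x i)\<^sup>2)" using d by simp
 finally show "(\<integral>\<omega>. (\<Sum>i=1..n. c i \<omega> * x i)\<^sup>2 \<partial>P) <= (const_C P n W)\<^sup>2 * (\<Sum>i=1..n. (x i)\<^sup>2)"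
  unfolding const_C_square(2)[OF n2] d_def .
qed

lemma c_measurable: "i \<in> {1..n} ==> c i \<in> borel_measurable P"
 by (rule borel_measurable_integrable[OF integrable_c])

lemma const_B_eq: "const_B P n W = (\<integral>\<omega>. L2_set (%i. c i \<omega>) {1..n} \<partial>P) / sqrt (real n)"
proof -
 have "sqrt (average n (%i. (c i \<omega>)\<^sup>2)) = L2_set (%i. c i \<omega>) {1..n} / sqrt (real n)" for \<omega>
  by (simp add: average_def L2_set_def real_sqrt_divide)
 then show ?thesis by (simp add: const_B_def)
qed

lemma L2_c_integrable: "integrable P (%\<omega>. L2_set (%i. c i \<omega>) {1..n})"
proof (rule Bochner_Integration.integrable_bound)
 show "integrable P (%\<omega>. \<Sum>i=1..n. \<bar>c i \<omega>\<bar>)"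
  by (intro Bochner_Integration.integrable_sum integrable_abs integrable_c)
 show "(%\<omega>. L2_set (%i. c i \<omega>) {1..n}) \<in> borel_measurable P" unfolding L2_set_def
  by (intro measurable_compose[OF _ borel_measurable_sqrt] borel_measurable_sum borel_measurable_power c_measurable)
 have "norm (L2_set (%i. c i \<omega>) {1..n}) <= norm (\<Sum>i=1..n. \<bar>c i \<omega>\<bar>)" for \<omega>
  using order_trans[OF L2_set_le_sum_abs abs_ge_self] by (simp add: L2_set_nonneg)
 then show "AE \<omega> in P. norm (L2_set (%i. c i \<omega>) {1..n}) <= norm (\<Sum>i=1..n. \<bar>c i \<omega>\<bar>)" by (rule AE_I2)
qed

lemma const_B_pos: "0 < const_B P n W"
proof -
 have "real n * const_A P n W = (\<Sum>i=1..n. \<integral>\<omega>. \<bar>c i \<omega>\<bar> \<partial>P)" using integral_abs_c by simp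
 also have "... = (\<integral>\<omega>. (\<Sum>i=1..n. \<bar>c i \<omega>\<bar>) \<partial>P)" using integrable_c by simp
 also have "... <= (\<integral>\<omega>. L2_set (%i. c i \<omega>) {1..n} * sqrt (real n) \<partial>P)"
 proof (rule integral_mono)
  show "integrable P (%\<omega>. \<Sum>i=1..n. \<bar>c i \<omega>\<bar>)"
   by (intro Bochner_Integration.integrable_sum integrable_abs integrable_c)
  show "integrable P (%\<omega>. L2_set (%i. c i \<omega>) {1..n} * sqrt (real n))"
   by (intro integrable_mult_left L2_c_integrable)
  show "(\<Sum>i=1..n. \<bar>c i \<omega>\<bar>) <= L2_set (%i. c i \<omega>) {1..n} * sqrt (real n)" for \<omega>
   using L2_set_mult_ineq[of "%i. c i \<omega>" "%_. 1" "{1..n}"] by (simp add: L2_set_def)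
 qed
 also have "... = real n * const_B P n W" using n0 by (simp add: const_B_eq real_div_sqrt field_simps)
 finally have "const_A P n W <= const_B P n W" using n0 by simp
 then show ?thesis using const_A_pos by linarith
qed

text \<open>For weights at distance \<open>a\<close> from \<open>x0\<close> this set determines all weights.\<close>

definition minus_set :: "real => 'a => nat set" where
 "minus_set x0 \<omega> = {i\<in>{1..n}. W i \<omega> < x0}"

lemma minus_set_event: "{\<omega>\<in>space P. minus_set x0 \<omega> = S} \<in> events" if "S \<subseteq> {1..n}"
proof -
 have "{\<omega>\<in>space P. minus_set x0 \<omega> = S} = {\<omega>\<in>space P. \<forall>i\<in>{1..n}. (W i \<omega> < x0) = (i \<in> S)}"
  using that by (auto simp: minus_set_def)
 also have "... \<in> events"
 proof (rule sets.sets_Collect_finite_All)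
  fix i assume "i \<in> {1..n}"
  then have [measurable]: "W i \<in> borel_measurable P" by (rule W)
  show "{\<omega>\<in>space P. (W i \<omega> < x0) = (i \<in> S)} \<in> events" by measurable
 qed simp
 finally show ?thesis .
qed

lemma integral_minus_set:
 fixes g :: "nat set => real"
 shows "(\<integral>\<omega>. g (minus_set x0 \<omega>) \<partial>P) = (\<Sum>S\<in>Pow {1..n}. prob {\<omega>\<in>space P. minus_set x0 \<omega> = S} * g S)"
proof -
 have "(\<integral>\<omega>. g (minus_set x0 \<omega>) \<partial>P) = (\<integral>\<omega>. (\<Sum>S\<in>Pow {1..n}. g S * indicator {\<omega>\<in>space P. minus_set x0 \<omega> = S} \<omega>) \<partial>P)"
 proof (rule Bochner_Integration.integral_cong[OF refl])
  fix \<omega> assume "\<omega> \<in> space P"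
  then have "(\<Sum>S\<in>Pow {1..n}. g S * indicator {\<omega>\<in>space P. minus_set x0 \<omega> = S} \<omega>) = (\<Sum>S\<in>Pow {1..n}. if S = minus_set x0 \<omega> then g S else 0)"
   by (intro sum.cong refl) (auto simp: indicator_def)
  also have "... = g (minus_set x0 \<omega>)" by (subst sum.delta) (auto simp: minus_set_def)
  finally show "g (minus_set x0 \<omega>) = (\<Sum>S\<in>Pow {1..n}. g S * indicator {\<omega>\<in>space P. minus_set x0 \<omega> = S} \<omega>)" by simp
 qed
 also have "... = (\<Sum>S\<in>Pow {1..n}. \<integral>\<omega>. g S * indicator {\<omega>\<in>space P. minus_set x0 \<omega> = S} \<omega> \<partial>P)"
  using minus_set_event[of _ x0] by (intro Bochner_Integration.integral_sum) (auto simp: emeasure_eq_measure)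
 also have "... = (\<Sum>S\<in>Pow {1..n}. prob {\<omega>\<in>space P. minus_set x0 \<omega> = S} * g S)"
  by (intro sum.cong refl) (simp add: mult.commute Int_absorb2 minus_set_event)
 finally show ?thesis .
qed

text \<open>Given its cardinality, the set of low weights is uniformly distributed.\<close>

lemma prob_minus_set_eq:
 assumes S: "S \<subseteq> {1..n}" "T \<subseteq> {1..n}" "card S = card T"
 shows "prob {\<omega>\<in>space P. minus_set x0 \<omega> = S} = prob {\<omega>\<in>space P. minus_set x0 \<omega> = T}"
proof -
 have "card ({1..n} - S) = card ({1..n} - T)"
  using S by (simp add: card_Diff_subset finite_subset[OF _ finite_atLeastAtMost])
 then have "image_mset (%i. i \<in> S) (mset_set {1..n}) = image_mset (%i. i \<in> T) (mset_set {1..n})"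
 proof -
  have "count (image_mset (%i. i \<in> S) (mset_set {1..n})) b = count (image_mset (%i. i \<in> T) (mset_set {1..n})) b" for b
  proof -
   have "(\<Sum>x | x \<in># mset_set {1..n} \<and> b = (x \<in> X). count (mset_set {1..n}) x) = card (if b then X else {1..n} - X)"
    if "X \<subseteq> {1..n}" for X
   proof -
    have "{x. x \<in># mset_set {1..n} \<and> b = (x \<in> X)} = (if b then X else {1..n} - X)" using that by auto
    moreover have "(\<Sum>x\<in>(if b then X else {1..n} - X). count (mset_set {1..n}) x) = (\<Sum>x\<in>(if b then X else {1..n} - X). 1)"
     by (intro sum.cong refl count_mset_set(1)) (use that in \<open>auto split: if_splits\<close>)
    ultimately show ?thesis by simp
   qed
   from this[OF S(1)] this[OF S(2)] show ?thesis
    using S(3) \<open>card ({1..n} - S) = card ({1..n} - T)\<close> unfolding count_image_mset' by simp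
  qed
  then show ?thesis by (rule multiset_eqI)
 qed
 then obtain \<pi> where \<pi>: "\<pi> permutes {1..n}" "\<forall>i\<in>{1..n}. (i \<in> S) = (\<pi> i \<in> T)"
  by (rule image_mset_eq_implies_permutes[OF finite_atLeastAtMost]) 
 let ?h = "%x. indicator {x. {i\<in>{1..n}. x i < x0} = S} x :: real"
 have "?h \<in> borel_measurable (\<Pi>\<^sub>M i\<in>{1..n}. borel)"
 proof -
  have eq: "?h = (%x. \<Prod>i=1..n. if (x i < x0) = (i \<in> S) then 1 else 0)"
   using S by (intro ext) (auto simp: indicator_def prod_zero_iff)
  have "(%x. if (x i < x0) = (i \<in> S) then 1 else 0 :: real) \<in> borel_measurable (\<Pi>\<^sub>M i\<in>{1..n}. borel)" if "i \<in> {1..n}" for i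
  proof -
   have [measurable]: "(%x. x i) \<in> borel_measurable (\<Pi>\<^sub>M i\<in>{1..n}. (borel :: real measure))"
    using that by (rule measurable_component_singleton)
   show ?thesis by measurable
  qed
  then show ?thesis unfolding eq by (intro borel_measurable_prod) auto
 qed
 from exchange[OF \<pi>(1) this]
 have "(\<integral>\<omega>. ?h (\<lambda>i\<in>{1..n}. W (\<pi> i) \<omega>) \<partial>P) = (\<integral>\<omega>. ?h (\<lambda>i\<in>{1..n}. W i \<omega>) \<partial>P)" .
 also have "(\<integral>\<omega>. ?h (\<lambda>i\<in>{1..n}. W i \<omega>) \<partial>P) = (\<integral>\<omega>. indicator {\<omega>\<in>space P. minus_set x0 \<omega> = S} \<omega> \<partial>P)"
  by (intro Bochner_Integration.integral_cong refl) (auto simp: indicator_def minus_set_def)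
 also have "(\<integral>\<omega>. ?h (\<lambda>i\<in>{1..n}. W (\<pi> i) \<omega>) \<partial>P) = (\<integral>\<omega>. indicator {\<omega>\<in>space P. minus_set x0 \<omega> = T} \<omega> \<partial>P)"
 proof (intro Bochner_Integration.integral_cong refl)
  fix \<omega> assume "\<omega> \<in> space P"
  have "{i\<in>{1..n}. W (\<pi> i) \<omega> < x0} = S \<longleftrightarrow> minus_set x0 \<omega> = T"
  proof -
   have "{i\<in>{1..n}. W (\<pi> i) \<omega> < x0} = S \<longleftrightarrow> (\<forall>i\<in>{1..n}. W (\<pi> i) \<omega> < x0 \<longleftrightarrow> i \<in> S)" using S by blast
   also have "... \<longleftrightarrow> (\<forall>i\<in>{1..n}. W (\<pi> i) \<omega> < x0 \<longleftrightarrow> \<pi> i \<in> T)" using \<pi>(2) by blast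
   also have "... \<longleftrightarrow> (\<forall>i\<in>\<pi> ` {1..n}. W i \<omega> < x0 \<longleftrightarrow> i \<in> T)" by blast
   also have "... \<longleftrightarrow> minus_set x0 \<omega> = T" unfolding permutes_image[OF \<pi>(1)] minus_set_def using S by blast
   finally show ?thesis .
  qed
  moreover have "{i\<in>{1..n}. (\<lambda>i\<in>{1..n}. W (\<pi> i) \<omega>) i < x0} = {i\<in>{1..n}. W (\<pi> i) \<omega> < x0}" by auto
  ultimately show "?h (\<lambda>i\<in>{1..n}. W (\<pi> i) \<omega>) = indicator {\<omega>\<in>space P. minus_set x0 \<omega> = T} \<omega>"
   using \<open>\<omega> \<in> space P\<close> by (simp add: indicator_def)
 qed
 finally show ?thesis using minus_set_event S by (simp add: Int_absorb2)
qed

end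

section \<open>Symmetric bounded samples\<close>

lemma lp_exponent: "1 <= p ==> p \<noteq> \<infinity> ==> 1 <= real_of_ereal p"
 by (cases p) (auto simp: one_ereal_def)

lemma infnorm_cart_mono:
 fixes x y :: "real ^ 'k"
 assumes "!!k. \<bar>x $ k\<bar> <= \<bar>y $ k\<bar>" shows "infnorm x <= infnorm y"
proof -
 have "\<bar>x $ k\<bar> <= infnorm y" for k using component_le_infnorm_cart[of y k] assms[of k] by linarith
 then show ?thesis unfolding infnorm_cart[of x] by (intro cSup_least) auto
qed

lemma lp_norm_mono:
 fixes x y :: "real ^ 'k"
 assumes p: "1 <= p" and le: "!!k. \<bar>x $ k\<bar> <= \<bar>y $ k\<bar>"
 shows "lp_norm p x <= lp_norm p y"
proof (cases "p = \<infinity>")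
 case True
 then show ?thesis using infnorm_cart_mono[OF le] by (simp add: lp_norm_def)
next
 case False
 have r: "1 <= real_of_ereal p" by (rule lp_exponent[OF p False])
 show ?thesis unfolding lp_norm_def using False r le
  by (auto intro!: powr_mono2 sum_mono sum_nonneg)
qed

lemma lp_norm_scale:
 fixes x :: "real ^ 'k"
 assumes p: "1 <= p" shows "lp_norm p (c *\<^sub>R x) = \<bar>c\<bar> * lp_norm p x"
proof (cases "p = \<infinity>")
 case True
 then show ?thesis by (simp add: lp_norm_def infnorm_mul)
next
 case False
 define r where "r = real_of_ereal p"
 have r: "1 <= r" unfolding r_def by (rule lp_exponent[OF p False])
 have "(\<Sum>k\<in>UNIV. \<bar>(c *\<^sub>R x) $ k\<bar> powr r) = \<bar>c\<bar> powr r * (\<Sum>k\<in>UNIV. \<bar>x $ k\<bar> powr r)"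
  by (simp add: abs_mult powr_mult sum_distrib_left)
 then have "(\<Sum>k\<in>UNIV. \<bar>(c *\<^sub>R x) $ k\<bar> powr r) powr (1 / r) = (\<bar>c\<bar> powr r) powr (1 / r) * (\<Sum>k\<in>UNIV. \<bar>x $ k\<bar> powr r) powr (1 / r)"
  by (simp add: powr_mult sum_nonneg)
 also have "(\<bar>c\<bar> powr r) powr (1 / r) = \<bar>c\<bar>" using r by (simp add: powr_powr)
 finally show ?thesis using False by (simp add: lp_norm_def r_def)
qed

lemma lp_norm_uminus: "1 <= p ==> lp_norm p (- x) = lp_norm p x"
 using lp_norm_scale[of p "- 1" x] by simp

lemma lp_norm_ge_component:
 fixes x :: "real ^ 'k"
 assumes p: "1 <= p" shows "\<bar>x $ k\<bar> <= lp_norm p x"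
proof (cases "p = \<infinity>")
 case True
 then show ?thesis by (simp add: lp_norm_def component_le_infnorm_cart)
next
 case False
 define r where "r = real_of_ereal p"
 have r: "1 <= r" unfolding r_def by (rule lp_exponent[OF p False])
 have "\<bar>x $ k\<bar> = (\<bar>x $ k\<bar> powr r) powr (1 / r)" using r by (simp add: powr_powr)
 also have "... <= (\<Sum>k\<in>UNIV. \<bar>x $ k\<bar> powr r) powr (1 / r)"
  using r by (intro powr_mono2 member_le_sum) auto
 finally show ?thesis using False by (simp add: lp_norm_def r_def)
qed

lemma lp_norm_nonneg: "1 <= p ==> 0 <= lp_norm p x"
 using lp_norm_ge_component[of p x] abs_ge_zero order_trans by blast

lemma lp_norm_le_norm:
 fixes x :: "real ^ 'k"
 assumes p: "1 <= p" shows "lp_norm p x <= CARD('k) * norm x"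
proof (cases "p = \<infinity>")
 case True
 have "infnorm x <= 1 * norm x" using infnorm_le_norm[of x] by simp
 also have "... <= CARD('k) * norm x" by (intro mult_right_mono) (simp_all add: Suc_leI zero_less_card_finite)
 finally show ?thesis using True by (simp add: lp_norm_def)
next
 case False
 define r where "r = real_of_ereal p"
 have r: "1 <= r" unfolding r_def by (rule lp_exponent[OF p False])
 have "(\<Sum>k\<in>UNIV. \<bar>x $ k\<bar> powr r) <= (\<Sum>k\<in>(UNIV::'k set). norm x powr r)"
  using r by (intro sum_mono powr_mono2) (auto simp: component_le_norm_cart)
 also have "... = CARD('k) * norm x powr r" by simp
 finally have "(\<Sum>k\<in>UNIV. \<bar>x $ k\<bar> powr r) powr (1 / r) <= (CARD('k) * norm x powr r) powr (1 / r)"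
  using r by (intro powr_mono2 sum_nonneg) auto
 also have "... = CARD('k) powr (1 / r) * norm x" using r by (simp add: powr_mult powr_powr)
 also have "... <= CARD('k) powr 1 * norm x" using r by (intro mult_right_mono powr_mono) (auto simp: Suc_leI zero_less_card_finite)
 finally show ?thesis using False by (simp add: lp_norm_def r_def)
qed

locale sublinear_functional =
 fixes phi :: "real ^ 'k => real" and p :: ereal
 assumes p: "1 <= p" and subadd: "!!u v. phi (u + v) <= phi u + phi v"
  and homog: "!!c u. 0 <= c ==> phi (c *\<^sub>R u) = c * phi u"
  and lp: "!!u. \<bar>phi u\<bar> <= lp_norm p u"
begin

lemma phi_diff: "\<bar>phi u - phi v\<bar> <= lp_norm p (u - v)"
proof -
 have *: "phi u - phi v <= lp_norm p (u - v)" for u v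
  using subadd[of "u - v" v] lp[of "u - v"] by simp
 show ?thesis using *[of u v] *[of v u] lp_norm_uminus[OF p, of "u - v"] by simp
qed

lemma phi_measurable [measurable]: "phi \<in> borel_measurable borel"
proof (rule borel_measurable_continuous_onI)
 have "CARD('k)-lipschitz_on UNIV phi"
  using phi_diff lp_norm_le_norm[OF p]
  by (intro lipschitz_onI) (auto simp: dist_norm intro: order_trans)
 then show "continuous_on UNIV phi" by (rule lipschitz_on_continuous_on)
qed

text \<open>Measurability in the sample of an integral over the weights, by Fubini's theorem.\<close>

lemma resampled_expectation_measurable:
 fixes P :: "'a measure"
 assumes P: "prob_space P" and c: "!!i. i \<in> {1..n} ==> centred n W i \<in> borel_measurable P"
 shows "(%y. resampled_expectation P n phi W y) \<in> borel_measurable (PiM {1..n} (%_. borel))"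
proof -
 interpret prob_space P by fact
 have "(%(y, \<omega>). phi (weighted_average n (%i. centred n W i \<omega>) y)) \<in> borel_measurable (PiM {1..n} (%_. borel) \<Otimes>\<^sub>M P)"
 proof -
  have "(%yw. centred n W i (snd yw)) \<in> borel_measurable (PiM {1..n} (%_. borel :: (real ^ 'k) measure) \<Otimes>\<^sub>M P)" if "i \<in> {1..n}" for i
   by (rule measurable_compose[OF measurable_snd c[OF that]])
  note m1 = this
  have m2: "(%yw. fst yw i) \<in> borel_measurable (PiM {1..n} (%_. borel :: (real ^ 'k) measure) \<Otimes>\<^sub>M P)" if "i \<in> {1..n}" for i
   by (rule measurable_compose[OF measurable_fst measurable_component_singleton[OF that]])
  have "(%yw. weighted_average n (%i. centred n W i (snd yw)) (fst yw :: nat => real ^ 'k)) \<in> borel_measurable (PiM {1..n} (%_. borel) \<Otimes>\<^sub>M P)"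
   unfolding weighted_average_def
  proof (rule borel_measurable_scaleR[OF borel_measurable_const], rule borel_measurable_sum)
   fix i assume "i \<in> {1..n}"
   then show "(%yw. centred n W i (snd yw) *\<^sub>R (fst yw :: nat => real ^ 'k) i) \<in> borel_measurable (PiM {1..n} (%_. borel) \<Otimes>\<^sub>M P)"
    using borel_measurable_scaleR[OF m1 m2] by blast
  qed
  from measurable_compose[OF this phi_measurable] show ?thesis by (simp add: case_prod_unfold)
 qed
 then show ?thesis unfolding resampled_expectation_def by (rule borel_measurable_lebesgue_integral)
qed

lemma average_measurable: "(%y. phi (average n y)) \<in> borel_measurable (PiM {1..n} (%_. borel))"
 unfolding average_def
 by (intro measurable_compose[OF _ phi_measurable] borel_measurable_scaleR borel_measurable_const borel_measurable_sum
   measurable_component_singleton)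

end

text \<open>Sign changes do not affect the joint law of the sample, so its exponential moment is the expectation of the moment over all
sign patterns, which is bounded for every realisation in \<open>good\<close>; Markov's inequality is then applied at the optimal exponent.\<close>

lemma symmetric_sample_deviation:
 fixes X :: "nat => 'a => real ^ 'k" and F :: "(nat => real ^ 'k) => real"
 assumes P: "prob_space P" and ind: "prob_space.indep_vars P (%_. borel) X {1..n}" and n0: "0 < n"
  and sym: "!!i. i \<in> {1..n} ==> distr P borel (X i) = distr P borel (%\<omega>. - X i \<omega>)"
  and F: "F \<in> borel_measurable (PiM {1..n} (%_. borel))"
  and good: "!!i. i \<in> {1..n} ==> AE \<omega> in P. good (X i \<omega>)"
  and cube: "!!y lam. (!!i. i \<in> {1..n} ==> good (y i)) ==> 0 <= lam ==>
   (\<Sum>A\<in>Pow {1..n}. exp (lam * F (\<lambda>i\<in>{1..n}. sv A i *\<^sub>R y i))) <= 2 ^ n * exp (v * lam\<^sup>2 / 2)"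
  and v: "0 < v" and \<alpha>: "0 < \<alpha>" "\<alpha> < 1"
 shows "measure P {\<omega>\<in>space P. F (\<lambda>i\<in>{1..n}. X i \<omega>) < sqrt (2 * v * ln (1 / \<alpha>))} >= 1 - \<alpha>"
proof -
 interpret prob_space P by fact
 let ?I = "{1..n}" and ?B = "PiM {1..n} (%_. borel :: (real ^ 'k) measure)"
 have I0: "?I \<noteq> {}" using n0 by auto
 have Xm: "X i \<in> borel_measurable P" if "i \<in> ?I" for i using ind that by (auto simp: indep_vars_def)
 have svm: "(%x :: real ^ 'k. sv A i *\<^sub>R x) \<in> borel_measurable borel" for A i by measurable
 have XA: "(%\<omega>. \<lambda>i\<in>?I. sv A i *\<^sub>R X i \<omega>) \<in> measurable P ?B" for A
  using Xm by (intro measurable_restrict borel_measurable_scaleR) auto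
 have X1: "(%\<omega>. \<lambda>i\<in>?I. X i \<omega>) \<in> measurable P ?B" using Xm by (intro measurable_restrict)
 \<comment> \<open>changing signs does not change the joint law\<close>
 have law: "distr P ?B (%\<omega>. \<lambda>i\<in>?I. sv A i *\<^sub>R X i \<omega>) = distr P ?B (%\<omega>. \<lambda>i\<in>?I. X i \<omega>)" for A
 proof -
  have "indep_vars (%_. borel) (%i \<omega>. sv A i *\<^sub>R X i \<omega>) ?I"
   by (rule indep_vars_compose2[OF ind svm])
  then have "distr P ?B (%\<omega>. \<lambda>i\<in>?I. sv A i *\<^sub>R X i \<omega>) = PiM ?I (%i. distr P borel (%\<omega>. sv A i *\<^sub>R X i \<omega>))"
   using Xm by (subst indep_vars_iff_distr_eq_PiM'[OF I0, symmetric]) auto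
  also have "... = PiM ?I (%i. distr P borel (X i))"
   using sym by (intro PiM_cong refl) (auto simp: sv_def)
  also have "PiM ?I (%i. distr P borel (X i)) = distr P ?B (%\<omega>. \<lambda>i\<in>?I. X i \<omega>)"
  proof (rule HOL.sym)
   show "distr P ?B (%\<omega>. \<lambda>i\<in>?I. X i \<omega>) = PiM ?I (%i. distr P borel (X i))"
    using ind Xm by (subst indep_vars_iff_distr_eq_PiM'[OF I0, symmetric]) auto
  qed
  finally show ?thesis .
 qed
 define t where "t = sqrt (2 * v * ln (1 / \<alpha>))"
 have ln0: "0 < ln (1 / \<alpha>)" using \<alpha> by simp
 have t: "0 <= t" "t\<^sup>2 = 2 * v * ln (1 / \<alpha>)" using v ln0 by (auto simp: t_def)
 \<comment> \<open>the minimiser of \<open>v * lam\<^sup>2 / 2 - lam * t\<close>\<close>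
 define lam where "lam = t / v"
 have lam: "0 <= lam" using t v by (simp add: lam_def)
 define H where "H = (%y. ennreal (exp (lam * F y)))"
 have H: "H \<in> borel_measurable ?B" unfolding H_def using F by measurable
 have goodAE: "AE \<omega> in P. \<forall>i\<in>?I. good (X i \<omega>)" using good by (simp add: AE_finite_all)
 have "2 ^ n * (\<integral>\<^sup>+\<omega>. H (\<lambda>i\<in>?I. X i \<omega>) \<partial>P) = (\<Sum>A\<in>Pow ?I. \<integral>\<^sup>+\<omega>. H (\<lambda>i\<in>?I. X i \<omega>) \<partial>P)"
  by (simp add: card_Pow)
 also have "... = (\<Sum>A\<in>Pow ?I. \<integral>\<^sup>+\<omega>. H (\<lambda>i\<in>?I. sv A i *\<^sub>R X i \<omega>) \<partial>P)"
 proof (rule sum.cong[OF refl])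
  fix A
  show "(\<integral>\<^sup>+\<omega>. H (\<lambda>i\<in>?I. X i \<omega>) \<partial>P) = (\<integral>\<^sup>+\<omega>. H (\<lambda>i\<in>?I. sv A i *\<^sub>R X i \<omega>) \<partial>P)"
   using nn_integral_distr[OF XA[of A], of H] nn_integral_distr[OF X1, of H] H law[of A] by simp
 qed
 also have "... = (\<integral>\<^sup>+\<omega>. (\<Sum>A\<in>Pow ?I. H (\<lambda>i\<in>?I. sv A i *\<^sub>R X i \<omega>)) \<partial>P)"
  using measurable_compose[OF XA H] by (intro nn_integral_sum[symmetric])
 also have "... <= (\<integral>\<^sup>+\<omega>. ennreal (2 ^ n * exp (v * lam\<^sup>2 / 2)) \<partial>P)"
 proof (rule nn_integral_mono_AE)
  show "AE \<omega> in P. (\<Sum>A\<in>Pow ?I. H (\<lambda>i\<in>?I. sv A i *\<^sub>R X i \<omega>)) <= ennreal (2 ^ n * exp (v * lam\<^sup>2 / 2))"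
   using goodAE
  proof eventually_elim
   case (elim \<omega>)
   have "(\<Sum>A\<in>Pow ?I. H (\<lambda>i\<in>?I. sv A i *\<^sub>R X i \<omega>)) = ennreal (\<Sum>A\<in>Pow ?I. exp (lam * F (\<lambda>i\<in>?I. sv A i *\<^sub>R X i \<omega>)))"
    unfolding H_def by (rule sum_ennreal) simp
   also have "... <= ennreal (2 ^ n * exp (v * lam\<^sup>2 / 2))"
    using cube[of "%i. X i \<omega>" lam] elim lam by (intro ennreal_leI) auto
   finally show ?case .
  qed
 qed
 also have "... = 2 ^ n * ennreal (exp (v * lam\<^sup>2 / 2))"
  by (simp add: emeasure_space_1 ennreal_mult ennreal_power[symmetric])
 finally have moment: "(\<integral>\<^sup>+\<omega>. H (\<lambda>i\<in>?I. X i \<omega>) \<partial>P) <= ennreal (exp (v * lam\<^sup>2 / 2))"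
  by (subst (asm) ennreal_mult_le_mult_iff) (auto simp: power_eq_top_ennreal)
 have FX: "(%\<omega>. F (\<lambda>i\<in>?I. X i \<omega>)) \<in> borel_measurable P" by (rule measurable_compose[OF X1 F])
 have ev: "{\<omega>\<in>space P. t <= F (\<lambda>i\<in>?I. X i \<omega>)} \<in> events" using FX by measurable
 have "emeasure P {\<omega>\<in>space P. t <= F (\<lambda>i\<in>?I. X i \<omega>)} = (\<integral>\<^sup>+\<omega>. indicator {\<omega>\<in>space P. t <= F (\<lambda>i\<in>?I. X i \<omega>)} \<omega> \<partial>P)"
  using ev by simp
 also have "... <= (\<integral>\<^sup>+\<omega>. ennreal (exp (- lam * t)) * H (\<lambda>i\<in>?I. X i \<omega>) \<partial>P)"
 proof (rule nn_integral_mono)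
  fix \<omega>
  show "indicator {\<omega>\<in>space P. t <= F (\<lambda>i\<in>?I. X i \<omega>)} \<omega> <= ennreal (exp (- lam * t)) * H (\<lambda>i\<in>?I. X i \<omega>)"
  proof (cases "t <= F (\<lambda>i\<in>?I. X i \<omega>)")
   case True
   then have "1 <= exp (- lam * t) * exp (lam * F (\<lambda>i\<in>?I. X i \<omega>))"
    using lam by (simp add: exp_add[symmetric] mult_left_mono)
   then have "ennreal 1 <= ennreal (exp (- lam * t) * exp (lam * F (\<lambda>i\<in>?I. X i \<omega>)))" by (rule ennreal_leI)
   then show ?thesis by (simp add: H_def ennreal_mult indicator_def)
  qed simp
 qed
 also have "... = ennreal (exp (- lam * t)) * (\<integral>\<^sup>+\<omega>. H (\<lambda>i\<in>?I. X i \<omega>) \<partial>P)"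
  by (rule nn_integral_cmult) (rule measurable_compose[OF X1 H])
 also have "... <= ennreal (exp (- lam * t)) * ennreal (exp (v * lam\<^sup>2 / 2))"
  by (intro mult_left_mono moment) simp
 also have "... = ennreal (exp (- lam * t + v * lam\<^sup>2 / 2))"
  by (subst exp_add, subst ennreal_mult) auto
 also have "- lam * t + v * lam\<^sup>2 / 2 = - (t\<^sup>2 / (2 * v))" using v by (simp add: lam_def power2_eq_square field_simps)
 also have "... = ln \<alpha>" using v \<alpha> by (simp add: t(2) ln_div)
 also have "exp (ln \<alpha>) = \<alpha>" using \<alpha> by simp
 finally have "prob {\<omega>\<in>space P. t <= F (\<lambda>i\<in>?I. X i \<omega>)} <= \<alpha>"
  unfolding emeasure_eq_measure using \<alpha> by (subst (asm) ennreal_le_iff) auto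
 moreover have "{\<omega>\<in>space P. F (\<lambda>i\<in>?I. X i \<omega>) < t} = space P - {\<omega>\<in>space P. t <= F (\<lambda>i\<in>?I. X i \<omega>)}" by auto
 ultimately show ?thesis using prob_compl[OF ev] by (simp add: t_def)
qed

lemma weighted_average_shift:
 assumes "(\<Sum>i=1..n. w i) = 0"
 shows "weighted_average n w (%i. y i - m) = weighted_average n w y"
 using assms by (simp add: weighted_average_def scaleR_diff_right sum_subtractf flip: scaleR_sum_left)

lemma average_shift: "0 < n ==> average n (%i. y i - m) = average n y - m"
 by (simp add: average_def scaleR_diff_right sum_subtractf sum_constant_scaleR)

lemma weighted_average_cong: "(!!i. i \<in> {1..n} ==> y i = z i) ==> weighted_average n w y = weighted_average n w z"
 by (simp add: weighted_average_def)

locale resampling_setting = exchangeable_weights P n W + sublinear_functional phi p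
 for P :: "'a measure" and n W and phi :: "real ^ 'k => real" and p
begin

abbreviation "RE y \<equiv> resampled_expectation P n phi W y"

lemma RE_shift: "RE (\<lambda>i\<in>{1..n}. y i - m) = RE y"
proof -
 have "weighted_average n (%i. c i w) (\<lambda>i\<in>{1..n}. y i - m) = weighted_average n (%i. c i w) y" for w
  using weighted_average_cong[of n "\<lambda>i\<in>{1..n}. y i - m" "%i. y i - m"] weighted_average_shift[OF sum_c] by simp
 then show ?thesis by (simp add: resampled_expectation_def)
qed

lemma avg_shift: "average n (\<lambda>i\<in>{1..n}. y i - m) = average n y - m"
 using average_cong[of "\<lambda>i\<in>{1..n}. y i - m" "%i. y i - m"] average_shift[OF n0] by simp

end

locale symmetric_setting = resampling_setting P n W phi p
 for P :: "'a measure" and n W and phi :: "real ^ 'k => real" and p +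
 fixes Y :: "nat => 'a => real ^ 'k" and \<mu> :: "real ^ 'k" and M \<alpha> :: real
 assumes ind: "indep_vars (%_. borel) Y {1..n}"
  and sym: "!!i. i \<in> {1..n} ==> distr P borel (%\<omega>. Y i \<omega> - \<mu>) = distr P borel (%\<omega>. \<mu> - Y i \<omega>)"
  and bound: "!!i. i \<in> {1..n} ==> AE \<omega> in P. lp_norm p (Y i \<omega> - \<mu>) <= M"
  and M: "0 < M" and \<alpha>: "0 < \<alpha>" "\<alpha> < 1"
begin

lemma deviation:
 assumes F: "F \<in> borel_measurable (PiM {1..n} (%_. borel))" and v: "0 < v"
  and cube: "!!y lam. (!!i. i \<in> {1..n} ==> lp_norm p (y i) <= M) ==> 0 <= lam ==>
   (\<Sum>A\<in>Pow {1..n}. exp (lam * F (\<lambda>i\<in>{1..n}. sv A i *\<^sub>R y i))) <= 2 ^ n * exp (v * lam\<^sup>2 / 2)"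
 shows "prob {\<omega>\<in>space P. F (\<lambda>i\<in>{1..n}. Y i \<omega> - \<mu>) < sqrt (2 * v * ln (1 / \<alpha>))} >= 1 - \<alpha>"
proof (rule symmetric_sample_deviation[where good = "%u. lp_norm p u <= M"])
 show "indep_vars (%_. borel) (%i \<omega>. Y i \<omega> - \<mu>) {1..n}"
  by (rule indep_vars_compose2[OF ind]) simp
 show "distr P borel (%\<omega>. Y i \<omega> - \<mu>) = distr P borel (%\<omega>. - (Y i \<omega> - \<mu>))" if "i \<in> {1..n}" for i
  using sym[OF that] by simp
next
 fix y :: "nat => real ^ 'k" and lam :: real
 assume "!!i. i \<in> {1..n} ==> lp_norm p (y i) <= M" "0 <= lam"
 then show "(\<Sum>A\<in>Pow {1..n}. exp (lam * F (\<lambda>i\<in>{1..n}. sv A i *\<^sub>R y i))) <= 2 ^ n * exp (v * lam\<^sup>2 / 2)"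
  by (rule cube)
qed (use F v \<alpha> bound n0 prob_space_axioms in auto)

lemma form_of_sample:
 assumes y: "!!i. i \<in> {1..n} ==> lp_norm p (y i) <= M"
 shows "sublinear_form phi y n M"
  "phi (average n (\<lambda>i\<in>{1..n}. sv A i *\<^sub>R y i)) = sublinear_form.form phi y n (sv A)"
  "RE (\<lambda>i\<in>{1..n}. sv A i *\<^sub>R y i) = (\<integral>\<omega>. sublinear_form.form phi y n (%i. c i \<omega> * sv A i) \<partial>P)"
proof -
 show sl: "sublinear_form phi y n M"
 proof
  fix i assume i: "i \<in> {1..n}"
  show "\<bar>phi (y i)\<bar> <= M" "\<bar>phi (- y i)\<bar> <= M"
   using lp[of "y i"] lp[of "- y i"] y[OF i] by (auto simp: lp_norm_uminus[OF p])
 qed (use subadd homog n0 in auto)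
 interpret sublinear_form phi y n M by (rule sl)
 show "phi (average n (\<lambda>i\<in>{1..n}. sv A i *\<^sub>R y i)) = form (sv A)"
  by (simp add: form_def average_def weighted_average_def)
 show "RE (\<lambda>i\<in>{1..n}. sv A i *\<^sub>R y i) = (\<integral>\<omega>. form (%i. c i \<omega> * sv A i) \<partial>P)"
  by (simp add: form_def resampled_expectation_def weighted_average_def)
qed

text \<open>The hypothesis of Jensen type in \<open>centred_weights_exp_moment\<close> is supplied by exchangeability.\<close>

theorem upper_deviation:
 "prob {\<omega>\<in>space P. phi (average n (%i. Y i \<omega>) - \<mu>)
   < RE (%i. Y i \<omega>) / const_A P n W + 2 * M / sqrt (real n) * sqrt (ln (1 / \<alpha>))} >= 1 - \<alpha>"
proof -
 define F where "F = (%y. phi (average n y) - RE y / const_A P n W)"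
 define v where "v = 2 * M\<^sup>2 / n"
 have "prob {\<omega>\<in>space P. F (\<lambda>i\<in>{1..n}. Y i \<omega> - \<mu>) < sqrt (2 * v * ln (1 / \<alpha>))} >= 1 - \<alpha>"
 proof (rule deviation)
  show "F \<in> borel_measurable (PiM {1..n} (%_. borel))" unfolding F_def
   by (intro borel_measurable_diff borel_measurable_divide borel_measurable_const average_measurable
     resampled_expectation_measurable prob_space_axioms c_measurable)
  show "0 < v" using M n0 by (simp add: v_def)
  fix y :: "nat => real ^ 'k" and lam :: real assume y: "!!i. i \<in> {1..n} ==> lp_norm p (y i) <= M" and lam: "0 <= lam"
  interpret sf: sublinear_form phi y n M by (rule form_of_sample[OF y])
  have fs: "phi (average n (\<lambda>i\<in>{1..n}. sv A i *\<^sub>R y i)) = sf.form (sv A)"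
   "RE (\<lambda>i\<in>{1..n}. sv A i *\<^sub>R y i) = (\<integral>\<omega>. sf.form (%i. c i \<omega> * sv A i) \<partial>P)" for A
   by (rule form_of_sample(2)[OF y], assumption) (rule form_of_sample(3)[OF y], assumption)
  show "(\<Sum>A\<in>Pow {1..n}. exp (lam * F (\<lambda>i\<in>{1..n}. sv A i *\<^sub>R y i))) <= 2 ^ n * exp (v * lam\<^sup>2 / 2)"
   using sf.centred_weights_exp_moment[OF prob_space_axioms integrable_c integral_c integral_abs_c const_A_pos
     abs_c_jensen[OF sf.sublinear_form_axioms] lam]
   unfolding F_def fs v_def by (simp add: mult_ac)
 qed
 moreover have "sqrt (2 * v * ln (1 / \<alpha>)) = 2 * M / sqrt (real n) * sqrt (ln (1 / \<alpha>))"
 proof -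
  have "2 * v * ln (1 / \<alpha>) = (2 * M)\<^sup>2 / n * ln (1 / \<alpha>)" by (simp add: v_def power2_eq_square)
  then show ?thesis using M by (simp add: real_sqrt_mult real_sqrt_divide)
 qed
 ultimately show ?thesis unfolding F_def RE_shift avg_shift by (simp add: algebra_simps)
qed

text \<open>Conditionally on their number, the low weights occupy a uniformly random set. This writes the resampled expectation as a mixture
of sign averages, and \<open>A / D\<close> as the mean in \<open>sign_weights_exp_moment\<close>.\<close>

theorem lower_deviation:
 assumes a: "0 < a" and W2v: "!!i. i \<in> {1..n} ==> AE \<omega> in P. \<bar>W i \<omega> - x0\<bar> = a"
 shows "prob {\<omega>\<in>space P. phi (average n (%i. Y i \<omega>) - \<mu>)
   > RE (%i. Y i \<omega>) / const_D P n W a x0 - M / sqrt (real n) * sqrt (1 + (const_A P n W)\<^sup>2 / (const_D P n W a x0)\<^sup>2)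
    * sqrt (2 * ln (1 / \<alpha>))} >= 1 - \<alpha>"
proof -
 let ?I = "{1..n}"
 define N where "N = minus_set x0"
 define \<tau> where "\<tau> = (%s. (real n - 2 * real s) / real n)"
 define pr where "pr = (%S. prob {\<omega>\<in>space P. N \<omega> = S})"
 define ps where "ps = (%s. \<Sum>S | S \<subseteq> ?I \<and> card S = s. pr S)"
 have Nsub: "N \<omega> \<subseteq> ?I" for \<omega> by (auto simp: N_def minus_set_def)
 have twoval: "AE \<omega> in P. \<forall>i\<in>?I. W i \<omega> - x0 = a * sv (N \<omega>) i"
 proof -
  have "AE \<omega> in P. \<forall>i\<in>?I. \<bar>W i \<omega> - x0\<bar> = a" using W2v by (simp add: AE_finite_all)
  then show ?thesis
   by eventually_elim (use a in \<open>auto simp: N_def minus_set_def sv_def abs_if split: if_splits\<close>)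
 qed
 have sumsv: "(\<Sum>i\<in>?I. sv S i) = n * \<tau> (card S)" if "S \<subseteq> ?I" for S
 proof -
  have "(\<Sum>i\<in>?I. sv S i) = (\<Sum>i\<in>?I. 1) - 2 * (\<Sum>i\<in>?I. if i \<in> S then 1 else 0)"
   unfolding sum_distrib_left sum_subtractf[symmetric] by (intro sum.cong refl) (simp add: sv_def)
  also have "(\<Sum>i\<in>?I. if i \<in> S then 1 else 0 :: real) = card S"
   using that by (simp add: sum.If_cases Int_absorb1)
  finally show ?thesis using n0 by (simp add: \<tau>_def)
 qed
 have avgW: "AE \<omega> in P. average n (%i. W i \<omega>) - x0 = a * \<tau> (card (N \<omega>)) \<and> (\<forall>i\<in>?I. c i \<omega> = a * (sv (N \<omega>) i - \<tau> (card (N \<omega>))))"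
  using twoval
 proof eventually_elim
  case (elim \<omega>)
  have "average n (%i. W i \<omega>) = average n (%i. x0 + a * sv (N \<omega>) i)"
   using elim by (intro average_cong) (auto simp: algebra_simps)
  also have "... = x0 + a * \<tau> (card (N \<omega>))"
   using n0 sumsv[OF Nsub[of \<omega>]] by (simp add: average_def sum.distrib distrib_left flip: sum_distrib_left)
  finally show ?case using elim by (auto simp: centred_def algebra_simps)
 qed
 have ex_card: "(\<integral>\<omega>. f (card (N \<omega>)) \<partial>P) = (\<Sum>s\<le>n. ps s * f s)" for f :: "nat => real"
 proof -
  have "(\<integral>\<omega>. f (card (N \<omega>)) \<partial>P) = (\<Sum>S\<in>Pow ?I. pr S * f (card S))"
   unfolding N_def pr_def by (rule integral_minus_set)
  also have "... = (\<Sum>s\<in>{..n}. \<Sum>S | S \<subseteq> ?I \<and> card S = s. pr S * f (card S))"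
  proof -
   have "(\<Sum>S | S \<subseteq> ?I \<and> card S \<in> {..n}. pr S * f (card S)) = (\<Sum>s\<in>{..n} \<inter> {..card ?I}. \<Sum>S | S \<subseteq> ?I \<and> card S = s. pr S * f (card S))"
    by (rule sum_by_card) simp
   moreover have "{S. S \<subseteq> ?I \<and> card S \<in> {..n}} = Pow ?I" using card_mono[of ?I] by auto
   ultimately show ?thesis by simp
  qed
  also have "... = (\<Sum>s\<le>n. ps s * f s)" unfolding ps_def sum_distrib_right by (intro sum.cong refl) auto
  finally show ?thesis .
 qed
 have ps: "0 <= ps s" for s unfolding ps_def pr_def by (intro sum_nonneg) simp
 have ps1: "(\<Sum>s\<le>n. ps s) = 1" using ex_card[of "%_. 1"] prob_space by simp
 have pr_eq: "pr S = ps s / real (n choose s)" if "S \<subseteq> ?I" "card S = s" for S s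
 proof -
  have "ps s = (\<Sum>T | T \<subseteq> ?I \<and> card T = s. pr S)"
   unfolding ps_def pr_def N_def using that by (intro sum.cong refl prob_minus_set_eq) auto
  also have "... = real (n choose s) * pr S" using n_subsets[of ?I s] by simp
  finally show ?thesis
   using that card_mono[of ?I S] by (simp add: zero_less_binomial[THEN less_imp_neq, THEN not_sym])
 qed
 define D where "D = (\<Sum>s\<le>n. ps s * (1 + \<bar>\<tau> s\<bar>))"
 have D1: "1 <= D"
 proof -
  have "(\<Sum>s\<le>n. ps s) <= D" unfolding D_def by (intro sum_mono) (use ps in \<open>auto simp: distrib_left\<close>)
  then show ?thesis using ps1 by simp
 qed
 have Dc: "const_D P n W a x0 = a * D"
 proof -
  have "(\<integral>\<omega>. \<bar>average n (%i. W i \<omega>) - x0\<bar> \<partial>P) = (\<integral>\<omega>. a * \<bar>\<tau> (card (N \<omega>))\<bar> \<partial>P)"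
  proof (rule integral_cong_AE)
   show "(%\<omega>. \<bar>average n (%i. W i \<omega>) - x0\<bar>) \<in> borel_measurable P"
    unfolding average_def using W by measurable
   have "(%\<omega>. \<bar>(\<Sum>i=1..n. sv (N \<omega>) i) / n\<bar> * a) \<in> borel_measurable P"
   proof -
    have "(%\<omega>. sv (N \<omega>) i) \<in> borel_measurable P" if "i \<in> ?I" for i
    proof -
     have [measurable]: "W i \<in> borel_measurable P" by (rule W[OF that])
     have "(%\<omega>. sv (N \<omega>) i) = (%\<omega>. if W i \<omega> < x0 then - 1 else 1)" using that by (auto simp: sv_def N_def minus_set_def)
     then show ?thesis by simp
    qed
    then show ?thesis by (intro borel_measurable_times borel_measurable_abs borel_measurable_divide borel_measurable_sum) auto
   qed
   then show "(%\<omega>. a * \<bar>\<tau> (card (N \<omega>))\<bar>) \<in> borel_measurable P"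
    unfolding sumsv[OF Nsub] using n0 by (simp add: mult.commute)
   show "AE \<omega> in P. \<bar>average n (%i. W i \<omega>) - x0\<bar> = a * \<bar>\<tau> (card (N \<omega>))\<bar>"
    using avgW by eventually_elim (use a in \<open>auto simp: abs_mult\<close>)
  qed
  also have "... = a * (\<Sum>s\<le>n. ps s * \<bar>\<tau> s\<bar>)" using ex_card[of "%s. a * \<bar>\<tau> s\<bar>"] by (simp add: sum_distrib_left mult_ac)
  finally show ?thesis using ps1 by (simp add: const_D_def D_def distrib_left sum.distrib)
 qed
 have Ac: "const_A P n W = a * (\<Sum>s\<le>n. ps s * (1 - (\<tau> s)\<^sup>2))"
 proof -
  have "real n * const_A P n W = (\<Sum>i\<in>?I. \<integral>\<omega>. \<bar>c i \<omega>\<bar> \<partial>P)" using integral_abs_c by simp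
  also have "... = (\<integral>\<omega>. (\<Sum>i\<in>?I. \<bar>c i \<omega>\<bar>) \<partial>P)" using integrable_c by simp
  also have "... = (\<integral>\<omega>. n * (a * (1 - (\<tau> (card (N \<omega>)))\<^sup>2)) \<partial>P)"
  proof (rule integral_cong_AE)
   show "(%\<omega>. \<Sum>i\<in>?I. \<bar>c i \<omega>\<bar>) \<in> borel_measurable P" using c_measurable by (intro borel_measurable_sum borel_measurable_abs)
   show *: "AE \<omega> in P. (\<Sum>i\<in>?I. \<bar>c i \<omega>\<bar>) = n * (a * (1 - (\<tau> (card (N \<omega>)))\<^sup>2))"
    using avgW
   proof eventually_elim
    case (elim \<omega>)
    define T where "T = \<tau> (card (N \<omega>))"
    have "card (N \<omega>) <= n" using card_mono[OF _ Nsub[of \<omega>]] by simp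
    then have T: "- 1 <= T" "T <= 1" using n0 by (auto simp: T_def \<tau>_def field_simps)
    have "(\<Sum>i\<in>?I. \<bar>c i \<omega>\<bar>) = (\<Sum>i\<in>?I. a * (1 - T * sv (N \<omega>) i))"
    proof (rule sum.cong[OF refl])
     fix i assume "i \<in> ?I"
     then have "\<bar>c i \<omega>\<bar> = a * \<bar>sv (N \<omega>) i - T\<bar>" using elim a by (simp add: T_def abs_mult)
     also have "\<bar>sv (N \<omega>) i - T\<bar> = 1 - T * sv (N \<omega>) i" using T by (simp add: sv_def)
     finally show "\<bar>c i \<omega>\<bar> = a * (1 - T * sv (N \<omega>) i)" .
    qed
    also have "... = a * (n - T * (n * T))"
     using sumsv[OF Nsub[of \<omega>]] by (simp add: sum_subtractf T_def flip: sum_distrib_left)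
    finally show ?case by (simp add: T_def power2_eq_square algebra_simps)
   qed
   have "(%\<omega>. n * (a * (1 - ((\<Sum>i=1..n. sv (N \<omega>) i) / n)\<^sup>2))) \<in> borel_measurable P"
   proof -
    have "(%\<omega>. sv (N \<omega>) i) \<in> borel_measurable P" if "i \<in> ?I" for i
    proof -
     have [measurable]: "W i \<in> borel_measurable P" by (rule W[OF that])
     have "(%\<omega>. sv (N \<omega>) i) = (%\<omega>. if W i \<omega> < x0 then - 1 else 1)" using that by (auto simp: sv_def N_def minus_set_def)
     then show ?thesis by simp
    qed
    then show ?thesis by (intro borel_measurable_times borel_measurable_diff borel_measurable_const borel_measurable_power borel_measurable_divide borel_measurable_sum) auto
   qed
   then show "(%\<omega>. n * (a * (1 - (\<tau> (card (N \<omega>)))\<^sup>2))) \<in> borel_measurable P"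
    unfolding sumsv[OF Nsub] using n0 by simp
  qed
  also have "... = real n * (a * (\<Sum>s\<le>n. ps s * (1 - (\<tau> s)\<^sup>2)))"
   using ex_card[of "%s. n * (a * (1 - (\<tau> s)\<^sup>2))"] by (simp add: sum_distrib_left mult_ac)
  finally show ?thesis using n0 by simp
 qed
 define r where "r = (\<Sum>s\<le>n. ps s * (1 - (\<tau> s)\<^sup>2)) / D"
 have rAD: "const_A P n W / const_D P n W a x0 = r" using a by (simp add: Ac Dc r_def)
 define F where "F = (%y. RE y / const_D P n W a x0 - phi (average n y))"
 define v where "v = M\<^sup>2 * (1 + r\<^sup>2) / n"
 have "prob {\<omega>\<in>space P. F (\<lambda>i\<in>{1..n}. Y i \<omega> - \<mu>) < sqrt (2 * v * ln (1 / \<alpha>))} >= 1 - \<alpha>"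
 proof (rule deviation)
  show "F \<in> borel_measurable (PiM {1..n} (%_. borel))" unfolding F_def
   by (intro borel_measurable_diff borel_measurable_divide borel_measurable_const average_measurable
     resampled_expectation_measurable prob_space_axioms c_measurable)
  show "0 < v" using M n0 by (simp add: v_def add_pos_nonneg)
  fix y :: "nat => real ^ 'k" and lam :: real assume y: "!!i. i \<in> {1..n} ==> lp_norm p (y i) <= M" and lam: "0 <= lam"
  interpret sf: sublinear_form phi y n M by (rule form_of_sample[OF y])
  have fs: "phi (average n (\<lambda>i\<in>{1..n}. sv A i *\<^sub>R y i)) = sf.form (sv A)"
   "RE (\<lambda>i\<in>{1..n}. sv A i *\<^sub>R y i) = (\<integral>\<omega>. sf.form (%i. c i \<omega> * sv A i) \<partial>P)" for A
   by (rule form_of_sample(2)[OF y], assumption) (rule form_of_sample(3)[OF y], assumption)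
  have tau: "sf.tau s = \<tau> s" for s by (simp add: sf.tau_def \<tau>_def)
  have RE: "(\<integral>\<omega>. sf.form (%i. c i \<omega> * sv A i) \<partial>P) = a * (\<Sum>s\<le>n. ps s * sf.sign_average s A)" for A
  proof -
   let ?g = "%S. a * sf.form (%i. (sv S i - \<tau> (card S)) * sv A i)"
   have "(\<integral>\<omega>. sf.form (%i. c i \<omega> * sv A i) \<partial>P) = (\<integral>\<omega>. ?g (N \<omega>) \<partial>P)"
   proof (rule integral_cong_AE)
    show "(%\<omega>. sf.form (%i. c i \<omega> * sv A i)) \<in> borel_measurable P"
     using c_measurable by (intro sf.form_measurable borel_measurable_times) auto
    show "AE \<omega> in P. sf.form (%i. c i \<omega> * sv A i) = ?g (N \<omega>)"
     using avgW
    proof eventually_elim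
     case (elim \<omega>)
     have "sf.form (%i. c i \<omega> * sv A i) = sf.form (%i. a * ((sv (N \<omega>) i - \<tau> (card (N \<omega>))) * sv A i))"
      using elim by (intro sf.form_cong) simp
     then show ?case using a by (simp add: sf.form_scale)
    qed
    have "(%\<omega>. \<Sum>S\<in>Pow ?I. ?g S * indicator {\<omega>\<in>space P. N \<omega> = S} \<omega>) \<in> borel_measurable P"
     using minus_set_event[of _ x0] unfolding N_def by (intro borel_measurable_sum borel_measurable_times borel_measurable_const borel_measurable_indicator) auto
    also have "?this \<longleftrightarrow> (%\<omega>. ?g (N \<omega>)) \<in> borel_measurable P"
    proof (rule measurable_cong)
     fix \<omega> assume "\<omega> \<in> space P"
     then have "(\<Sum>S\<in>Pow ?I. ?g S * indicator {\<omega>\<in>space P. N \<omega> = S} \<omega>) = (\<Sum>S\<in>Pow ?I. if S = N \<omega> then ?g S else 0)"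
      by (intro sum.cong refl) (auto simp: indicator_def)
     also have "... = ?g (N \<omega>)" using Nsub[of \<omega>] by (subst sum.delta) auto
     finally show "(\<Sum>S\<in>Pow ?I. ?g S * indicator {\<omega>\<in>space P. N \<omega> = S} \<omega>) = ?g (N \<omega>)" .
    qed
    finally show "(%\<omega>. ?g (N \<omega>)) \<in> borel_measurable P" .
   qed
   also have "... = (\<Sum>S\<in>Pow ?I. pr S * ?g S)" unfolding N_def pr_def by (rule integral_minus_set)
   also have "... = (\<Sum>s\<in>{..n}. \<Sum>S | S \<subseteq> ?I \<and> card S = s. pr S * ?g S)"
   proof -
    have "(\<Sum>S | S \<subseteq> ?I \<and> card S \<in> {..n}. pr S * ?g S) = (\<Sum>s\<in>{..n} \<inter> {..card ?I}. \<Sum>S | S \<subseteq> ?I \<and> card S = s. pr S * ?g S)"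
     by (rule sum_by_card) simp
    moreover have "{S. S \<subseteq> ?I \<and> card S \<in> {..n}} = Pow ?I" using card_mono[of ?I] by auto
    ultimately show ?thesis by simp
   qed
   also have "... = (\<Sum>s\<le>n. a * (ps s * sf.sign_average s A))"
   proof (rule sum.cong[OF refl])
    fix s
    have "(\<Sum>S | S \<subseteq> ?I \<and> card S = s. pr S * ?g S)
     = (\<Sum>S | S \<subseteq> ?I \<and> card S = s. a * (ps s / real (n choose s)) * sf.form (%i. (sv S i - sf.tau s) * sv A i))"
     by (intro sum.cong refl) (auto simp: pr_eq tau)
    then show "(\<Sum>S | S \<subseteq> ?I \<and> card S = s. pr S * ?g S) = a * (ps s * sf.sign_average s A)"
     unfolding sum_distrib_left[symmetric] by (simp add: sf.sign_average_def)
   qed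
   finally show ?thesis by (simp add: sum_distrib_left)
  qed
  have "(\<Sum>A\<in>Pow ?I. exp (lam * ((\<Sum>s\<le>n. ps s * sf.sign_average s A) / D - sf.form (sv A)))) <= 2 ^ n * exp (M\<^sup>2 * (1 + r\<^sup>2) * lam\<^sup>2 / (2 * n))"
   by (rule sf.sign_weights_exp_moment) (use ps ps1 lam in \<open>auto simp: D_def r_def tau\<close>)
  then show "(\<Sum>A\<in>Pow {1..n}. exp (lam * F (\<lambda>i\<in>{1..n}. sv A i *\<^sub>R y i))) <= 2 ^ n * exp (v * lam\<^sup>2 / 2)"
   unfolding F_def fs v_def RE Dc using a by (simp add: mult_ac)
 qed
 moreover have "sqrt (2 * v * ln (1 / \<alpha>)) = M / sqrt (real n) * sqrt (1 + (const_A P n W)\<^sup>2 / (const_D P n W a x0)\<^sup>2) * sqrt (2 * ln (1 / \<alpha>))"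
 proof -
  have "2 * v * ln (1 / \<alpha>) = M\<^sup>2 / n * (1 + r\<^sup>2) * (2 * ln (1 / \<alpha>))" by (simp add: v_def)
  then have "sqrt (2 * v * ln (1 / \<alpha>)) = M / sqrt (real n) * sqrt (1 + r\<^sup>2) * sqrt (2 * ln (1 / \<alpha>))"
   using M by (simp only: real_sqrt_mult real_sqrt_divide) simp
  then show ?thesis by (simp add: rAD[symmetric] power_divide)
 qed
 ultimately show ?thesis unfolding F_def RE_shift avg_shift by (simp add: algebra_simps)
qed

end

section \<open>Gaussian measures and characteristic functions\<close>

text \<open>The uniqueness theorem for characteristic functions, applied to the law of \<open>X\<close> under the measure with density \<open>w\<close>.\<close>

lemma weighted_law_unique:
 fixes M N :: "'a measure" and w X :: "'a => real"
 assumes M: "prob_space M" and N: "prob_space N" and sets: "sets M = sets N"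
  and w: "w \<in> borel_measurable M" "!!x. 0 <= w x" "!!x. w x <= B" and X: "X \<in> borel_measurable M"
  and c: "!!t. (\<integral>x. w x * cos (t * X x) \<partial>M) = (\<integral>x. w x * cos (t * X x) \<partial>N)"
  and s: "!!t. (\<integral>x. w x * sin (t * X x) \<partial>M) = (\<integral>x. w x * sin (t * X x) \<partial>N)"
  and A: "A \<in> sets borel"
 shows "(\<integral>x. w x * indicator A (X x) \<partial>M) = (\<integral>x. w x * indicator A (X x) \<partial>N)"
proof -
 define m where "m = (\<integral>x. w x \<partial>M)"
 have mN: "m = (\<integral>x. w x \<partial>N)" using c[of 0] by (simp add: m_def)
 have meas: "w \<in> borel_measurable L" "X \<in> borel_measurable L" if "sets L = sets M" for L
  using w(1) X measurable_cong_sets[OF that refl] by auto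
 have int: "integrable L (%x. w x *\<^sub>R f x)" if L: "prob_space L" "sets L = sets M"
  and f: "f \<in> borel_measurable L" "!!x. norm (f x) <= 1"
  for L and f :: "'a => 'b::{banach, second_countable_topology}"
 proof -
  interpret prob_space L by fact
  show ?thesis
  proof (rule integrable_const_bound[of _ B])
   show "AE x in L. norm (w x *\<^sub>R f x) <= B"
   proof (rule AE_I2)
    fix x
    have "w x * norm (f x) <= w x * 1" using w(2) f(2) by (intro mult_left_mono) auto
    then show "norm (w x *\<^sub>R f x) <= B" using w(2)[of x] w(3)[of x] by simp
   qed
  qed (use meas[OF L(2)] f in measurable)
 qed
 have m0: "0 <= m" unfolding m_def using w by simp
 show ?thesis
 proof (cases "m = 0")
  case True
  have zero: "(\<integral>x. w x * indicator A (X x) \<partial>L) = 0" if L: "prob_space L" "sets L = sets M" "(\<integral>x. w x \<partial>L) = 0" for L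
  proof -
   have "integrable L w" using int[OF L(1,2), of "%_. 1::real"] by simp
   then have "AE x in L. w x = 0" using integral_nonneg_eq_0_iff_AE[of L w] w L(3) by simp
   then have "(\<integral>x. w x * indicator A (X x) \<partial>L) = (\<integral>x. 0 \<partial>L)"
    using meas[OF L(2)] A by (intro integral_cong_AE) auto
   then show ?thesis by simp
  qed
  show ?thesis using zero[OF M refl] zero[OF N sets[symmetric]] True mN m_def by simp
 next
  case False
  then have mp: "0 < m" using m0 by simp
  define D where "D = (%L. distr (density L (%x. ennreal (w x / m))) borel X)"
  have D: "real_distribution (D L)"
   "char (D L) t = complex_of_real (\<integral>x. w x * cos (t * X x) \<partial>L) / m + \<i> * complex_of_real (\<integral>x. w x * sin (t * X x) \<partial>L) / m"
   "measure (D L) A = (\<integral>x. w x * indicator A (X x) \<partial>L) / m"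
   if L: "prob_space L" "sets L = sets M" "(\<integral>x. w x \<partial>L) = m" for L t
  proof -
   interpret prob_space L by fact
   note [measurable] = meas[OF L(2)]
   have wi: "integrable L w" using int[OF L(1,2), of "%_. 1::real"] by simp
   have "prob_space (density L (%x. ennreal (w x / m)))"
   proof
    have "(\<integral>\<^sup>+x. ennreal (w x / m) \<partial>L) = ennreal (\<integral>x. w x / m \<partial>L)"
     using wi w(2) mp by (intro nn_integral_eq_integral) auto
    also have "... = 1" using L(3) mp by simp
    finally show "emeasure (density L (%x. ennreal (w x / m))) (space (density L (%x. ennreal (w x / m)))) = 1"
     by (simp add: emeasure_density nn_integral_cong[of L "%x. ennreal (w x / m) * indicator (space L) x" "%x. ennreal (w x / m)"])
   qed
   then have "prob_space (D L)" unfolding D_def by (rule prob_space.prob_space_distr) simp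
   then show rd: "real_distribution (D L)"
    unfolding real_distribution_def real_distribution_axioms_def by (simp add: D_def)
   have tr: "(\<integral>y. f y \<partial>D L) = (\<integral>x. (w x / m) *\<^sub>R f (X x) \<partial>L)" if [measurable]: "f \<in> borel_measurable borel"
    for f :: "real => 'b::{banach, second_countable_topology}"
    unfolding D_def using w(2) mp by (subst integral_distr) (auto intro!: integral_density)
   have ie: "integrable L (%x. w x *\<^sub>R iexp (t * X x))" by (rule int[OF L(1,2)]) auto
   have "char (D L) t = (\<integral>x. (w x *\<^sub>R iexp (t * X x)) / complex_of_real m \<partial>L)"
    unfolding char_def by (subst tr) (auto simp: scaleR_conv_of_real)
   also have "... = (\<integral>x. w x *\<^sub>R iexp (t * X x) \<partial>L) / m" by simp
   also have "(\<integral>x. w x *\<^sub>R iexp (t * X x) \<partial>L) = complex_of_real (\<integral>x. w x * cos (t * X x) \<partial>L) + \<i> * complex_of_real (\<integral>x. w x * sin (t * X x) \<partial>L)"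
   proof (rule complex_eqI)
    show "Re (\<integral>x. w x *\<^sub>R iexp (t * X x) \<partial>L) = Re (complex_of_real (\<integral>x. w x * cos (t * X x) \<partial>L) + \<i> * complex_of_real (\<integral>x. w x * sin (t * X x) \<partial>L))"
     by (subst integral_Re[OF ie, symmetric]) (simp add: Re_exp)
    show "Im (\<integral>x. w x *\<^sub>R iexp (t * X x) \<partial>L) = Im (complex_of_real (\<integral>x. w x * cos (t * X x) \<partial>L) + \<i> * complex_of_real (\<integral>x. w x * sin (t * X x) \<partial>L))"
     by (subst integral_Im[OF ie, symmetric]) (simp add: Im_exp)
   qed
   finally show "char (D L) t = complex_of_real (\<integral>x. w x * cos (t * X x) \<partial>L) / m + \<i> * complex_of_real (\<integral>x. w x * sin (t * X x) \<partial>L) / m"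
    by (simp add: add_divide_distrib)
   interpret DL: real_distribution "D L" by (rule rd)
   have "measure (D L) A = (\<integral>y. indicator A y \<partial>D L)" using A by simp
   also have "... = (\<integral>x. w x * indicator A (X x) / m \<partial>L)"
    using A by (subst tr) (auto simp: mult_ac)
   finally show "measure (D L) A = (\<integral>x. w x * indicator A (X x) \<partial>L) / m" by simp
  qed
  have "D M = D N"
   using D(1)[OF M refl m_def[symmetric]] D(1)[OF N sets[symmetric] mN[symmetric]]
  proof (rule Levy_uniqueness)
   show "char (D M) = char (D N)"
    using D(2)[OF M refl m_def[symmetric]] D(2)[OF N sets[symmetric] mN[symmetric]] c s by (intro ext) simp
  qed
  then show ?thesis
   using D(3)[OF M refl m_def[symmetric]] D(3)[OF N sets[symmetric] mN[symmetric]] mp by simp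
 qed
qed

text \<open>Coordinates are treated one at a time: trigonometric weights in the remaining coordinates are made nonnegative by
adding the constant 1, which reduces the claim to one dimension.\<close>

theorem PiM_eq_if_characteristic_functions_eq:
 fixes M N :: "('i => real) measure"
 assumes I: "finite I" and M: "prob_space M" and N: "prob_space N"
  and sM: "sets M = sets (PiM I (%_. borel))" and sN: "sets N = sets (PiM I (%_. borel))"
  and ch: "!!u. (\<integral>x. iexp (\<Sum>i\<in>I. u i * x i) \<partial>M) = (\<integral>x. iexp (\<Sum>i\<in>I. u i * x i) \<partial>N)"
 shows "M = N"
proof -
 have x_meas: "(%x. x i) \<in> borel_measurable L" if "i \<in> I" "sets L = sets (PiM I (%_. borel :: real measure))" for i and L :: "('i => real) measure"
  using measurable_component_singleton[OF that(1), of "%_. borel"] measurable_cong_sets[OF that(2) refl] by blast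
 have meas: "(%x. (\<Prod>j\<in>J. indicator (A j) (x j)) * cos ((\<Sum>l\<in>I-J. u l * x l) + c)) \<in> borel_measurable L"
  "(%x. (\<Prod>j\<in>J. indicator (A j) (x j) :: real)) \<in> borel_measurable L"
  if "J \<subseteq> I" "!!j. A j \<in> sets borel" "sets L = sets (PiM I (%_. borel :: real measure))"
  for J and A :: "'i => real set" and u c and L :: "('i => real) measure"
 proof -
  have xm: "(%x. x i) \<in> borel_measurable L" if "i \<in> I" for i by (rule x_meas) fact+
  show p: "(%x. (\<Prod>j\<in>J. indicator (A j) (x j) :: real)) \<in> borel_measurable L"
   using that(1,2) by (intro borel_measurable_prod measurable_compose[OF xm]) auto
  have "(%x. (\<Sum>l\<in>I-J. u l * x l) + c) \<in> borel_measurable L"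
   by (intro borel_measurable_add borel_measurable_sum borel_measurable_times xm) auto
  then have "(%x. cos ((\<Sum>l\<in>I-J. u l * x l) + c)) \<in> borel_measurable L"
   by (intro measurable_compose[of _ L borel cos]) auto
  with p show "(%x. (\<Prod>j\<in>J. indicator (A j) (x j)) * cos ((\<Sum>l\<in>I-J. u l * x l) + c)) \<in> borel_measurable L"
   by (rule borel_measurable_times)
 qed
 have ind01: "0 <= (\<Prod>j\<in>J. indicator (A j) (x j) :: real)" "(\<Prod>j\<in>J. indicator (A j) (x j) :: real) <= 1"
  for J A and x :: "'i => real"
  by (auto intro!: prod_nonneg prod_le_1 simp: indicator_def)
 have int: "integrable L (%x. (\<Prod>j\<in>J. indicator (A j) (x j)) * cos ((\<Sum>l\<in>I-J. u l * x l) + c))"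
  if "J \<subseteq> I" "!!j. A j \<in> sets borel" "L = M \<or> L = N"
  for J and A :: "'i => real set" and u c L
 proof -
  have L: "prob_space L" "sets L = sets (PiM I (%_. borel))" using that(3) M N sM sN by auto
  interpret prob_space L by fact
  show ?thesis
  proof (rule integrable_const_bound[of _ 1])
   show "AE x in L. norm ((\<Prod>j\<in>J. indicator (A j) (x j)) * cos ((\<Sum>l\<in>I-J. u l * x l) + c)) <= 1"
   proof (rule AE_I2)
    fix x
    have "\<bar>\<Prod>j\<in>J. indicator (A j) (x j) :: real\<bar> * \<bar>cos ((\<Sum>l\<in>I-J. u l * x l) + c)\<bar> <= 1"
     using ind01[of A x J] by (intro mult_le_one) auto
    then show "norm ((\<Prod>j\<in>J. indicator (A j) (x j)) * cos ((\<Sum>l\<in>I-J. u l * x l) + c)) <= 1"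
     by (simp add: abs_mult)
   qed
  qed (rule meas[OF that(1,2) L(2)])
 qed
 define E where "E = (%L J A u c. \<integral>x. (\<Prod>j\<in>J. indicator (A j) (x j)) * cos ((\<Sum>l\<in>I-J. u l * x l) + c) \<partial>(L :: ('i => real) measure))"
 have "\<forall>A u c. (\<forall>j. A j \<in> sets borel) --> E M J A u c = E N J A u c" if "J \<subseteq> I" for J
  using finite_subset[OF that I] that
 proof (induction J rule: finite_induct)
  case empty
  have *: "E L {} A u c = Re (iexp c * (\<integral>x. iexp (\<Sum>i\<in>I. u i * x i) \<partial>L))" if L: "L = M \<or> L = N" for L A u c
  proof -
   have sL: "prob_space L" "sets L = sets (PiM I (%_. borel))" using that M N sM sN by auto
   interpret prob_space L by fact
   have "(%x. \<Sum>i\<in>I. u i * x i) \<in> borel_measurable L"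
    by (intro borel_measurable_sum borel_measurable_times x_meas[OF _ sL(2)]) auto
   then have "(%x. iexp (\<Sum>i\<in>I. u i * x i)) \<in> borel_measurable L"
    by (rule measurable_compose[where g = "%r. iexp r"]) measurable
   then have "integrable L (%x. iexp (\<Sum>i\<in>I. u i * x i))"
    by (intro integrable_const_bound[of _ 1]) (simp_all del: of_real_sum)
   then have "integrable L (%x. iexp c * iexp (\<Sum>i\<in>I. u i * x i))" by simp
   then have "(\<integral>x. Re (iexp c * iexp (\<Sum>i\<in>I. u i * x i)) \<partial>L) = Re (\<integral>x. iexp c * iexp (\<Sum>i\<in>I. u i * x i) \<partial>L)"
    by (rule integral_Re)
   also have "(%x. Re (iexp c * iexp (\<Sum>i\<in>I. u i * x i))) = (%x. cos ((\<Sum>i\<in>I. u i * x i) + c))"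
    by (simp add: exp_add[symmetric] Re_exp algebra_simps)
   finally show ?thesis by (simp add: E_def)
  qed
  show ?case using *[of M] *[of N] ch by simp
 next
  case (insert i J)
  then have i: "i \<in> I" "i \<notin> J" and J: "J \<subseteq> I" by auto
  have IH: "E M J A u c = E N J A u c" if "!!j. A j \<in> sets borel" for A u c
   using insert.IH J that by blast
  show ?case
  proof (intro allI impI)
   fix A :: "'i => real set" and u c assume A: "\<forall>j. A j \<in> sets borel"
   have A': "!!j. A j \<in> sets borel" using A by blast
   let ?p = "%x. (\<Prod>j\<in>J. indicator (A j) (x j) :: real)"
   have IJ: "I - J = insert i (I - insert i J)" using i by auto
   have sumJ: "(\<Sum>l\<in>I-J. (u(i := t)) l * x l) = t * x i + (\<Sum>l\<in>I - insert i J. u l * x l)" for t u and x :: "'i => real"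
   proof -
    have "(\<Sum>l\<in>I - insert i J. (u(i := t)) l * x l) = (\<Sum>l\<in>I - insert i J. u l * x l)"
     by (intro sum.cong) auto
    then show ?thesis unfolding IJ using I by simp
   qed
   \<comment> \<open>the law of \<open>x i\<close> under the nonnegative weight \<open>1 + cos\<close> is determined by the induction hypothesis\<close>
   have key: "(\<integral>x. ?p x * (1 + cos ((\<Sum>l\<in>I - insert i J. u l * x l) + c)) * indicator (A i) (x i) \<partial>M)
     = (\<integral>x. ?p x * (1 + cos ((\<Sum>l\<in>I - insert i J. u l * x l) + c)) * indicator (A i) (x i) \<partial>N)" for u c
   proof (rule weighted_law_unique[OF M N, where B = 2])
    show "sets M = sets N" using sM sN by simp
    let ?w = "%x. ?p x * (1 + cos ((\<Sum>l\<in>I - insert i J. u l * x l) + c))"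
    have w_eq: "?w x = ?p x * cos ((\<Sum>l\<in>I-J. 0 * x l) + 0) + ?p x * cos ((\<Sum>l\<in>I-J. (u(i := 0)) l * x l) + c)" for x
     unfolding sumJ by (simp add: distrib_left)
    show "?w \<in> borel_measurable M" unfolding w_eq
     by (intro borel_measurable_add meas(1)[OF J A' sM])
    have cb: "0 <= 1 + cos r" "1 + cos r <= 2" for r :: real using cos_ge_minus_one[of r] cos_le_one[of r] by linarith+
    show "0 <= ?w x" for x using ind01(1) cb(1) by (rule mult_nonneg_nonneg)
    show "?w x <= 2" for x using mult_mono[OF ind01(2) cb(2) _ cb(1)] by simp
    show "(%x. x i) \<in> borel_measurable M" by (rule x_meas[OF i(1) sM])
    show "A i \<in> sets borel" by (rule A')
    have trig: "?w x * cos (t * x i + d) = ?p x * cos ((\<Sum>l\<in>I-J. ((%_. 0)(i := t)) l * x l) + d)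
      + (1/2) * (?p x * cos ((\<Sum>l\<in>I-J. (u(i := t)) l * x l) + (d + c)))
      + (1/2) * (?p x * cos ((\<Sum>l\<in>I-J. ((%l. - u l)(i := t)) l * x l) + (d - c)))" for t d x
    proof -
     define s where "s = (\<Sum>l\<in>I - insert i J. u l * x l)"
     have e: "cos (s + c) * cos (t * x i + d) = cos (t * x i + s + (d + c)) / 2 + cos (t * x i + - s + (d - c)) / 2"
     proof -
      have "t * x i + s + (d + c) = (t * x i + d) + (s + c)" "t * x i + - s + (d - c) = (t * x i + d) - (s + c)" by auto
      then show ?thesis by (simp only: cos_add[of "t * x i + d"] cos_diff[of "t * x i + d"]) (simp add: field_simps)
     qed
     have "?w x * cos (t * x i + d) = ?p x * cos (t * x i + d) + ?p x * (cos (s + c) * cos (t * x i + d))"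
      by (simp add: s_def algebra_simps)
     then show ?thesis unfolding sumJ e s_def[symmetric] by (simp add: sum_negf s_def algebra_simps)
    qed
    have *: "(\<integral>x. ?w x * cos (t * x i + d) \<partial>M) = (\<integral>x. ?w x * cos (t * x i + d) \<partial>N)" for t d
    proof -
     have "(\<integral>x. ?w x * cos (t * x i + d) \<partial>L) = E L J A ((%_. 0)(i := t)) d + (1/2) * E L J A (u(i := t)) (d + c) + (1/2) * E L J A ((%l. - u l)(i := t)) (d - c)"
      if "L = M \<or> L = N" for L
      unfolding trig E_def using int[OF J A' that]
      by (subst Bochner_Integration.integral_add, simp, simp)+ simp
     from this[of M] this[of N] show ?thesis using IH[OF A'] by simp
    qed
    show "(\<integral>x. ?w x * cos (t * x i) \<partial>M) = (\<integral>x. ?w x * cos (t * x i) \<partial>N)" for t using *[of t 0] by simp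
    show "(\<integral>x. ?w x * sin (t * x i) \<partial>M) = (\<integral>x. ?w x * sin (t * x i) \<partial>N)" for t
     using *[of t "- (pi / 2)"] by (simp add: cos_diff)
   qed
   have pins: "(\<Prod>j\<in>insert i J. indicator (A j) (x j) :: real) = ?p x * indicator (A i) (x i)" for x
    using insert.hyps by simp
   have split: "(\<integral>x. ?p x * (1 + cos ((\<Sum>l\<in>I - insert i J. u l * x l) + c)) * indicator (A i) (x i) \<partial>L)
     = E L (insert i J) A (%_. 0) 0 + E L (insert i J) A u c" if "L = M \<or> L = N" for L u c
   proof -
    have "(%x. ?p x * (1 + cos ((\<Sum>l\<in>I - insert i J. u l * x l) + c)) * indicator (A i) (x i))
     = (%x. (\<Prod>j\<in>insert i J. indicator (A j) (x j)) * cos ((\<Sum>l\<in>I-insert i J. 0 * x l) + 0)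
       + (\<Prod>j\<in>insert i J. indicator (A j) (x j)) * cos ((\<Sum>l\<in>I-insert i J. u l * x l) + c))"
     unfolding pins by (simp add: algebra_simps)
    then show ?thesis unfolding E_def
     using Bochner_Integration.integral_add[OF int[OF insert.prems A' that, where u = "%_. 0" and c = 0] int[OF insert.prems A' that, where u = u and c = c]] by simp
   qed
   have "E M (insert i J) A (%_. 0) 0 = E N (insert i J) A (%_. 0) 0"
    using key[of "%_. 0" 0] unfolding split[OF disjI1[OF refl]] split[OF disjI2[OF refl]] by simp
   then show "E M (insert i J) A u c = E N (insert i J) A u c"
    using key[of u c] unfolding split[OF disjI1[OF refl]] split[OF disjI2[OF refl]] by simp
  qed
 qed
 then have rect: "E M I A u c = E N I A u c" if "!!j. A j \<in> sets borel" for A u c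
  using that by blast
 show "M = N"
 proof (rule measure_eqI_PiM_finite[OF I sM sN])
  fix A :: "'i => real set" assume A: "!!i. i \<in> I ==> A i \<in> sets borel"
  define A' where "A' = (%i. if i \<in> I then A i else {})"
  have A': "A' j \<in> sets borel" for j using A by (simp add: A'_def)
  have *: "E L I A' (%_. 0) 0 = measure L (PiE I A)" if "L = M \<or> L = N" for L
  proof -
   have sL: "prob_space L" "sets L = sets (PiM I (%_. borel))" using that M N sM sN by auto
   interpret prob_space L by fact
   have sp: "space L = PiE I (%_. UNIV)" using sets_eq_imp_space_eq[OF sL(2)] by (simp add: space_PiM)
   have "E L I A' (%_. 0) 0 = (\<integral>x. indicator (PiE I A) x \<partial>L)"
    unfolding E_def
   proof (rule Bochner_Integration.integral_cong[OF refl])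
    fix x assume "x \<in> space L"
    then show "(\<Prod>j\<in>I. indicator (A' j) (x j)) * cos ((\<Sum>l\<in>I - I. 0 * x l) + 0) = (indicator (PiE I A) x :: real)"
     using I by (auto simp: sp A'_def indicator_def PiE_iff prod_zero_iff)
   qed
   also have "... = measure L (PiE I A)"
    using A by (simp add: sL(2) sets_PiM_I_finite[OF I])
   finally show ?thesis .
  qed
  have "measure M (PiE I A) = measure N (PiE I A)" using *[of M] *[of N] rect[OF A', where u = "%_. 0" and c = 0] by simp
  then show "emeasure M (PiE I A) = emeasure N (PiE I A)"
   using M N by (simp add: finite_measure.emeasure_eq_measure prob_space_def)
 next
  show "range (%_::nat. PiE I (%_. UNIV)) \<subseteq> prod_algebra I (%_. borel :: real measure)"
   using space_in_prod_algebra[of I "%_. borel :: real measure"] by auto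
  show "(\<Union>i::nat. PiE I (%_. UNIV)) = space (PiM I (%_. borel :: real measure))" by (simp add: space_PiM)
  show "emeasure M (PiE I (%_. UNIV)) \<noteq> \<infinity>" for i :: nat
   using M by (simp add: finite_measure.emeasure_finite prob_space_def)
 qed
qed

definition gauss :: "'i set => ('i => real) measure" where
 "gauss I = PiM I (%_. density lborel (%t. ennreal (std_normal_density t)))"

lemma prob_space_std_normal: "prob_space (density lborel (%t. ennreal (std_normal_density t)))"
 by (rule prob_space_normal_density) simp

lemma prob_space_gauss [simp]: "prob_space (gauss I)"
 unfolding gauss_def by (intro prob_space_PiM prob_space_std_normal)

lemma sets_gauss [simp, measurable_cong]: "sets (gauss I) = sets (PiM I (%_. borel))"
 unfolding gauss_def by (intro sets_PiM_cong) auto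

interpretation std_normal: product_sigma_finite "%_ :: 'i. density lborel (%t. ennreal (std_normal_density t))"
 unfolding product_sigma_finite_def using prob_space_std_normal
 by (auto simp: prob_space_imp_sigma_finite)

lemma gauss_integral_prod:
 fixes f :: "'i => real => 'b::{real_normed_field, banach, second_countable_topology}"
 assumes "finite I" "!!i. i \<in> I ==> integrable (density lborel (%t. ennreal (std_normal_density t))) (f i)"
 shows "(\<integral>x. (\<Prod>i\<in>I. f i (x i)) \<partial>gauss I) = (\<Prod>i\<in>I. \<integral>t. f i t \<partial>density lborel (%t. ennreal (std_normal_density t)))"
 unfolding gauss_def by (rule std_normal.product_integral_prod) (use assms in auto)

lemma gauss_integrable_prod:
 fixes f :: "'i => real => 'b::{real_normed_field, banach, second_countable_topology}"
 assumes "finite I" "!!i. i \<in> I ==> integrable (density lborel (%t. ennreal (std_normal_density t))) (f i)"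
 shows "integrable (gauss I) (%x. (\<Prod>i\<in>I. f i (x i)))"
 unfolding gauss_def by (rule std_normal.product_integrable_prod) (use assms in auto)

lemma gauss_char:
 assumes I: "finite I"
 shows "(\<integral>x. iexp (\<Sum>i\<in>I. u i * x i) \<partial>gauss I) = exp (- (\<Sum>i\<in>I. (u i)\<^sup>2) / 2)"
proof -
 let ?N = "density lborel (%t. ennreal (std_normal_density t))"
 interpret N: prob_space ?N by (rule prob_space_std_normal)
 have "integrable ?N (%t. iexp (u i * t))" for i
  by (rule N.integrable_const_bound[of _ 1]) auto
 then have "(\<integral>x. (\<Prod>i\<in>I. iexp (u i * x i)) \<partial>gauss I) = (\<Prod>i\<in>I. \<integral>t. iexp (u i * t) \<partial>?N)"
  by (intro gauss_integral_prod I)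
 also have "... = (\<Prod>i\<in>I. complex_of_real (exp (- (u i)\<^sup>2 / 2)))"
 proof (intro prod.cong refl)
  fix i
  show "(\<integral>t. iexp (u i * t) \<partial>?N) = exp (- (u i)\<^sup>2 / 2)"
   using char_std_normal_distribution by (simp add: char_def fun_eq_iff exp_of_real[symmetric])
 qed
 also have "... = exp (- (\<Sum>i\<in>I. (u i)\<^sup>2) / 2)"
  unfolding sum_divide_distrib sum_negf[symmetric] using I by (simp add: exp_sum sum_negf[symmetric] sum_divide_distrib)
 also have "(%x. \<Prod>i\<in>I. iexp (u i * x i)) = (%x. iexp (\<Sum>i\<in>I. u i * x i))"
  using I by (simp add: exp_sum[symmetric] sum_distrib_left)
 finally show ?thesis .
qed

lemma std_normal_exp_abs: "integrable (density lborel (%t. ennreal (std_normal_density t))) (%t. exp (k * \<bar>t\<bar>))"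
proof -
 let ?N = "density lborel (%t. ennreal (std_normal_density t))"
 have shift: "std_normal_density t * exp (k * t) = exp (k\<^sup>2 / 2) * normal_density k 1 t" for k t
  by (simp add: normal_density_def exp_add[symmetric] power2_eq_square field_simps)
 have *: "integrable ?N (%t. exp (k * t))" for k
  by (subst integrable_real_density) (auto simp: shift)
 have "integrable ?N (%t. exp (k * t) + exp (- k * t))" by (intro Bochner_Integration.integrable_add *)
 then show ?thesis
 proof (rule Bochner_Integration.integrable_bound)
  show "AE t in ?N. norm (exp (k * \<bar>t\<bar>)) <= norm (exp (k * t) + exp (- k * t))"
  proof (rule AE_I2)
   fix t
   have "exp (k * \<bar>t\<bar>) <= exp (k * t) + exp (- k * t)" by (cases "0 <= t") auto
   then have "exp (k * \<bar>t\<bar>) <= \<bar>exp (k * t) + exp (- k * t)\<bar>" by (rule order_trans[OF _ abs_ge_self])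
   then show "norm (exp (k * \<bar>t\<bar>)) <= norm (exp (k * t) + exp (- k * t))" by simp
  qed
 qed simp
qed

lemma gauss_exp_abs_integrable:
 assumes I: "finite I"
 shows "integrable (gauss I) (%x. exp (k * (\<Sum>i\<in>I. \<bar>x i\<bar>)))"
proof -
 have "integrable (gauss I) (%x. \<Prod>i\<in>I. exp (k * \<bar>x i\<bar>))"
  by (rule gauss_integrable_prod[OF I std_normal_exp_abs])
 then show ?thesis using I by (simp add: exp_sum[symmetric] sum_distrib_left)
qed

lemma gauss_power_exp_integrable:
 assumes I: "finite I"
 shows "integrable (gauss I) (%x. (1 + (\<Sum>i\<in>I. \<bar>x i\<bar>)) ^ m * exp (k * (\<Sum>i\<in>I. \<bar>x i\<bar>)))"
proof (rule Bochner_Integration.integrable_bound[OF gauss_exp_abs_integrable[OF I, of "real m + k"]])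
 show "AE x in gauss I. norm ((1 + (\<Sum>i\<in>I. \<bar>x i\<bar>)) ^ m * exp (k * (\<Sum>i\<in>I. \<bar>x i\<bar>))) <= norm (exp ((real m + k) * (\<Sum>i\<in>I. \<bar>x i\<bar>)))"
 proof (rule AE_I2)
  fix x :: "'a => real"
  define s where "s = (\<Sum>i\<in>I. \<bar>x i\<bar>)"
  have s: "0 <= s" by (auto simp: s_def intro: sum_nonneg)
  have "(1 + s) ^ m <= exp s ^ m" using s by (intro power_mono exp_ge_add_one_self) auto
  then have "(1 + s) ^ m * exp (k * s) <= exp ((real m + k) * s)"
   by (simp add: exp_of_nat_mult[symmetric] distrib_right exp_add mult_right_mono)
  then show "norm ((1 + (\<Sum>i\<in>I. \<bar>x i\<bar>)) ^ m * exp (k * (\<Sum>i\<in>I. \<bar>x i\<bar>))) <= norm (exp ((real m + k) * (\<Sum>i\<in>I. \<bar>x i\<bar>)))"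
   using s by (simp add: s_def[symmetric] abs_mult)
 qed
qed measurable

lemma std_normal_moments:
 defines "N \<equiv> density lborel (%t. ennreal (std_normal_density t))"
 shows "integrable N (%t. t)" "(\<integral>t. t \<partial>N) = 0" "integrable N (%t. t * t)" "(\<integral>t. t * t \<partial>N) = 1"
proof -
 show "integrable N (%t. t)" unfolding N_def
  using integrable_normal_moment_nz_1[of 1 0] by (subst integrable_real_density) auto
 show "(\<integral>t. t \<partial>N) = 0" unfolding N_def
  using integral_normal_moment_nz_1[of 1 0] by (subst integral_real_density) auto
 show "integrable N (%t. t * t)" unfolding N_def
  using integrable_normal_moment[of 1 0 2] by (subst integrable_real_density) (auto simp: power2_eq_square)
 show "(\<integral>t. t * t \<partial>N) = 1" unfolding N_def
  using integral_normal_moment_even[of 1 0 1] by (subst integral_real_density) (auto simp: power2_eq_square)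
qed

lemma gauss_coordinate:
 assumes I: "finite I" and ij: "i \<in> I" "j \<in> I"
 shows "integrable (gauss I) (%x. x i)" "(\<integral>x. x i \<partial>gauss I) = 0"
  "integrable (gauss I) (%x. x i * x j)" "(\<integral>x. x i * x j \<partial>gauss I) = (if i = j then 1 else 0)"
proof -
 let ?N = "density lborel (%t. ennreal (std_normal_density t))"
 interpret N: prob_space ?N by (rule prob_space_std_normal)
 have one: "integrable (gauss I) (%x. f (x i)) \<and> (\<integral>x. f (x i) \<partial>gauss I) = (\<integral>t. f t \<partial>?N)"
  if f: "integrable ?N f" and i: "i \<in> I" for f :: "real => real" and i
 proof -
  have eq: "(\<Prod>l\<in>I. (if l = i then f else (%_. 1)) (x l)) = f (x i)" for x
   using I i by (subst prod.remove[of _ i]) auto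
  have int: "integrable ?N (if l = i then f else (%_. 1))" for l using f by simp
  have "(\<Prod>l\<in>I. \<integral>t. (if l = i then f else (%_. 1)) t \<partial>?N) = (\<integral>t. f t \<partial>?N)"
   using I i N.prob_space by (subst prod.remove[of _ i]) auto
  then show ?thesis
   using gauss_integrable_prod[where f = "%l. if l = i then f else (%_. 1)", OF I int]
    gauss_integral_prod[where f = "%l. if l = i then f else (%_. 1)", OF I int] unfolding eq by simp
 qed
 show "integrable (gauss I) (%x. x i)" "(\<integral>x. x i \<partial>gauss I) = 0"
  using one[OF std_normal_moments(1) ij(1)] std_normal_moments(2) by auto
 have "integrable (gauss I) (%x. x i * x j) \<and> (\<integral>x. x i * x j \<partial>gauss I) = (if i = j then 1 else 0)"
 proof (cases "i = j")
  case True
  then show ?thesis using one[OF std_normal_moments(3) ij(1)] std_normal_moments(4) by auto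
 next
  case False
  let ?f = "%l. if l = i \<or> l = j then (%t. t) else (%_. 1 :: real)"
  have eq: "(\<Prod>l\<in>I. ?f l (x l)) = x i * x j" for x
  proof -
   have "(\<Prod>l\<in>I. ?f l (x l)) = x i * (\<Prod>l\<in>I - {i}. ?f l (x l))"
    using I ij by (subst prod.remove[of _ i]) auto
   also have "(\<Prod>l\<in>I - {i}. ?f l (x l)) = x j * (\<Prod>l\<in>I - {i} - {j}. ?f l (x l))"
    using I ij False by (subst prod.remove[of _ j]) auto
   also have "(\<Prod>l\<in>I - {i} - {j}. ?f l (x l)) = 1" by (rule prod.neutral) auto
   finally show ?thesis by simp
  qed
  have int: "integrable ?N (?f l)" for l using std_normal_moments(1) by simp
  have "(\<Prod>l\<in>I. \<integral>t. ?f l t \<partial>?N) = 0"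
   using I ij std_normal_moments(2) by (subst prod_zero_iff) auto
  then show ?thesis
   using gauss_integrable_prod[where f = ?f, OF I int] gauss_integral_prod[where f = ?f, OF I int] False
   unfolding eq by simp
 qed
 then show "integrable (gauss I) (%x. x i * x j)" "(\<integral>x. x i * x j \<partial>gauss I) = (if i = j then 1 else 0)"
  by auto
qed

lemma gauss_linear_square:
 assumes I: "finite I"
 shows "(\<integral>x. (\<Sum>i\<in>I. l i * x i)\<^sup>2 \<partial>gauss I) = (\<Sum>i\<in>I. (l i)\<^sup>2)" "integrable (gauss I) (%x. (\<Sum>i\<in>I. l i * x i)\<^sup>2)"
proof -
 have eq: "(%x. (\<Sum>i\<in>I. l i * x i)\<^sup>2) = (%x. \<Sum>i\<in>I. \<Sum>j\<in>I. l i * l j * (x i * x j))"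
  by (simp add: power2_eq_square sum_product mult_ac)
 show "integrable (gauss I) (%x. (\<Sum>i\<in>I. l i * x i)\<^sup>2)" unfolding eq
  using gauss_coordinate[OF I] by (intro Bochner_Integration.integrable_sum integrable_mult_right) auto
 have "(\<integral>x. (\<Sum>i\<in>I. l i * x i)\<^sup>2 \<partial>gauss I) = (\<Sum>i\<in>I. \<Sum>j\<in>I. l i * l j * (\<integral>x. x i * x j \<partial>gauss I))"
  unfolding eq using gauss_coordinate[OF I]
  by (subst Bochner_Integration.integral_sum; (intro Bochner_Integration.integrable_sum integrable_mult_right)?; simp?)+
 also have "... = (\<Sum>i\<in>I. \<Sum>j\<in>I. if i = j then (l i)\<^sup>2 else 0)"
  by (intro sum.cong refl) (simp add: gauss_coordinate(4)[OF I] power2_eq_square)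
 also have "... = (\<Sum>i\<in>I. (l i)\<^sup>2)" using I by (simp add: sum.delta)
 finally show "(\<integral>x. (\<Sum>i\<in>I. l i * x i)\<^sup>2 \<partial>gauss I) = (\<Sum>i\<in>I. (l i)\<^sup>2)" .
qed

section \<open>The normal tail as a crossing probability\<close>

definition Phi :: "real => real" where "Phi y = std_normal_tail (- y)"

lemma std_normal_tail_diff:
 assumes "a <= x"
 shows "std_normal_tail a - std_normal_tail x = integral {a..x} std_normal_density"
proof -
 let ?N = "density lborel (%t. ennreal (std_normal_density t))"
 interpret N: prob_space ?N by (rule prob_space_normal_density) simp
 have si: "set_integrable lborel {a..x} std_normal_density"
  unfolding set_integrable_def by (intro borel_integrable_compact) (auto simp: normal_density_def intro!: continuous_intros)
 have "{a..} = {a..<x} \<union> {x..}" using assms by auto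
 then have "std_normal_tail a = measure ?N {a..<x} + std_normal_tail x"
  unfolding std_normal_tail_def by (metis (no_types, lifting) N.finite_measure_Union atLeastLessThan_borel disjoint_iff atLeastLessThan_iff atLeast_iff closed_atLeast borel_closed leD sets_density sets_lborel)
 also have "measure ?N {a..<x} = measure ?N {a..x}"
 proof -
  have "emeasure ?N {x} = 0"
   by (subst emeasure_density) (auto simp: nn_integral_indicator_singleton')
  then have "measure ?N {x} = 0" by (simp add: measure_def)
  moreover have "{a..x} = {a..<x} \<union> {x}" using assms by auto
  ultimately show ?thesis using N.finite_measure_Union[of "{a..<x}" "{x}"] by simp
 qed
 also have "measure ?N {a..x} = integral\<^sup>L ?N (indicator {a..x})" by simp
 also have "... = (\<integral>t. std_normal_density t * indicator {a..x} t \<partial>lborel)"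
  by (subst integral_real_density) auto
 also have "... = (LINT t:{a..x}|lborel. std_normal_density t)"
  unfolding set_lebesgue_integral_def by (simp add: mult.commute)
 also have "... = integral {a..x} std_normal_density" by (rule set_borel_integral_eq_integral(2)[OF si])
 finally show ?thesis by simp
qed

text \<open>The tail differs from an integral of the density over a bounded interval by a constant.\<close>

lemma std_normal_tail_deriv: "(std_normal_tail has_real_derivative - std_normal_density x) (at x)"
proof -
 have "continuous_on {x - 1..x + 1} std_normal_density"
  by (auto simp: normal_density_def intro!: continuous_intros)
 then have "((%t. integral {x - 1..t} std_normal_density) has_real_derivative std_normal_density x) (at x within {x - 1..x + 1})"
  by (rule integral_has_real_derivative) auto
 then have "((%t. integral {x - 1..t} std_normal_density) has_real_derivative std_normal_density x) (at x within {x - 1<..<x + 1})"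
  by (rule DERIV_subset) auto
 then have "((%t. integral {x - 1..t} std_normal_density) has_real_derivative std_normal_density x) (at x)"
  by (subst (asm) at_within_open) auto
 then have "((%t. std_normal_tail (x - 1) - integral {x - 1..t} std_normal_density) has_real_derivative - std_normal_density x) (at x)"
  by (auto intro!: derivative_eq_intros)
 then show ?thesis
 proof (rule has_field_derivative_transform_within_open[where S = "{x - 1<..<x + 1}"])
  fix t assume "t \<in> {x - 1<..<x + 1}"
  then show "std_normal_tail (x - 1) - integral {x - 1..t} std_normal_density = std_normal_tail t"
   using std_normal_tail_diff[of "x - 1" t] by simp
 qed auto
qed

lemma std_normal_density_uminus: "std_normal_density (- x) = std_normal_density x"
 by (simp add: normal_density_def)

lemma Phi_deriv [derivative_intros]:
 "(f has_real_derivative f') (at x) ==> ((%x. Phi (f x)) has_real_derivative std_normal_density (f x) * f') (at x)"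
proof -
 assume f: "(f has_real_derivative f') (at x)"
 have "((%x. std_normal_tail (- f x)) has_real_derivative (- std_normal_density (- f x)) * (- f')) (at x)"
  by (rule DERIV_chain2[OF std_normal_tail_deriv DERIV_minus[OF f]])
 then show ?thesis by (simp add: Phi_def[abs_def] std_normal_density_uminus)
qed

lemma density_deriv [derivative_intros]:
 "(f has_real_derivative f') (at x) ==> ((%x. std_normal_density (f x)) has_real_derivative - f x * std_normal_density (f x) * f') (at x)"
proof -
 assume f: "(f has_real_derivative f') (at x)"
 have *: "((%x. c * exp (- (f x)\<^sup>2 / 2)) has_real_derivative - f x * (c * exp (- (f x)\<^sup>2 / 2)) * f') (at x)" for c
  by (auto intro!: derivative_eq_intros f)
 show ?thesis using *[of "1 / sqrt (2 * pi)"] by (simp add: normal_density_def)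
qed

lemma Phi_bounds: "0 <= Phi y" "Phi y <= 1"
proof -
 interpret N: prob_space "density lborel (%t. ennreal (std_normal_density t))" by (rule prob_space_normal_density) simp
 show "0 <= Phi y" "Phi y <= 1" by (auto simp: Phi_def std_normal_tail_def)
qed

lemma Phi_mono: "x <= y ==> Phi x <= Phi y"
 by (rule DERIV_nonneg_imp_nondecreasing[of x y Phi]) (auto intro!: exI derivative_eq_intros)

lemma Phi_measurable [measurable]: "Phi \<in> borel_measurable borel"
 by (intro borel_measurable_mono monoI Phi_mono)

lemma isCont_Phi: "isCont Phi x"
 using Phi_deriv[of "%x. x", OF DERIV_ident] by (auto intro: DERIV_isCont)

lemma Phi_tendsto_0: "(%i. Phi (- real i)) \<longlonglongrightarrow> 0"
proof -
 let ?N = "density lborel (%t. ennreal (std_normal_density t))"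
 interpret N: prob_space ?N by (rule prob_space_normal_density) simp
 have "(%i. measure ?N {real i..}) \<longlonglongrightarrow> measure ?N (\<Inter>i. {real i..})"
  by (rule N.finite_Lim_measure_decseq) (auto simp: decseq_def)
 moreover have "(\<Inter>i. {real i..}) = {}"
 proof (rule equals0I)
  fix x assume x: "x \<in> (\<Inter>i. {real i..})"
  obtain m where "x < real m" using reals_Archimedean2 by blast
  moreover have "x \<in> {real m..}" using x by (rule INT_D) simp
  ultimately show False by simp
 qed
 ultimately show ?thesis by (simp add: Phi_def std_normal_tail_def)
qed

lemma Phi_0: "Phi 0 = 1 / 2"
proof -
 let ?N = "density lborel (%t. ennreal (std_normal_density t))"
 interpret N: prob_space ?N by (rule prob_space_normal_density) simp
 have "((%x. Phi x + Phi (- x)) has_real_derivative 0) (at x)" for x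
  by (auto intro!: derivative_eq_intros simp: std_normal_density_uminus)
 then have const: "Phi x + Phi (- x) = Phi 0 + Phi (- 0)" for x
  using DERIV_const_ratio_const[of 0 x "%x. Phi x + Phi (- x)" 0] by (cases "x = 0") auto
 have "(%i. measure ?N {- real i..}) \<longlonglongrightarrow> measure ?N (\<Union>i. {- real i..})"
  by (rule N.finite_Lim_measure_incseq) (auto simp: incseq_def)
 moreover have "(\<Union>i. {- real i..}) = UNIV"
 proof (rule UNIV_eq_I[symmetric])
  fix x :: real
  obtain m where "- x <= real m" using real_arch_simple by blast
  then show "x \<in> (\<Union>i. {- real i..})" by (intro UN_I[of m]) auto
 qed
 ultimately have 1: "(%i. Phi (real i)) \<longlonglongrightarrow> 1" using N.prob_space by (simp add: Phi_def std_normal_tail_def)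
 have "(%i. Phi (real i) + Phi (- real i)) \<longlonglongrightarrow> 1 + 0" by (rule tendsto_add[OF 1 Phi_tendsto_0])
 then have "(%i :: nat. Phi 0 + Phi (- 0)) \<longlonglongrightarrow> 1 + 0" by (simp only: const[of "real _"])
 then have "Phi 0 + Phi (- 0) = 1" by (simp add: LIMSEQ_const_iff)
 then show ?thesis by simp
qed

lemma density_decay: "(1 + u\<^sup>2)\<^sup>2 * std_normal_density u <= 4"
proof -
 define w where "w = u\<^sup>2 / 2"
 have w: "0 <= w" by (simp add: w_def)
 have "1 + w + w\<^sup>2 / 2 <= exp w" using exp_lower_Taylor_quadratic[OF w] .
 then have "(1 + 2 * w)\<^sup>2 <= 8 * exp w" using w by (simp add: power2_eq_square algebra_simps)
 then have 1: "(1 + u\<^sup>2)\<^sup>2 * exp (- w) <= 8" by (simp add: w_def exp_minus field_simps)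
 have "sqrt 4 <= sqrt (2 * pi)" using pi_ge_two by (intro real_sqrt_le_mono) simp
 then have "2 <= sqrt (2 * pi)" by simp
 then have 2: "1 / sqrt (2 * pi) <= 1 / 2" by (intro divide_left_mono) auto
 have "(1 + u\<^sup>2)\<^sup>2 * std_normal_density u = (1 / sqrt (2 * pi)) * ((1 + u\<^sup>2)\<^sup>2 * exp (- w))"
  by (simp add: normal_density_def w_def)
 also have "... <= 1 / 2 * 8" by (intro mult_mono 1 2) auto
 finally show ?thesis by simp
qed

lemma density_decay':
 shows "(1 + u\<^sup>2) * std_normal_density u <= 4" "\<bar>u\<bar> * std_normal_density u <= 4" "\<bar>u\<bar> * (1 + u\<^sup>2) * std_normal_density u <= 4"
proof -
 have a: "\<bar>u\<bar> <= 1 + u\<^sup>2"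
 proof -
  have "0 <= (\<bar>u\<bar> - 1)\<^sup>2" by simp
  then have "2 * \<bar>u\<bar> <= 1 + u\<^sup>2" by (simp add: power2_eq_square algebra_simps)
  then show ?thesis by linarith
 qed
 have b: "1 + u\<^sup>2 <= (1 + u\<^sup>2)\<^sup>2"
  using mult_right_mono[of 1 "1 + u\<^sup>2" "1 + u\<^sup>2"] by (simp add: power2_eq_square[of "1 + u\<^sup>2"])
 have c: "\<bar>u\<bar> * (1 + u\<^sup>2) <= (1 + u\<^sup>2)\<^sup>2" unfolding power2_eq_square[of "1 + u\<^sup>2"] using a by (intro mult_right_mono) auto
 have d: "x <= (1 + u\<^sup>2)\<^sup>2 ==> x * std_normal_density u <= 4" for x
  using density_decay[of u] mult_right_mono[of x "(1 + u\<^sup>2)\<^sup>2" "std_normal_density u"] by simp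
 show "(1 + u\<^sup>2) * std_normal_density u <= 4" "\<bar>u\<bar> * std_normal_density u <= 4" "\<bar>u\<bar> * (1 + u\<^sup>2) * std_normal_density u <= 4"
  using d[OF b] d[OF order_trans[OF a b]] d[OF c] by auto
qed

text \<open>Taylor expansion of order two; the third derivative of \<open>Phi\<close> is bounded.\<close>

lemma Phi_Taylor: "Phi (x + d) <= Phi x + std_normal_density x * d - x * std_normal_density x * d\<^sup>2 / 2 + \<bar>d\<bar> ^ 3"
proof (cases "d = 0")
 case False
 define D where "D = (%m :: nat. if m = 0 then Phi else if m = 1 then std_normal_density else if m = 2 then (%t. - t * std_normal_density t) else (%t. (t\<^sup>2 - 1) * std_normal_density t))"
 let ?a = "min x (x + d)" and ?b = "max x (x + d)"
 have "\<exists>t. (if x + d < x then x + d < t \<and> t < x else x < t \<and> t < x + d) \<and>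
   Phi (x + d) = (\<Sum>m<3. D m x / fact m * (x + d - x) ^ m) + D 3 t / fact 3 * (x + d - x) ^ 3"
 proof (rule Taylor[where a = ?a and b = ?b])
  show "\<forall>m t. m < 3 \<and> ?a <= t \<and> t <= ?b --> (D m has_real_derivative D (Suc m) t) (at t)"
  proof (intro allI impI, elim conjE)
   fix m :: nat and t :: real assume "m < 3"
   then consider "m = 0" | "m = 1" | "m = 2" by linarith
   then show "(D m has_real_derivative D (Suc m) t) (at t)"
    by cases (auto simp: D_def power2_eq_square algebra_simps intro!: derivative_eq_intros)
  qed
 qed (use False in \<open>auto simp: D_def\<close>)
 then obtain t where t: "Phi (x + d) = (\<Sum>m<3. D m x / fact m * d ^ m) + D 3 t / fact 3 * d ^ 3" by auto
 have "D 3 t / fact 3 * d ^ 3 <= \<bar>d\<bar> ^ 3"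
 proof -
  have "\<bar>D 3 t\<bar> = \<bar>t\<^sup>2 - 1\<bar> * std_normal_density t" by (simp add: D_def abs_mult)
  also have "... <= (1 + t\<^sup>2) * std_normal_density t"
   by (intro mult_right_mono) (auto simp: abs_le_iff)
  also have "... <= 4" by (rule density_decay')
  finally have "\<bar>D 3 t / fact 3\<bar> <= 1" by (simp add: fact_numeral)
  then have "\<bar>D 3 t / fact 3\<bar> * \<bar>d ^ 3\<bar> <= 1 * \<bar>d ^ 3\<bar>" by (intro mult_right_mono) auto
  then show ?thesis using abs_ge_self[of "D 3 t / fact 3 * d ^ 3"] by (simp add: abs_mult power_abs)
 qed
 moreover have "(\<Sum>m<3. D m x / fact m * d ^ m) = Phi x + std_normal_density x * d - x * std_normal_density x * d\<^sup>2 / 2"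
  by (simp add: D_def eval_nat_numeral)
 ultimately show ?thesis using t by simp
qed simp

text \<open>Enlarging the variance \<open>s\<^sup>2\<close> by \<open>v\<close> acts on \<open>Phi (y / s)\<close> like half the second derivative in \<open>y\<close>
times \<open>v\<close>, to first order: the function solves the heat equation.\<close>

lemma Phi_scale_ge:
 assumes s: "0 < s" and v: "0 <= v"
 shows "Phi (y / sqrt (s\<^sup>2 + v)) >= Phi (y / s) - (y / s) * std_normal_density (y / s) * v / (2 * s\<^sup>2) - 2 * v\<^sup>2 / s ^ 4"
proof (cases "v = 0")
 case True
 then show ?thesis using s by simp
next
 case False
 then have v: "0 < v" using v by simp
 define u where "u = (%t. y / sqrt (s\<^sup>2 + t))"
 define D where "D = (%m :: nat. if m = 0 then (%t. Phi (u t)) else if m = 1 then (%t. - u t * std_normal_density (u t) / (2 * (s\<^sup>2 + t)))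
   else (%t. u t * std_normal_density (u t) * (1 - (u t)\<^sup>2) / (4 * (s\<^sup>2 + t)\<^sup>2) + u t * std_normal_density (u t) / (2 * (s\<^sup>2 + t)\<^sup>2)))"
 have pos: "0 < s\<^sup>2 + t" if "0 <= t" for t using s that by (simp add: add_pos_nonneg)
 have alg: "((1 - U\<^sup>2) * N * (U / (2 * r)) * (2 * r) - - U * N * 2) / (2 * r * (2 * r))
   = U * N * (1 - U\<^sup>2) / (4 * r\<^sup>2) + U * N / (2 * r\<^sup>2)" if "r \<noteq> 0" for r U N :: real
 proof -
  define w where "w = U / (2 * r)"
  have "U = w * (2 * r)" using that by (simp add: w_def)
  then have "(1 - U\<^sup>2) * N * w * (2 * r) - - U * N * 2 = U * N * (1 - U\<^sup>2) + U * N * 2" by algebra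
  moreover have "2 * r * (2 * r) = 4 * r\<^sup>2" by algebra
  ultimately have "((1 - U\<^sup>2) * N * w * (2 * r) - - U * N * 2) / (2 * r * (2 * r))
    = U * N * (1 - U\<^sup>2) / (4 * r\<^sup>2) + U * N * 2 / (4 * r\<^sup>2)" by (simp only: add_divide_distrib)
  moreover have "x * 2 / (4 * y) = x / (2 * y)" for x y :: real by simp
  ultimately show ?thesis unfolding w_def by (simp only:)
 qed
 have ud: "(u has_real_derivative - u t / (2 * (s\<^sup>2 + t))) (at t)" if "0 <= t" for t
 proof -
  define q where "q = sqrt (s\<^sup>2 + t)"
  have q: "0 < q" "q * q = s\<^sup>2 + t" using pos[OF that] by (auto simp: q_def)
  have "((%t. s\<^sup>2 + t) has_real_derivative 1) (at t)" by (auto intro!: derivative_eq_intros)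
  from DERIV_chain2[OF DERIV_real_sqrt[OF pos[OF that]] this]
  have "((%t. sqrt (s\<^sup>2 + t)) has_real_derivative inverse q / 2 * 1) (at t)" unfolding q_def .
  from DERIV_divide[OF DERIV_const[of y] this]
  have "((%t. y / sqrt (s\<^sup>2 + t)) has_real_derivative (0 * q - y * (inverse q / 2 * 1)) / (q * q)) (at t)"
   using q(1) by (simp add: q_def)
  moreover have "(0 * a - y * (inverse a / 2 * 1)) / b = - (y / a) / (2 * b)" for a b :: real
   by (simp add: inverse_eq_divide mult_ac)
  note this[of q "q * q"]
  ultimately have "((%t. y / sqrt (s\<^sup>2 + t)) has_real_derivative - (y / q) / (2 * (q * q))) (at t)" by metis
  then show ?thesis unfolding q(2) by (simp add: u_def[abs_def] q_def)
 qed
 have "\<exists>t. (if v < 0 then v < t \<and> t < 0 else 0 < t \<and> t < v) \<and>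
   Phi (u v) = (\<Sum>m<2. D m 0 / fact m * (v - 0) ^ m) + D 2 t / fact 2 * (v - 0) ^ 2"
 proof (rule Taylor[where a = 0 and b = v])
  show "\<forall>m t. m < 2 \<and> 0 <= t \<and> t <= v --> (D m has_real_derivative D (Suc m) t) (at t)"
  proof (intro allI impI, elim conjE)
   fix m :: nat and t :: real assume m: "m < 2" and t: "0 <= t"
   define r where "r = s\<^sup>2 + t"
   have r: "0 < r" "r \<noteq> 0" using pos[OF t] by (auto simp: r_def)
   consider "m = 0" | "m = 1" using m by linarith
   then show "(D m has_real_derivative D (Suc m) t) (at t)"
   proof cases
    case 1
    have "((%t. Phi (u t)) has_real_derivative std_normal_density (u t) * (- u t / (2 * (s\<^sup>2 + t)))) (at t)"
     by (rule Phi_deriv[OF ud[OF t]])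
    then show ?thesis using 1 by (simp add: D_def mult.commute)
   next
    case 2
    have num: "((%t. - u t * std_normal_density (u t)) has_real_derivative
      (1 - (u t)\<^sup>2) * std_normal_density (u t) * (u t / (2 * (s\<^sup>2 + t)))) (at t)"
     by (rule DERIV_cong, rule DERIV_mult[OF DERIV_minus[OF ud[OF t]] density_deriv[OF ud[OF t]]])
      (simp add: power2_eq_square algebra_simps)
    have den: "((%t. 2 * (s\<^sup>2 + t)) has_real_derivative 2) (at t)" by (auto intro!: derivative_eq_intros)
    have "((%t. - u t * std_normal_density (u t) / (2 * (s\<^sup>2 + t))) has_real_derivative D 2 t) (at t)"
    proof (rule DERIV_cong, rule DERIV_divide[OF num den])
     show "2 * (s\<^sup>2 + t) \<noteq> 0" using r by (simp add: r_def)
     show "((1 - (u t)\<^sup>2) * std_normal_density (u t) * (u t / (2 * (s\<^sup>2 + t))) * (2 * (s\<^sup>2 + t)) - - u t * std_normal_density (u t) * 2) /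
       (2 * (s\<^sup>2 + t) * (2 * (s\<^sup>2 + t))) = D 2 t"
      using alg[of "s\<^sup>2 + t" "u t" "std_normal_density (u t)"] r unfolding r_def by (simp add: D_def)
    qed
    then show ?thesis using 2 by (simp add: D_def numeral_2_eq_2)
   qed
  qed
 qed (use v in \<open>auto simp: D_def\<close>)
 then obtain t where t: "0 < t" "Phi (u v) = (\<Sum>m<2. D m 0 / fact m * v ^ m) + D 2 t / fact 2 * v ^ 2" using v by auto
 have rt: "s\<^sup>2 <= s\<^sup>2 + t" "0 < s\<^sup>2" using t s by auto
 have "\<bar>D 2 t\<bar> <= 3 / (s\<^sup>2 + t)\<^sup>2"
 proof -
  have "\<bar>D 2 t\<bar> <= \<bar>u t * std_normal_density (u t) * (1 - (u t)\<^sup>2) / (4 * (s\<^sup>2 + t)\<^sup>2)\<bar> + \<bar>u t * std_normal_density (u t) / (2 * (s\<^sup>2 + t)\<^sup>2)\<bar>"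
  proof -
   have "D 2 t = u t * std_normal_density (u t) * (1 - (u t)\<^sup>2) / (4 * (s\<^sup>2 + t)\<^sup>2) + u t * std_normal_density (u t) / (2 * (s\<^sup>2 + t)\<^sup>2)"
    by (simp add: D_def)
   then show ?thesis by (simp only: abs_triangle_ineq)
  qed
  also have "... = (\<bar>u t\<bar> * \<bar>1 - (u t)\<^sup>2\<bar> * std_normal_density (u t)) / (4 * (s\<^sup>2 + t)\<^sup>2) + (\<bar>u t\<bar> * std_normal_density (u t)) / (2 * (s\<^sup>2 + t)\<^sup>2)"
   by (simp add: abs_mult mult_ac)
  also have "... <= 4 / (4 * (s\<^sup>2 + t)\<^sup>2) + 4 / (2 * (s\<^sup>2 + t)\<^sup>2)"
  proof (intro add_mono divide_right_mono)
   have "\<bar>u t\<bar> * \<bar>1 - (u t)\<^sup>2\<bar> * std_normal_density (u t) <= \<bar>u t\<bar> * (1 + (u t)\<^sup>2) * std_normal_density (u t)"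
    by (intro mult_right_mono mult_left_mono) (auto simp: abs_le_iff)
   then show "\<bar>u t\<bar> * \<bar>1 - (u t)\<^sup>2\<bar> * std_normal_density (u t) <= 4" using density_decay'(3)[of "u t"] by linarith
  qed (use density_decay'(2) in auto)
  also have "... = 3 / (s\<^sup>2 + t)\<^sup>2" by simp
  finally show ?thesis .
 qed
 also have "... <= 3 / (s\<^sup>2)\<^sup>2"
  using rt s less_le_trans[OF rt(2,1)] by (intro divide_left_mono power_mono mult_pos_pos zero_less_power) auto
 finally have "- (4 / s ^ 4) <= D 2 t" using s by (simp add: abs_le_iff power2_eq_square eval_nat_numeral divide_right_mono) 
 then have "- (4 / s ^ 4) / fact 2 * v ^ 2 <= D 2 t / fact 2 * v ^ 2" by (intro mult_right_mono divide_right_mono) auto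
 moreover have "(\<Sum>m<2. D m 0 / fact m * v ^ m) = Phi (y / s) - (y / s) * std_normal_density (y / s) * v / (2 * s\<^sup>2)"
  using s by (simp add: D_def u_def eval_nat_numeral)
 ultimately show ?thesis using t by (simp add: u_def)
qed

text \<open>For \<open>y <= 0\<close> this is the probability that a Brownian motion started at \<open>y\<close> reaches 0 before time \<open>s\<^sup>2\<close>, by the
reflection principle.\<close>

definition V :: "real => real => real" where "V s y = min 1 (2 * Phi (y / s))"

lemma V_bounds: "0 <= V s y" "V s y <= 1" using Phi_bounds by (auto simp: V_def)

lemma V_mono: "0 < s ==> x <= y ==> V s x <= V s y"
 unfolding V_def by (intro min.mono mult_left_mono Phi_mono divide_right_mono) auto

lemma V_nonneg_arg: "0 < s ==> 0 <= y ==> V s y = 1"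
 using Phi_mono[of 0 "y / s"] Phi_0 by (simp add: V_def)

lemma V_measurable [measurable]: "V s \<in> borel_measurable borel"
 unfolding V_def[abs_def] by measurable

text \<open>A centred step of variance about \<open>v\<close> followed by time \<open>s\<^sup>2\<close> reaches 0 no more likely than time \<open>s\<^sup>2 + v\<close> allows, up to
third-order errors. On the negative half-line this is the heat equation for \<open>2 * Phi (y / s)\<close>; elsewhere the value is already the maximal one.\<close>

theorem V_one_step:
 assumes "prob_space M" and D: "integrable M D" "(\<integral>x. D x \<partial>M) = 0" and D2: "integrable M (%x. (D x)\<^sup>2)" "(\<integral>x. (D x)\<^sup>2 \<partial>M) <= v + e"
  and D3: "integrable M (%x. \<bar>D x\<bar> ^ 3)" "(\<integral>x. \<bar>D x\<bar> ^ 3 \<partial>M) <= t"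
  and s: "0 < s" and v: "0 <= v" and e: "0 <= e" and t: "0 <= t"
 shows "(\<integral>x. V s (y + D x) \<partial>M) <= V (sqrt (s\<^sup>2 + v)) y + 4 * e / s\<^sup>2 + 2 * t / s ^ 3 + 4 * v\<^sup>2 / s ^ 4"
proof -
 interpret prob_space M by fact
 have Dm [measurable]: "D \<in> borel_measurable M" using D by simp
 have intV: "integrable M (%x. V s (y + D x))"
  by (rule integrable_const_bound[of _ 1]) (auto simp: abs_of_nonneg V_bounds)
 have err: "0 <= 4 * e / s\<^sup>2 + 2 * t / s ^ 3 + 4 * v\<^sup>2 / s ^ 4" using s e t by simp
 show ?thesis
 proof (cases "0 <= y")
  case True
  have "0 < s\<^sup>2 + v" using s v by (simp add: add_pos_nonneg)
  then have "V (sqrt (s\<^sup>2 + v)) y = 1" using True by (intro V_nonneg_arg) auto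
  moreover have "(\<integral>x. V s (y + D x) \<partial>M) <= (\<integral>x. 1 \<partial>M)" by (intro integral_mono intV) (auto simp: V_bounds)
  ultimately show ?thesis using err by (simp add: prob_space)
 next
  case False
  define u where "u = y / s"
  define k where "k = - u * std_normal_density u"
  have u: "u < 0" using False s by (simp add: u_def divide_less_0_iff)
  have k: "0 <= k" "k <= 4" using u density_decay'(2)[of u] by (auto simp: k_def mult_nonpos_nonneg)
  let ?U = "%x. 2 * Phi u + 2 * std_normal_density u / s * D x + k / s\<^sup>2 * (D x)\<^sup>2 + 2 / s ^ 3 * \<bar>D x\<bar> ^ 3"
  have "(\<integral>x. V s (y + D x) \<partial>M) <= (\<integral>x. ?U x \<partial>M)"
  proof (rule integral_mono[OF intV])
   show "integrable M ?U" using D(1) D2(1) D3(1) by (intro Bochner_Integration.integrable_add integrable_mult_right) auto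
   fix x
   have "V s (y + D x) <= 2 * Phi (u + D x / s)" by (simp add: V_def u_def add_divide_distrib)
   also have "... <= 2 * (Phi u + std_normal_density u * (D x / s) - u * std_normal_density u * (D x / s)\<^sup>2 / 2 + \<bar>D x / s\<bar> ^ 3)"
    by (intro mult_left_mono Phi_Taylor) auto
   also have "... = ?U x" using s by (simp add: k_def power_divide abs_divide algebra_simps)
   finally show "V s (y + D x) <= ?U x" .
  qed
  also have "... = 2 * Phi u + k / s\<^sup>2 * (\<integral>x. (D x)\<^sup>2 \<partial>M) + 2 / s ^ 3 * (\<integral>x. \<bar>D x\<bar> ^ 3 \<partial>M)"
   using D D2(1) D3(1) by (simp add: prob_space)
  also have "... <= 2 * Phi u + k / s\<^sup>2 * (v + e) + 2 / s ^ 3 * t"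
   using s k D2(2) D3(2) by (intro add_mono mult_left_mono) auto
  finally have 1: "(\<integral>x. V s (y + D x) \<partial>M) <= 2 * Phi u + k / s\<^sup>2 * (v + e) + 2 / s ^ 3 * t" .
  have "2 * Phi (y / sqrt (s\<^sup>2 + v)) >= 2 * Phi u + k * v / s\<^sup>2 - 4 * v\<^sup>2 / s ^ 4"
  proof -
   have "2 * (Phi u - u * std_normal_density u * v / (2 * s\<^sup>2) - 2 * v\<^sup>2 / s ^ 4) <= 2 * Phi (y / sqrt (s\<^sup>2 + v))"
    using Phi_scale_ge[OF s v, of y, folded u_def] by (rule mult_left_mono) simp
   moreover have "2 * (Phi u - u * std_normal_density u * v / (2 * s\<^sup>2) - 2 * v\<^sup>2 / s ^ 4)
     = 2 * Phi u + k * v / s\<^sup>2 - 4 * v\<^sup>2 / s ^ 4"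
    by (simp add: k_def right_diff_distrib)
   ultimately show ?thesis by simp
  qed
  moreover have "k / s\<^sup>2 * e <= 4 * e / s\<^sup>2" using k e s by (simp add: divide_right_mono mult_right_mono)
  ultimately have "(\<integral>x. V s (y + D x) \<partial>M) <= 2 * Phi (y / sqrt (s\<^sup>2 + v)) + 4 * e / s\<^sup>2 + 2 * t / s ^ 3 + 4 * v\<^sup>2 / s ^ 4"
   using 1 by (simp add: distrib_left)
  moreover have "(\<integral>x. V s (y + D x) \<partial>M) <= (\<integral>x. 1 \<partial>M)" by (intro integral_mono intV) (auto simp: V_bounds)
  ultimately show ?thesis using err by (simp add: V_def prob_space min_def)
 qed
qed

section \<open>Linear images and translations of Gaussian measures\<close>

lemma gauss_space [simp]: "space (gauss I) = PiE I (%_. UNIV)"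
 using sets_eq_imp_space_eq[OF sets_gauss[of I]] by (simp add: space_PiM)

lemma component_gauss: "i \<in> I ==> (%x. x i) \<in> borel_measurable (gauss I)"
 using measurable_component_singleton[of i I "%_. borel"] measurable_cong_sets[OF sets_gauss refl] by blast

lemma iexp_integrable:
 assumes "prob_space M" "f \<in> borel_measurable M"
 shows "integrable M (%x. iexp (f x))"
proof -
 interpret prob_space M by fact
 have "(%x. iexp (f x)) \<in> borel_measurable M"
  by (rule measurable_compose[OF assms(2), where g = "%r. iexp r"]) measurable
 then show ?thesis by (intro integrable_const_bound[of _ 1]) simp_all
qed

lemma linear_image_measurable:
 "(%x. \<lambda>j\<in>J. \<Sum>i\<in>I. T j i * x i) \<in> measurable (gauss I) (PiM J (%_. borel))"
 by (intro measurable_restrict borel_measurable_sum borel_measurable_times borel_measurable_const component_gauss)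

lemma gauss_linear_image_char:
 assumes I: "finite I" and J: "finite J"
 shows "(\<integral>y. iexp (\<Sum>j\<in>J. u j * y j) \<partial>distr (gauss I) (PiM J (%_. borel)) (%x. \<lambda>j\<in>J. \<Sum>i\<in>I. T j i * x i))
  = exp (- (\<Sum>j\<in>J. \<Sum>k\<in>J. u j * u k * (\<Sum>i\<in>I. T j i * T k i)) / 2)"
proof -
 have ym: "(%y. iexp (\<Sum>j\<in>J. u j * y j)) \<in> borel_measurable (PiM J (%_. borel))"
  by (rule measurable_compose[where N = borel and g = "%r. iexp r"])
   (intro borel_measurable_sum borel_measurable_times borel_measurable_const measurable_component_singleton, measurable)
 have "(\<integral>y. iexp (\<Sum>j\<in>J. u j * y j) \<partial>distr (gauss I) (PiM J (%_. borel)) (%x. \<lambda>j\<in>J. \<Sum>i\<in>I. T j i * x i))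
  = (\<integral>x. iexp (\<Sum>j\<in>J. u j * (\<lambda>j\<in>J. \<Sum>i\<in>I. T j i * x i) j) \<partial>gauss I)"
  by (rule integral_distr[OF linear_image_measurable ym])
 also have "... = (\<integral>x. iexp (\<Sum>i\<in>I. (\<Sum>j\<in>J. u j * T j i) * x i) \<partial>gauss I)"
 proof (rule Bochner_Integration.integral_cong[OF refl])
  fix x
  have "(\<Sum>j\<in>J. u j * (\<lambda>j\<in>J. \<Sum>i\<in>I. T j i * x i) j) = (\<Sum>j\<in>J. \<Sum>i\<in>I. u j * T j i * x i)"
   by (intro sum.cong refl) (simp add: sum_distrib_left mult_ac)
  also have "... = (\<Sum>i\<in>I. (\<Sum>j\<in>J. u j * T j i) * x i)"
   by (subst sum.swap) (simp add: sum_distrib_right)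
  finally show "iexp (\<Sum>j\<in>J. u j * (\<lambda>j\<in>J. \<Sum>i\<in>I. T j i * x i) j) = iexp (\<Sum>i\<in>I. (\<Sum>j\<in>J. u j * T j i) * x i)"
   by (simp only:)
 qed
 also have "... = exp (- (\<Sum>i\<in>I. (\<Sum>j\<in>J. u j * T j i)\<^sup>2) / 2)" by (rule gauss_char[OF I])
 also have "(\<Sum>i\<in>I. (\<Sum>j\<in>J. u j * T j i)\<^sup>2) = (\<Sum>j\<in>J. \<Sum>k\<in>J. u j * u k * (\<Sum>i\<in>I. T j i * T k i))"
 proof -
  have "(\<Sum>i\<in>I. (\<Sum>j\<in>J. u j * T j i)\<^sup>2) = (\<Sum>i\<in>I. \<Sum>j\<in>J. \<Sum>k\<in>J. u j * u k * (T j i * T k i))"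
   unfolding power2_eq_square sum_product by (intro sum.cong refl) (simp add: mult_ac)
  also have "... = (\<Sum>j\<in>J. \<Sum>i\<in>I. \<Sum>k\<in>J. u j * u k * (T j i * T k i))" by (rule sum.swap)
  also have "... = (\<Sum>j\<in>J. \<Sum>k\<in>J. \<Sum>i\<in>I. u j * u k * (T j i * T k i))" by (intro sum.cong refl sum.swap)
  finally show ?thesis by (simp only: sum_distrib_left)
 qed
 finally show ?thesis .
qed

text \<open>A centred Gaussian law is determined by its covariance.\<close>

theorem gauss_linear_images_eq:
 assumes "finite I" "finite I'" "finite J"
  and cov: "!!j k. j \<in> J ==> k \<in> J ==> (\<Sum>i\<in>I. T j i * T k i) = (\<Sum>i\<in>I'. T' j i * T' k i)"
 shows "distr (gauss I) (PiM J (%_. borel)) (%x. \<lambda>j\<in>J. \<Sum>i\<in>I. T j i * x i)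
  = distr (gauss I') (PiM J (%_. borel)) (%x. \<lambda>j\<in>J. \<Sum>i\<in>I'. T' j i * x i)"
proof (rule PiM_eq_if_characteristic_functions_eq[OF assms(3)])
 show "prob_space (distr (gauss I) (PiM J (%_. borel)) (%x. \<lambda>j\<in>J. \<Sum>i\<in>I. T j i * x i))"
  "prob_space (distr (gauss I') (PiM J (%_. borel)) (%x. \<lambda>j\<in>J. \<Sum>i\<in>I'. T' j i * x i))"
  by (intro prob_space.prob_space_distr prob_space_gauss linear_image_measurable)+
 fix u
 have "(\<Sum>j\<in>J. \<Sum>k\<in>J. u j * u k * (\<Sum>i\<in>I. T j i * T k i)) = (\<Sum>j\<in>J. \<Sum>k\<in>J. u j * u k * (\<Sum>i\<in>I'. T' j i * T' k i))"
  by (intro sum.cong refl) (simp add: cov)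
 then show "(\<integral>y. iexp (\<Sum>j\<in>J. u j * y j) \<partial>distr (gauss I) (PiM J (%_. borel)) (%x. \<lambda>j\<in>J. \<Sum>i\<in>I. T j i * x i))
  = (\<integral>y. iexp (\<Sum>j\<in>J. u j * y j) \<partial>distr (gauss I') (PiM J (%_. borel)) (%x. \<lambda>j\<in>J. \<Sum>i\<in>I'. T' j i * x i))"
  unfolding gauss_linear_image_char[OF assms(1,3)] gauss_linear_image_char[OF assms(2,3)] by (simp only:)
qed simp_all

lemma gauss_convolution_law:
 assumes I: "finite I"
 shows "distr (gauss I \<Otimes>\<^sub>M gauss I) (PiM I (%_. borel)) (%q. \<lambda>i\<in>I. h * fst q i + t * snd q i)
  = distr (gauss I) (PiM I (%_. borel)) (%z. \<lambda>i\<in>I. sqrt (h\<^sup>2 + t\<^sup>2) * z i)"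
proof (rule PiM_eq_if_characteristic_functions_eq[OF I])
 interpret G: prob_space "gauss I" by simp
 interpret GG: pair_prob_space "gauss I" "gauss I" ..
 have f: "(%q. fst q i) \<in> borel_measurable (gauss I \<Otimes>\<^sub>M gauss I)" "(%q. snd q i) \<in> borel_measurable (gauss I \<Otimes>\<^sub>M gauss I)" if "i \<in> I" for i
  by (rule measurable_compose[OF measurable_fst component_gauss[OF that]], rule measurable_compose[OF measurable_snd component_gauss[OF that]])
 have m1: "(%q. \<lambda>i\<in>I. h * fst q i + t * snd q i) \<in> measurable (gauss I \<Otimes>\<^sub>M gauss I) (PiM I (%_. borel))"
  by (intro measurable_restrict borel_measurable_add borel_measurable_times borel_measurable_const f)
 have m2: "(%z. \<lambda>i\<in>I. r * z i) \<in> measurable (gauss I) (PiM I (%_. borel))" for r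
  by (intro measurable_restrict borel_measurable_times borel_measurable_const component_gauss)
 show "prob_space (distr (gauss I \<Otimes>\<^sub>M gauss I) (PiM I (%_. borel)) (%q. \<lambda>i\<in>I. h * fst q i + t * snd q i))"
  by (rule GG.prob_space_distr[OF m1])
 show "prob_space (distr (gauss I) (PiM I (%_. borel)) (%z. \<lambda>i\<in>I. sqrt (h\<^sup>2 + t\<^sup>2) * z i))"
  by (rule G.prob_space_distr[OF m2])
 fix u
 have ym: "(%y. iexp (\<Sum>j\<in>I. u j * y j)) \<in> borel_measurable (PiM I (%_. borel))"
  by (rule measurable_compose[where N = borel and g = "%r. iexp r"])
   (intro borel_measurable_sum borel_measurable_times borel_measurable_const measurable_component_singleton, measurable)
 have lin: "(\<integral>z. iexp (\<Sum>i\<in>I. (u i * r) * z i) \<partial>gauss I) = exp (- (r\<^sup>2 * (\<Sum>i\<in>I. (u i)\<^sup>2)) / 2)" for r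
  unfolding gauss_char[OF I] by (simp add: power_mult_distrib sum_distrib_left mult_ac)
 have split: "iexp (\<Sum>i\<in>I. u i * (\<lambda>i\<in>I. h * fst q i + t * snd q i) i)
   = iexp (\<Sum>i\<in>I. (u i * h) * fst q i) * iexp (\<Sum>i\<in>I. (u i * t) * snd q i)" for q
 proof -
  have "(\<Sum>i\<in>I. u i * (\<lambda>i\<in>I. h * fst q i + t * snd q i) i) = (\<Sum>i\<in>I. (u i * h) * fst q i) + (\<Sum>i\<in>I. (u i * t) * snd q i)"
   unfolding sum.distrib[symmetric] by (intro sum.cong refl) (simp add: algebra_simps)
  then show ?thesis by (simp only: of_real_add distrib_left exp_add)
 qed
 have "(\<integral>y. iexp (\<Sum>j\<in>I. u j * y j) \<partial>distr (gauss I \<Otimes>\<^sub>M gauss I) (PiM I (%_. borel)) (%q. \<lambda>i\<in>I. h * fst q i + t * snd q i))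
   = (\<integral>q. iexp (\<Sum>i\<in>I. (u i * h) * fst q i) * iexp (\<Sum>i\<in>I. (u i * t) * snd q i) \<partial>(gauss I \<Otimes>\<^sub>M gauss I))"
  unfolding integral_distr[OF m1 ym] split ..
 also have "... = (\<integral>z. \<integral>z'. iexp (\<Sum>i\<in>I. (u i * h) * z i) * iexp (\<Sum>i\<in>I. (u i * t) * z' i) \<partial>gauss I \<partial>gauss I)"
 proof -
  have "integrable (gauss I \<Otimes>\<^sub>M gauss I) (%q. iexp ((\<Sum>i\<in>I. (u i * h) * fst q i) + (\<Sum>i\<in>I. (u i * t) * snd q i)))"
   by (intro iexp_integrable GG.prob_space_axioms borel_measurable_add borel_measurable_sum borel_measurable_times borel_measurable_const f)
  then have "integrable (gauss I \<Otimes>\<^sub>M gauss I) (%q. iexp (\<Sum>i\<in>I. (u i * h) * fst q i) * iexp (\<Sum>i\<in>I. (u i * t) * snd q i))"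
   by (simp only: of_real_add distrib_left exp_add)
  from GG.integral_fst'[OF this] show ?thesis by simp
 qed
 also have "... = exp (- (h\<^sup>2 * (\<Sum>i\<in>I. (u i)\<^sup>2)) / 2) * exp (- (t\<^sup>2 * (\<Sum>i\<in>I. (u i)\<^sup>2)) / 2)"
  using lin[of h] lin[of t] by simp
 also have "... = exp (- ((sqrt (h\<^sup>2 + t\<^sup>2))\<^sup>2 * (\<Sum>i\<in>I. (u i)\<^sup>2)) / 2)"
  by (simp add: exp_add[symmetric] of_real_mult[symmetric] distrib_right add_divide_distrib del: of_real_mult)
 also have "... = (\<integral>z. iexp (\<Sum>i\<in>I. (u i * sqrt (h\<^sup>2 + t\<^sup>2)) * z i) \<partial>gauss I)" by (simp only: lin)
 also have "... = (\<integral>z. iexp (\<Sum>i\<in>I. u i * (\<lambda>i\<in>I. sqrt (h\<^sup>2 + t\<^sup>2) * z i) i) \<partial>gauss I)"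
  by (intro Bochner_Integration.integral_cong refl arg_cong[where f = "%s. iexp s"] sum.cong) simp
 also have "... = (\<integral>y. iexp (\<Sum>j\<in>I. u j * y j) \<partial>distr (gauss I) (PiM I (%_. borel)) (%z. \<lambda>i\<in>I. sqrt (h\<^sup>2 + t\<^sup>2) * z i))"
  by (rule integral_distr[OF m2 ym, symmetric])
 finally show "(\<integral>y. iexp (\<Sum>j\<in>I. u j * y j) \<partial>distr (gauss I \<Otimes>\<^sub>M gauss I) (PiM I (%_. borel)) (%q. \<lambda>i\<in>I. h * fst q i + t * snd q i))
  = (\<integral>y. iexp (\<Sum>j\<in>I. u j * y j) \<partial>distr (gauss I) (PiM I (%_. borel)) (%z. \<lambda>i\<in>I. sqrt (h\<^sup>2 + t\<^sup>2) * z i))" .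
qed simp_all

text \<open>Independent Gaussian increments add up to a Gaussian increment with the variances added.\<close>

lemma gauss_convolution:
 fixes f :: "('i => real) => real"
 assumes I: "finite I" and f: "f \<in> borel_measurable (PiM I (%_. borel))"
  and int: "integrable (gauss I) (%z. f (\<lambda>i\<in>I. sqrt (h\<^sup>2 + t\<^sup>2) * z i))"
 shows "(\<integral>z. \<integral>z'. f (\<lambda>i\<in>I. h * z i + t * z' i) \<partial>gauss I \<partial>gauss I) = (\<integral>z. f (\<lambda>i\<in>I. sqrt (h\<^sup>2 + t\<^sup>2) * z i) \<partial>gauss I)"
  "integrable (gauss I) (%z. \<integral>z'. f (\<lambda>i\<in>I. h * z i + t * z' i) \<partial>gauss I)"
proof -
 interpret G: prob_space "gauss I" by simp
 interpret GG: pair_prob_space "gauss I" "gauss I" ..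
 have fm: "(%q. fst q i) \<in> borel_measurable (gauss I \<Otimes>\<^sub>M gauss I)" "(%q. snd q i) \<in> borel_measurable (gauss I \<Otimes>\<^sub>M gauss I)" if "i \<in> I" for i
  by (rule measurable_compose[OF measurable_fst component_gauss[OF that]], rule measurable_compose[OF measurable_snd component_gauss[OF that]])
 have m1: "(%q. \<lambda>i\<in>I. h * fst q i + t * snd q i) \<in> measurable (gauss I \<Otimes>\<^sub>M gauss I) (PiM I (%_. borel))"
  by (intro measurable_restrict borel_measurable_add borel_measurable_times borel_measurable_const fm)
 have m2: "(%z. \<lambda>i\<in>I. sqrt (h\<^sup>2 + t\<^sup>2) * z i) \<in> measurable (gauss I) (PiM I (%_. borel))"
  by (intro measurable_restrict borel_measurable_times borel_measurable_const component_gauss)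
 have "integrable (distr (gauss I) (PiM I (%_. borel)) (%z. \<lambda>i\<in>I. sqrt (h\<^sup>2 + t\<^sup>2) * z i)) f"
  using int by (simp add: integrable_distr_eq[OF m2 f])
 then have i1: "integrable (gauss I \<Otimes>\<^sub>M gauss I) (%q. f (\<lambda>i\<in>I. h * fst q i + t * snd q i))"
  unfolding gauss_convolution_law[OF I, symmetric] by (simp add: integrable_distr_eq[OF m1 f])
 have "(\<integral>q. f (\<lambda>i\<in>I. h * fst q i + t * snd q i) \<partial>(gauss I \<Otimes>\<^sub>M gauss I)) = (\<integral>z. f (\<lambda>i\<in>I. sqrt (h\<^sup>2 + t\<^sup>2) * z i) \<partial>gauss I)"
  using integral_distr[OF m1 f] integral_distr[OF m2 f] unfolding gauss_convolution_law[OF I] by simp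
 then show "(\<integral>z. \<integral>z'. f (\<lambda>i\<in>I. h * z i + t * z' i) \<partial>gauss I \<partial>gauss I) = (\<integral>z. f (\<lambda>i\<in>I. sqrt (h\<^sup>2 + t\<^sup>2) * z i) \<partial>gauss I)"
  using GG.integral_fst'[OF i1] by simp
 show "integrable (gauss I) (%z. \<integral>z'. f (\<lambda>i\<in>I. h * z i + t * z' i) \<partial>gauss I)"
  using GG.integrable_fst'[OF i1] by simp
qed

lemma std_normal_shift:
 assumes A: "A \<in> sets borel"
 defines "N \<equiv> density lborel (%t. ennreal (std_normal_density t))"
 shows "emeasure N ((%t. t + b) -` A) = (\<integral>\<^sup>+t. ennreal (exp (b * t - b\<^sup>2 / 2)) * indicator A t \<partial>N)"
proof -
 have "(\<integral>\<^sup>+t. ennreal (exp (b * t - b\<^sup>2 / 2)) * indicator A t \<partial>N)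
   = (\<integral>\<^sup>+t. ennreal (std_normal_density t) * (ennreal (exp (b * t - b\<^sup>2 / 2)) * indicator A t) \<partial>lborel)"
  unfolding N_def using A by (intro nn_integral_density) auto
 also have "... = (\<integral>\<^sup>+t. ennreal (std_normal_density (t - b)) * indicator A t \<partial>lborel)"
 proof (rule nn_integral_cong)
  fix t
  have "std_normal_density t * exp (b * t - b\<^sup>2 / 2) = std_normal_density (t - b)"
   by (simp add: normal_density_def exp_add[symmetric] power2_eq_square field_simps)
  then show "ennreal (std_normal_density t) * (ennreal (exp (b * t - b\<^sup>2 / 2)) * indicator A t) = ennreal (std_normal_density (t - b)) * indicator A t"
   by (simp add: mult.assoc[symmetric] ennreal_mult[symmetric])
 qed
 also have "... = (\<integral>\<^sup>+t. ennreal (std_normal_density t) * indicator A (t + b) \<partial>lborel)"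
  using A by (subst nn_integral_real_affine[where c = 1 and t = b]) (auto simp: add.commute)
 also have "... = (\<integral>\<^sup>+t. indicator ((%t. t + b) -` A) t \<partial>N)"
  unfolding N_def using A by (subst nn_integral_density) (auto simp: indicator_def measurable_sets_borel[of "%t. t + b"] intro!: nn_integral_cong)
 also have "... = emeasure N ((%t. t + b) -` A)"
  using A measurable_sets_borel[of "%t. t + b" borel A] by (subst nn_integral_indicator) (auto simp: N_def)
 finally show ?thesis by simp
qed

text \<open>The formula of Cameron and Martin, coordinate by coordinate.\<close>

lemma gauss_shift_law:
 assumes I: "finite I"
 shows "distr (gauss I) (PiM I (%_. borel)) (%z. \<lambda>i\<in>I. z i + b i)
  = density (gauss I) (%z. ennreal (exp ((\<Sum>i\<in>I. b i * z i) - (\<Sum>i\<in>I. (b i)\<^sup>2) / 2)))"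
proof -
 let ?N = "density lborel (%t. ennreal (std_normal_density t))"
 have m: "(%z. \<lambda>i\<in>I. z i + b i) \<in> measurable (gauss I) (PiM I (%_. borel))"
  by (intro measurable_restrict borel_measurable_add borel_measurable_const component_gauss)
 have dm: "(%z. ennreal (exp ((\<Sum>i\<in>I. b i * z i) - (\<Sum>i\<in>I. (b i)\<^sup>2) / 2))) \<in> borel_measurable (gauss I)"
  by (intro measurable_compose[OF _ measurable_ennreal] measurable_compose[OF _ borel_measurable_exp] borel_measurable_diff
    borel_measurable_sum borel_measurable_times borel_measurable_const component_gauss)
 show ?thesis
 proof (rule measure_eqI_PiM_finite[OF I])
  fix A :: "'a => real set" assume A: "!!i. i \<in> I ==> A i \<in> sets borel"
  have PA: "PiE I A \<in> sets (PiM I (%_. borel))" using A by (intro sets_PiM_I_finite[OF I])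
  have Ab: "(%t. t + b i) -` A i \<in> sets borel" if "i \<in> I" for i
   using measurable_sets_borel[of "%t. t + b i" borel "A i"] A[OF that] by simp
  have "emeasure (distr (gauss I) (PiM I (%_. borel)) (%z. \<lambda>i\<in>I. z i + b i)) (PiE I A) = emeasure (gauss I) (PiE I (%i. (%t. t + b i) -` A i))"
   unfolding emeasure_distr[OF m PA] by (intro arg_cong[where f = "emeasure _"]) (auto simp: PiE_iff)
  also have "... = (\<Prod>i\<in>I. emeasure ?N ((%t. t + b i) -` A i))"
   unfolding gauss_def using Ab by (intro std_normal.emeasure_PiM[OF I]) auto
  also have "... = (\<Prod>i\<in>I. \<integral>\<^sup>+t. ennreal (exp (b i * t - (b i)\<^sup>2 / 2)) * indicator (A i) t \<partial>?N)"
   using A by (intro prod.cong refl std_normal_shift)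
  also have "... = (\<integral>\<^sup>+z. (\<Prod>i\<in>I. ennreal (exp (b i * z i - (b i)\<^sup>2 / 2)) * indicator (A i) (z i)) \<partial>gauss I)"
   unfolding gauss_def using A by (intro std_normal.product_nn_integral_prod[OF I, symmetric]) auto
  also have "... = (\<integral>\<^sup>+z. ennreal (exp ((\<Sum>i\<in>I. b i * z i) - (\<Sum>i\<in>I. (b i)\<^sup>2) / 2)) * indicator (PiE I A) z \<partial>gauss I)"
  proof (rule nn_integral_cong)
   fix z assume "z \<in> space (gauss I)"
   then have "(\<Prod>i\<in>I. indicator (A i) (z i)) = (indicator (PiE I A) z :: ennreal)"
    using I by (auto simp: indicator_def PiE_iff prod_zero_iff intro!: prod.neutral)
   moreover have "(\<Prod>i\<in>I. ennreal (exp (b i * z i - (b i)\<^sup>2 / 2))) = ennreal (exp ((\<Sum>i\<in>I. b i * z i) - (\<Sum>i\<in>I. (b i)\<^sup>2) / 2))"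
    using I by (simp add: prod_ennreal exp_sum[symmetric] sum_subtractf sum_divide_distrib)
   ultimately show "(\<Prod>i\<in>I. ennreal (exp (b i * z i - (b i)\<^sup>2 / 2)) * indicator (A i) (z i)) = ennreal (exp ((\<Sum>i\<in>I. b i * z i) - (\<Sum>i\<in>I. (b i)\<^sup>2) / 2)) * indicator (PiE I A) z"
    by (simp only: prod.distrib)
  qed
  also have "... = emeasure (density (gauss I) (%z. ennreal (exp ((\<Sum>i\<in>I. b i * z i) - (\<Sum>i\<in>I. (b i)\<^sup>2) / 2)))) (PiE I A)"
   using PA by (intro emeasure_density[OF dm, symmetric]) simp
  finally show "emeasure (distr (gauss I) (PiM I (%_. borel)) (%z. \<lambda>i\<in>I. z i + b i)) (PiE I A)
   = emeasure (density (gauss I) (%z. ennreal (exp ((\<Sum>i\<in>I. b i * z i) - (\<Sum>i\<in>I. (b i)\<^sup>2) / 2)))) (PiE I A)" .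
 next
  show "range (%_::nat. PiE I (%_. UNIV)) \<subseteq> prod_algebra I (%_. borel :: real measure)"
   using space_in_prod_algebra[of I "%_. borel :: real measure"] by auto
  show "(\<Union>i::nat. PiE I (%_. UNIV)) = space (PiM I (%_. borel :: real measure))" by (simp add: space_PiM)
  interpret D: prob_space "distr (gauss I) (PiM I (%_. borel)) (%z. \<lambda>i\<in>I. z i + b i)"
   by (rule prob_space.prob_space_distr[OF prob_space_gauss m])
  show "emeasure (distr (gauss I) (PiM I (%_. borel)) (%z. \<lambda>i\<in>I. z i + b i)) (PiE I (%_. UNIV)) \<noteq> \<infinity>" for i :: nat
   by (simp add: D.emeasure_eq_measure)
 qed simp_all
qed

lemma gauss_shift:
 fixes f :: "('i => real) => real"
 assumes I: "finite I" and f: "f \<in> borel_measurable (PiM I (%_. borel))"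
 shows "(\<integral>z. f (\<lambda>i\<in>I. z i + b i) \<partial>gauss I)
  = (\<integral>z. exp ((\<Sum>i\<in>I. b i * z i) - (\<Sum>i\<in>I. (b i)\<^sup>2) / 2) * f z \<partial>gauss I)"
proof -
 have m: "(%z. \<lambda>i\<in>I. z i + b i) \<in> measurable (gauss I) (PiM I (%_. borel))"
  by (intro measurable_restrict borel_measurable_add borel_measurable_const component_gauss)
 have dm: "(%z. exp ((\<Sum>i\<in>I. b i * z i) - (\<Sum>i\<in>I. (b i)\<^sup>2) / 2)) \<in> borel_measurable (gauss I)"
  by (intro measurable_compose[OF _ borel_measurable_exp] borel_measurable_diff
    borel_measurable_sum borel_measurable_times borel_measurable_const component_gauss)
 have fg: "f \<in> borel_measurable (gauss I)" using f measurable_cong_sets[OF sets_gauss refl] by blast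
 have "(\<integral>z. f (\<lambda>i\<in>I. z i + b i) \<partial>gauss I) = (\<integral>z. f z \<partial>distr (gauss I) (PiM I (%_. borel)) (%z. \<lambda>i\<in>I. z i + b i))"
  by (rule integral_distr[OF m f, symmetric])
 also have "... = (\<integral>z. exp ((\<Sum>i\<in>I. b i * z i) - (\<Sum>i\<in>I. (b i)\<^sup>2) / 2) *\<^sub>R f z \<partial>gauss I)"
  unfolding gauss_shift_law[OF I] by (intro integral_density fg dm) auto
 finally show ?thesis by simp
qed

section \<open>Gaussian concentration of Lipschitz functions\<close>

lemma exp_second_order: "\<bar>exp x - 1 - x\<bar> <= x\<^sup>2 * exp \<bar>x\<bar>" for x :: real
proof -
 have a: "0 <= exp x - 1 - x" using exp_ge_add_one_self[of x] by linarith
 have b: "exp x - 1 <= x * exp x"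
 proof -
  have "(1 - x) * exp x <= exp (- x) * exp x" using exp_ge_add_one_self[of "- x"] by (intro mult_right_mono) auto
  then show ?thesis by (simp add: exp_minus algebra_simps)
 qed
 have c: "exp x - 1 - x <= x * (exp x - 1)" using b by (simp add: algebra_simps)
 have d: "x * (exp x - 1) <= x\<^sup>2 * exp \<bar>x\<bar>"
 proof (cases "0 <= x")
  case True
  have "x * (exp x - 1) <= x * (x * exp x)" using b True by (intro mult_left_mono)
  then show ?thesis using True by (simp add: power2_eq_square)
 next
  case False
  have "1 - exp x <= - x" using exp_ge_add_one_self[of x] by linarith
  then have "(- x) * (1 - exp x) <= (- x) * (- x)" using False by (intro mult_left_mono) auto
  moreover have "x\<^sup>2 * 1 <= x\<^sup>2 * exp \<bar>x\<bar>" by (intro mult_left_mono) auto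
  ultimately show ?thesis by (simp add: power2_eq_square algebra_simps)
 qed
 show ?thesis using a c d by linarith
qed

text \<open>The Lipschitz condition also says that \<open>g\<close> depends on the coordinates in \<open>I\<close> only.\<close>

locale gauss_lipschitz =
 fixes I :: "'i::countable set" and g :: "('i => real) => real" and L :: real
 assumes I: "finite I" and L: "0 < L"
  and lip: "!!x y. \<bar>g x - g y\<bar> <= L * L2_set (%i. x i - y i) I"
begin

sublocale G: prob_space "gauss I" by simp

abbreviation N1 :: "('i => real) => real" where "N1 x \<equiv> (\<Sum>i\<in>I. \<bar>x i\<bar>)"

lemma N1_nonneg: "0 <= N1 x" by (intro sum_nonneg) auto

lemma L2_le_N1: "L2_set x I <= N1 x" by (rule L2_set_le_sum_abs)

lemma lip1: "\<bar>g x - g y\<bar> <= L * N1 (%i. x i - y i)"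
 using lip[of x y] mult_left_mono[OF L2_le_N1[of "%i. x i - y i"], of L] L by linarith

lemma g_restrict: "g (\<lambda>i\<in>I. x i) = g x"
proof -
 have "N1 (%i. (\<lambda>i\<in>I. x i) i - x i) = 0" by (rule sum.neutral) simp
 then show ?thesis using lip1[of "\<lambda>i\<in>I. x i" x] by simp
qed

lemma g_measurable: "(!!i. i \<in> I ==> c i \<in> borel_measurable P) ==> (%w. g (%i. c i w)) \<in> borel_measurable P"
 by (rule lipschitz_measurable[OF I lip1])

lemma g_PiM: "(%z. g (%i. x i + t * z i)) \<in> borel_measurable (PiM I (%_. borel))"
 by (intro g_measurable borel_measurable_add borel_measurable_times borel_measurable_const measurable_component_singleton)

lemma g_gauss: "(%z. g (%i. x i + t * z i)) \<in> borel_measurable (gauss I)"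
 using g_PiM measurable_cong_sets[OF sets_gauss refl] by blast

lemma N1_moments: "integrable (gauss I) (%z. (1 + N1 z) ^ m * exp (k * N1 z))" "integrable (gauss I) (%z. (1 + N1 z) ^ m)"
 "integrable (gauss I) N1"
proof -
 show *: "integrable (gauss I) (%z. (1 + N1 z) ^ m * exp (k * N1 z))" for m k by (rule gauss_power_exp_integrable[OF I])
 show **: "integrable (gauss I) (%z. (1 + N1 z) ^ m)" for m using *[of m 0] by simp
 have "integrable (gauss I) (%z. (1 + N1 z) ^ 1 - 1)" by (intro Bochner_Integration.integrable_diff **) simp
 then show "integrable (gauss I) N1" by simp
qed

lemma g_growth: "\<bar>g (%i. x i + t * z i) - g x\<bar> <= L * \<bar>t\<bar> * N1 z"
proof -
 have "N1 (%i. x i + t * z i - x i) = \<bar>t\<bar> * N1 z" by (simp add: abs_mult sum_distrib_left)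
 then show ?thesis using lip1[of "%i. x i + t * z i" x] by (simp add: mult_ac)
qed

lemma g_integrable: "integrable (gauss I) (%z. g (%i. x i + t * z i))"
proof -
 have "integrable (gauss I) (%z. g (%i. x i + t * z i) - g x)"
 proof (rule Bochner_Integration.integrable_bound)
  show "integrable (gauss I) (%z. L * \<bar>t\<bar> * N1 z)" by (intro integrable_mult_right N1_moments)
  show "(%z. g (%i. x i + t * z i) - g x) \<in> borel_measurable (gauss I)" by (intro borel_measurable_diff g_gauss borel_measurable_const)
  show "AE z in gauss I. norm (g (%i. x i + t * z i) - g x) <= norm (L * \<bar>t\<bar> * N1 z)"
   using g_growth L N1_nonneg by (intro AE_I2) (simp add: abs_mult)
 qed
 from Bochner_Integration.integrable_add[OF this G.integrable_const[of "g x"]] show ?thesis by simp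
qed

text \<open>The heat semigroup: the conditional expectation of \<open>g\<close> at the end of a Brownian path, given its position \<open>x\<close>, when the
remaining standard deviation is \<open>t\<close>.\<close>

definition Q :: "real => ('i => real) => real" where
 "Q t x = (\<integral>z. g (%i. x i + t * z i) \<partial>gauss I)"

lemma Q_lip: "\<bar>Q t x - Q t y\<bar> <= L * L2_set (%i. x i - y i) I"
proof -
 have "\<bar>Q t x - Q t y\<bar> = \<bar>\<integral>z. g (%i. x i + t * z i) - g (%i. y i + t * z i) \<partial>gauss I\<bar>"
  unfolding Q_def by (subst Bochner_Integration.integral_diff) (simp_all add: g_integrable)
 also have "... <= (\<integral>z. \<bar>g (%i. x i + t * z i) - g (%i. y i + t * z i)\<bar> \<partial>gauss I)" by (rule integral_abs_bound)
 also have "... <= (\<integral>z. L * L2_set (%i. x i - y i) I \<partial>gauss I)"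
 proof (rule integral_mono)
  show "integrable (gauss I) (%z. \<bar>g (%i. x i + t * z i) - g (%i. y i + t * z i)\<bar>)"
   by (intro integrable_abs Bochner_Integration.integrable_diff g_integrable)
  show "\<bar>g (%i. x i + t * z i) - g (%i. y i + t * z i)\<bar> <= L * L2_set (%i. x i - y i) I" for z
   using lip[of "%i. x i + t * z i" "%i. y i + t * z i"] by simp
 qed simp
 also have "... = L * L2_set (%i. x i - y i) I" by (simp add: G.prob_space del: gauss_space)
 finally show ?thesis .
qed

lemma Q_gauss_lipschitz: "gauss_lipschitz I (Q t) L"
 by unfold_locales (use I L Q_lip in auto)

definition m1 :: real where "m1 = (\<integral>z. N1 z \<partial>gauss I)"

lemma m1_nonneg: "0 <= m1" unfolding m1_def using N1_nonneg by (intro integral_nonneg_AE) auto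

lemma Q_time: "\<bar>Q t x - Q s x\<bar> <= L * \<bar>t - s\<bar> * m1"
proof -
 have "\<bar>Q t x - Q s x\<bar> = \<bar>\<integral>z. g (%i. x i + t * z i) - g (%i. x i + s * z i) \<partial>gauss I\<bar>"
  unfolding Q_def by (subst Bochner_Integration.integral_diff) (simp_all add: g_integrable)
 also have "... <= (\<integral>z. \<bar>g (%i. x i + t * z i) - g (%i. x i + s * z i)\<bar> \<partial>gauss I)" by (rule integral_abs_bound)
 also have "... <= (\<integral>z. L * \<bar>t - s\<bar> * N1 z \<partial>gauss I)"
 proof (rule integral_mono)
  show "integrable (gauss I) (%z. \<bar>g (%i. x i + t * z i) - g (%i. x i + s * z i)\<bar>)"
   by (intro integrable_abs Bochner_Integration.integrable_diff g_integrable)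
  show "integrable (gauss I) (%z. L * \<bar>t - s\<bar> * N1 z)" by (intro integrable_mult_right N1_moments)
  show "\<bar>g (%i. x i + t * z i) - g (%i. x i + s * z i)\<bar> <= L * \<bar>t - s\<bar> * N1 z" for z
  proof -
   have "N1 (%i. x i + t * z i - (x i + s * z i)) = \<bar>t - s\<bar> * N1 z"
    unfolding sum_distrib_left by (intro sum.cong refl) (simp add: abs_mult[symmetric] algebra_simps)
   then show ?thesis using lip1[of "%i. x i + t * z i" "%i. x i + s * z i"] by (simp add: mult_ac)
  qed
 qed
 finally show ?thesis by (simp add: m1_def)
qed

lemma Q_0: "Q 0 x = g x" by (simp add: Q_def G.prob_space del: gauss_space)

lemma Q_semigroup: "(\<integral>z. Q t (%i. x i + h * z i) \<partial>gauss I) = Q (sqrt (h\<^sup>2 + t\<^sup>2)) x"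
proof -
 let ?f = "%w. g (%i. x i + 1 * w i)"
 have eq: "?f (\<lambda>i\<in>I. w i) = g (%i. x i + w i)" for w
  using g_restrict[of "%i. x i + (\<lambda>i\<in>I. w i) i"] g_restrict[of "%i. x i + w i"]
  by (simp cong: restrict_cong)
 have "(\<integral>z. \<integral>z'. ?f (\<lambda>i\<in>I. h * z i + t * z' i) \<partial>gauss I \<partial>gauss I) = (\<integral>z. ?f (\<lambda>i\<in>I. sqrt (h\<^sup>2 + t\<^sup>2) * z i) \<partial>gauss I)"
  by (rule gauss_convolution(1)[OF I g_PiM]) (unfold eq, rule g_integrable)
 then show ?thesis unfolding eq by (simp add: Q_def add.assoc)
qed

definition c0 :: real where "c0 = (\<integral>z. 2 * ((1 + N1 z) ^ 3 * exp (1 + N1 z)) \<partial>gauss I)"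

lemma c0_integrable: "integrable (gauss I) (%z. 2 * ((1 + N1 z) ^ 3 * exp (1 + N1 z)))"
proof -
 have "integrable (gauss I) (%z. (2 * exp 1) * ((1 + N1 z) ^ 3 * exp (1 * N1 z)))"
  by (intro integrable_mult_right N1_moments)
 then show ?thesis by (simp add: exp_add mult_ac)
qed

text \<open>Moving \<open>x\<close> by \<open>a\<close> amounts to tilting the Gaussian measure by an exponential density, whose second-order expansion in
\<open>a / t\<close> is integrable against the linear growth of \<open>g\<close>.\<close>

lemma Q_smooth:
 assumes t: "0 < t"
 obtains l where "!!a. \<bar>Q t (%i. x i + a i) - Q t x - (\<Sum>i\<in>I. l i * a i)\<bar> <= L * (1 + c0) / t * (N1 a)\<^sup>2"
proof -
 define l where "l = (%i. (\<integral>z. (g (%i. x i + t * z i) - g x) * z i \<partial>gauss I) / t)"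
 let ?d = "%z. g (%i. x i + t * z i) - g x"
 have dz_le: "\<bar>?d z * z i\<bar> <= L * t * (1 + N1 z) ^ 2" if "i \<in> I" for i z
 proof -
  have "\<bar>z i\<bar> <= N1 z" using that I by (intro member_le_sum) auto
  then have "\<bar>?d z\<bar> * \<bar>z i\<bar> <= (L * t * (1 + N1 z)) * (1 + N1 z)"
   using g_growth[of x t z] t L N1_nonneg[of z]
   by (intro mult_mono order_trans[OF g_growth[of x t z]]) auto
  then show ?thesis by (simp add: abs_mult power2_eq_square mult_ac)
 qed
 have dm: "?d \<in> borel_measurable (gauss I)" by (intro borel_measurable_diff g_gauss borel_measurable_const)
 have dzi: "integrable (gauss I) (%z. ?d z * z i)" if "i \<in> I" for i
 proof (rule Bochner_Integration.integrable_bound)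
  show "integrable (gauss I) (%z. L * t * (1 + N1 z) ^ 2)" by (intro integrable_mult_right N1_moments)
  show "(%z. ?d z * z i) \<in> borel_measurable (gauss I)" by (intro borel_measurable_times dm component_gauss that)
  show "AE z in gauss I. norm (?d z * z i) <= norm (L * t * (1 + N1 z) ^ 2)"
   using dz_le[OF that] by (intro AE_I2) (auto intro: order_trans[OF _ abs_ge_self])
 qed
 have sq_le: "(1 + N1 z) ^ 2 <= 2 * ((1 + N1 z) ^ 3 * exp (1 + N1 z))" for z
 proof -
  have "(1 + N1 z) ^ 2 * 1 <= (1 + N1 z) ^ 3 * exp (1 + N1 z)"
   using N1_nonneg[of z] by (intro mult_mono power_increasing) auto
  moreover have "0 <= (1 + N1 z) ^ 3 * exp (1 + N1 z)" using N1_nonneg[of z] by auto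
  ultimately show ?thesis by linarith
 qed
 have c0: "0 <= c0" unfolding c0_def
  using N1_nonneg by (intro integral_nonneg_AE AE_I2) auto
 have l_le: "\<bar>l i\<bar> <= L * c0" if "i \<in> I" for i
 proof -
  have "\<bar>\<integral>z. ?d z * z i \<partial>gauss I\<bar> <= (\<integral>z. \<bar>?d z * z i\<bar> \<partial>gauss I)" by (rule integral_abs_bound)
  also have "... <= (\<integral>z. L * t * (2 * ((1 + N1 z) ^ 3 * exp (1 + N1 z))) \<partial>gauss I)"
  proof (rule integral_mono)
   show "\<bar>?d z * z i\<bar> <= L * t * (2 * ((1 + N1 z) ^ 3 * exp (1 + N1 z)))" for z
   proof -
    have "L * t * (1 + N1 z) ^ 2 <= L * t * (2 * ((1 + N1 z) ^ 3 * exp (1 + N1 z)))"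
     using L t by (intro mult_left_mono[OF sq_le]) simp
    with dz_le[OF that, of z] show ?thesis by (rule order_trans)
   qed
  qed (intro integrable_abs dzi that integrable_mult_right c0_integrable)+
  also have "... = L * t * c0" by (simp add: c0_def)
  finally show ?thesis using t by (simp add: l_def divide_le_eq mult_ac)
 qed
 have "\<bar>Q t (%i. x i + a i) - Q t x - (\<Sum>i\<in>I. l i * a i)\<bar> <= L * (1 + c0) / t * (N1 a)\<^sup>2" for a
 proof -
  define b where "b = (%i. a i / t)"
  define \<beta> where "\<beta> = N1 b"
  have \<beta>: "0 <= \<beta>" "N1 a = t * \<beta>"
  proof -
   show "0 <= \<beta>" unfolding \<beta>_def by (rule N1_nonneg)
   show "N1 a = t * \<beta>" using t by (simp add: \<beta>_def b_def sum_distrib_left abs_divide)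
  qed
  show ?thesis
  proof (cases "\<beta> <= 1")
   case False
   have "\<bar>Q t (%i. x i + a i) - Q t x\<bar> <= L * N1 a"
   proof -
    have "\<bar>Q t (%i. x i + a i) - Q t x\<bar> <= L * L2_set a I" using Q_lip[of t "%i. x i + a i" x] by simp
    also have "... <= L * N1 a" using L by (intro mult_left_mono[OF L2_le_N1]) simp
    finally show ?thesis .
   qed
   moreover have "\<bar>\<Sum>i\<in>I. l i * a i\<bar> <= L * c0 * N1 a"
   proof -
    have "\<bar>\<Sum>i\<in>I. l i * a i\<bar> <= (\<Sum>i\<in>I. \<bar>l i * a i\<bar>)" by (rule sum_abs)
    also have "... <= (\<Sum>i\<in>I. L * c0 * \<bar>a i\<bar>)"
     unfolding abs_mult by (intro sum_mono mult_right_mono l_le) auto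
    finally show ?thesis by (simp add: sum_distrib_left)
   qed
   ultimately have "\<bar>Q t (%i. x i + a i) - Q t x - (\<Sum>i\<in>I. l i * a i)\<bar> <= L * N1 a + L * c0 * N1 a" by linarith
   also have "... = L * (1 + c0) * N1 a * 1" by (simp add: algebra_simps)
   also have "... <= L * (1 + c0) * N1 a * \<beta>"
    using False L c0 N1_nonneg[of a] by (intro mult_left_mono mult_nonneg_nonneg) auto
   also have "... = L * (1 + c0) / t * (N1 a)\<^sup>2" using t by (simp add: \<beta>(2) power2_eq_square)
   finally show ?thesis .
  next
   case True
   define U where "U = (%z. (\<Sum>i\<in>I. b i * z i) - (\<Sum>i\<in>I. (b i)\<^sup>2) / 2)"
   define e where "e = (%z. exp (U z) - 1 - (\<Sum>i\<in>I. b i * z i))"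
    have bz: "\<bar>\<Sum>i\<in>I. b i * z i\<bar> <= \<beta> * N1 z" for z
    proof -
     have "\<bar>\<Sum>i\<in>I. b i * z i\<bar> <= (\<Sum>i\<in>I. \<bar>b i\<bar> * \<bar>z i\<bar>)" unfolding abs_mult[symmetric] by (rule sum_abs)
     also have "... <= (\<Sum>i\<in>I. \<bar>b i\<bar> * N1 z)"
      using I by (intro sum_mono mult_left_mono member_le_sum) auto
     finally show ?thesis by (simp add: \<beta>_def sum_distrib_right)
    qed
    have bb: "0 <= (\<Sum>i\<in>I. (b i)\<^sup>2)" "(\<Sum>i\<in>I. (b i)\<^sup>2) <= \<beta>\<^sup>2"
    proof -
     show "0 <= (\<Sum>i\<in>I. (b i)\<^sup>2)" by (intro sum_nonneg) auto
     have "(\<Sum>i\<in>I. (b i)\<^sup>2) = (\<Sum>i\<in>I. \<bar>b i\<bar> * \<bar>b i\<bar>)" by (simp add: power2_eq_square)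
     also have "... <= (\<Sum>i\<in>I. \<bar>b i\<bar> * \<beta>)"
      unfolding \<beta>_def using I by (intro sum_mono mult_left_mono member_le_sum) auto
     finally show "(\<Sum>i\<in>I. (b i)\<^sup>2) <= \<beta>\<^sup>2" by (simp add: \<beta>_def power2_eq_square sum_distrib_right)
    qed
    have b2: "\<beta>\<^sup>2 <= \<beta>" using \<beta> True by (simp add: power2_eq_square mult_left_le)
    have U: "\<bar>U z\<bar> <= \<beta> * (1 + N1 z)" for z using bz[of z] bb b2 by (simp add: U_def distrib_left abs_le_iff)
    have U1: "\<bar>U z\<bar> <= 1 + N1 z" for z
    proof -
     have "\<beta> * (1 + N1 z) <= 1 * (1 + N1 z)" using N1_nonneg[of z] by (intro mult_right_mono[OF True]) linarith
     then have "\<beta> * (1 + N1 z) <= 1 + N1 z" by (simp only: mult_1)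
     then show ?thesis by (rule order_trans[OF U[of z]])
    qed
   have e_le: "\<bar>e z\<bar> <= \<beta>\<^sup>2 * (2 * ((1 + N1 z) ^ 2 * exp (1 + N1 z)))" for z
   proof -
    have "\<bar>U z\<bar>\<^sup>2 <= (\<beta> * (1 + N1 z))\<^sup>2" by (rule power_mono[OF U[of z]]) simp
    then have U2: "(U z)\<^sup>2 <= \<beta>\<^sup>2 * (1 + N1 z)\<^sup>2" by (simp add: power_mult_distrib)
    have "\<bar>exp (U z) - 1 - U z\<bar> <= (U z)\<^sup>2 * exp \<bar>U z\<bar>" by (rule exp_second_order)
    also have "... <= (\<beta>\<^sup>2 * (1 + N1 z)\<^sup>2) * exp (1 + N1 z)" using U1[of z] U2 by (intro mult_mono) auto
    finally have 1: "\<bar>exp (U z) - 1 - U z\<bar> <= \<beta>\<^sup>2 * ((1 + N1 z)\<^sup>2 * exp (1 + N1 z))" by (simp add: mult_ac)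
    have "1 * 1 <= (1 + N1 z)\<^sup>2 * exp (1 + N1 z)" using N1_nonneg[of z] by (intro mult_mono one_le_power) auto
    then have 2: "\<beta>\<^sup>2 * 1 <= \<beta>\<^sup>2 * ((1 + N1 z)\<^sup>2 * exp (1 + N1 z))" by (intro mult_left_mono) auto
    have "\<bar>e z\<bar> <= \<bar>exp (U z) - 1 - U z\<bar> + (\<Sum>i\<in>I. (b i)\<^sup>2) / 2"
    proof -
     have "e z = (exp (U z) - 1 - U z) - (\<Sum>i\<in>I. (b i)\<^sup>2) / 2" by (simp add: e_def U_def)
     then show ?thesis using abs_triangle_ineq4[of "exp (U z) - 1 - U z" "(\<Sum>i\<in>I. (b i)\<^sup>2) / 2"] bb by simp
    qed
    also have "... <= \<beta>\<^sup>2 * ((1 + N1 z)\<^sup>2 * exp (1 + N1 z)) + \<beta>\<^sup>2 * ((1 + N1 z)\<^sup>2 * exp (1 + N1 z))" using 1 2 bb by linarith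
    finally show ?thesis by (simp add: mult_ac)
   qed
   have Um: "(%z. exp (U z)) \<in> borel_measurable (gauss I)" unfolding U_def
    by (intro measurable_compose[OF _ borel_measurable_exp] borel_measurable_diff
      borel_measurable_sum borel_measurable_times borel_measurable_const component_gauss)
   have eU: "integrable (gauss I) (%z. exp (U z) * g (%i. x i + t * z i))"
   proof (rule Bochner_Integration.integrable_bound)
    show "integrable (gauss I) (%z. (\<bar>g x\<bar> + L * t) * exp 1 * ((1 + N1 z) ^ 1 * exp (1 * N1 z)))"
     by (intro integrable_mult_right N1_moments)
    show "(%z. exp (U z) * g (%i. x i + t * z i)) \<in> borel_measurable (gauss I)"
     by (intro borel_measurable_times Um g_gauss)
    show "AE z in gauss I. norm (exp (U z) * g (%i. x i + t * z i)) <= norm ((\<bar>g x\<bar> + L * t) * exp 1 * ((1 + N1 z) ^ 1 * exp (1 * N1 z)))"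
    proof (rule AE_I2)
     fix z
     have "\<bar>g (%i. x i + t * z i)\<bar> <= \<bar>g x\<bar> * 1 + L * t * N1 z" using g_growth[of x t z] t by simp
     also have "... <= \<bar>g x\<bar> * (1 + N1 z) + L * t * (1 + N1 z)"
      using N1_nonneg[of z] L t by (intro add_mono mult_left_mono) auto
     finally have "\<bar>g (%i. x i + t * z i)\<bar> <= (\<bar>g x\<bar> + L * t) * (1 + N1 z)" by (simp add: distrib_right)
     moreover have "exp (U z) <= exp (1 + N1 z)" using U1[of z] by simp
     ultimately have "exp (U z) * \<bar>g (%i. x i + t * z i)\<bar> <= exp (1 + N1 z) * ((\<bar>g x\<bar> + L * t) * (1 + N1 z))"
      by (intro mult_mono) auto
     also have "... = (\<bar>g x\<bar> + L * t) * exp 1 * ((1 + N1 z) ^ 1 * exp (1 * N1 z))" by (simp add: exp_add mult_ac)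
     finally have "exp (U z) * \<bar>g (%i. x i + t * z i)\<bar> <= \<bar>(\<bar>g x\<bar> + L * t) * exp 1 * ((1 + N1 z) ^ 1 * exp (1 * N1 z))\<bar>"
      by (rule order_trans[OF _ abs_ge_self])
     then show "norm (exp (U z) * g (%i. x i + t * z i)) <= norm ((\<bar>g x\<bar> + L * t) * exp 1 * ((1 + N1 z) ^ 1 * exp (1 * N1 z)))"
      by (simp only: real_norm_def abs_mult[of "exp (U z)"] abs_exp_cancel)
    qed
   qed
   have eU1: "integrable (gauss I) (%z. exp (U z))" "(\<integral>z. exp (U z) \<partial>gauss I) = 1"
   proof -
    show "integrable (gauss I) (%z. exp (U z))"
    proof (rule Bochner_Integration.integrable_bound[OF _ Um])
     show "integrable (gauss I) (%z. exp 1 * ((1 + N1 z) ^ 0 * exp (1 * N1 z)))"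
      by (intro integrable_mult_right N1_moments)
     show "AE z in gauss I. norm (exp (U z)) <= norm (exp 1 * ((1 + N1 z) ^ 0 * exp (1 * N1 z)))"
      using U1 by (intro AE_I2) (simp add: exp_add[symmetric] abs_le_iff)
    qed
    show "(\<integral>z. exp (U z) \<partial>gauss I) = 1"
     using gauss_shift[OF I, of "%_. 1" b] by (simp add: U_def G.prob_space del: gauss_space)
   qed
   have shift: "Q t (%i. x i + a i) = (\<integral>z. exp (U z) * g (%i. x i + t * z i) \<partial>gauss I)"
   proof -
    have "g (%i. x i + a i + t * z i) = g (%i. x i + t * (\<lambda>i\<in>I. z i + b i) i)" for z
    proof -
     have "N1 (%i. x i + a i + t * z i - (x i + t * (\<lambda>i\<in>I. z i + b i) i)) = 0"
      by (rule sum.neutral) (use t in \<open>simp add: b_def distrib_left\<close>)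
     then show ?thesis using lip1[of "%i. x i + a i + t * z i" "%i. x i + t * (\<lambda>i\<in>I. z i + b i) i"] by simp
    qed
    then show ?thesis unfolding Q_def U_def using gauss_shift[OF I g_PiM[of x t], of b] by simp
   qed
   have sumint: "integrable (gauss I) (%z. ?d z * (\<Sum>i\<in>I. b i * z i))" "(\<integral>z. ?d z * (\<Sum>i\<in>I. b i * z i) \<partial>gauss I) = (\<Sum>i\<in>I. l i * a i)"
   proof -
    have eq: "(%z. ?d z * (\<Sum>i\<in>I. b i * z i)) = (%z. \<Sum>i\<in>I. b i * (?d z * z i))" by (simp only: sum_distrib_left mult.left_commute)
    show "integrable (gauss I) (%z. ?d z * (\<Sum>i\<in>I. b i * z i))" unfolding eq
     by (intro Bochner_Integration.integrable_sum integrable_mult_right dzi)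
    have "(\<integral>z. (\<Sum>i\<in>I. b i * (?d z * z i)) \<partial>gauss I) = (\<Sum>i\<in>I. b i * (\<integral>z. ?d z * z i \<partial>gauss I))"
     using dzi by (subst Bochner_Integration.integral_sum) (auto intro: integrable_mult_right)
    then show "(\<integral>z. ?d z * (\<Sum>i\<in>I. b i * z i) \<partial>gauss I) = (\<Sum>i\<in>I. l i * a i)"
     unfolding eq by (simp add: l_def b_def mult_ac)
   qed
   have "Q t (%i. x i + a i) - Q t x - (\<Sum>i\<in>I. l i * a i) = (\<integral>z. ?d z * e z \<partial>gauss I)"
   proof -
    have "(%z. ?d z * e z) = (%z. exp (U z) * g (%i. x i + t * z i) - g x * exp (U z) - ?d z - ?d z * (\<Sum>i\<in>I. b i * z i))"
     by (simp add: e_def algebra_simps)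
    then have "(\<integral>z. ?d z * e z \<partial>gauss I) = (\<integral>z. exp (U z) * g (%i. x i + t * z i) - g x * exp (U z) - ?d z - ?d z * (\<Sum>i\<in>I. b i * z i) \<partial>gauss I)"
     by simp
    also have "... = (\<integral>z. exp (U z) * g (%i. x i + t * z i) \<partial>gauss I) - g x * (\<integral>z. exp (U z) \<partial>gauss I)
      - ((\<integral>z. g (%i. x i + t * z i) \<partial>gauss I) - (\<integral>z. g x \<partial>gauss I)) - (\<integral>z. ?d z * (\<Sum>i\<in>I. b i * z i) \<partial>gauss I)"
     using eU eU1(1) sumint(1) g_integrable[of x t]
     by (simp del: gauss_space)
    also have "... = Q t (%i. x i + a i) - Q t x - (\<Sum>i\<in>I. l i * a i)"
     unfolding shift unfolding sumint(2) eU1(2) Q_def by (simp add: G.prob_space del: gauss_space)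
    finally show ?thesis by simp
   qed
   also have "\<bar>...\<bar> <= (\<integral>z. \<bar>?d z * e z\<bar> \<partial>gauss I)" by (rule integral_abs_bound)
   also have "... <= (\<integral>z. L * t * \<beta>\<^sup>2 * (2 * ((1 + N1 z) ^ 3 * exp (1 + N1 z))) \<partial>gauss I)"
   proof (rule integral_mono')
    show "integrable (gauss I) (%z. L * t * \<beta>\<^sup>2 * (2 * ((1 + N1 z) ^ 3 * exp (1 + N1 z))))"
     by (intro integrable_mult_right c0_integrable)
    fix z
    have "\<bar>?d z\<bar> <= L * t * N1 z" using g_growth[of x t z] t by simp
    also have "... <= L * t * (1 + N1 z)" using L t by (intro mult_left_mono) auto
    finally have "\<bar>?d z\<bar> <= L * t * (1 + N1 z)" .
    then have "\<bar>?d z\<bar> * \<bar>e z\<bar> <= (L * t * (1 + N1 z)) * (\<beta>\<^sup>2 * (2 * ((1 + N1 z) ^ 2 * exp (1 + N1 z))))"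
     using e_le[of z] by (intro mult_mono) auto
    then show "\<bar>?d z * e z\<bar> <= L * t * \<beta>\<^sup>2 * (2 * ((1 + N1 z) ^ 3 * exp (1 + N1 z)))"
     by (simp add: abs_mult eval_nat_numeral mult_ac)
   next
    fix z
    show "0 <= L * t * \<beta>\<^sup>2 * (2 * ((1 + N1 z) ^ 3 * exp (1 + N1 z)))"
     using L t \<beta>(1) N1_nonneg[of z] by (intro mult_nonneg_nonneg zero_le_power) auto
   qed
   also have "... = L * t * \<beta>\<^sup>2 * c0" unfolding c0_def by simp
   also have "... = L * c0 / t * (N1 a)\<^sup>2" unfolding \<beta>(2) using t by (simp add: field_simps power2_eq_square)
   also have "... <= L * (1 + c0) / t * (N1 a)\<^sup>2"
    using L t by (intro mult_right_mono divide_right_mono mult_left_mono) auto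
   finally show ?thesis .
  qed
 qed
 then show ?thesis using that by blast
qed

text \<open>Compare the expansion with the Lipschitz bound along the small vector \<open>\<tau> * l\<close>.\<close>

lemma Q_gradient_le:
 assumes t: "0 < t" and l: "!!a. \<bar>Q t (%i. x i + a i) - Q t x - (\<Sum>i\<in>I. l i * a i)\<bar> <= C * (N1 a)\<^sup>2"
 shows "(\<Sum>i\<in>I. (l i)\<^sup>2) <= L\<^sup>2"
proof -
 define r where "r = L2_set l I"
 have r: "0 <= r" "r * r = (\<Sum>i\<in>I. (l i)\<^sup>2)"
  by (auto simp: r_def L2_set_def sum_nonneg)
 have "r * r <= L * r + e" if e: "0 < e" for e
 proof -
  \<comment> \<open>small enough to make the quadratic remainder at most \<open>e\<close> after division by \<open>\<tau>\<close>\<close>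
  define \<tau> where "\<tau> = e / (1 + \<bar>C\<bar> * (N1 l)\<^sup>2)"
  have den: "0 < 1 + \<bar>C\<bar> * (N1 l)\<^sup>2" by (simp add: add_pos_nonneg)
  have \<tau>: "0 < \<tau>" using e den by (simp add: \<tau>_def)
  have "\<tau> * (r * r) = (\<Sum>i\<in>I. l i * (\<tau> * l i))" unfolding r(2) by (simp add: sum_distrib_left power2_eq_square mult_ac)
  also have "... <= \<bar>Q t (%i. x i + \<tau> * l i) - Q t x\<bar> + C * (N1 (%i. \<tau> * l i))\<^sup>2"
   using l[of "%i. \<tau> * l i"] by linarith
  also have "\<bar>Q t (%i. x i + \<tau> * l i) - Q t x\<bar> <= L * (\<tau> * r)"
   using Q_lip[of t "%i. x i + \<tau> * l i" x] \<tau> by (simp add: r_def L2_set_right_distrib)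
  also have "C * (N1 (%i. \<tau> * l i))\<^sup>2 = \<tau> * (\<tau> * (C * (N1 l)\<^sup>2))"
   using \<tau> by (simp add: abs_mult power2_eq_square mult_ac flip: sum_distrib_left)
  also have "\<tau> * (\<tau> * (C * (N1 l)\<^sup>2)) <= \<tau> * e"
  proof -
   have "C * (N1 l)\<^sup>2 <= \<bar>C\<bar> * (N1 l)\<^sup>2" by (intro mult_right_mono) auto
   then have "\<tau> * (C * (N1 l)\<^sup>2) <= \<tau> * (1 + \<bar>C\<bar> * (N1 l)\<^sup>2)" using \<tau> by (intro mult_left_mono) auto
   also have "... = e" using den by (simp add: \<tau>_def)
   finally show ?thesis using \<tau> by (intro mult_left_mono) auto
  qed
  finally have "\<tau> * (r * r) <= \<tau> * (L * r + e)" by (simp add: algebra_simps)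
  then show ?thesis using \<tau> by simp
 qed
 then have rL: "r * r <= L * r" by (rule field_le_epsilon)
 have "r <= L"
 proof (cases "r = 0")
  case False
  then have "0 < r" using r(1) by simp
  then show ?thesis using rL by (simp only: mult_le_cancel_right_pos)
 qed (use L in simp)
 then have "r * r <= L * L" using r L by (intro mult_mono) auto
 then show ?thesis using r by (simp add: power2_eq_square)
qed

definition c4 :: real where "c4 = (\<integral>z. (1 + N1 z) ^ 4 \<partial>gauss I)"

text \<open>The increment of \<open>Q t\<close> over a Gaussian step of size \<open>h\<close> is linear up to order \<open>h\<^sup>2\<close>, hence has variance at most
\<open>L\<^sup>2 * h\<^sup>2\<close> up to an error of order \<open>h ^ 3\<close>, and third absolute moment of order \<open>h ^ 3\<close>, uniformly for \<open>t >= d\<close>.\<close>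

lemma Q_step:
 assumes dt: "0 < d" "d <= t" and h: "0 <= h" "h <= 1" and s: "0 < s0" "s0 <= s"
 defines "C \<equiv> L * (1 + c0) / d"
 defines "K \<equiv> 4 * ((2 * L * C + C\<^sup>2) * c4) / s0\<^sup>2 + 2 * (L ^ 3 * (1 + m1) ^ 3 * c4) / s0 ^ 3 + 4 * (L\<^sup>2)\<^sup>2 / s0 ^ 4"
 shows "(\<integral>z. V s (Q t (%i. x i + h * z i) - T) \<partial>gauss I) <= V (sqrt (s\<^sup>2 + L\<^sup>2 * h\<^sup>2)) (Q (sqrt (h\<^sup>2 + t\<^sup>2)) x - T) + K * h ^ 3"
  and "0 <= K"
proof -
 have t: "0 < t" using dt by simp
 have c0: "0 <= c0" unfolding c0_def using N1_nonneg by (intro integral_nonneg_AE AE_I2) auto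
 have c4: "0 <= c4" unfolding c4_def using N1_nonneg by (intro integral_nonneg_AE AE_I2) auto
 have C: "0 <= C" using L c0 dt by (simp add: C_def)
 define e where "e = (2 * L * C + C\<^sup>2) * c4 * h ^ 3"
 define \<tau> where "\<tau> = L ^ 3 * (1 + m1) ^ 3 * c4 * h ^ 3"
 have e: "0 <= e" using C c4 h L by (simp add: e_def)
 have \<tau>: "0 <= \<tau>" using c4 h L m1_nonneg by (simp add: \<tau>_def)
 show K: "0 <= K" using C c4 L m1_nonneg s by (simp add: K_def)
 obtain l where l: "!!a. \<bar>Q t (%i. x i + a i) - Q t x - (\<Sum>i\<in>I. l i * a i)\<bar> <= L * (1 + c0) / t * (N1 a)\<^sup>2"
  using Q_smooth[OF t] by blast
 have CR: "L * (1 + c0) / t <= C" unfolding C_def using dt L c0 by (intro divide_left_mono) auto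
 define R where "R = (%z. Q t (%i. x i + h * z i) - Q t x - h * (\<Sum>i\<in>I. l i * z i))"
 have R: "\<bar>R z\<bar> <= C * h\<^sup>2 * (N1 z)\<^sup>2" for z
 proof -
  have "\<bar>R z\<bar> <= L * (1 + c0) / t * (N1 (%i. h * z i))\<^sup>2"
   using l[of "%i. h * z i"] by (simp add: R_def sum_distrib_left mult_ac)
  also have "(N1 (%i. h * z i))\<^sup>2 = h\<^sup>2 * (N1 z)\<^sup>2"
   using h by (simp add: abs_mult power_mult_distrib flip: sum_distrib_left)
  also have "L * (1 + c0) / t * (h\<^sup>2 * (N1 z)\<^sup>2) <= C * (h\<^sup>2 * (N1 z)\<^sup>2)" using CR by (intro mult_right_mono) auto
  finally show ?thesis by (simp add: mult.assoc)
 qed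
 have grad: "(\<Sum>i\<in>I. (l i)\<^sup>2) <= L\<^sup>2" by (rule Q_gradient_le[OF t l])
 have lz: "\<bar>\<Sum>i\<in>I. l i * z i\<bar> <= L * N1 z" for z
 proof -
  have "\<bar>\<Sum>i\<in>I. l i * z i\<bar> <= (\<Sum>i\<in>I. \<bar>l i\<bar> * \<bar>z i\<bar>)" unfolding abs_mult[symmetric] by (rule sum_abs)
  also have "... <= L2_set l I * L2_set z I" by (rule L2_set_mult_ineq)
  also have "... <= L * N1 z"
  proof (rule mult_mono)
   show "L2_set l I <= L" using grad L by (simp add: L2_set_def real_le_lsqrt sum_nonneg)
  qed (use L L2_le_N1 L2_set_nonneg in auto)
  finally show ?thesis .
 qed
 interpret Qt: gauss_lipschitz I "Q t" L by (rule Q_gauss_lipschitz)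
 define m where "m = (\<integral>z. Q t (%i. x i + h * z i) \<partial>gauss I)"
 define D where "D = (%z. Q t (%i. x i + h * z i) - m)"
 have Qi: "integrable (gauss I) (%z. Q t (%i. x i + h * z i))" by (rule Qt.g_integrable)
 have Dm: "D \<in> borel_measurable (gauss I)" unfolding D_def using Qi by auto
 have dev: "\<bar>Q t (%i. x i + h * z i) - Q t x\<bar> <= L * h * N1 z" for z
  using Qt.g_growth[of x h z] h by simp
 have mx: "\<bar>m - Q t x\<bar> <= L * h * m1"
 proof -
  have "\<bar>m - Q t x\<bar> = \<bar>\<integral>z. Q t (%i. x i + h * z i) - Q t x \<partial>gauss I\<bar>"
   unfolding m_def using Qi by (simp add: G.prob_space del: gauss_space)
  also have "... <= (\<integral>z. \<bar>Q t (%i. x i + h * z i) - Q t x\<bar> \<partial>gauss I)" by (rule integral_abs_bound)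
  also have "... <= (\<integral>z. L * h * N1 z \<partial>gauss I)"
  proof (rule integral_mono)
   show "integrable (gauss I) (%z. \<bar>Q t (%i. x i + h * z i) - Q t x\<bar>)"
    using Qi by (intro integrable_abs Bochner_Integration.integrable_diff) auto
  qed (use dev N1_moments(3) in \<open>auto intro: integrable_mult_right\<close>)
  finally show ?thesis by (simp add: m1_def)
 qed
 have D_le: "\<bar>D z\<bar> <= L * h * (1 + m1) * (1 + N1 z)" for z
 proof -
  have "\<bar>D z\<bar> <= L * h * N1 z + L * h * m1" using dev[of z] mx by (simp add: D_def)
  also have "... = L * h * (N1 z + m1)" by (simp add: distrib_left)
  also have "... <= L * h * ((1 + m1) * (1 + N1 z))"
  proof (rule mult_left_mono)
   have "0 <= m1 * N1 z" using m1_nonneg N1_nonneg by simp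
   then show "N1 z + m1 <= (1 + m1) * (1 + N1 z)" by (simp add: algebra_simps)
  qed (use L h in auto)
  finally show ?thesis by (simp add: mult.assoc)
 qed
 have pow34: "(1 + N1 z) ^ 3 <= (1 + N1 z) ^ 4" "(1 + N1 z) ^ 2 <= (1 + N1 z) ^ 4" for z
  using N1_nonneg[of z] by (auto intro!: power_increasing)
 have Dk: "integrable (gauss I) (%z. \<bar>D z\<bar> ^ k)" for k
 proof (rule Bochner_Integration.integrable_bound)
  show "integrable (gauss I) (%z. (L * h * (1 + m1)) ^ k * (1 + N1 z) ^ k)" by (intro integrable_mult_right N1_moments)
  show "(%z. \<bar>D z\<bar> ^ k) \<in> borel_measurable (gauss I)" using Dm by measurable
  show "AE z in gauss I. norm (\<bar>D z\<bar> ^ k) <= norm ((L * h * (1 + m1)) ^ k * (1 + N1 z) ^ k)"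
  proof (rule AE_I2)
   fix z
   have "\<bar>D z\<bar> ^ k <= (L * h * (1 + m1) * (1 + N1 z)) ^ k" by (rule power_mono[OF D_le]) simp
   also have "... = (L * h * (1 + m1)) ^ k * (1 + N1 z) ^ k" by (simp add: power_mult_distrib)
   finally have "\<bar>D z\<bar> ^ k <= \<bar>(L * h * (1 + m1)) ^ k * (1 + N1 z) ^ k\<bar>" by (rule order_trans[OF _ abs_ge_self])
   then show "norm (\<bar>D z\<bar> ^ k) <= norm ((L * h * (1 + m1)) ^ k * (1 + N1 z) ^ k)" by simp
  qed
 qed
 have D2i: "integrable (gauss I) (%z. (D z)\<^sup>2)" using Dk[of 2] by simp
 have "(\<integral>z. V s ((m - T) + D z) \<partial>gauss I) <= V (sqrt (s\<^sup>2 + L\<^sup>2 * h\<^sup>2)) (m - T) + 4 * e / s\<^sup>2 + 2 * \<tau> / s ^ 3 + 4 * (L\<^sup>2 * h\<^sup>2)\<^sup>2 / s ^ 4"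
 proof (rule V_one_step)
  show "prob_space (gauss I)" by simp
  show "integrable (gauss I) D" unfolding D_def using Qi by simp
  show "(\<integral>z. D z \<partial>gauss I) = 0" unfolding D_def using Qi by (simp add: m_def G.prob_space del: gauss_space)
  show "integrable (gauss I) (%z. (D z)\<^sup>2)" by (rule D2i)
  show "integrable (gauss I) (%z. \<bar>D z\<bar> ^ 3)" by (rule Dk)
  show "(\<integral>z. \<bar>D z\<bar> ^ 3 \<partial>gauss I) <= \<tau>"
  proof -
   have "(\<integral>z. \<bar>D z\<bar> ^ 3 \<partial>gauss I) <= (\<integral>z. (L * h * (1 + m1)) ^ 3 * (1 + N1 z) ^ 4 \<partial>gauss I)"
   proof (rule integral_mono[OF Dk])
    show "integrable (gauss I) (%z. (L * h * (1 + m1)) ^ 3 * (1 + N1 z) ^ 4)" by (intro integrable_mult_right N1_moments)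
    fix z
    have "\<bar>D z\<bar> ^ 3 <= (L * h * (1 + m1) * (1 + N1 z)) ^ 3" by (rule power_mono[OF D_le]) simp
    also have "... = (L * h * (1 + m1)) ^ 3 * (1 + N1 z) ^ 3" by (simp add: power_mult_distrib)
    also have "... <= (L * h * (1 + m1)) ^ 3 * (1 + N1 z) ^ 4"
     using L h m1_nonneg by (intro mult_left_mono pow34) auto
    finally show "\<bar>D z\<bar> ^ 3 <= (L * h * (1 + m1)) ^ 3 * (1 + N1 z) ^ 4" .
   qed
   then show ?thesis by (simp add: c4_def \<tau>_def power_mult_distrib mult_ac)
  qed
  show "(\<integral>z. (D z)\<^sup>2 \<partial>gauss I) <= L\<^sup>2 * h\<^sup>2 + e"
  proof -
   have D0i: "integrable (gauss I) (%z. (Q t (%i. x i + h * z i) - Q t x)\<^sup>2)"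
   proof (rule Bochner_Integration.integrable_bound)
    show "integrable (gauss I) (%z. (L * h)\<^sup>2 * (1 + N1 z) ^ 2)" by (intro integrable_mult_right N1_moments)
    show "(%z. (Q t (%i. x i + h * z i) - Q t x)\<^sup>2) \<in> borel_measurable (gauss I)" using Qi by measurable
    show "AE z in gauss I. norm ((Q t (%i. x i + h * z i) - Q t x)\<^sup>2) <= norm ((L * h)\<^sup>2 * (1 + N1 z) ^ 2)"
    proof (rule AE_I2)
     fix z
     have "\<bar>Q t (%i. x i + h * z i) - Q t x\<bar> <= L * h * (1 + N1 z)"
      using dev[of z] L h by (simp add: distrib_left add_increasing)
     then have "\<bar>Q t (%i. x i + h * z i) - Q t x\<bar>\<^sup>2 <= (L * h * (1 + N1 z))\<^sup>2" by (rule power_mono) simp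
     then show "norm ((Q t (%i. x i + h * z i) - Q t x)\<^sup>2) <= norm ((L * h)\<^sup>2 * (1 + N1 z) ^ 2)"
      by (simp add: power_mult_distrib)
    qed
   qed
   have "(\<integral>z. (D z)\<^sup>2 \<partial>gauss I) <= (\<integral>z. (Q t (%i. x i + h * z i) - Q t x)\<^sup>2 \<partial>gauss I)"
   proof -
    have "(%z. (Q t (%i. x i + h * z i) - Q t x)\<^sup>2) = (%z. (D z)\<^sup>2 + 2 * (m - Q t x) * D z + (m - Q t x)\<^sup>2)"
     by (simp add: D_def power2_eq_square algebra_simps)
    then have "(\<integral>z. (Q t (%i. x i + h * z i) - Q t x)\<^sup>2 \<partial>gauss I) = (\<integral>z. (D z)\<^sup>2 \<partial>gauss I) + 2 * (m - Q t x) * (\<integral>z. D z \<partial>gauss I) + (m - Q t x)\<^sup>2"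
     using D2i Qi by (simp add: D_def G.prob_space del: gauss_space)
    moreover have "(\<integral>z. D z \<partial>gauss I) = 0" unfolding D_def using Qi by (simp add: m_def G.prob_space del: gauss_space)
    ultimately show ?thesis by simp
   qed
   also have "... <= (\<integral>z. h\<^sup>2 * (\<Sum>i\<in>I. l i * z i)\<^sup>2 + (2 * L * C + C\<^sup>2) * h ^ 3 * (1 + N1 z) ^ 4 \<partial>gauss I)"
   proof (rule integral_mono[OF D0i])
    show "integrable (gauss I) (%z. h\<^sup>2 * (\<Sum>i\<in>I. l i * z i)\<^sup>2 + (2 * L * C + C\<^sup>2) * h ^ 3 * (1 + N1 z) ^ 4)"
     by (intro Bochner_Integration.integrable_add integrable_mult_right N1_moments gauss_linear_square(2)[OF I])
    fix z
    define S where "S = N1 z"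
    define p where "p = (\<Sum>i\<in>I. l i * z i)"
    have S: "0 <= S" using N1_nonneg by (simp add: S_def)
    have h34: "h ^ 4 <= h ^ 3" using h by (intro power_decreasing) auto
    have "Q t (%i. x i + h * z i) - Q t x = h * p + R z" by (simp add: R_def p_def)
    then have "(Q t (%i. x i + h * z i) - Q t x)\<^sup>2 = h\<^sup>2 * p\<^sup>2 + 2 * (h * p * R z) + (R z)\<^sup>2"
     by (simp add: power2_eq_square algebra_simps)
    also have "h * p * R z <= L * C * (h ^ 3 * S ^ 3)"
    proof -
     have "h * p * R z <= h * (\<bar>p\<bar> * \<bar>R z\<bar>)" using h abs_ge_self[of "p * R z"]
      by (simp add: abs_mult mult.assoc mult_left_mono)
     also have "... <= h * ((L * S) * (C * h\<^sup>2 * S\<^sup>2))"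
      using lz[of z] R[of z] h L S unfolding p_def S_def by (intro mult_left_mono mult_mono) auto
     finally show ?thesis by (simp add: eval_nat_numeral mult_ac)
    qed
    also have "(R z)\<^sup>2 <= C\<^sup>2 * (h ^ 3 * S ^ 4)"
    proof -
     have "\<bar>R z\<bar>\<^sup>2 <= (C * h\<^sup>2 * S\<^sup>2)\<^sup>2" using R[of z] unfolding S_def by (rule power_mono) simp
     then have "(R z)\<^sup>2 <= C\<^sup>2 * (h ^ 4 * S ^ 4)" by (simp add: power_mult_distrib mult.assoc flip: power_mult)
     also have "... <= C\<^sup>2 * (h ^ 3 * S ^ 4)" using h34 by (intro mult_left_mono mult_right_mono) auto
     finally show ?thesis .
    qed
    also have "L * C * (h ^ 3 * S ^ 3) <= L * C * (h ^ 3 * (1 + S) ^ 4)"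
    proof -
     have "S ^ 3 <= (1 + S) ^ 3" using S by (intro power_mono) auto
     also have "... <= (1 + S) ^ 4" using pow34 by (simp add: S_def)
     finally show ?thesis using L C h by (intro mult_left_mono) auto
    qed
    also have "C\<^sup>2 * (h ^ 3 * S ^ 4) <= C\<^sup>2 * (h ^ 3 * (1 + S) ^ 4)"
     using S h by (intro mult_left_mono power_mono) auto
    finally show "(Q t (%i. x i + h * z i) - Q t x)\<^sup>2 <= h\<^sup>2 * (\<Sum>i\<in>I. l i * z i)\<^sup>2 + (2 * L * C + C\<^sup>2) * h ^ 3 * (1 + N1 z) ^ 4"
     by (simp add: S_def p_def algebra_simps)
   qed
   also have "... = h\<^sup>2 * (\<Sum>i\<in>I. (l i)\<^sup>2) + e"
    using gauss_linear_square[OF I, of l] N1_moments(2)[of 4] by (simp add: e_def c4_def mult_ac)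
   also have "... <= L\<^sup>2 * h\<^sup>2 + e" using mult_left_mono[OF grad, of "h\<^sup>2"] by (simp add: mult.commute)
   finally show ?thesis .
  qed
 qed (use e \<tau> s in auto)
 also have "... <= V (sqrt (s\<^sup>2 + L\<^sup>2 * h\<^sup>2)) (m - T) + K * h ^ 3"
 proof -
  have "4 * e / s\<^sup>2 <= 4 * e / s0\<^sup>2" "2 * \<tau> / s ^ 3 <= 2 * \<tau> / s0 ^ 3"
   using e \<tau> s by (auto intro!: divide_left_mono power_mono mult_pos_pos)
  moreover have "4 * (L\<^sup>2 * h\<^sup>2)\<^sup>2 / s ^ 4 <= 4 * ((L\<^sup>2)\<^sup>2 * h ^ 3) / s0 ^ 4"
  proof -
   have "(L\<^sup>2 * h\<^sup>2)\<^sup>2 = (L\<^sup>2)\<^sup>2 * h ^ 4" by (simp add: power_mult_distrib flip: power_mult)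
   also have "... <= (L\<^sup>2)\<^sup>2 * h ^ 3" using h by (intro mult_left_mono power_decreasing) auto
   finally have 1: "4 * (L\<^sup>2 * h\<^sup>2)\<^sup>2 <= 4 * ((L\<^sup>2)\<^sup>2 * h ^ 3)" by simp
   have "4 * (L\<^sup>2 * h\<^sup>2)\<^sup>2 / s ^ 4 <= 4 * ((L\<^sup>2)\<^sup>2 * h ^ 3) / s ^ 4" using 1 s by (intro divide_right_mono) auto
   also have "... <= 4 * ((L\<^sup>2)\<^sup>2 * h ^ 3) / s0 ^ 4" using s h by (intro divide_left_mono power_mono mult_pos_pos) auto
   finally show ?thesis .
  qed
  moreover have "4 * e / s0\<^sup>2 + 2 * \<tau> / s0 ^ 3 + 4 * ((L\<^sup>2)\<^sup>2 * h ^ 3) / s0 ^ 4 = K * h ^ 3"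
   unfolding K_def e_def \<tau>_def by (simp only: distrib_left distrib_right times_divide_eq_left times_divide_eq_right mult_ac)
  ultimately show ?thesis by linarith
 qed
 finally show "(\<integral>z. V s (Q t (%i. x i + h * z i) - T) \<partial>gauss I) <= V (sqrt (s\<^sup>2 + L\<^sup>2 * h\<^sup>2)) (Q (sqrt (h\<^sup>2 + t\<^sup>2)) x - T) + K * h ^ 3"
  unfolding D_def m_def Q_semigroup by simp
qed

end

context gauss_lipschitz begin

lemma Q_step_constant:
 assumes d: "0 < d" and s0: "0 < s0"
 obtains K where "0 <= K" "!!t h s x T. d <= t ==> 0 <= h ==> h <= 1 ==> s0 <= s ==>
  (\<integral>z. V s (Q t (%i. x i + h * z i) - T) \<partial>gauss I) <= V (sqrt (s\<^sup>2 + L\<^sup>2 * h\<^sup>2)) (Q (sqrt (h\<^sup>2 + t\<^sup>2)) x - T) + K * h ^ 3"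
 using Q_step(2)[OF d order_refl order_refl zero_le_one s0 order_refl] Q_step(1)[OF d _ _ _ s0] that by blast

lemma V_Q_measurable: "(%z. V s (Q t (%i. x i + r * z i) - T)) \<in> borel_measurable (PiM I (%_. borel))"
proof -
 interpret Qt: gauss_lipschitz I "Q t" L by (rule Q_gauss_lipschitz)
 show ?thesis by (intro measurable_compose[OF _ V_measurable] borel_measurable_diff Qt.g_PiM borel_measurable_const)
qed

lemma V_Q_integrable: "integrable (gauss I) (%z. V s (Q t (%i. x i + r * z i) - T))"
proof (rule G.integrable_const_bound[of _ 1])
 show "(%z. V s (Q t (%i. x i + r * z i) - T)) \<in> borel_measurable (gauss I)"
  using V_Q_measurable measurable_cong_sets[OF sets_gauss refl] by blast
qed (auto simp: V_bounds)

text \<open>Induction over \<open>k\<close> Gaussian steps of size \<open>h\<close>; each costs an error of order \<open>h ^ 3\<close> and moves \<open>L\<^sup>2 * h\<^sup>2\<close> into the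
time allowed to the Brownian motion.\<close>

lemma Q_iterate:
 assumes d: "0 < d" and s0: "0 < s0" and h: "0 <= h" "h <= 1" and K: "0 <= K"
  and step: "!!t h s x T. d <= t ==> 0 <= h ==> h <= 1 ==> s0 <= s ==>
   (\<integral>z. V s (Q t (%i. x i + h * z i) - T) \<partial>gauss I) <= V (sqrt (s\<^sup>2 + L\<^sup>2 * h\<^sup>2)) (Q (sqrt (h\<^sup>2 + t\<^sup>2)) x - T) + K * h ^ 3"
 shows "(\<integral>z. V s0 (Q d (%i. x i + (sqrt (real k) * h) * z i) - T) \<partial>gauss I)
  <= V (sqrt (s0\<^sup>2 + real k * (L\<^sup>2 * h\<^sup>2))) (Q (sqrt (d\<^sup>2 + real k * h\<^sup>2)) x - T) + real k * (K * h ^ 3)"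
proof (induction k arbitrary: x)
 case 0
 then show ?case using d s0 by (simp add: G.prob_space del: gauss_space)
next
 case (Suc k)
 interpret Qd: gauss_lipschitz I "Q d" L by (rule Q_gauss_lipschitz)
 define r where "r = sqrt (real k) * h"
 define t where "t = sqrt (d\<^sup>2 + real k * h\<^sup>2)"
 define s where "s = sqrt (s0\<^sup>2 + real k * (L\<^sup>2 * h\<^sup>2))"
 have kh: "0 <= real k * h\<^sup>2" "0 <= real k * (L\<^sup>2 * h\<^sup>2)" by auto
 have "sqrt (d\<^sup>2) <= t" unfolding t_def using kh by (intro real_sqrt_le_mono) auto
 then have t: "d <= t" using d by simp
 have "sqrt (s0\<^sup>2) <= s" unfolding s_def using kh by (intro real_sqrt_le_mono) auto
 then have s: "s0 <= s" using s0 by simp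
 have t2: "t\<^sup>2 = d\<^sup>2 + real k * h\<^sup>2" unfolding t_def by (intro real_sqrt_pow2) auto
 have s2: "s\<^sup>2 = s0\<^sup>2 + real k * (L\<^sup>2 * h\<^sup>2)" unfolding s_def by (intro real_sqrt_pow2) auto
 have hr: "sqrt (h\<^sup>2 + r\<^sup>2) = sqrt (real (Suc k)) * h"
 proof -
  have "h\<^sup>2 + r\<^sup>2 = real (Suc k) * h\<^sup>2" by (simp add: r_def power_mult_distrib algebra_simps)
  then show ?thesis using h by (simp add: real_sqrt_mult)
 qed
 let ?f = "%w. V s0 (Q d (%i. x i + 1 * w i) - T)"
 have eq: "?f (\<lambda>i\<in>I. w i) = V s0 (Q d (%i. x i + w i) - T)" for w
  using Qd.g_restrict[of "%i. x i + (\<lambda>i\<in>I. w i) i"] Qd.g_restrict[of "%i. x i + w i"]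
  by (simp cong: restrict_cong)
 have int: "integrable (gauss I) (%z. ?f (\<lambda>i\<in>I. sqrt (h\<^sup>2 + r\<^sup>2) * z i))" unfolding eq by (rule V_Q_integrable)
 note conv = gauss_convolution[OF I V_Q_measurable int, unfolded eq]
 have "(\<integral>z. V s0 (Q d (%i. x i + (sqrt (real (Suc k)) * h) * z i) - T) \<partial>gauss I)
   = (\<integral>z. \<integral>z'. V s0 (Q d (%i. (x i + h * z i) + r * z' i) - T) \<partial>gauss I \<partial>gauss I)"
  using conv(1) unfolding hr by (simp add: add.assoc)
 also have "... <= (\<integral>z. V s (Q t (%i. x i + h * z i) - T) + real k * (K * h ^ 3) \<partial>gauss I)"
 proof (rule integral_mono)
  show "integrable (gauss I) (%z. \<integral>z'. V s0 (Q d (%i. (x i + h * z i) + r * z' i) - T) \<partial>gauss I)"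
   using conv(2) by (simp add: add.assoc)
  show "integrable (gauss I) (%z. V s (Q t (%i. x i + h * z i) - T) + real k * (K * h ^ 3))"
   by (intro Bochner_Integration.integrable_add V_Q_integrable) simp
  show "(\<integral>z'. V s0 (Q d (%i. (x i + h * z i) + r * z' i) - T) \<partial>gauss I) <= V s (Q t (%i. x i + h * z i) - T) + real k * (K * h ^ 3)" for z
   unfolding r_def s_def t_def by (rule Suc.IH)
 qed
 also have "... = (\<integral>z. V s (Q t (%i. x i + h * z i) - T) \<partial>gauss I) + real k * (K * h ^ 3)"
  by (subst Bochner_Integration.integral_add) (simp_all add: V_Q_integrable G.prob_space del: gauss_space)
 also have "... <= V (sqrt (s\<^sup>2 + L\<^sup>2 * h\<^sup>2)) (Q (sqrt (h\<^sup>2 + t\<^sup>2)) x - T) + K * h ^ 3 + real k * (K * h ^ 3)"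
  by (intro add_right_mono step t h s)
 also have "s\<^sup>2 + L\<^sup>2 * h\<^sup>2 = s0\<^sup>2 + real (Suc k) * (L\<^sup>2 * h\<^sup>2)" by (simp add: s2 algebra_simps)
 also have "h\<^sup>2 + t\<^sup>2 = d\<^sup>2 + real (Suc k) * h\<^sup>2" by (simp add: t2 algebra_simps)
 finally show ?case by (simp add: algebra_simps)
qed

text \<open>With \<open>m\<close> steps of size \<open>1 / sqrt m\<close> the accumulated error is of order \<open>1 / sqrt m\<close> and vanishes in the limit.\<close>

lemma smoothed_bound:
 assumes d: "0 < d" and s0: "0 < s0"
 shows "(\<integral>z. V s0 (Q d z - T) \<partial>gauss I) <= V (sqrt (s0\<^sup>2 + L\<^sup>2)) (Q (sqrt (d\<^sup>2 + 1)) (%_. 0) - T)"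
proof (rule Q_step_constant[OF d s0])
 fix K assume K: "0 <= K" and step: "!!t h s x T. d <= t ==> 0 <= h ==> h <= 1 ==> s0 <= s ==>
  (\<integral>z. V s (Q t (%i. x i + h * z i) - T) \<partial>gauss I) <= V (sqrt (s\<^sup>2 + L\<^sup>2 * h\<^sup>2)) (Q (sqrt (h\<^sup>2 + t\<^sup>2)) x - T) + K * h ^ 3"
 let ?b = "V (sqrt (s0\<^sup>2 + L\<^sup>2)) (Q (sqrt (d\<^sup>2 + 1)) (%_. 0) - T)"
 have le: "(\<integral>z. V s0 (Q d z - T) \<partial>gauss I) <= ?b + K / sqrt (real (Suc m))" for m
 proof -
  define h where "h = 1 / sqrt (real (Suc m))"
  have h: "0 <= h" "h <= 1" "sqrt (real (Suc m)) * h = 1" "real (Suc m) * h\<^sup>2 = 1"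
   by (auto simp: h_def power_divide)
  have "real (Suc m) * (L\<^sup>2 * h\<^sup>2) = L\<^sup>2 * (real (Suc m) * h\<^sup>2)" by (simp only: mult_ac)
  then have h5: "real (Suc m) * (L\<^sup>2 * h\<^sup>2) = L\<^sup>2" by (simp only: h(4) mult_1_right)
  have "real (Suc m) * (K * h ^ 3) = K * h * (real (Suc m) * h\<^sup>2)" by (simp only: power3_eq_cube power2_eq_square mult_ac)
  then have h6: "real (Suc m) * (K * h ^ 3) = K / sqrt (real (Suc m))" unfolding h(4) by (simp add: h_def)
  from Q_iterate[OF d s0 h(1,2) K step, of "%_. 0" "Suc m" T]
  show ?thesis unfolding h(3,4) h5 h6 by simp
 qed
 have "(%m. ?b + K / sqrt (real (Suc m))) \<longlonglongrightarrow> ?b + 0"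
 proof (intro tendsto_add tendsto_const)
  have "filterlim (%m. sqrt (real (Suc m))) at_top sequentially"
   by (intro filterlim_compose[OF sqrt_at_top] filterlim_compose[OF filterlim_real_sequentially filterlim_Suc])
  then show "(%m. K / sqrt (real (Suc m))) \<longlonglongrightarrow> 0"
   by (intro tendsto_divide_0[OF tendsto_const] filterlim_at_top_imp_at_infinity)
 qed
 then have "(\<integral>z. V s0 (Q d z - T) \<partial>gauss I) <= ?b + 0"
  by (rule LIMSEQ_le_const) (use le in blast)
 then show ?thesis by simp
qed

text \<open>The smoothing parameter \<open>\<epsilon>\<close> replaces \<open>g\<close> by \<open>Q \<epsilon>\<close> and starts the crossing probability at time \<open>\<epsilon>\<^sup>2\<close>; both
effects disappear as \<open>\<epsilon>\<close> tends to 0, because \<open>L > 0\<close> keeps the final time positive.\<close>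

theorem gauss_concentration:
 "measure (gauss I) {z \<in> space (gauss I). (\<integral>z. g z \<partial>gauss I) + L * q <= g z} <= 2 * std_normal_tail q"
proof -
 define E where "E = (\<integral>z. g z \<partial>gauss I)"
 have E: "Q 1 (%_. 0) = E" by (simp add: Q_def E_def)
 define F where "F = (%\<epsilon>. 2 * Phi ((- (L * q) + L * m1 * \<epsilon> + L * m1 * (sqrt (\<epsilon>\<^sup>2 + 1) - 1)) / sqrt (\<epsilon>\<^sup>2 + L\<^sup>2)))"
 have gm: "g \<in> borel_measurable (gauss I)" using g_gauss[of "%_. 0" 1] by simp
 let ?A = "{z \<in> space (gauss I). E + L * q <= g z}"
 have A: "?A \<in> sets (gauss I)" using gm by measurable
 have le: "measure (gauss I) ?A <= F \<epsilon>" if \<epsilon>: "0 < \<epsilon>" for \<epsilon>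
 proof -
  \<comment> \<open>\<open>L * \<epsilon> * m1\<close> bounds the distance between \<open>g\<close> and \<open>Q \<epsilon>\<close>\<close>
  define T where "T = E + L * q - L * \<epsilon> * m1"
  have "measure (gauss I) ?A = (\<integral>z. indicator ?A z \<partial>gauss I)"
   unfolding Bochner_Integration.integral_indicator by (intro arg_cong[where f = "measure (gauss I)"]) blast
  also have "... <= (\<integral>z. V \<epsilon> (Q \<epsilon> z - T) \<partial>gauss I)"
  proof (rule integral_mono)
   show "integrable (gauss I) (indicator ?A :: _ => real)" using A by (simp add: G.emeasure_eq_measure)
   show "integrable (gauss I) (%z. V \<epsilon> (Q \<epsilon> z - T))" using V_Q_integrable[of \<epsilon> \<epsilon> "%_. 0" 1 T] by simp
   fix z
   show "indicator ?A z <= V \<epsilon> (Q \<epsilon> z - T)"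
   proof (cases "E + L * q <= g z")
    case True
    have "g z - L * \<epsilon> * m1 <= Q \<epsilon> z" using Q_time[of \<epsilon> z 0] \<epsilon> by (simp add: Q_0 abs_le_iff)
    then have "V \<epsilon> (Q \<epsilon> z - T) = 1" using True by (intro V_nonneg_arg \<epsilon>) (simp add: T_def)
    then show ?thesis by (simp add: indicator_def)
   qed (simp add: V_bounds)
  qed
  also have "... <= V (sqrt (\<epsilon>\<^sup>2 + L\<^sup>2)) (Q (sqrt (\<epsilon>\<^sup>2 + 1)) (%_. 0) - T)" by (rule smoothed_bound[OF \<epsilon> \<epsilon>])
  also have "... <= V (sqrt (\<epsilon>\<^sup>2 + L\<^sup>2)) (- (L * q) + L * m1 * \<epsilon> + L * m1 * (sqrt (\<epsilon>\<^sup>2 + 1) - 1))"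
  proof (rule V_mono)
   show "0 < sqrt (\<epsilon>\<^sup>2 + L\<^sup>2)" using \<epsilon> by (simp add: add_pos_nonneg)
   have "1 <= sqrt (\<epsilon>\<^sup>2 + 1)" by simp
   then have "Q (sqrt (\<epsilon>\<^sup>2 + 1)) (%_. 0) - E <= L * (sqrt (\<epsilon>\<^sup>2 + 1) - 1) * m1"
    using Q_time[of "sqrt (\<epsilon>\<^sup>2 + 1)" "%_. 0" 1] E by (simp add: abs_le_iff)
   then show "Q (sqrt (\<epsilon>\<^sup>2 + 1)) (%_. 0) - T <= - (L * q) + L * m1 * \<epsilon> + L * m1 * (sqrt (\<epsilon>\<^sup>2 + 1) - 1)"
    by (simp add: T_def mult_ac)
  qed
  also have "... <= F \<epsilon>" by (simp add: V_def F_def)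
  finally show ?thesis .
 qed
 have "isCont F 0"
  unfolding F_def using L by (intro continuous_intros isCont_o2[OF _ isCont_Phi]) auto
 then have "(F \<longlongrightarrow> F 0) (at_right 0)" unfolding isCont_def by (rule tendsto_within_subset) auto
 moreover have "\<forall>\<^sub>F \<epsilon> in at_right 0. measure (gauss I) ?A <= F \<epsilon>"
  using eventually_at_right_less[of "0::real"] by eventually_elim (rule le)
 ultimately have "measure (gauss I) ?A <= F 0" by (rule tendsto_lowerbound) simp
 also have "F 0 = 2 * std_normal_tail q" using L by (simp add: F_def Phi_def)
 finally show ?thesis by (simp add: E_def)
qed

end

section \<open>Factorising a covariance matrix\<close>

lemma quadratic_form_shift:
 fixes c :: "'k::finite => 'k => real"
 assumes sym: "!!k l. c k l = c l k"
 shows "(\<Sum>k\<in>UNIV. \<Sum>l\<in>UNIV. (u k + (if k = s then t else 0)) * (u l + (if l = s then t else 0)) * c k l)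
  = (\<Sum>k\<in>UNIV. \<Sum>l\<in>UNIV. u k * u l * c k l) + 2 * t * (\<Sum>k\<in>UNIV. u k * c k s) + t\<^sup>2 * c s s"
proof -
 have inner: "(\<Sum>l\<in>UNIV. (u l + (if l = s then t else 0)) * c k l) = (\<Sum>l\<in>UNIV. u l * c k l) + t * c k s" for k
 proof -
  have "(\<Sum>l\<in>UNIV. (u l + (if l = s then t else 0)) * c k l) = (\<Sum>l\<in>UNIV. u l * c k l) + (\<Sum>l\<in>UNIV. if l = s then t * c k l else 0)"
   unfolding sum.distrib[symmetric] by (intro sum.cong refl) (simp add: distrib_right)
  then show ?thesis by simp
 qed
 have "(\<Sum>k\<in>UNIV. \<Sum>l\<in>UNIV. (u k + (if k = s then t else 0)) * (u l + (if l = s then t else 0)) * c k l)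
   = (\<Sum>k\<in>UNIV. (u k + (if k = s then t else 0)) * ((\<Sum>l\<in>UNIV. u l * c k l) + t * c k s))"
  unfolding inner[symmetric] by (simp add: sum_distrib_left mult.assoc)
 also have "... = (\<Sum>k\<in>UNIV. u k * (\<Sum>l\<in>UNIV. u l * c k l)) + t * (\<Sum>k\<in>UNIV. u k * c k s)
   + (\<Sum>k\<in>UNIV. if k = s then t * ((\<Sum>l\<in>UNIV. u l * c k l) + t * c k s) else 0)"
  unfolding sum_distrib_left[of t] sum.distrib[symmetric] by (intro sum.cong refl) (simp add: algebra_simps)
 also have "(\<Sum>k\<in>UNIV. if k = s then t * ((\<Sum>l\<in>UNIV. u l * c k l) + t * c k s) else 0) = t * ((\<Sum>l\<in>UNIV. u l * c s l) + t * c s s)"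
  by simp
 also have "(\<Sum>l\<in>UNIV. u l * c s l) = (\<Sum>k\<in>UNIV. u k * c k s)" by (intro sum.cong refl) (simp add: sym[of s])
 finally show ?thesis by (simp add: sum_distrib_left mult.assoc power2_eq_square distrib_left)
qed

text \<open>Cholesky factorisation by induction on the support: the row of \<open>s\<close> is split off as a rank-one term and the Schur complement is
again positive semidefinite. A vanishing diagonal entry forces its whole row to vanish.\<close>

lemma positive_semidefinite_gram_supported:
 fixes c :: "'k::finite => 'k => real"
 assumes "finite S" "!!k l. c k l = c l k" "!!u. 0 <= (\<Sum>k\<in>UNIV. \<Sum>l\<in>UNIV. u k * u l * c k l)"
  "!!k l. k \<notin> S ==> c k l = 0"
 shows "\<exists>a. \<forall>k l. c k l = (\<Sum>m\<in>S. a k m * a l m)"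
 using assms
proof (induction S arbitrary: c rule: finite_induct)
 case (insert s S)
 note sym = insert.prems(1) and psd = insert.prems(2) and supp = insert.prems(3)
 have shift: "0 <= (\<Sum>k\<in>UNIV. \<Sum>l\<in>UNIV. u k * u l * c k l) + 2 * t * (\<Sum>k\<in>UNIV. u k * c k s) + t\<^sup>2 * c s s" for u t
  using psd[of "%k. u k + (if k = s then t else 0)"] unfolding quadratic_form_shift[OF sym] .
 have ss: "0 <= c s s" using shift[of "%_. 0" 1] by simp
 show ?case
 proof (cases "c s s = 0")
  case True
  have zero: "c k s = 0" for k
  proof (rule ccontr)
   assume nz: "c k s \<noteq> 0"
   have unit: "(\<Sum>i\<in>UNIV. (if i = k then 1 else 0) * f i) = f k" for f :: "'k => real"
   proof -
    have "(\<Sum>i\<in>UNIV. (if i = k then 1 else 0) * f i) = (\<Sum>i\<in>UNIV. if i = k then f i else 0)" by (intro sum.cong refl) simp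
    then show ?thesis by simp
   qed
   have "(\<Sum>i\<in>UNIV. \<Sum>j\<in>UNIV. (if i = k then 1 else 0) * (if j = k then 1 else 0) * c i j) = c k k"
    unfolding mult.assoc sum_distrib_left[symmetric] unit ..
   then have "0 <= c k k + 2 * t * c k s" for t
    using shift[of "%i. if i = k then 1 else 0" t] True unfolding unit by simp
   from this[of "- (c k k + 1) / (2 * c k s)"]
   have "0 <= c k k + 2 * (- (c k k + 1) / (2 * c k s)) * c k s" .
   moreover have "2 * (- (c k k + 1) / (2 * c k s)) * c k s = - (c k k + 1)" using nz by simp
   ultimately show False by linarith
  qed
  have "c k l = 0" if "k \<notin> S" for k l
   using supp[of k l] zero[of l] sym[of k l] that by (cases "k = s") auto
  then obtain a where a: "\<forall>k l. c k l = (\<Sum>m\<in>S. a k m * a l m)" using insert.IH[OF sym psd] by blast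
  have "c k l = (\<Sum>m\<in>insert s S. (if m = s then 0 else a k m) * (if m = s then 0 else a l m))" for k l
  proof -
   have "(\<Sum>m\<in>S. (if m = s then 0 else a k m) * (if m = s then 0 else a l m)) = (\<Sum>m\<in>S. a k m * a l m)"
    using insert.hyps by (intro sum.cong refl) auto
   then show ?thesis using insert.hyps a by simp
  qed
  note rep = this
  show ?thesis by (intro exI[of _ "%k m. if m = s then 0 else a k m"] allI) (rule rep)
 next
  case False
  then have sp: "0 < c s s" using ss by simp
  define c' where "c' = (%k l. c k l - c k s * c l s / c s s)"
  have "c' k l = c' l k" for k l using sym[of k l] by (simp add: c'_def mult.commute)
  moreover have "0 <= (\<Sum>k\<in>UNIV. \<Sum>l\<in>UNIV. u k * u l * c' k l)" for u
  proof -
   define w where "w = (\<Sum>k\<in>UNIV. u k * c k s)"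
   have ww: "w * w / c s s = (\<Sum>k\<in>UNIV. \<Sum>l\<in>UNIV. u k * u l * (c k s * c l s / c s s))"
    unfolding w_def sum_product sum_divide_distrib by (intro sum.cong refl) simp
   have "(\<Sum>k\<in>UNIV. \<Sum>l\<in>UNIV. u k * u l * c' k l) = (\<Sum>k\<in>UNIV. \<Sum>l\<in>UNIV. u k * u l * c k l) - w * w / c s s"
    unfolding ww sum_subtractf[symmetric] by (intro sum.cong refl) (simp add: c'_def right_diff_distrib)
   moreover have "0 <= (\<Sum>k\<in>UNIV. \<Sum>l\<in>UNIV. u k * u l * c k l) - w * w / c s s"
    using shift[of u "- w / c s s"] sp unfolding w_def[symmetric] by (simp add: power2_eq_square)
   ultimately show ?thesis by simp
  qed
  moreover have "c' k l = 0" if "k \<notin> S" for k l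
  proof (cases "k = s")
   case True
   then show ?thesis using sp sym[of s l] by (simp add: c'_def)
  next
   case False
   then show ?thesis using supp[of k] that by (simp add: c'_def)
  qed
  ultimately obtain a where a: "\<forall>k l. c' k l = (\<Sum>m\<in>S. a k m * a l m)" using insert.IH[of c'] by blast
  let ?a = "%k m. if m = s then c k s / sqrt (c s s) else a k m"
  have "c k l = (\<Sum>m\<in>insert s S. ?a k m * ?a l m)" for k l
  proof -
   have "(\<Sum>m\<in>S. ?a k m * ?a l m) = c' k l" using insert.hyps a by (simp) (intro sum.cong refl, auto)
   then have "(\<Sum>m\<in>insert s S. ?a k m * ?a l m) = c k s / sqrt (c s s) * (c l s / sqrt (c s s)) + c' k l" using insert.hyps by simp
   also have "... = c k l" using sp by (simp add: c'_def)
   finally show ?thesis by simp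
  qed
  note rep = this
  show ?thesis by (intro exI[of _ ?a] allI) (rule rep)
 qed
qed simp

theorem positive_semidefinite_gram:
 fixes c :: "'k::finite => 'k => real"
 assumes "!!k l. c k l = c l k" "!!u. 0 <= (\<Sum>k\<in>UNIV. \<Sum>l\<in>UNIV. u k * u l * c k l)"
 obtains a where "!!k l. c k l = (\<Sum>m\<in>(UNIV :: 'k set). a k m * a l m)"
proof -
 have "\<exists>a. \<forall>k l. c k l = (\<Sum>m\<in>(UNIV :: 'k set). a k m * a l m)"
  by (rule positive_semidefinite_gram_supported) (use assms in auto)
 then obtain a where "\<forall>k l. c k l = (\<Sum>m\<in>(UNIV :: 'k set). a k m * a l m)" ..
 then show ?thesis by (intro that) simp
qed

section \<open>Gaussian samples\<close>

text \<open>The two cases of the definition, a normal density and a point mass, are brought into one form: only centred second moment and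
characteristic function are used from here on.\<close>

lemma gaussian_functional:
 fixes X :: "'a => real ^ 'k"
 assumes P: "prob_space P" and X: "gaussian_vector P X"
 shows "\<exists>m. integrable P (%\<omega>. (u \<bullet> X \<omega> - m)\<^sup>2) \<and> (\<integral>\<omega>. u \<bullet> X \<omega> - m \<partial>P) = 0 \<and> integrable P (%\<omega>. u \<bullet> X \<omega> - m) \<and>
  (\<integral>\<omega>. iexp (u \<bullet> X \<omega> - m) \<partial>P) = exp (- (\<integral>\<omega>. (u \<bullet> X \<omega> - m)\<^sup>2 \<partial>P) / 2)"
proof -
 interpret prob_space P by fact
 have Xm: "(%\<omega>. u \<bullet> X \<omega>) \<in> borel_measurable P" using X by (auto simp: gaussian_vector_def)
 consider m s where "s > 0" "distributed P lborel (%\<omega>. u \<bullet> X \<omega>) (normal_density m s)" | m where "AE \<omega> in P. u \<bullet> X \<omega> = m"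
  using X unfolding gaussian_vector_def by blast
 then show ?thesis
 proof cases
  case (1 m s)
  let ?N = "density lborel (%t. ennreal (std_normal_density t))"
  define Z where "Z = (%\<omega>. (u \<bullet> X \<omega> - m) / s)"
  have "distributed P lborel Z std_normal_density"
   unfolding Z_def using 1 normal_standard_normal_convert[of s "%\<omega>. u \<bullet> X \<omega>" m] by simp
  then have law: "distr P lborel Z = ?N" and Zm': "Z \<in> measurable P lborel" by (auto simp: distributed_def)
  have Zm: "Z \<in> borel_measurable P" using Zm' by simp
  have sZ: "u \<bullet> X \<omega> - m = s * Z \<omega>" for \<omega> using 1 by (simp add: Z_def)
  have tr: "(\<integral>\<omega>. f (Z \<omega>) \<partial>P) = (\<integral>t. f t \<partial>?N)" if "f \<in> borel_measurable lborel" for f :: "real => 'b::{banach, second_countable_topology}"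
   unfolding law[symmetric] by (rule integral_distr[OF Zm' that, symmetric])
  have tri: "integrable P (%\<omega>. f (Z \<omega>)) = integrable ?N f" if "f \<in> borel_measurable lborel" for f :: "real => real"
   unfolding law[symmetric] by (rule integrable_distr_eq[OF Zm' that, symmetric])
  have m1: "(%t. t) \<in> borel_measurable (lborel :: real measure)" "(%t. t * t) \<in> borel_measurable (lborel :: real measure)" by measurable
  have i1: "integrable P Z" "(\<integral>\<omega>. Z \<omega> \<partial>P) = 0"
   by (rule iffD2[OF tri[OF m1(1)] std_normal_moments(1)]) (rule trans[OF tr[OF m1(1)] std_normal_moments(2)])
  have i2: "integrable P (%\<omega>. Z \<omega> * Z \<omega>)" "(\<integral>\<omega>. Z \<omega> * Z \<omega> \<partial>P) = 1"
   by (rule iffD2[OF tri[OF m1(2)] std_normal_moments(3)]) (rule trans[OF tr[OF m1(2)] std_normal_moments(4)])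
  have sq: "(s * Z \<omega>)\<^sup>2 = s\<^sup>2 * (Z \<omega> * Z \<omega>)" for \<omega> by (simp add: power2_eq_square)
  have em: "(%t. iexp (s * t)) \<in> borel_measurable lborel" by measurable
  have "(\<integral>\<omega>. iexp (s * Z \<omega>) \<partial>P) = char ?N s" unfolding char_def by (rule tr[OF em])
  also have "... = complex_of_real (exp (- (s\<^sup>2) / 2))" using char_std_normal_distribution by (simp add: fun_eq_iff)
  finally have "(\<integral>\<omega>. iexp (s * Z \<omega>) \<partial>P) = complex_of_real (exp (- (s\<^sup>2) / 2))" .
  note ch = this
  have v: "(\<integral>\<omega>. (s * Z \<omega>)\<^sup>2 \<partial>P) = s\<^sup>2" unfolding sq using i2 by simp
  show ?thesis
  proof (intro exI[of _ m] conjI)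
   show "integrable P (%\<omega>. (u \<bullet> X \<omega> - m)\<^sup>2)" unfolding sZ sq by (intro integrable_mult_right i2(1))
   show "(\<integral>\<omega>. u \<bullet> X \<omega> - m \<partial>P) = 0" unfolding sZ using i1 by simp
   show "integrable P (%\<omega>. u \<bullet> X \<omega> - m)" unfolding sZ by (intro integrable_mult_right i1(1))
   show "(\<integral>\<omega>. iexp (u \<bullet> X \<omega> - m) \<partial>P) = exp (- (\<integral>\<omega>. (u \<bullet> X \<omega> - m)\<^sup>2 \<partial>P) / 2)"
    unfolding sZ v by (rule ch)
  qed
 next
  case (2 m)
  have "(\<integral>\<omega>. iexp (u \<bullet> X \<omega> - m) \<partial>P) = (\<integral>\<omega>. 1 \<partial>P)"
  proof (rule integral_cong_AE)
   have "(%\<omega>. u \<bullet> X \<omega> - m) \<in> borel_measurable P" using Xm by simp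
   then show "(%\<omega>. iexp (u \<bullet> X \<omega> - m)) \<in> borel_measurable P"
    by (rule measurable_compose[where N = borel and g = "%r. iexp r"]) measurable
   show "AE \<omega> in P. iexp (u \<bullet> X \<omega> - m) = 1" using 2 by eventually_elim simp
  qed simp
  moreover have sq0: "AE \<omega> in P. (u \<bullet> X \<omega> - m)\<^sup>2 = 0" "AE \<omega> in P. u \<bullet> X \<omega> - m = 0" using 2 by (eventually_elim, simp)+
  moreover have "integrable P (%\<omega>. (u \<bullet> X \<omega> - m)\<^sup>2)" "integrable P (%\<omega>. u \<bullet> X \<omega> - m)"
   using Xm integrable_cong_AE[OF _ _ sq0(1)] integrable_cong_AE[OF _ _ sq0(2)] by auto
  moreover have "(\<integral>\<omega>. (u \<bullet> X \<omega> - m)\<^sup>2 \<partial>P) = 0" "(\<integral>\<omega>. u \<bullet> X \<omega> - m \<partial>P) = 0"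
   using Xm integral_cong_AE[OF _ _ sq0(1)] integral_cong_AE[OF _ _ sq0(2)] by auto
  ultimately show ?thesis by (intro exI[of _ m]) (simp add: prob_space)
 qed
qed

locale gaussian_sample = prob_space P for P :: "'a measure" +
 fixes n :: nat and Y :: "nat => 'a => real ^ 'k" and \<mu> :: "real ^ 'k"
 assumes n0: "0 < n" and iid: "iid_vectors P n Y"
  and intY: "!!i. i \<in> {1..n} ==> integrable P (Y i)" and mu: "\<mu> = (\<integral>\<omega>. Y 1 \<omega> \<partial>P)"
  and gaussian: "!!i. i \<in> {1..n} ==> gaussian_vector P (Y i)"
begin

definition cov :: "'k => 'k => real" where "cov k l = (\<integral>\<omega>. (Y 1 \<omega> - \<mu>) $ k * (Y 1 \<omega> - \<mu>) $ l \<partial>P)"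

lemma one_in: "1 \<in> {1..n}" using n0 by auto

lemma Y_measurable: "i \<in> {1..n} ==> Y i \<in> borel_measurable P" by (rule borel_measurable_integrable[OF intY])

lemma functional:
 "integrable P (%\<omega>. (u \<bullet> (Y 1 \<omega> - \<mu>))\<^sup>2)"
 "(\<integral>\<omega>. iexp (u \<bullet> (Y 1 \<omega> - \<mu>)) \<partial>P) = exp (- (\<integral>\<omega>. (u \<bullet> (Y 1 \<omega> - \<mu>))\<^sup>2 \<partial>P) / 2)"
proof -
 obtain m where m: "integrable P (%\<omega>. (u \<bullet> Y 1 \<omega> - m)\<^sup>2)" "(\<integral>\<omega>. u \<bullet> Y 1 \<omega> - m \<partial>P) = 0"
  "(\<integral>\<omega>. iexp (u \<bullet> Y 1 \<omega> - m) \<partial>P) = exp (- (\<integral>\<omega>. (u \<bullet> Y 1 \<omega> - m)\<^sup>2 \<partial>P) / 2)"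
  using gaussian_functional[OF prob_space_axioms gaussian[OF one_in], of u] by blast
 have "(\<integral>\<omega>. u \<bullet> Y 1 \<omega> - m \<partial>P) = u \<bullet> \<mu> - m"
  unfolding mu using intY[OF one_in] by (simp add: prob_space)
 then have "m = u \<bullet> \<mu>" using m(2) by simp
 then have eq: "u \<bullet> (Y 1 \<omega> - \<mu>) = u \<bullet> Y 1 \<omega> - m" for \<omega> by (simp add: inner_diff_right)
 show "integrable P (%\<omega>. (u \<bullet> (Y 1 \<omega> - \<mu>))\<^sup>2)"
  "(\<integral>\<omega>. iexp (u \<bullet> (Y 1 \<omega> - \<mu>)) \<partial>P) = exp (- (\<integral>\<omega>. (u \<bullet> (Y 1 \<omega> - \<mu>))\<^sup>2 \<partial>P) / 2)"
  unfolding eq by (rule m(1)) (rule m(3))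
qed

lemma component_sq: "integrable P (%\<omega>. ((Y 1 \<omega> - \<mu>) $ k)\<^sup>2)"
 using functional(1)[of "axis k 1"] by (simp add: inner_axis' del: vector_minus_component)

lemma component_prod: "integrable P (%\<omega>. (Y 1 \<omega> - \<mu>) $ k * (Y 1 \<omega> - \<mu>) $ l)"
proof -
 have c: "(%\<omega>. (Y 1 \<omega> - \<mu>) $ k) \<in> borel_measurable P" for k
  using Y_measurable[OF one_in] by (intro measurable_compose[where g = "%v. v $ k" and N = borel and f = "%\<omega>. Y 1 \<omega> - \<mu>"]) auto
 show ?thesis by (rule integrable_mult_of_squares[OF c c component_sq component_sq])
qed

lemma functional_variance: "(\<integral>\<omega>. (u \<bullet> (Y 1 \<omega> - \<mu>))\<^sup>2 \<partial>P) = (\<Sum>k\<in>UNIV. \<Sum>l\<in>UNIV. u $ k * u $ l * cov k l)"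
proof -
 have "(%\<omega>. (u \<bullet> (Y 1 \<omega> - \<mu>))\<^sup>2) = (%\<omega>. \<Sum>k\<in>UNIV. \<Sum>l\<in>UNIV. u $ k * u $ l * ((Y 1 \<omega> - \<mu>) $ k * (Y 1 \<omega> - \<mu>) $ l))"
  by (simp add: inner_vec_def power2_eq_square sum_product mult_ac del: vector_minus_component)
 moreover have "(\<integral>\<omega>. (\<Sum>k\<in>UNIV. \<Sum>l\<in>UNIV. u $ k * u $ l * ((Y 1 \<omega> - \<mu>) $ k * (Y 1 \<omega> - \<mu>) $ l)) \<partial>P)
  = (\<Sum>k\<in>UNIV. \<integral>\<omega>. (\<Sum>l\<in>UNIV. u $ k * u $ l * ((Y 1 \<omega> - \<mu>) $ k * (Y 1 \<omega> - \<mu>) $ l)) \<partial>P)"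
  by (intro Bochner_Integration.integral_sum Bochner_Integration.integrable_sum integrable_mult_right component_prod)
 moreover have "(\<integral>\<omega>. (\<Sum>l\<in>UNIV. u $ k * u $ l * ((Y 1 \<omega> - \<mu>) $ k * (Y 1 \<omega> - \<mu>) $ l)) \<partial>P) = (\<Sum>l\<in>UNIV. u $ k * u $ l * cov k l)" for k
 proof -
  have "(\<integral>\<omega>. (\<Sum>l\<in>UNIV. u $ k * u $ l * ((Y 1 \<omega> - \<mu>) $ k * (Y 1 \<omega> - \<mu>) $ l)) \<partial>P)
   = (\<Sum>l\<in>UNIV. \<integral>\<omega>. u $ k * u $ l * ((Y 1 \<omega> - \<mu>) $ k * (Y 1 \<omega> - \<mu>) $ l) \<partial>P)"
   by (intro Bochner_Integration.integral_sum integrable_mult_right component_prod)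
  then show ?thesis by (simp add: cov_def del: vector_minus_component)
 qed
 ultimately show ?thesis by simp
qed

lemma cov_sym: "cov k l = cov l k" by (simp add: cov_def mult.commute del: vector_minus_component)

lemma cov_psd: "0 <= (\<Sum>k\<in>UNIV. \<Sum>l\<in>UNIV. u k * u l * cov k l)"
proof -
 have "0 <= (\<integral>\<omega>. ((\<chi> k. u k) \<bullet> (Y 1 \<omega> - \<mu>))\<^sup>2 \<partial>P)" by (intro integral_nonneg_AE) auto
 then show ?thesis unfolding functional_variance by simp
qed

lemma std_dev_cov: "(std_dev_vector P (Y 1) $ k)\<^sup>2 = cov k k"
proof -
 have "(\<integral>\<omega>. Y 1 \<omega> $ k \<partial>P) = \<mu> $ k"
  using integral_inner_right[of "axis k 1" P "Y 1"] intY[OF one_in] unfolding mu by (simp add: inner_axis')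
 then have "variance (%\<omega>. Y 1 \<omega> $ k) = cov k k"
  unfolding cov_def by (simp add: power2_eq_square)
 moreover have "0 <= variance (%\<omega>. Y 1 \<omega> $ k)" by (intro integral_nonneg_AE) auto
 ultimately show ?thesis by (simp add: std_dev_vector_def)
qed

definition J :: "(nat \<times> 'k) set" where "J = {1..n} \<times> UNIV"

text \<open>The centred sample as one vector of \<open>n\<close> times \<open>CARD('k)\<close> real coordinates.\<close>

definition coords :: "'a => nat \<times> 'k => real" where "coords \<omega> = (\<lambda>q\<in>J. (Y (fst q) \<omega> - \<mu>) $ snd q)"

definition block :: "('k => 'k => real) => nat \<times> 'k => nat \<times> 'k => real" where
 "block a q r = (if fst q = fst r then a (snd q) (snd r) else 0)"

lemma finite_J: "finite J" by (simp add: J_def)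

lemma sum_J: "(\<Sum>q\<in>J. f q) = (\<Sum>i=1..n. \<Sum>k\<in>UNIV. f (i, k))"
 by (simp add: J_def sum.cartesian_product case_prod_unfold)

lemma coords_measurable: "coords \<in> measurable P (PiM J (%_. borel))"
 unfolding coords_def
proof (rule measurable_restrict)
 fix q assume "q \<in> J"
 then have "fst q \<in> {1..n}" by (auto simp: J_def)
 then have "(%\<omega>. Y (fst q) \<omega> - \<mu>) \<in> borel_measurable P" using Y_measurable by (intro borel_measurable_diff) auto
 then show "(%\<omega>. (Y (fst q) \<omega> - \<mu>) $ snd q) \<in> borel_measurable P"
  by (rule measurable_compose[where g = "%v. v $ snd q" and N = borel]) measurable
qed

lemma coords_char:
 "(\<integral>y. iexp (\<Sum>q\<in>J. v q * y q) \<partial>distr P (PiM J (%_. borel)) coords)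
  = exp (- (\<Sum>i=1..n. \<Sum>k\<in>UNIV. \<Sum>l\<in>UNIV. v (i, k) * v (i, l) * cov k l) / 2)"
proof -
 have ym: "(%y. iexp (\<Sum>q\<in>J. v q * y q)) \<in> borel_measurable (PiM J (%_. borel))"
  by (rule measurable_compose[where N = borel and g = "%r. iexp r"])
   (intro borel_measurable_sum borel_measurable_times borel_measurable_const measurable_component_singleton, measurable)
 let ?u = "%i. (\<chi> k. v (i, k)) :: real ^ 'k"
 have split: "iexp (\<Sum>q\<in>J. v q * coords \<omega> q) = (\<Prod>i=1..n. iexp (?u i \<bullet> (Y i \<omega> - \<mu>)))" for \<omega>
 proof -
  have "(\<Sum>q\<in>J. v q * coords \<omega> q) = (\<Sum>(i, k)\<in>{1..n} \<times> UNIV. v (i, k) * (Y i \<omega> - \<mu>) $ k)"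
   unfolding J_def by (intro sum.cong refl) (auto simp: coords_def J_def)
  also have "... = (\<Sum>i=1..n. ?u i \<bullet> (Y i \<omega> - \<mu>))"
   by (simp add: sum.cartesian_product[symmetric] inner_vec_def del: vector_minus_component)
  finally have "(\<Sum>q\<in>J. v q * coords \<omega> q) = (\<Sum>i=1..n. ?u i \<bullet> (Y i \<omega> - \<mu>))" .
  then show ?thesis by (simp only: of_real_sum sum_distrib_left exp_sum[OF finite_atLeastAtMost])
 qed
 have em: "(%x. iexp (w \<bullet> (x - \<mu>))) \<in> borel_measurable borel" for w :: "real ^ 'k"
  by (rule measurable_compose[where N = borel and g = "%r. iexp r"]) measurable
 have ind: "indep_vars (%_. borel) Y {1..n}" using iid by (simp add: iid_vectors_def)
 have indE: "indep_vars (%_. borel) (%i \<omega>. iexp (?u i \<bullet> (Y i \<omega> - \<mu>))) {1..n}"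
  by (rule indep_vars_compose2[OF ind em])
 have "(\<integral>y. iexp (\<Sum>q\<in>J. v q * y q) \<partial>distr P (PiM J (%_. borel)) coords) = (\<integral>\<omega>. (\<Prod>i=1..n. iexp (?u i \<bullet> (Y i \<omega> - \<mu>))) \<partial>P)"
  unfolding integral_distr[OF coords_measurable ym] split ..
 also have "... = (\<Prod>i=1..n. \<integral>\<omega>. iexp (?u i \<bullet> (Y i \<omega> - \<mu>)) \<partial>P)"
 proof (rule indep_vars_lebesgue_integral[OF _ indE])
  fix i assume "i \<in> {1..n}"
  then show "integrable P (%\<omega>. iexp (?u i \<bullet> (Y i \<omega> - \<mu>)))"
   by (intro iexp_integrable prob_space_axioms borel_measurable_inner borel_measurable_const borel_measurable_diff Y_measurable)
 qed simp
 also have "... = (\<Prod>i=1..n. complex_of_real (exp (- (\<Sum>k\<in>UNIV. \<Sum>l\<in>UNIV. v (i, k) * v (i, l) * cov k l) / 2)))"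
 proof (rule prod.cong[OF refl])
  fix i assume i: "i \<in> {1..n}"
  have "(\<integral>\<omega>. iexp (?u i \<bullet> (Y i \<omega> - \<mu>)) \<partial>P) = (\<integral>x. iexp (?u i \<bullet> (x - \<mu>)) \<partial>distr P borel (Y i))"
   by (rule integral_distr[OF Y_measurable[OF i] em, symmetric])
  also have "distr P borel (Y i) = distr P borel (Y 1)" using iid i unfolding iid_vectors_def by blast
  also have "(\<integral>x. iexp (?u i \<bullet> (x - \<mu>)) \<partial>distr P borel (Y 1)) = (\<integral>\<omega>. iexp (?u i \<bullet> (Y 1 \<omega> - \<mu>)) \<partial>P)"
   by (rule integral_distr[OF Y_measurable[OF one_in] em])
  also have "... = complex_of_real (exp (- (\<Sum>k\<in>UNIV. \<Sum>l\<in>UNIV. v (i, k) * v (i, l) * cov k l) / 2))"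
   unfolding functional(2) functional_variance by simp
  finally show "(\<integral>\<omega>. iexp (?u i \<bullet> (Y i \<omega> - \<mu>)) \<partial>P) = complex_of_real (exp (- (\<Sum>k\<in>UNIV. \<Sum>l\<in>UNIV. v (i, k) * v (i, l) * cov k l) / 2))" .
 qed
 also have "... = complex_of_real (exp (\<Sum>i=1..n. - (\<Sum>k\<in>UNIV. \<Sum>l\<in>UNIV. v (i, k) * v (i, l) * cov k l) / 2))"
  by (simp only: of_real_prod[symmetric] exp_sum[OF finite_atLeastAtMost])
 also have "(\<Sum>i=1..n. - (\<Sum>k\<in>UNIV. \<Sum>l\<in>UNIV. v (i, k) * v (i, l) * cov k l) / 2) = - (\<Sum>i=1..n. \<Sum>k\<in>UNIV. \<Sum>l\<in>UNIV. v (i, k) * v (i, l) * cov k l) / 2"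
  by (simp only: sum_divide_distrib[symmetric] sum_negf)
 finally show ?thesis .
qed

text \<open>Both laws have the same characteristic function, by independence across the sample and the factorisation of the common covariance.\<close>

theorem coords_law:
 assumes a: "!!k l. cov k l = (\<Sum>m\<in>UNIV. a k m * a l m)"
 shows "distr P (PiM J (%_. borel)) coords = distr (gauss J) (PiM J (%_. borel)) (%z. \<lambda>q\<in>J. \<Sum>r\<in>J. block a q r * z r)"
proof (rule PiM_eq_if_characteristic_functions_eq[OF finite_J])
 show "prob_space (distr P (PiM J (%_. borel)) coords)" by (rule prob_space_distr[OF coords_measurable])
 show "prob_space (distr (gauss J) (PiM J (%_. borel)) (%z. \<lambda>q\<in>J. \<Sum>r\<in>J. block a q r * z r))"
  by (rule prob_space.prob_space_distr[OF prob_space_gauss linear_image_measurable])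
 fix v
 have inner: "(\<Sum>r\<in>J. block a q r * block a q' r) = (if fst q = fst q' then cov (snd q) (snd q') else 0)" if "q \<in> J" "q' \<in> J" for q q'
 proof -
  have "(\<Sum>r\<in>J. block a q r * block a q' r) = (\<Sum>j=1..n. \<Sum>m\<in>UNIV. block a q (j, m) * block a q' (j, m))"
   by (rule sum_J)
  also have "... = (\<Sum>j=1..n. if j = fst q then (if fst q = fst q' then cov (snd q) (snd q') else 0) else 0)"
   by (intro sum.cong refl) (auto simp: block_def a)
  also have "... = (if fst q = fst q' then cov (snd q) (snd q') else 0)"
   using that by (subst sum.delta) (auto simp: J_def)
  finally show ?thesis .
 qed
 have "(\<Sum>q\<in>J. \<Sum>q'\<in>J. v q * v q' * (\<Sum>r\<in>J. block a q r * block a q' r))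
   = (\<Sum>q\<in>J. \<Sum>q'\<in>J. v q * v q' * (if fst q = fst q' then cov (snd q) (snd q') else 0))"
  by (intro sum.cong refl) (simp add: inner)
 also have "... = (\<Sum>i=1..n. \<Sum>k\<in>UNIV. \<Sum>j=1..n. \<Sum>l\<in>UNIV. v (i, k) * v (j, l) * (if i = j then cov k l else 0))"
  unfolding sum_J fst_conv snd_conv ..
 also have "... = (\<Sum>i=1..n. \<Sum>k\<in>UNIV. \<Sum>l\<in>UNIV. v (i, k) * v (i, l) * cov k l)"
 proof (intro sum.cong refl)
  fix i k assume i: "i \<in> {1..n}"
  have "(\<Sum>j=1..n. \<Sum>l\<in>UNIV. v (i, k) * v (j, l) * (if i = j then cov k l else 0)) = (\<Sum>j=1..n. if j = i then \<Sum>l\<in>UNIV. v (i, k) * v (i, l) * cov k l else 0)"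
   by (intro sum.cong refl) auto
  then show "(\<Sum>j=1..n. \<Sum>l\<in>UNIV. v (i, k) * v (j, l) * (if i = j then cov k l else 0)) = (\<Sum>l\<in>UNIV. v (i, k) * v (i, l) * cov k l)"
   using i by (simp add: sum.delta)
 qed
 finally show "(\<integral>y. iexp (\<Sum>q\<in>J. v q * y q) \<partial>distr P (PiM J (%_. borel)) coords)
  = (\<integral>y. iexp (\<Sum>q\<in>J. v q * y q) \<partial>distr (gauss J) (PiM J (%_. borel)) (%z. \<lambda>q\<in>J. \<Sum>r\<in>J. block a q r * z r))"
  unfolding coords_char gauss_linear_image_char[OF finite_J finite_J] by (simp only:)
qed simp_all

end

section \<open>Gaussian deviation bounds\<close>

text \<open>Continuity and the values at 0 and at infinity place \<open>\<alpha> / 2\<close> in the range of the tail function.\<close>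

lemma std_normal_tail_inv:
 assumes "0 < \<alpha>" "\<alpha> < 1" shows "std_normal_tail (std_normal_tail_inv (\<alpha> / 2)) = \<alpha> / 2"
proof -
 obtain m where m: "Phi (- real m) < \<alpha> / 2"
  using order_tendstoD(2)[OF Phi_tendsto_0, of "\<alpha> / 2"] assms by (auto simp: eventually_sequentially)
 have "\<exists>x\<ge>0. x <= real m \<and> std_normal_tail x = \<alpha> / 2"
 proof (rule IVT2')
  show "std_normal_tail (real m) <= \<alpha> / 2" using m by (simp add: Phi_def)
  show "\<alpha> / 2 <= std_normal_tail 0" using Phi_0 assms by (simp add: Phi_def)
  show "continuous_on {0..real m} std_normal_tail"
   by (intro continuous_at_imp_continuous_on ballI DERIV_isCont[OF std_normal_tail_deriv])
 qed simp
 then have "\<alpha> / 2 \<in> range std_normal_tail" by (metis rangeI)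
 then show ?thesis unfolding std_normal_tail_inv_def by (rule f_inv_into_f)
qed

locale gaussian_setting = resampling_setting P n W phi p + gaussian_sample P n Y \<mu>
 for P :: "'a measure" and n W and phi :: "real ^ 'k => real" and p and Y :: "nat => 'a => real ^ 'k" and \<mu> +
 assumes n2: "2 <= n" and nonconstant: "std_dev_vector P (Y 1) \<noteq> 0"
begin

definition cov_root :: "'k => 'k => real" where
 "cov_root = (SOME a. \<forall>k l. cov k l = (\<Sum>m\<in>UNIV. a k m * a l m))"

lemma cov_root: "cov k l = (\<Sum>m\<in>UNIV. cov_root k m * cov_root l m)"
proof -
 have "\<exists>a. \<forall>k l. cov k l = (\<Sum>m\<in>(UNIV :: 'k set). a k m * a l m)"
 proof (rule positive_semidefinite_gram[OF cov_sym cov_psd])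
  fix a :: "'k => 'k => real" assume *: "!!k l. cov k l = (\<Sum>m\<in>UNIV. a k m * a l m)"
  show "\<exists>a. \<forall>k l. cov k l = (\<Sum>m\<in>(UNIV :: 'k set). a k m * a l m)" by (intro exI[of _ a] allI) (rule *)
 qed
 from someI_ex[OF this] show ?thesis unfolding cov_root_def by blast
qed

text \<open>The linear map sending a standard Gaussian vector to one with the covariance of the sample.\<close>

definition mix :: "('k => real) => real ^ 'k" where "mix d = (\<chi> k. \<Sum>m\<in>UNIV. cov_root k m * d m)"

definition spread :: real where "spread = lp_norm p (std_dev_vector P (Y 1))"

lemma spread_pos: "0 < spread"
proof -
 obtain k where "std_dev_vector P (Y 1) $ k \<noteq> 0" using nonconstant by (auto simp: vec_eq_iff)
 then have "0 < \<bar>std_dev_vector P (Y 1) $ k\<bar>" by simp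
 also have "... <= spread" unfolding spread_def by (rule lp_norm_ge_component[OF p])
 finally show ?thesis .
qed

lemma mix_scale: "mix (%m. t * d m) = t *\<^sub>R mix d"
 by (simp add: mix_def vec_eq_iff sum_distrib_left mult_ac)

lemma mix_diff: "mix d - mix d' = mix (%m. d m - d' m)"
 by (simp add: mix_def vec_eq_iff right_diff_distrib sum_subtractf)

text \<open>Each coordinate is bounded by Cauchy's inequality with the norm of a row of \<open>cov_root\<close>, which is the standard deviation; monotonicity of
the norm then gives the norm of the vector of standard deviations.\<close>

lemma mix_bound: "lp_norm p (mix d) <= spread * L2_set d UNIV"
proof -
 let ?s = "std_dev_vector P (Y 1)"
 have "\<bar>mix d $ k\<bar> <= \<bar>(L2_set d UNIV *\<^sub>R ?s) $ k\<bar>" for k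
 proof -
  have "\<bar>mix d $ k\<bar> <= (\<Sum>m\<in>UNIV. \<bar>cov_root k m\<bar> * \<bar>d m\<bar>)"
   using sum_abs[of "%m. cov_root k m * d m" UNIV] by (simp add: mix_def abs_mult)
  also have "... <= L2_set (cov_root k) UNIV * L2_set d UNIV" by (rule L2_set_mult_ineq)
  also have "L2_set (cov_root k) UNIV = sqrt ((?s $ k)\<^sup>2)"
   unfolding std_dev_cov cov_root by (simp add: L2_set_def power2_eq_square)
  finally show ?thesis by (simp add: abs_mult L2_set_nonneg mult.commute)
 qed
 then have "lp_norm p (mix d) <= lp_norm p (L2_set d UNIV *\<^sub>R ?s)" by (rule lp_norm_mono[OF p])
 then show ?thesis by (simp add: lp_norm_scale[OF p] L2_set_nonneg spread_def mult.commute)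
qed

lemma vector_measurable:
 "(!!k. (%x. f x k) \<in> borel_measurable M) ==> (%x. (\<chi> k. f x k) :: real ^ 'k) \<in> borel_measurable M"
 by (subst borel_measurable_euclidean_space) (auto simp: Basis_vec_def inner_axis)

lemma mix_measurable: "(!!m. (%x. d x m) \<in> borel_measurable M) ==> (%x. mix (d x)) \<in> borel_measurable M"
 unfolding mix_def by (intro vector_measurable borel_measurable_sum borel_measurable_times borel_measurable_const)

definition X :: "(nat \<times> 'k => real) => nat => real ^ 'k" where "X z i = mix (%m. z (i, m))"

lemma sum_J_swap: "(\<Sum>m\<in>UNIV. \<Sum>i=1..n. f (i, m)) = (\<Sum>q\<in>J. f q)"
 unfolding sum_J by (rule sum.swap)

lemma weighted_X: "weighted_average n w (X z) = mix (%m. (\<Sum>i=1..n. w i * z (i, m)) / n)"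
proof -
 have "(\<Sum>i=1..n. w i * (\<Sum>m\<in>UNIV. cov_root k m * z (i, m))) / n = (\<Sum>m\<in>UNIV. cov_root k m * ((\<Sum>i=1..n. w i * z (i, m)) / n))" for k
 proof -
  have "(\<Sum>i=1..n. w i * (\<Sum>m\<in>UNIV. cov_root k m * z (i, m))) = (\<Sum>i=1..n. \<Sum>m\<in>UNIV. cov_root k m * (w i * z (i, m)))"
   by (simp add: sum_distrib_left mult_ac)
  also have "... = (\<Sum>m\<in>UNIV. cov_root k m * (\<Sum>i=1..n. w i * z (i, m)))"
   unfolding sum_distrib_left by (rule sum.swap)
  finally have eq: "(\<Sum>i=1..n. w i * (\<Sum>m\<in>UNIV. cov_root k m * z (i, m))) = (\<Sum>m\<in>UNIV. cov_root k m * (\<Sum>i=1..n. w i * z (i, m)))" .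
  show ?thesis by (simp only: eq times_divide_eq_right sum_divide_distrib[symmetric])
 qed
 then show ?thesis by (simp add: vec_eq_iff weighted_average_def mix_def X_def)
qed

lemma weighted_X_diff:
 "lp_norm p (weighted_average n w (X z) - weighted_average n w (X z'))
  <= spread / n * L2_set (%m. \<Sum>i=1..n. w i * (z (i, m) - z' (i, m))) UNIV"
proof -
 have "weighted_average n w (X z) - weighted_average n w (X z') = mix (%m. (1 / n) * (\<Sum>i=1..n. w i * (z (i, m) - z' (i, m))))"
  unfolding weighted_X mix_diff by (simp add: right_diff_distrib sum_subtractf diff_divide_distrib)
 then have "weighted_average n w (X z) - weighted_average n w (X z') = (1 / n) *\<^sub>R mix (%m. \<Sum>i=1..n. w i * (z (i, m) - z' (i, m)))"
  unfolding mix_scale .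
 then show ?thesis
  using divide_right_mono[OF mix_bound[of "%m. \<Sum>i=1..n. w i * (z (i, m) - z' (i, m))"], of "real n"]
  by (simp add: lp_norm_scale[OF p])
qed

lemma weighted_X_lipschitz:
 "lp_norm p (weighted_average n w (X z) - weighted_average n w (X z'))
  <= spread / n * (L2_set w {1..n} * L2_set (%q. z q - z' q) J)"
proof -
 let ?x = "%q. z q - z' q"
 have "(\<Sum>m\<in>UNIV. (\<Sum>i=1..n. w i * ?x (i, m))\<^sup>2) <= (\<Sum>m\<in>UNIV. (\<Sum>i=1..n. (w i)\<^sup>2) * (\<Sum>i=1..n. (?x (i, m))\<^sup>2))"
  by (intro sum_mono Cauchy_Schwarz_ineq_sum)
 also have "... = (\<Sum>i=1..n. (w i)\<^sup>2) * (\<Sum>q\<in>J. (?x q)\<^sup>2)"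
  unfolding sum_distrib_left[symmetric] using sum_J_swap[of "%q. (?x q)\<^sup>2"] by simp
 finally have "L2_set (%m. \<Sum>i=1..n. w i * ?x (i, m)) UNIV <= L2_set w {1..n} * L2_set ?x J"
  unfolding L2_set_def real_sqrt_mult[symmetric] by (rule real_sqrt_le_mono)
 then have "spread / n * L2_set (%m. \<Sum>i=1..n. w i * ?x (i, m)) UNIV <= spread / n * (L2_set w {1..n} * L2_set ?x J)"
  using spread_pos by (intro mult_left_mono) auto
 with weighted_X_diff show ?thesis by (rule order_trans)
qed

text \<open>The weighted average of independent copies is Gaussian with covariance scaled by the squared norm of the weights, so homogeneity
pulls that norm out of the expectation.\<close>

lemma gauss_weighted_average:
 fixes f :: "real ^ 'k => real"
 assumes f: "f \<in> borel_measurable borel" and homog: "!!t u. 0 <= t ==> f (t *\<^sub>R u) = t * f u"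
 shows "(\<integral>z. f (weighted_average n w (X z)) \<partial>gauss J) = L2_set w {1..n} / n * (\<integral>z. f (mix z) \<partial>gauss UNIV)"
proof -
 let ?B = "PiM UNIV (%_ :: 'k. borel :: real measure)"
 define l where "l = L2_set w {1..n} / n"
 define T where "T = (%m (r :: nat \<times> 'k). if snd r = m then w (fst r) / n else 0)"
 define T' where "T' = (%m m' :: 'k. if m = m' then l else 0)"
 have l: "0 <= l" by (simp add: l_def L2_set_nonneg)
 have l2: "l\<^sup>2 = (\<Sum>i=1..n. (w i / n)\<^sup>2)"
  by (simp add: l_def L2_set_def power_divide sum_nonneg sum_divide_distrib)
 have law: "distr (gauss J) ?B (%z. \<lambda>m\<in>UNIV. \<Sum>r\<in>J. T m r * z r)
   = distr (gauss UNIV) ?B (%z. \<lambda>m\<in>UNIV. \<Sum>m'\<in>UNIV. T' m m' * z m')"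
 proof (rule gauss_linear_images_eq[OF finite_J finite finite])
  fix m m' :: 'k
  have "(\<Sum>r\<in>J. T m r * T m' r) = (\<Sum>i=1..n. \<Sum>k\<in>UNIV. if k = m then (if m = m' then (w i / n)\<^sup>2 else 0) else 0)"
   unfolding sum_J by (intro sum.cong refl) (auto simp: T_def power2_eq_square)
  also have "... = (if m = m' then l\<^sup>2 else 0)" by (simp add: l2)
  also have "... = (\<Sum>k\<in>UNIV. if k = m then (if m = m' then l\<^sup>2 else 0) else 0)" by simp
  also have "... = (\<Sum>k\<in>UNIV. T' m k * T' m' k)"
   by (intro sum.cong refl) (auto simp: T'_def power2_eq_square)
  finally show "(\<Sum>r\<in>J. T m r * T m' r) = (\<Sum>k\<in>UNIV. T' m k * T' m' k)" .
 qed
 have fm: "(%y. f (mix y)) \<in> borel_measurable ?B"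
  by (rule measurable_compose[OF mix_measurable f]) simp
 have 1: "(\<lambda>m\<in>UNIV. \<Sum>r\<in>J. T m r * z r) = (%m. (\<Sum>i=1..n. w i * z (i, m)) / n)" for z
 proof (rule ext)
  fix m
  have "(\<Sum>r\<in>J. T m r * z r) = (\<Sum>i=1..n. \<Sum>k\<in>UNIV. if k = m then w i * z (i, m) / n else 0)"
   unfolding sum_J by (intro sum.cong refl) (auto simp: T_def)
  then show "(\<lambda>m\<in>UNIV. \<Sum>r\<in>J. T m r * z r) m = (\<Sum>i=1..n. w i * z (i, m)) / n" by (simp add: sum_divide_distrib)
 qed
 have 2: "(\<lambda>m\<in>UNIV. \<Sum>m'\<in>UNIV. T' m m' * z m') = (%m. l * z m)" for z
 proof (rule ext)
  fix m
  have "(\<Sum>m'\<in>UNIV. T' m m' * z m') = (\<Sum>m'\<in>UNIV. if m' = m then l * z m else 0)"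
   by (intro sum.cong refl) (auto simp: T'_def)
  then show "(\<lambda>m\<in>UNIV. \<Sum>m'\<in>UNIV. T' m m' * z m') m = l * z m" by simp
 qed
 have "(\<integral>z. f (weighted_average n w (X z)) \<partial>gauss J) = (\<integral>z. f (mix (\<lambda>m\<in>UNIV. \<Sum>r\<in>J. T m r * z r)) \<partial>gauss J)"
  unfolding 1 weighted_X ..
 also have "... = (\<integral>y. f (mix y) \<partial>distr (gauss J) ?B (%z. \<lambda>m\<in>UNIV. \<Sum>r\<in>J. T m r * z r))"
  by (rule integral_distr[OF linear_image_measurable fm, symmetric])
 also have "... = (\<integral>z. f (mix (\<lambda>m\<in>UNIV. \<Sum>m'\<in>UNIV. T' m m' * z m')) \<partial>gauss UNIV)"
  unfolding law by (rule integral_distr[OF linear_image_measurable fm])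
 also have "... = (\<integral>z. f (mix (%m. l * z m)) \<partial>gauss UNIV)" unfolding 2 ..
 also have "... = l * (\<integral>z. f (mix z) \<partial>gauss UNIV)" unfolding mix_scale homog[OF l] by simp
 finally show ?thesis by (simp add: l_def)
qed

lemma weighted_phi_lipschitz: "gauss_lipschitz J (%z. phi (weighted_average n w (X z))) (spread / n * (L2_set w {1..n} + 1))"
proof
 show "0 < spread / n * (L2_set w {1..n} + 1)" using spread_pos n0 by (simp add: L2_set_nonneg add_nonneg_pos)
 fix x y
 have "\<bar>phi (weighted_average n w (X x)) - phi (weighted_average n w (X y))\<bar> <= spread / n * (L2_set w {1..n} * L2_set (%q. x q - y q) J)"
  using phi_diff weighted_X_lipschitz by (rule order_trans)
 also have "... <= spread / n * ((L2_set w {1..n} + 1) * L2_set (%q. x q - y q) J)"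
  using spread_pos by (intro mult_left_mono mult_right_mono) (auto simp: L2_set_nonneg)
 finally show "\<bar>phi (weighted_average n w (X x)) - phi (weighted_average n w (X y))\<bar> <= spread / n * (L2_set w {1..n} + 1) * L2_set (%q. x q - y q) J"
  by (simp only: mult.assoc)
qed (rule finite_J)

lemma weighted_phi_integrable: "integrable (gauss J) (%z. phi (weighted_average n w (X z)))"
proof -
 interpret gauss_lipschitz J "%z. phi (weighted_average n w (X z))" "spread / n * (L2_set w {1..n} + 1)"
  by (rule weighted_phi_lipschitz)
 show ?thesis using g_integrable[of "%_. 0" 1] by simp
qed

definition kappa :: real where "kappa = (\<integral>z. phi (mix z) \<partial>gauss UNIV)"

text \<open>Integrating over the Gaussian sample first leaves the norm of the centred weights, whose expectation is \<open>B\<close>.\<close>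

lemma gauss_RE: "(\<integral>z. RE (X z) \<partial>gauss J) = const_B P n W / sqrt n * kappa"
proof -
 interpret \<gamma>: prob_space "gauss J" by simp
 interpret PG: pair_sigma_finite P "gauss J" ..
 let ?f = "%\<omega> z. phi (weighted_average n (%i. c i \<omega>) (X z))"
 have zm: "(%q. snd q r) \<in> borel_measurable (P \<Otimes>\<^sub>M gauss J)" if "r \<in> J" for r
  by (rule measurable_compose[OF measurable_snd component_gauss[OF that]])
 have cm: "(%q. c i (fst q)) \<in> borel_measurable (P \<Otimes>\<^sub>M gauss J)" if "i \<in> {1..n}" for i
  by (rule measurable_compose[OF measurable_fst c_measurable[OF that]])
 have dm: "(%q. (\<Sum>i=1..n. c i (fst q) * snd q (i, m)) / n) \<in> borel_measurable (P \<Otimes>\<^sub>M gauss J)" for m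
  by (intro borel_measurable_divide borel_measurable_const borel_measurable_sum borel_measurable_times cm zm) (auto simp: J_def)
 have meas: "case_prod ?f \<in> borel_measurable (P \<Otimes>\<^sub>M gauss J)"
  unfolding weighted_X case_prod_unfold by (rule measurable_compose[OF mix_measurable phi_measurable]) (rule dm)
 have abs: "(\<integral>z. norm (?f \<omega> z) \<partial>gauss J) = L2_set (%i. c i \<omega>) {1..n} / n * (\<integral>z. \<bar>phi (mix z)\<bar> \<partial>gauss UNIV)" for \<omega>
  unfolding real_norm_def by (rule gauss_weighted_average) (auto simp: homog abs_mult)
 have int: "integrable (P \<Otimes>\<^sub>M gauss J) (case_prod ?f)"
 proof (rule PG.Fubini_integrable[OF meas])
  show "integrable P (%\<omega>. \<integral>z. norm (case (\<omega>, z) of (\<omega>, z) => ?f \<omega> z) \<partial>gauss J)"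
   unfolding case_prod_conv abs by (intro integrable_mult_left integrable_divide L2_c_integrable)
  show "AE \<omega> in P. integrable (gauss J) (%z. case (\<omega>, z) of (\<omega>, z) => ?f \<omega> z)"
   unfolding case_prod_conv by (intro AE_I2 weighted_phi_integrable)
 qed
 have "(\<integral>z. RE (X z) \<partial>gauss J) = (\<integral>\<omega>. (\<integral>z. ?f \<omega> z \<partial>gauss J) \<partial>P)"
  unfolding resampled_expectation_def by (rule PG.Fubini_integral[OF int])
 also have "... = (\<integral>\<omega>. L2_set (%i. c i \<omega>) {1..n} / n * kappa \<partial>P)"
  unfolding kappa_def by (intro Bochner_Integration.integral_cong refl gauss_weighted_average phi_measurable homog)
 also have "... = (\<integral>\<omega>. L2_set (%i. c i \<omega>) {1..n} \<partial>P) / n * kappa" by simp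
 also have "real n = sqrt n * sqrt n" by simp
 finally show ?thesis unfolding const_B_eq by simp
qed

lemma resampled_integrable: "integrable P (%\<omega>. phi (weighted_average n (%i. c i \<omega>) y))"
proof -
 have "sublinear_form phi y n (\<Sum>i=1..n. lp_norm p (y i))"
 proof
  fix i assume i: "i \<in> {1..n}"
  have "lp_norm p (y i) <= (\<Sum>i=1..n. lp_norm p (y i))"
   using i by (intro member_le_sum) (auto simp: lp_norm_nonneg[OF p])
  then show "\<bar>phi (y i)\<bar> <= (\<Sum>i=1..n. lp_norm p (y i))" "\<bar>phi (- y i)\<bar> <= (\<Sum>i=1..n. lp_norm p (y i))"
   using lp[of "y i"] lp[of "- y i"] by (auto simp: lp_norm_uminus[OF p])
 qed (use subadd homog n0 in auto)
 then interpret sf: sublinear_form phi y n "\<Sum>i=1..n. lp_norm p (y i)" .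
 show ?thesis using sf.form_integrable[OF integrable_c] unfolding sf.form_def .
qed

text \<open>The second moments of the weights are used under the square root, after Jensen's inequality; this is where the constant \<open>C\<close> enters.\<close>

lemma RE_lipschitz: "\<bar>RE (X z) - RE (X z')\<bar> <= spread / n * (const_C P n W * L2_set (%q. z q - z' q) J)"
proof -
 define x where "x = (%q. z q - z' q)"
 define R where "R = (%\<omega>. L2_set (%m. \<Sum>i=1..n. c i \<omega> * x (i, m)) UNIV)"
 have R2: "(R \<omega>)\<^sup>2 = (\<Sum>m\<in>UNIV. (\<Sum>i=1..n. c i \<omega> * x (i, m))\<^sup>2)" for \<omega>
  by (simp add: R_def L2_set_def sum_nonneg)
 have Rm: "R \<in> borel_measurable P" unfolding R_def L2_set_def
  by (intro measurable_compose[OF _ borel_measurable_sqrt] borel_measurable_sum borel_measurable_power borel_measurable_times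
    borel_measurable_const c_measurable)
 have R2int: "integrable P (%\<omega>. (R \<omega>)\<^sup>2)" unfolding R2
  by (intro Bochner_Integration.integrable_sum linear_form_second_moment n2)
 have Rint: "integrable P R" by (rule square_integrable_imp_integrable[OF Rm R2int])
 have "(\<integral>\<omega>. (R \<omega>)\<^sup>2 \<partial>P) = (\<Sum>m\<in>UNIV. \<integral>\<omega>. (\<Sum>i=1..n. c i \<omega> * x (i, m))\<^sup>2 \<partial>P)"
  unfolding R2 by (intro Bochner_Integration.integral_sum linear_form_second_moment n2)
 also have "... <= (\<Sum>m\<in>UNIV. (const_C P n W)\<^sup>2 * (\<Sum>i=1..n. (x (i, m))\<^sup>2))"
  by (intro sum_mono linear_form_second_moment n2)
 also have "... = (const_C P n W)\<^sup>2 * (\<Sum>q\<in>J. (x q)\<^sup>2)"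
  unfolding sum_distrib_left[symmetric] using sum_J_swap[of "%q. (x q)\<^sup>2"] by simp
 also have "... = (const_C P n W * L2_set x J)\<^sup>2" by (simp add: power_mult_distrib L2_set_def sum_nonneg)
 finally have R2le: "(\<integral>\<omega>. (R \<omega>)\<^sup>2 \<partial>P) <= (const_C P n W * L2_set x J)\<^sup>2" .
 have "(\<integral>\<omega>. R \<omega> \<partial>P)\<^sup>2 <= (\<integral>\<omega>. (R \<omega>)\<^sup>2 \<partial>P)"
  using variance_eq[OF Rint R2int] variance_positive[of R] by linarith
 with R2le have "(\<integral>\<omega>. R \<omega> \<partial>P)\<^sup>2 <= (const_C P n W * L2_set x J)\<^sup>2" by (rule order_trans[rotated])
 then have Rle: "(\<integral>\<omega>. R \<omega> \<partial>P) <= const_C P n W * L2_set x J"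
  by (rule power2_le_imp_le) (simp add: const_C_square[OF n2] L2_set_nonneg)
 have "RE (X z) - RE (X z') = (\<integral>\<omega>. phi (weighted_average n (%i. c i \<omega>) (X z)) - phi (weighted_average n (%i. c i \<omega>) (X z')) \<partial>P)"
  unfolding resampled_expectation_def by (intro Bochner_Integration.integral_diff[symmetric] resampled_integrable)
 also have "\<bar>...\<bar> <= (\<integral>\<omega>. \<bar>phi (weighted_average n (%i. c i \<omega>) (X z)) - phi (weighted_average n (%i. c i \<omega>) (X z'))\<bar> \<partial>P)"
  by (rule integral_abs_bound)
 also have "... <= (\<integral>\<omega>. spread / n * R \<omega> \<partial>P)"
 proof (rule integral_mono)
  show "integrable P (%\<omega>. \<bar>phi (weighted_average n (%i. c i \<omega>) (X z)) - phi (weighted_average n (%i. c i \<omega>) (X z'))\<bar>)"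
   by (intro integrable_abs Bochner_Integration.integrable_diff resampled_integrable)
  show "integrable P (%\<omega>. spread / n * R \<omega>)" by (intro integrable_mult_right Rint)
  show "\<bar>phi (weighted_average n (%i. c i \<omega>) (X z)) - phi (weighted_average n (%i. c i \<omega>) (X z'))\<bar> <= spread / n * R \<omega>" for \<omega>
   unfolding R_def x_def using phi_diff weighted_X_diff by (rule order_trans)
 qed
 also have "... = spread / n * (\<integral>\<omega>. R \<omega> \<partial>P)" by simp
 also have "... <= spread / n * (const_C P n W * L2_set x J)" using Rle spread_pos by (intro mult_left_mono) auto
 finally show ?thesis by (simp add: x_def)
qed

definition gap :: "(nat => real ^ 'k) => real" where "gap y = phi (average n y) - RE y / const_B P n W"

definition modulus :: real where "modulus = spread * (const_C P n W / (n * const_B P n W) + 1 / sqrt n)"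

lemma average_weighted: "average n y = weighted_average n (%_. 1) y"
 by (simp add: average_def weighted_average_def)

lemma L2_one: "L2_set (%_. 1) {1..n} = sqrt n" by (simp add: L2_set_def)

lemma gap_lipschitz: "\<bar>gap (X z) - gap (X z')\<bar> <= modulus * L2_set (%q. z q - z' q) J"
proof -
 let ?d = "L2_set (%q. z q - z' q) J"
 have 1: "\<bar>phi (average n (X z)) - phi (average n (X z'))\<bar> <= spread / n * (sqrt n * ?d)"
  unfolding average_weighted L2_one[symmetric] using phi_diff weighted_X_lipschitz by (rule order_trans)
 have "spread / n * (sqrt n * ?d) = spread * (sqrt n / n) * ?d" by simp
 also have "sqrt n / n = 1 / sqrt n" by (simp add: sqrt_divide_self_eq inverse_eq_divide)
 finally have 1: "\<bar>phi (average n (X z)) - phi (average n (X z'))\<bar> <= spread * (1 / sqrt n) * ?d" using 1 by simp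
 have "\<bar>RE (X z) / const_B P n W - RE (X z') / const_B P n W\<bar> = \<bar>RE (X z) - RE (X z')\<bar> / const_B P n W"
  using const_B_pos by (simp add: diff_divide_distrib[symmetric] abs_divide)
 also have "... <= spread / n * (const_C P n W * ?d) / const_B P n W"
  using const_B_pos RE_lipschitz by (intro divide_right_mono) auto
 also have "... = spread * (const_C P n W / (n * const_B P n W)) * ?d" by simp
 finally have 2: "\<bar>RE (X z) / const_B P n W - RE (X z') / const_B P n W\<bar> <= spread * (const_C P n W / (n * const_B P n W)) * ?d" .
 have "\<bar>gap (X z) - gap (X z')\<bar> <= spread * (1 / sqrt n) * ?d + spread * (const_C P n W / (n * const_B P n W)) * ?d"
  unfolding gap_def using 1 2 by linarith
 also have "... = modulus * ?d" by (simp add: modulus_def distrib_left distrib_right)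
 finally show ?thesis .
qed

lemma modulus_pos: "0 < modulus"
 unfolding modulus_def using spread_pos const_B_pos n0 const_C_square(1)[OF n2]
 by (intro mult_pos_pos add_nonneg_pos) auto

lemma gap_gauss_lipschitz: "\<bar>s\<bar> = 1 ==> gauss_lipschitz J (%z. s * gap (X z)) modulus"
 by (unfold_locales; (rule finite_J modulus_pos)?) (simp add: right_diff_distrib[symmetric] abs_mult gap_lipschitz)

text \<open>Both terms have expectation \<open>kappa / sqrt n\<close>; the division by \<open>B\<close> is chosen for this.\<close>

lemma gap_mean: "(\<integral>z. gap (X z) \<partial>gauss J) = 0"
proof -
 interpret \<gamma>: prob_space "gauss J" by simp
 have avg: "(\<integral>z. phi (average n (X z)) \<partial>gauss J) = sqrt n / n * kappa"
  unfolding average_weighted L2_one[symmetric] kappa_def by (intro gauss_weighted_average phi_measurable homog)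
 have avgi: "integrable (gauss J) (%z. phi (average n (X z)))"
  unfolding average_weighted by (rule weighted_phi_integrable)
 interpret gauss_lipschitz J "%z. 1 * gap (X z)" modulus by (rule gap_gauss_lipschitz) simp
 have gapi: "integrable (gauss J) (%z. gap (X z))" using g_integrable[of "%_. 0" 1] by simp
 have "integrable (gauss J) (%z. phi (average n (X z)) - gap (X z))" using avgi gapi by (rule Bochner_Integration.integrable_diff)
 then have REi: "integrable (gauss J) (%z. RE (X z) / const_B P n W)" by (simp add: gap_def)
 have "(\<integral>z. gap (X z) \<partial>gauss J) = sqrt n / n * kappa - (\<integral>z. RE (X z) / const_B P n W \<partial>gauss J)"
  unfolding gap_def using avgi REi avg by simp
 also have "(\<integral>z. RE (X z) / const_B P n W \<partial>gauss J) = kappa / sqrt n" using gauss_RE const_B_pos by simp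
 also have "sqrt n / n * kappa = kappa / sqrt n" by (simp add: sqrt_divide_self_eq inverse_eq_divide)
 finally show ?thesis by simp
qed

definition sample :: "(nat \<times> 'k => real) => nat => real ^ 'k" where
 "sample y = (\<lambda>i\<in>{1..n}. \<chi> k. y (i, k))"

lemma sample_coords: "sample (coords \<omega>) = (\<lambda>i\<in>{1..n}. Y i \<omega> - \<mu>)"
 by (auto simp: sample_def coords_def J_def vec_eq_iff)

lemma gap_cong: "(!!i. i \<in> {1..n} ==> y i = z i) ==> gap y = gap z"
 using average_cong[of y z] weighted_average_cong[of n y z] by (simp add: gap_def resampled_expectation_def)

lemma gap_sample_block: "gap (sample (\<lambda>q\<in>J. \<Sum>r\<in>J. block cov_root q r * z r)) = gap (X z)"
proof (rule gap_cong)
 fix i assume i: "i \<in> {1..n}"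
 have "(\<Sum>r\<in>J. block cov_root (i, k) r * z r) = (\<Sum>m\<in>UNIV. cov_root k m * z (i, m))" for k
 proof -
  have "(\<Sum>r\<in>J. block cov_root (i, k) r * z r) = (\<Sum>j=1..n. if j = i then \<Sum>m\<in>UNIV. cov_root k m * z (i, m) else 0)"
   unfolding sum_J by (intro sum.cong refl) (auto simp: block_def)
  then show ?thesis using i by simp
 qed
 then show "sample (\<lambda>q\<in>J. \<Sum>r\<in>J. block cov_root q r * z r) i = X z i"
  using i by (simp add: sample_def X_def mix_def J_def vec_eq_iff)
qed

lemma gap_sample_measurable: "(%y. gap (sample y)) \<in> borel_measurable (PiM J (%_. borel))"
proof -
 have "sample \<in> measurable (PiM J (%_. borel)) (PiM {1..n} (%_. borel))"
  unfolding sample_def by (intro measurable_restrict vector_measurable measurable_component_singleton) (auto simp: J_def)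
 then show ?thesis unfolding gap_def
  by (intro borel_measurable_diff borel_measurable_divide borel_measurable_const
    measurable_compose[OF _ average_measurable] measurable_compose[OF _ resampled_expectation_measurable] prob_space_axioms c_measurable)
qed

text \<open>The factor \<open>s\<close> is a sign: the two tails are the same statement for \<open>gap\<close> and its negative.\<close>

theorem gap_deviation:
 assumes s: "\<bar>s\<bar> = 1" and \<alpha>: "0 < \<alpha>" "\<alpha> < 1"
 shows "1 - \<alpha> <= prob {\<omega>\<in>space P. s * (phi (average n (%i. Y i \<omega>) - \<mu>) - RE (%i. Y i \<omega>) / const_B P n W)
  < modulus * std_normal_tail_inv (\<alpha> / 2)}"
proof -
 let ?B = "PiM J (%_. borel) :: (nat \<times> 'k => real) measure"
 define t where "t = modulus * std_normal_tail_inv (\<alpha> / 2)"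
 define A where "A = {y \<in> space ?B. t <= s * gap (sample y)}"
 have A: "A \<in> sets ?B" unfolding A_def using gap_sample_measurable by measurable
 interpret gauss_lipschitz J "%z. s * gap (X z)" modulus by (rule gap_gauss_lipschitz[OF s])
 have gap_Y: "gap (sample (coords \<omega>)) = phi (average n (%i. Y i \<omega>) - \<mu>) - RE (%i. Y i \<omega>) / const_B P n W" for \<omega>
  unfolding sample_coords gap_def RE_shift avg_shift ..
 have "prob (coords -` A \<inter> space P) = measure (distr P ?B coords) A"
  by (rule measure_distr[OF coords_measurable A, symmetric])
 also have "... = measure (gauss J) ((%z. \<lambda>q\<in>J. \<Sum>r\<in>J. block cov_root q r * z r) -` A \<inter> space (gauss J))"
  unfolding coords_law[OF cov_root] by (rule measure_distr[OF linear_image_measurable A])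
 also have "(%z. \<lambda>q\<in>J. \<Sum>r\<in>J. block cov_root q r * z r) -` A \<inter> space (gauss J) = {z \<in> space (gauss J). (\<integral>z. s * gap (X z) \<partial>gauss J) + t <= s * gap (X z)}"
  by (auto simp: A_def gap_sample_block gap_mean space_PiM)
 also have "measure (gauss J) ... <= 2 * std_normal_tail (std_normal_tail_inv (\<alpha> / 2))"
  unfolding t_def by (rule gauss_concentration)
 also have "... = \<alpha>" by (simp add: std_normal_tail_inv[OF \<alpha>])
 finally have "prob (coords -` A \<inter> space P) <= \<alpha>" .
 moreover have "coords -` A \<inter> space P \<in> events" by (rule measurable_sets[OF coords_measurable A])
 moreover have "{\<omega>\<in>space P. s * (phi (average n (%i. Y i \<omega>) - \<mu>) - RE (%i. Y i \<omega>) / const_B P n W) < t} = space P - (coords -` A \<inter> space P)"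
  using measurable_space[OF coords_measurable] by (auto simp: A_def gap_Y)
 ultimately show ?thesis using prob_compl[of "coords -` A \<inter> space P"] by (simp add: t_def)
qed

theorem gaussian_upper_deviation:
 assumes \<alpha>: "0 < \<alpha>" "\<alpha> < 1"
 shows "1 - \<alpha> <= prob {\<omega>\<in>space P. phi (average n (%i. Y i \<omega>) - \<mu>) < RE (%i. Y i \<omega>) / const_B P n W
  + spread * std_normal_tail_inv (\<alpha> / 2) * (const_C P n W / (n * const_B P n W) + 1 / sqrt n)}"
 using gap_deviation[of 1, OF _ \<alpha>] by (simp add: modulus_def diff_less_eq mult_ac add.commute)

theorem gaussian_lower_deviation:
 assumes \<alpha>: "0 < \<alpha>" "\<alpha> < 1"
 shows "1 - \<alpha> <= prob {\<omega>\<in>space P. phi (average n (%i. Y i \<omega>) - \<mu>) > RE (%i. Y i \<omega>) / const_B P n W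
  - spread * std_normal_tail_inv (\<alpha> / 2) * (const_C P n W / (n * const_B P n W) + 1 / sqrt n)}"
proof -
 have "- 1 * (a - b) < modulus * q \<longleftrightarrow> b - spread * q * (const_C P n W / (n * const_B P n W) + 1 / sqrt n) < a" for a b q
  by (auto simp: modulus_def mult_ac)
 then show ?thesis using gap_deviation[of "- 1", OF _ \<alpha>] by simp
qed

end

section \<open>The deviation theorem\<close>

theorem theorem2p1:
  fixes P :: "'a measure"
    and n :: nat
    and Y :: "nat \<Rightarrow> 'a \<Rightarrow> real ^ 'k"
    and \<mu> \<sigma> :: "real ^ 'k"
    and W :: "nat \<Rightarrow> 'a \<Rightarrow> real"
    and \<phi> :: "real ^ 'k \<Rightarrow> real"
    and p :: ereal
    and \<alpha> :: real
  assumes "prob_space P"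
    and "n \<ge> 2"
    and "iid_vectors P n Y"
    and "\<forall>i\<in>{1..n}. integrable P (Y i)"
    and "\<mu> = (\<integral>\<omega>. Y 1 \<omega> \<partial>P)"
    and "\<sigma> = std_dev_vector P (Y 1)"
    and "0 < \<alpha>" and "\<alpha> < 1"
    and "1 \<le> p"
    and "\<forall>x x'. \<phi> (x + x') \<le> \<phi> x + \<phi> x'"
    and "\<forall>x. \<forall>c\<ge>0. \<phi> (c *\<^sub>R x) = c * \<phi> x"
    and "\<forall>x. \<bar>\<phi> x\<bar> \<le> lp_norm p x"
    and "resampling_weights P n Y W"
    and "exchangeable P n W"
  shows
    "((\<forall>i\<in>{1..n}. gaussian_vector P (Y i)) \<and> \<sigma> \<noteq> 0 \<longrightarrow>
        measure P {\<omega> \<in> space P.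
          \<phi> (average n (\<lambda>i. Y i \<omega>) - \<mu>)
            < resampled_expectation P n \<phi> W (\<lambda>i. Y i \<omega>) / const_B P n W
              + lp_norm p \<sigma> * std_normal_tail_inv (\<alpha> / 2)
                * (const_C P n W / (real n * const_B P n W) + 1 / sqrt (real n))} \<ge> 1 - \<alpha> \<and>
        measure P {\<omega> \<in> space P.
          \<phi> (average n (\<lambda>i. Y i \<omega>) - \<mu>)
            > resampled_expectation P n \<phi> W (\<lambda>i. Y i \<omega>) / const_B P n W
              - lp_norm p \<sigma> * std_normal_tail_inv (\<alpha> / 2)
                * (const_C P n W / (real n * const_B P n W) + 1 / sqrt (real n))} \<ge> 1 - \<alpha>)
     \<and>
     (\<forall>M>0.
        (\<forall>i\<in>{1..n}. distr P borel (\<lambda>\<omega>. Y i \<omega> - \<mu>) = distr P borel (\<lambda>\<omega>. \<mu> - Y i \<omega>)) \<and>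
        (\<forall>i\<in>{1..n}. AE \<omega> in P. lp_norm p (Y i \<omega> - \<mu>) \<le> M) \<longrightarrow>
        measure P {\<omega> \<in> space P.
          \<phi> (average n (\<lambda>i. Y i \<omega>) - \<mu>)
            < resampled_expectation P n \<phi> W (\<lambda>i. Y i \<omega>) / const_A P n W
              + 2 * M / sqrt (real n) * sqrt (ln (1 / \<alpha>))} \<ge> 1 - \<alpha> \<and>
        (\<forall>a>0. \<forall>x\<^sub>0.
           (\<forall>i\<in>{1..n}. AE \<omega> in P. \<bar>W i \<omega> - x\<^sub>0\<bar> = a) \<longrightarrow>
           measure P {\<omega> \<in> space P.
             \<phi> (average n (\<lambda>i. Y i \<omega>) - \<mu>)
               > resampled_expectation P n \<phi> W (\<lambda>i. Y i \<omega>) / const_D P n W a x\<^sub>0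
                 - M / sqrt (real n)
                   * sqrt (1 + (const_A P n W)\<^sup>2 / (const_D P n W a x\<^sub>0)\<^sup>2)
                   * sqrt (2 * ln (1 / \<alpha>))} \<ge> 1 - \<alpha>))"
proof -
  interpret prob_space P by fact
  note weights = assms(13)[unfolded resampling_weights_def]
  have n0: "0 < n" using assms(2) by simp
  have setting: "resampling_setting P n W \<phi> p"
  proof (unfold_locales, goal_cases)
    case (1 i) then show ?case using weights by blast
  next
    case (2 i) then show ?case using weights by blast
  next
    case 3 show ?case by fact
  next
    case 4 show ?case by fact
  next
    case 5 show ?case using weights by blast
  next
    case 6 show ?case by fact
  next
    case (7 u v) show ?case using assms(10) by blast
  next
    case (8 c u) then show ?case using assms(11) by blast
  next
    case (9 u) show ?case using assms(12) by blast
  qed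
  have gaussian: "gaussian_setting P n W \<phi> p Y \<mu>" if "(\<forall>i\<in>{1..n}. gaussian_vector P (Y i)) \<and> \<sigma> \<noteq> 0"
    unfolding gaussian_setting_def gaussian_setting_axioms_def gaussian_sample_def gaussian_sample_axioms_def
    using setting that assms(2-6) n0 prob_space_axioms by blast
  have symmetric: "symmetric_setting P n W \<phi> p Y \<mu> M \<alpha>"
    if "0 < M" "(\<forall>i\<in>{1..n}. distr P borel (\<lambda>\<omega>. Y i \<omega> - \<mu>) = distr P borel (\<lambda>\<omega>. \<mu> - Y i \<omega>)) \<and>
        (\<forall>i\<in>{1..n}. AE \<omega> in P. lp_norm p (Y i \<omega> - \<mu>) \<le> M)" for M
    unfolding symmetric_setting_def symmetric_setting_axioms_def
    using setting that assms(3,7,8) unfolding iid_vectors_def by blast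
  show ?thesis
  proof (intro conjI impI allI, goal_cases)
    case 1
    interpret gaussian_setting P n W \<phi> p Y \<mu> by (rule gaussian[OF 1])
    show ?case using gaussian_upper_deviation[OF assms(7,8)] unfolding spread_def assms(6) .
  next
    case 2
    interpret gaussian_setting P n W \<phi> p Y \<mu> by (rule gaussian[OF 2])
    show ?case using gaussian_lower_deviation[OF assms(7,8)] unfolding spread_def assms(6) .
  next
    case (3 M)
    interpret symmetric_setting P n W \<phi> p Y \<mu> M \<alpha> by (rule symmetric[OF 3])
    show ?case by (rule upper_deviation)
  next
    case (4 M a x0)
    interpret symmetric_setting P n W \<phi> p Y \<mu> M \<alpha> by (rule symmetric[OF 4(1,2)])
    show ?case by (rule lower_deviation) (use 4 in auto)
  qed
qed

end
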